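(* Let $\lambda_0>0$, $0<h_1<1$ and let $f$ be a probability density on $[0,\infty)$ with $\int_0^\infty e^{\theta_0 t}f(t)\,dt<\infty$ for some $\theta_0>0$. Let $B$ denote the total birth time of a cluster with parameter $(h_1,f)$, let $\psi_B(\theta)=\log E[\exp(\theta B)]$, let $\theta_1>0$ be such that $\psi_B(\theta)<\infty$ for all $0<\theta<\theta_1$, and let $0<\eta<\theta_1$. Then the collection of clusters (with their arrival times) returned by Algorithm 1, run with input $(\lambda_0,h_1,f)$ and $\eta$, has exactly the distribution of $N_0$, the set of clusters of the stationary Hawkes process with parameters $(\lambda_0,h_1,f)$ that arrive at or before time $0$ and depart after time $0$. In particular: (1) The arrival times of the returned clusters form a non-homogeneous Poisson process on $(-\infty,0]$ with intensity $\gamma(t)=\lambda_0\,p(-t)$, $t\le 0$, where $p(s)=P(L>s)$ and $L$ is the cluster length of a cluster with parameter $(h_1,f)$. (2) For each returned cluster $C_m$, given its arrival time $\tau_m$, the cluster follows the conditional distribution of a cluster with parameter $(h_1,f)$ and immigrant arriving at $\tau_m$, given that its cluster length is $>-\tau_m$. Moreover, the expected total number of random variables generated by Algorithm 1 before termination equals $$\frac{\lambda_0\exp(\psi_B(\eta))\,(2-h_1-\psi_B(\eta))}{\eta\,(1-h_1-\psi_B(\eta))}.$$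
   Context: **Clusters.** Let $a>0$ and let $\varphi$ be a probability density on $[0,\infty)$. A cluster with parameter $(a,\varphi)$ and immigrant arriving at time $\tau$ is the random set of events $C=\{(k,t^k,pa^k):k=1,\dots,|C|\}$ obtained by the following branching construction: the event with index $1$ (the immigrant) arrives at $t^1=\tau$ (with $pa^1=0$); each event arriving at time $s$, independently of everything else, generates next-generation (child) events whose arrival times are the points of a Poisson process on $[s,\infty)$ with rate function $t\mapsto a\,\varphi(t-s)$; this is iterated over generations until no more events are generated. Here $t^k$ is the arrival time of event $k$ and $pa^k$ is the index of its parent. $\tau$ is called the arrival time of the cluster and $\max_k t^k$ its departure time. The cluster length is $L=\max_k t^k-\tau$. The birth time of event $k\ge 2$ is $b^k=t^k-t^{pa^k}$, and the total birth time is $B=\sum_{k=2}^{|C|}b^k$. **Stationary Hawkes process and $N_0$.** For the stationary Hawkes process with parameters $(\lambda_0,h_1,f)$ (background intensity $\lambda_0$, excitation function $h=h_1f$), the immigrants arrive according to a homogeneous Poisson process of rate $\lambda_0$ on $(-\infty,\infty)$, with arrival times $\cdots\le\tau_{-2}\le\tau_{-1}\le 0<\tau_1\le\cdots$; each immigrant $\tau_m$ independently generates a cluster $C_m$ with parameter $(h_1,f)$, with cluster length $L_m$. Then $N_0=\{C_m: m\le -1,\ L_m>-\tau_m\}$. **Algorithm 1.** Let $\psi_f(\theta)=\log\int_0^\infty e^{\theta t}f(t)\,dt$ and $f_\eta(t)=f(t)\exp(\eta t-\psi_f(\eta))$. The number $\psi_B(\eta)$ satisfies $\psi_B(\eta)=h_1\exp(\psi_f(\eta)+\psi_B(\eta))-h_1$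 and is computed from this equation. 1. Compute $\psi_B(\eta)$. 2. Generate a non-homogeneous Poisson process on $(-\infty,0]$ with rate function $\tilde\gamma(t)=\lambda_0\exp(\psi_B(\eta)+\eta t)$, $t\le 0$, obtaining points $\tau_1,\dots,\tau_K$. 3. Initialize $N_0=\emptyset$. 4. For $m=1,\dots,K$, independently: generate a cluster $C_m$ with parameter $(h_1\exp(\psi_f(\eta)+\psi_B(\eta)),\,f_\eta)$ and immigrant arriving at $\tau_m$, with cluster length $L_m$ and total birth time $B_m$, and an independent $X_m$ uniform on $[0,1]$. Add $C_m$ to $N_0$ (accept it) if and only if both $L_m>-\tau_m$ and $X_m\le\exp(-\eta(B_m+\tau_m))$. 5. Return $N_0$. **Counting convention.** The total number of random variables generated is $\sum_{m=1}^K(|C_m|+1)$: one for each event of each generated cluster (including the immigrant) and one for each uniform variable $X_m$. *)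

theory Defs
  imports "HOL-Probability.Probability"
begin

definition list_space :: "'a measure \<Rightarrow> 'a list measure" where
  "list_space S = sigma (lists (space S)) (listset ` lists (sets S))"

text \<open>Random countable sets of points carry the sigma-algebra generated by the numbers of points
  in measurable sets. Finiteness is stated separately because \<^const>\<open>card\<close> is 0 on infinite sets.\<close>

definition config_space :: "'a measure \<Rightarrow> 'a set measure" where
  "config_space S = sigma {X. X \<subseteq> space S \<and> countable X}
     {{X. X \<subseteq> space S \<and> countable X \<and> finite (X \<inter> A) \<and> card (X \<inter> A) = n} | A n. A \<in> sets S}"

text \<open>The points are \<open>T i \<omega>\<close> for \<open>i \<in> I \<omega>\<close>, counted with multiplicity. The product
  formula says that the numbers of points in disjoint sets of finite intensity are independent and
  Poisson distributed. It is written out because \<^const>\<open>poisson_pmf\<close> requires a positive rate,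
  whereas a set may have intensity 0.\<close>

definition poisson_process ::
    "'w measure \<Rightarrow> 'a measure \<Rightarrow> ('w \<Rightarrow> 'i set) \<Rightarrow> ('i \<Rightarrow> 'w \<Rightarrow> 'a) \<Rightarrow> bool" where
  "poisson_process M \<mu> I T \<longleftrightarrow> prob_space M \<and>
     (\<forall>(J::nat set) A k. finite J \<longrightarrow> disjoint_family_on A J \<longrightarrow>
        (\<forall>j\<in>J. A j \<in> sets \<mu> \<and> emeasure \<mu> (A j) < \<infinity>) \<longrightarrow>
        (let E = {\<omega> \<in> space M. \<forall>j\<in>J. finite {i \<in> I \<omega>. T i \<omega> \<in> A j} \<and>
                                   card {i \<in> I \<omega>. T i \<omega> \<in> A j} = k j}
         in E \<in> sets M \<and>
            measure M E =
              (\<Prod>j\<in>J. measure \<mu> (A j) ^ k j / fact (k j) * exp (- measure \<mu> (A j)))))"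

definition poisson_law :: "'a measure \<Rightarrow> 'a set measure" where
  "poisson_law \<mu> = (THE P. sets P = sets (config_space \<mu>) \<and>
                        poisson_process P \<mu> (\<lambda>X. X) (\<lambda>x X. x))"

text \<open>Each point independently receives a mark: given all the points, the marks are independent and
  the mark of a point \<open>t\<close> has law \<open>\<kappa> t\<close>. Taking some of the sets \<open>D j\<close> to be the
  whole mark space, the formula covers every finite set of marks jointly with all the points
  (and with the index set).\<close>

definition marked_poisson_process ::
    "'w measure \<Rightarrow> 'a measure \<Rightarrow> 'b measure \<Rightarrow> ('a \<Rightarrow> 'b measure) \<Rightarrow>
     ('w \<Rightarrow> 'i set) \<Rightarrow> ('i \<Rightarrow> 'w \<Rightarrow> 'a) \<Rightarrow> ('i \<Rightarrow> 'w \<Rightarrow> 'b) \<Rightarrow> bool" where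
  "marked_poisson_process M \<mu> N \<kappa> I T Y \<longleftrightarrow>
     poisson_process M \<mu> I T \<and>
     (\<forall>i. {\<omega> \<in> space M. i \<in> I \<omega>} \<in> sets M \<and> T i \<in> measurable M \<mu> \<and> Y i \<in> measurable M N) \<and>
     (\<forall>J A D. finite J \<longrightarrow> (\<forall>j\<in>J. A j \<in> sets \<mu> \<and> D j \<in> sets N) \<longrightarrow>
        emeasure M {\<omega> \<in> space M. \<forall>j\<in>J. j \<in> I \<omega> \<and> T j \<omega> \<in> A j \<and> Y j \<omega> \<in> D j} =
        (\<integral>\<^sup>+\<omega>\<in>{\<omega> \<in> space M. \<forall>j\<in>J. j \<in> I \<omega> \<and> T j \<omega> \<in> A j}.
           (\<Prod>j\<in>J. emeasure (\<kappa> (T j \<omega>)) (D j)) \<partial>M))"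

definition is_density :: "(real \<Rightarrow> real) \<Rightarrow> bool" where
  "is_density \<phi> \<longleftrightarrow> \<phi> \<in> borel_measurable borel \<and> (\<forall>t\<ge>0. 0 \<le> \<phi> t) \<and>
     (\<integral>\<^sup>+t\<in>{0..}. ennreal (\<phi> t) \<partial>lborel) = 1"

text \<open>The event with index \<open>k\<close> (counted from 1) is the list entry at position \<open>k - 1\<close>: its
  arrival time and the index of its parent (0 for the immigrant). The empty list stands for a
  branching construction that never stops.\<close>

type_synonym cluster = "(real \<times> nat) list"

definition cluster_space :: "cluster measure" where
  "cluster_space = list_space (borel \<Otimes>\<^sub>M count_space UNIV)"

definition event_time :: "cluster \<Rightarrow> nat \<Rightarrow> real" where
  "event_time C k = fst (C ! (k - 1))"

definition event_parent :: "cluster \<Rightarrow> nat \<Rightarrow> nat" where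
  "event_parent C k = snd (C ! (k - 1))"

definition cluster_size :: "cluster \<Rightarrow> ennreal" where
  "cluster_size C = (if C = [] then \<infinity> else of_nat (length C))"

definition arrival_time :: "cluster \<Rightarrow> real" where
  "arrival_time C = event_time C 1"

definition departure_time :: "cluster \<Rightarrow> real" where
  "departure_time C = Max (event_time C ` {1..length C})"

definition cluster_length :: "cluster \<Rightarrow> real" where
  "cluster_length C = departure_time C - arrival_time C"

definition birth_time :: "cluster \<Rightarrow> nat \<Rightarrow> real" where
  "birth_time C k = event_time C k - event_time C (event_parent C k)"

definition total_birth_time :: "cluster \<Rightarrow> real" where
  "total_birth_time C = (\<Sum>k = 2..length C. birth_time C k)"

text \<open>\<open>explore \<tau> G k\<close> lists the events known after the children of the events
  \<open>1, \<dots>, k\<close> have been generated; the children of event \<open>j\<close> arrive at the points of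
  \<open>G j\<close> shifted by the arrival time of event \<open>j\<close>. New events are appended at the end,
  so the indices run through the generations one after the other, siblings being ordered by arrival
  time. The construction stops once every listed event has been treated.\<close>

primrec explore :: "real \<Rightarrow> (nat \<Rightarrow> real set) \<Rightarrow> nat \<Rightarrow> cluster" where
  "explore \<tau> G 0 = [(\<tau>, 0)]"
| "explore \<tau> G (Suc k) =
     (let C = explore \<tau> G k in
      if k < length C
      then C @ map (\<lambda>x. (event_time C (Suc k) + x, Suc k)) (sorted_list_of_set (G (Suc k)))
      else C)"

definition grow_cluster :: "real \<Rightarrow> (nat \<Rightarrow> real set) \<Rightarrow> cluster" where
  "grow_cluster \<tau> G =
     (if \<exists>k. length (explore \<tau> G k) \<le> k
      then explore \<tau> G (LEAST k. length (explore \<tau> G k) \<le> k)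
      else [])"

text \<open>A Poisson process on \<open>[s, \<infinity>)\<close> with rate \<open>a \<phi>(t - s)\<close> is a Poisson process on
  \<open>[0, \<infinity>)\<close> with rate \<open>a \<phi>(t)\<close>, shifted by \<open>s\<close>.\<close>

definition offspring_law :: "real \<Rightarrow> (real \<Rightarrow> real) \<Rightarrow> real set measure" where
  "offspring_law a \<phi> = poisson_law (density lborel (\<lambda>t. ennreal (a * \<phi> t) * indicator {0..} t))"

definition cluster_law :: "real \<Rightarrow> (real \<Rightarrow> real) \<Rightarrow> real \<Rightarrow> cluster measure" where
  "cluster_law a \<phi> \<tau> =
     distr (\<Pi>\<^sub>M k\<in>(UNIV :: nat set). offspring_law a \<phi>) cluster_space (grow_cluster \<tau>)"

text \<open>The law of length and total birth time does not depend on the arrival time of the immigrant,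
  which is taken to be 0 in the next two definitions.\<close>

definition length_tail :: "real \<Rightarrow> (real \<Rightarrow> real) \<Rightarrow> real \<Rightarrow> real" where
  "length_tail a \<phi> s = measure (cluster_law a \<phi> 0) {C \<in> space cluster_space. cluster_length C > s}"

definition psi_B :: "real \<Rightarrow> (real \<Rightarrow> real) \<Rightarrow> real \<Rightarrow> real" where
  "psi_B a \<phi> \<theta> = ln (\<integral>C. exp (\<theta> * total_birth_time C) \<partial>cluster_law a \<phi> 0)"

definition cluster_law_given_longer :: "real \<Rightarrow> (real \<Rightarrow> real) \<Rightarrow> real \<Rightarrow> cluster measure" where
  "cluster_law_given_longer a \<phi> t =
     uniform_measure (cluster_law a \<phi> t) {C \<in> space cluster_space. cluster_length C > - t}"

definition stationary_hawkes ::
    "real \<Rightarrow> real \<Rightarrow> (real \<Rightarrow> real) \<Rightarrow>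
     'w measure \<Rightarrow> (int \<Rightarrow> 'w \<Rightarrow> real) \<Rightarrow> (int \<Rightarrow> 'w \<Rightarrow> cluster) \<Rightarrow> bool" where
  "stationary_hawkes lam0 h1 f M \<tau> C \<longleftrightarrow>
     marked_poisson_process M (density lborel (\<lambda>t. ennreal lam0)) cluster_space (cluster_law h1 f)
       (\<lambda>\<omega>. - {0}) \<tau> C \<and>
     (\<forall>\<omega>\<in>space M. (\<forall>m n. m \<noteq> 0 \<longrightarrow> n \<noteq> 0 \<longrightarrow> m \<le> n \<longrightarrow> \<tau> m \<omega> \<le> \<tau> n \<omega>) \<and>
                     \<tau> (-1) \<omega> \<le> 0 \<and> 0 < \<tau> 1 \<omega>)"

definition N0 :: "(int \<Rightarrow> 'w \<Rightarrow> real) \<Rightarrow> (int \<Rightarrow> 'w \<Rightarrow> cluster) \<Rightarrow> 'w \<Rightarrow> cluster set" where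
  "N0 \<tau> C \<omega> = {C m \<omega> | m. m \<le> -1 \<and> cluster_length (C m \<omega>) > - \<tau> m \<omega>}"

definition psi_f :: "(real \<Rightarrow> real) \<Rightarrow> real \<Rightarrow> real" where
  "psi_f f \<theta> = ln (LINT t:{0..}|lborel. exp (\<theta> * t) * f t)"

definition tilted_density :: "(real \<Rightarrow> real) \<Rightarrow> real \<Rightarrow> real \<Rightarrow> real" where
  "tilted_density f \<eta> t = f t * exp (\<eta> * t - psi_f f \<eta>)"

text \<open>The random variables generated in one run: \<open>K\<close> points \<open>\<tau> 1, \<dots>, \<tau> K\<close>
  (enumerated in any measurable way), the clusters \<open>C m\<close> and the uniform variables
  \<open>X m\<close>. The values at indices outside \<open>{1..K}\<close> are irrelevant.\<close>

definition algorithm_run ::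
    "real \<Rightarrow> real \<Rightarrow> (real \<Rightarrow> real) \<Rightarrow> real \<Rightarrow> 'w measure \<Rightarrow> ('w \<Rightarrow> nat) \<Rightarrow>
     (nat \<Rightarrow> 'w \<Rightarrow> real) \<Rightarrow> (nat \<Rightarrow> 'w \<Rightarrow> cluster) \<Rightarrow> (nat \<Rightarrow> 'w \<Rightarrow> real) \<Rightarrow> bool" where
  "algorithm_run lam0 h1 f \<eta> M K \<tau> C X \<longleftrightarrow>
     marked_poisson_process M
       (density lborel (\<lambda>t. ennreal (lam0 * exp (psi_B h1 f \<eta> + \<eta> * t)) * indicator {..0} t))
       (cluster_space \<Otimes>\<^sub>M borel)
       (\<lambda>t. cluster_law (h1 * exp (psi_f f \<eta> + psi_B h1 f \<eta>)) (tilted_density f \<eta>) t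
              \<Otimes>\<^sub>M uniform_measure lborel {0..1})
       (\<lambda>\<omega>. {1..K \<omega>}) \<tau> (\<lambda>m \<omega>. (C m \<omega>, X m \<omega>))"

definition accepted ::
    "real \<Rightarrow> ('w \<Rightarrow> nat) \<Rightarrow> (nat \<Rightarrow> 'w \<Rightarrow> real) \<Rightarrow> (nat \<Rightarrow> 'w \<Rightarrow> cluster) \<Rightarrow>
     (nat \<Rightarrow> 'w \<Rightarrow> real) \<Rightarrow> 'w \<Rightarrow> nat set" where
  "accepted \<eta> K \<tau> C X \<omega> =
     {m \<in> {1..K \<omega>}. cluster_length (C m \<omega>) > - \<tau> m \<omega> \<and>
        X m \<omega> \<le> exp (- \<eta> * (total_birth_time (C m \<omega>) + \<tau> m \<omega>))}"

definition returned ::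
    "real \<Rightarrow> ('w \<Rightarrow> nat) \<Rightarrow> (nat \<Rightarrow> 'w \<Rightarrow> real) \<Rightarrow> (nat \<Rightarrow> 'w \<Rightarrow> cluster) \<Rightarrow>
     (nat \<Rightarrow> 'w \<Rightarrow> real) \<Rightarrow> 'w \<Rightarrow> cluster set" where
  "returned \<eta> K \<tau> C X \<omega> = {C m \<omega> | m. m \<in> accepted \<eta> K \<tau> C X \<omega>}"

end

theory Submission
  imports Defs
begin

text \<open>Exponential tilting. Both the returned clusters and \<open>N\<^sub>0\<close> are images of independent thinnings of
  marked Poisson processes, hence Poisson processes on the space of clusters, and a Poisson process is
  determined by its intensity; so it suffices to compare two intensities. A cluster grown from the tilted
  parameters has density \<open>exp (\<eta> B - \<psi>)\<close>, \<open>\<psi> = \<psi>\<^sub>B(\<eta>)\<close>, with respect to the original law, because the births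
  contribute factors \<open>exp (\<eta> b - \<psi>\<^sub>f(\<eta>))\<close> and the numbers of children change their Poisson mean from \<open>h\<^sub>1\<close> to
  \<open>h\<^sub>1 + \<psi>\<close>. Multiplying by the acceptance probability \<open>exp (- \<eta> (B + \<tau>))\<close>, which is at most 1 since
  \<open>B \<ge> L > - \<tau>\<close>, and by the proposal rate \<open>\<lambda>\<^sub>0 exp (\<psi> + \<eta> \<tau>)\<close> leaves \<open>\<lambda>\<^sub>0\<close> times the original law on \<open>{L > - \<tau>}\<close>.
  Finite exponential moments beyond \<open>\<eta>\<close> make the tilted branching process subcritical,
  \<open>h\<^sub>1 + \<psi> < 1\<close>, so a proposal has mean size \<open>1 / (1 - h\<^sub>1 - \<psi>)\<close>.\<close>

section \<open>Generating functions of counts\<close>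

text \<open>The definitions fix a Poisson process only through its counts in disjoint sets, whereas
  uniqueness of a law on \<open>config_space\<close> concerns overlapping sets, and thinning
  concerns marks. Both are reached through Laplace functionals, which turn sums over points into
  products; generating functions lead back from them to counts. \<open>eneg\<close> is exp (- x)
  with exp (- \<infinity>) = 0, so that sums over points may diverge. Three further obstacles shape
  the proof. \<open>poisson_law\<close> is a definite description, so nothing can be said about a
  cluster before existence and uniqueness are settled. The output is a set of clusters, in which
  multiplicities are lost; no multiplicity is lost here because arrival times are almost surely
  distinct. A branching construction that never stops is encoded by \<open>[]\<close>, where length
  and total birth time are junk; likelihood ratios are therefore taken on terminated clusters, until
  subcriticality shows that almost every cluster terminates. For the tilted parameters this rests on
  E exp (\<eta> B) being the least, not just some, solution of its fixed point equation.\<close>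

definition eneg :: "ennreal \<Rightarrow> ennreal" where
  "eneg x = (if x = \<infinity> then 0 else ennreal (exp (- enn2real x)))"

lemma eneg_ennreal: "0 \<le> r \<Longrightarrow> eneg (ennreal r) = ennreal (exp (- r))"
  by (simp add: eneg_def)

lemma eneg_0 [simp]: "eneg 0 = 1" and eneg_top [simp]: "eneg top = 0"
  by (simp_all add: eneg_def)

lemma eneg_le_1: "eneg x \<le> 1"
  by (cases x) (auto simp: eneg_def ennreal_le_1)

lemma eneg_add: "eneg (x + y) = eneg x * eneg y"
proof (cases "x = \<infinity> \<or> y = \<infinity>")
  case True
  then show ?thesis by (elim disjE) (simp_all add: eneg_def)
next
  case False
  then obtain a b where "0 \<le> a" "0 \<le> b" "x = ennreal a" "y = ennreal b"
    by (cases x; cases y) simp_all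
  then show ?thesis
    by (simp add: eneg_ennreal mult_exp_exp flip: ennreal_plus ennreal_mult)
qed

lemma eneg_sum: "finite A \<Longrightarrow> eneg (sum f A) = (\<Prod>i\<in>A. eneg (f i))"
  by (induction A rule: finite_induct) (simp_all add: eneg_add)

lemma eneg_antimono: "x \<le> y \<Longrightarrow> eneg y \<le> eneg x"
  by (cases x; cases y) (auto simp: eneg_def top_unique)

lemma measurable_eneg [measurable]: "eneg \<in> borel_measurable borel"
  unfolding eneg_def by measurable

text \<open>Continuity from below includes the limit \<infinity>, where \<open>eneg\<close> drops to
  0. This carries the Laplace functional from simple functions to arbitrary ones and from finitely
  many points to all points.\<close>

lemma eneg_SUP:
  assumes "incseq X" shows "eneg (SUP n. X n) = (INF n::nat. eneg (X n))"
proof (rule antisym)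
  show "eneg (SUP n. X n) \<le> (INF n. eneg (X n))"
    by (auto intro!: INF_greatest eneg_antimono SUP_upper)
  show "(INF n. eneg (X n)) \<le> eneg (SUP n. X n)"
  proof (cases "(SUP n. X n) = \<infinity>")
    case True
    have "(INF n. eneg (X n)) \<le> 0 + ennreal e" if e: "e > 0" for e
    proof -
      \<comment> \<open>Beyond the level - ln e the value of \<open>eneg\<close> is at most e; the
        maximum with 0 keeps the level nonnegative.\<close>
      have "ennreal (max 0 (- ln e)) < (SUP n. X n)" unfolding True by simp
      then obtain n where n: "ennreal (max 0 (- ln e)) < X n" by (auto simp: less_SUP_iff)
      have "(INF n. eneg (X n)) \<le> eneg (X n)" by (rule INF_lower) simp
      also have "\<dots> \<le> eneg (ennreal (max 0 (- ln e)))" using n by (intro eneg_antimono) simp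
      also have "\<dots> = ennreal (exp (- max 0 (- ln e)))" by (rule eneg_ennreal) simp
      also have "\<dots> \<le> ennreal (exp (ln e))" by (intro ennreal_leI) auto
      finally show ?thesis using e by simp
    qed
    then have "(INF n. eneg (X n)) \<le> 0" by (rule ennreal_le_epsilon)
    then show ?thesis using True by simp
  next
    case False
    define S where "S = (SUP n. X n)"
    have S: "S \<noteq> \<infinity>" "\<And>n. X n \<le> S" using False by (auto simp: S_def intro: SUP_upper)
    have fin: "X n \<noteq> \<infinity>" for n using S(1) S(2)[of n] by (auto simp: top_unique)
    have "X \<longlonglongrightarrow> S" unfolding S_def by (rule LIMSEQ_SUP[OF assms])
    then have "(\<lambda>n. enn2real (X n)) \<longlonglongrightarrow> enn2real S"
      using S(1) by (cases S) (simp_all add: tendsto_enn2real)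
    then have "(\<lambda>n. ennreal (exp (- enn2real (X n)))) \<longlonglongrightarrow> ennreal (exp (- enn2real S))"
      by (intro tendsto_ennrealI tendsto_exp tendsto_minus)
    then have "(\<lambda>n. eneg (X n)) \<longlonglongrightarrow> eneg S"
      using S(1) fin by (simp add: eneg_def)
    then show ?thesis
      unfolding S_def[symmetric] by (rule LIMSEQ_le_const) (intro exI[of _ 0] allI impI INF_lower UNIV_I)
  qed
qed

text \<open>\<open>card\<close> is 0 both for the empty set and for infinite sets, so counts are
  kept in \<open>enat\<close>.\<close>

definition ecard :: "'a set \<Rightarrow> enat" where
  "ecard S = (if finite S then enat (card S) else \<infinity>)"

lemma ecard_eq_enat: "ecard S = enat k \<longleftrightarrow> finite S \<and> card S = k"
  by (simp add: ecard_def)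

text \<open>For 0 < x < 1 the convention x ^ \<infinity> = 0 is the limit of x ^ n, so E x ^ N is a
  power series over the finite values of N even if N may be infinite.\<close>

definition epow :: "real \<Rightarrow> enat \<Rightarrow> real" where
  "epow x n = (case n of enat k \<Rightarrow> x ^ k | \<infinity> \<Rightarrow> 0)"

lemma epow_simps [simp]: "epow x (enat k) = x ^ k" "epow x \<infinity> = 0"
  by (simp_all add: epow_def)

lemma epow_bounds: "0 \<le> x \<Longrightarrow> x \<le> 1 \<Longrightarrow> 0 \<le> epow x n \<and> epow x n \<le> 1"
  by (cases n) (auto simp: power_le_one)

lemma eneg_mult_count:
  assumes "0 < y" and that: "B \<subseteq> A"
  shows "eneg (ennreal y * emeasure (count_space A) B) = ennreal (epow (exp (- y)) (ecard B))"
proof (cases "finite B")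
  case True
  then have "emeasure (count_space A) B = of_nat (card B)" using that by simp
  then have "ennreal y * emeasure (count_space A) B = ennreal (y * real (card B))"
    using assms by (simp add: ennreal_mult ennreal_of_nat_eq_real_of_nat)
  then show ?thesis using True assms
    by (simp add: eneg_ennreal ecard_def mult.commute flip: exp_of_nat_mult)
next
  case False
  then have "ennreal y * emeasure (count_space A) B = \<infinity>"
    using assms that by (simp add: ennreal_mult_top)
  then have "eneg (ennreal y * emeasure (count_space A) B) = 0" by (simp add: eneg_def)
  then show ?thesis using False by (simp add: ecard_def)
qed

text \<open>The definition of a Poisson process supplies only events of the form N = k with k
  finite; N = \<infinity> is the complement of their countable union.\<close>

lemma measurable_enat_iff:
  fixes N :: "'w \<Rightarrow> enat"
  assumes "\<And>k. {\<omega>\<in>space M. N \<omega> = enat k} \<in> sets M"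
  shows "N \<in> measurable M (count_space UNIV)"
proof -
  have s: "N -` {n} \<inter> space M \<in> sets M" for n
  proof (cases n)
    case (enat k)
    then show ?thesis using assms[of k] by (simp add: vimage_def Int_def conj_commute)
  next
    case infinity
    have "N -` {\<infinity>} \<inter> space M = space M - (\<Union>k. {\<omega>\<in>space M. N \<omega> = enat k})" by (auto simp: enat_ord_simps)
    then show ?thesis using assms infinity by auto
  qed
  show ?thesis by (subst measurable_count_space_eq2_countable) (use s in auto)
qed

text \<open>Equality is known on (0, 1) only, not on a neighbourhood of 0. Once the coefficients
  below n agree, dividing by x ^ n leaves a series with constant term a n - b n that vanishes on (0,
  1); letting x tend to 0 from the right finishes.\<close>

lemma powser_unique:
  fixes a b :: "nat \<Rightarrow> real"
  assumes a: "\<And>x. 0 < x \<Longrightarrow> x < 1 \<Longrightarrow> (\<lambda>n. a n * x ^ n) sums s x"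
    and b: "\<And>x. 0 < x \<Longrightarrow> x < 1 \<Longrightarrow> (\<lambda>n. b n * x ^ n) sums s x"
  shows "a n = b n"
proof (induction n rule: less_induct)
  case (less n)
  define d where "d m = a (m + n) - b (m + n)" for m
  have d0: "(\<lambda>m. d m * x ^ m) sums 0" if x: "0 < x" "x < 1" for x
  proof -
    have "(\<lambda>n. (a n - b n) * x ^ n) sums 0"
      using sums_diff[OF a b, OF x x] by (simp add: algebra_simps)
    moreover have "(\<Sum>i<n. (a i - b i) * x ^ i) = 0" using less by (auto intro!: sum.neutral)
    ultimately have "(\<lambda>m. (a (m + n) - b (m + n)) * x ^ (m + n)) sums 0"
      using sums_split_initial_segment[of "\<lambda>n. (a n - b n) * x ^ n" 0 n] by simp
    then have "(\<lambda>m. inverse (x ^ n) * ((a (m + n) - b (m + n)) * x ^ (m + n))) sums (inverse (x^n) * 0)"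
      by (rule sums_mult)
    moreover have "inverse (x ^ n) * ((a (m + n) - b (m + n)) * x ^ (m + n)) = d m * x ^ m" for m
      using x by (simp add: d_def power_add)
    ultimately show ?thesis by simp
  qed
  define f where "f x = (\<Sum>m. d m * x ^ m)" for x
  have "f \<midarrow>0\<rightarrow> d 0"
  proof (rule powser_limit_0)
    fix x :: real assume "norm x < 1/2"
    have "summable (\<lambda>m. d m * x ^ m)"
      by (rule powser_inside[OF sums_summable[OF d0[of "1/2"]]]) (use \<open>norm x < 1/2\<close> in auto)
    then show "(\<lambda>m. d m * x ^ m) sums f x" unfolding f_def by (rule summable_sums)
  qed simp
  then have 1: "(f \<longlongrightarrow> d 0) (at_right 0)" by (rule tendsto_mono[rotated]) (rule at_le, simp)
  have "eventually (\<lambda>x. f x = 0) (at_right (0::real))"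
    unfolding eventually_at_right_field
    by (rule exI[of _ 1]) (use d0 in \<open>auto simp: f_def sums_iff\<close>)
  then have "(f \<longlongrightarrow> 0) (at_right 0)" by (simp add: tendsto_eventually)
  with 1 have "d 0 = 0" by (rule tendsto_unique[rotated]) simp
  then show ?case by (simp add: d_def)
qed

text \<open>Dominated by a geometric series, the expansion in powers of x may be integrated term by
  term. The weight V carries the factors of the other counts, so that several counts can be treated
  one after the other.\<close>

lemma epow_expand:
  fixes N :: "'w \<Rightarrow> enat"
  assumes "finite_measure M" and V[measurable]: "V \<in> borel_measurable M"
    and V01: "\<And>\<omega>. \<omega> \<in> space M \<Longrightarrow> 0 \<le> V \<omega> \<and> V \<omega> \<le> (1::real)"
    and N[measurable]: "N \<in> measurable M (count_space UNIV)" and x: "0 < x" "x < 1"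
  shows "(\<lambda>n. (\<integral>\<omega>. V \<omega> * of_bool (N \<omega> = enat n) \<partial>M) * x ^ n) sums (\<integral>\<omega>. V \<omega> * epow x (N \<omega>) \<partial>M)"
proof -
  interpret finite_measure M by fact
  define g where "g n \<omega> = V \<omega> * of_bool (N \<omega> = enat n) * x ^ n" for n \<omega>
  have gm[measurable]: "g n \<in> borel_measurable M" for n unfolding g_def by measurable
  have gb: "\<bar>g n \<omega>\<bar> \<le> x ^ n" if "\<omega> \<in> space M" for n \<omega>
    using V01[OF that] x by (auto simp: g_def mult_le_cancel_right2)
  have int: "integrable M (g n)" for n
    by (rule integrable_const_bound[of _ "x ^ n"]) (use gb in auto)
  have smx: "summable (\<lambda>n. x ^ n)" using x by (intro summable_geometric) auto
  have sm: "summable (\<lambda>n. norm (g n \<omega>))" if "\<omega> \<in> space M" for \<omega>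
    by (rule summable_comparison_test'[OF smx, of 0]) (use gb[OF that] in auto)
  have smi: "summable (\<lambda>n. \<integral>\<omega>. norm (g n \<omega>) \<partial>M)"
  proof (rule summable_comparison_test'[where g="\<lambda>n. x ^ n * measure M (space M)" and N=0])
    show "summable (\<lambda>n. x ^ n * measure M (space M))" using smx by (rule summable_mult2)
    fix n
    have "(\<integral>\<omega>. norm (g n \<omega>) \<partial>M) \<le> (\<integral>\<omega>. x ^ n \<partial>M)"
      using int gb by (intro integral_mono) auto
    then show "norm (\<integral>\<omega>. norm (g n \<omega>) \<partial>M) \<le> x ^ n * measure M (space M)" by (simp add: mult.commute)
  qed
  have "(\<lambda>n. integral\<^sup>L M (g n)) sums (\<integral>\<omega>. (\<Sum>n. g n \<omega>) \<partial>M)"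
    by (rule sums_integral) (use int sm smi in auto)
  moreover have "(\<Sum>n. g n \<omega>) = V \<omega> * epow x (N \<omega>)" for \<omega>
  proof (cases "N \<omega>")
    case (enat k)
    have "(\<Sum>n. g n \<omega>) = (\<Sum>n\<in>{k}. g n \<omega>)" by (rule suminf_finite) (auto simp: g_def enat)
    then show ?thesis by (simp add: g_def enat)
  qed (simp add: g_def)
  moreover have "integral\<^sup>L M (g n) = (\<integral>\<omega>. V \<omega> * of_bool (N \<omega> = enat n) \<partial>M) * x ^ n" for n
    unfolding g_def by simp
  ultimately show ?thesis by simp
qed

lemma measurable_epow [measurable]: "(\<lambda>n. epow x n) \<in> measurable (count_space UNIV) borel"
  by simp

lemma epow_prod_bounds:
  assumes "\<And>j. j \<in> J \<Longrightarrow> 0 < x j \<and> x j < 1"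
  shows "0 \<le> (\<Prod>j\<in>J. epow (x j) (n j)) \<and> (\<Prod>j\<in>J. epow (x j) (n j)) \<le> 1"
proof -
  have "0 \<le> epow (x j) (n j) \<and> epow (x j) (n j) \<le> 1" if "j \<in> J" for j
    using assms[OF that] by (intro epow_bounds) auto
  then show ?thesis by (simp add: prod_nonneg prod_le_1)
qed

lemma mult_le_1_real: "0 \<le> a \<and> a \<le> 1 \<Longrightarrow> 0 \<le> b \<and> b \<le> 1 \<Longrightarrow> 0 \<le> a * b \<and> a * b \<le> (1::real)"
  by (auto intro: mult_le_one)

text \<open>One count is resolved at a time: with the other variables held fixed, comparing power
  series in the variable of j replaces its generating factor by the indicator of N j = k j, which
  joins the weight. This is why W and W' run through the induction. The two families may live on
  different spaces.\<close>

lemma pgf_unique: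
  fixes N :: "'j \<Rightarrow> 'w \<Rightarrow> enat" and N' :: "'j \<Rightarrow> 'v \<Rightarrow> enat"
  assumes "finite J" and M: "finite_measure M" and M': "finite_measure M'"
    and "\<And>j. j \<in> J \<Longrightarrow> N j \<in> measurable M (count_space UNIV)"
    and "\<And>j. j \<in> J \<Longrightarrow> N' j \<in> measurable M' (count_space UNIV)"
    and "W \<in> borel_measurable M" "\<And>\<omega>. \<omega> \<in> space M \<Longrightarrow> 0 \<le> W \<omega> \<and> W \<omega> \<le> 1"
    and "W' \<in> borel_measurable M'" "\<And>\<omega>. \<omega> \<in> space M' \<Longrightarrow> 0 \<le> W' \<omega> \<and> W' \<omega> \<le> 1"
    and "\<And>x. (\<And>j. j \<in> J \<Longrightarrow> 0 < x j \<and> x j < 1) \<Longrightarrow>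
       (\<integral>\<omega>. W \<omega> * (\<Prod>j\<in>J. epow (x j) (N j \<omega>)) \<partial>M) =
       (\<integral>\<omega>. W' \<omega> * (\<Prod>j\<in>J. epow (x j) (N' j \<omega>)) \<partial>M')"
  shows "(\<integral>\<omega>. W \<omega> * (\<Prod>j\<in>J. of_bool (N j \<omega> = enat (k j))) \<partial>M) =
       (\<integral>\<omega>. W' \<omega> * (\<Prod>j\<in>J. of_bool (N' j \<omega> = enat (k j))) \<partial>M')"
  using assms(1,4-)
proof (induction J arbitrary: W W' rule: finite_induct)
  case empty
  then show ?case by simp
next
  case (insert j J)
  have [measurable]: "N i \<in> measurable M (count_space UNIV)" "N' i \<in> measurable M' (count_space UNIV)"
    if "i = j \<or> i \<in> J" for i using insert.prems(1,2)[of i] that by auto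
  note [measurable] = insert.prems(3,5)
  have "(\<integral>\<omega>. (W \<omega> * of_bool (N j \<omega> = enat (k j))) * (\<Prod>j\<in>J. of_bool (N j \<omega> = enat (k j))) \<partial>M) =
       (\<integral>\<omega>. (W' \<omega> * of_bool (N' j \<omega> = enat (k j))) * (\<Prod>j\<in>J. of_bool (N' j \<omega> = enat (k j))) \<partial>M')"
  proof (rule insert.IH)
    fix x assume x: "\<And>j. j \<in> J \<Longrightarrow> 0 < x j \<and> x j < (1::real)"
    have bx: "0 \<le> (\<Prod>j\<in>J. epow (x j) (n j))" "(\<Prod>j\<in>J. epow (x j) (n j)) \<le> 1" for n
      using epow_prod_bounds[OF x, of J id n] by auto
    let ?V = "\<lambda>\<omega>. W \<omega> * (\<Prod>j\<in>J. epow (x j) (N j \<omega>))"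
    let ?V' = "\<lambda>\<omega>. W' \<omega> * (\<Prod>j\<in>J. epow (x j) (N' j \<omega>))"
    have "(\<integral>\<omega>. ?V \<omega> * of_bool (N j \<omega> = enat (k j)) \<partial>M) = (\<integral>\<omega>. ?V' \<omega> * of_bool (N' j \<omega> = enat (k j)) \<partial>M')"
    proof (rule powser_unique[where s="\<lambda>y. \<integral>\<omega>. ?V \<omega> * epow y (N j \<omega>) \<partial>M"])
      fix y :: real assume y: "0 < y" "y < 1"
      show "(\<lambda>n. (\<integral>\<omega>. ?V \<omega> * of_bool (N j \<omega> = enat n) \<partial>M) * y ^ n) sums (\<integral>\<omega>. ?V \<omega> * epow y (N j \<omega>) \<partial>M)"
        by (rule epow_expand[OF M _ mult_le_1_real _ y])
           (use insert.prems(4) in \<open>auto simp: bx\<close>)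
      have "(\<integral>\<omega>. ?V \<omega> * epow y (N j \<omega>) \<partial>M) =
          (\<integral>\<omega>. W \<omega> * (\<Prod>i\<in>insert j J. epow ((x(j := y)) i) (N i \<omega>)) \<partial>M)"
        using insert.hyps by (intro Bochner_Integration.integral_cong refl)
          (auto simp: mult_ac intro!: prod.cong)
      also have "\<dots> = (\<integral>\<omega>. W' \<omega> * (\<Prod>i\<in>insert j J. epow ((x(j := y)) i) (N' i \<omega>)) \<partial>M')"
        by (rule insert.prems(7)) (use x y in auto)
      also have "\<dots> = (\<integral>\<omega>. ?V' \<omega> * epow y (N' j \<omega>) \<partial>M')"
        using insert.hyps by (intro Bochner_Integration.integral_cong refl)
          (auto simp: mult_ac intro!: prod.cong)
      finally show "(\<lambda>n. (\<integral>\<omega>. ?V' \<omega> * of_bool (N' j \<omega> = enat n) \<partial>M') * y ^ n) sums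
          (\<integral>\<omega>. ?V \<omega> * epow y (N j \<omega>) \<partial>M)"
        by (simp only:) (rule epow_expand[OF M' _ mult_le_1_real _ y],
          use insert.prems(6) in \<open>auto simp: bx\<close>)
    qed
    then show "(\<integral>\<omega>. W \<omega> * of_bool (N j \<omega> = enat (k j)) * (\<Prod>j\<in>J. epow (x j) (N j \<omega>)) \<partial>M) =
         (\<integral>\<omega>. W' \<omega> * of_bool (N' j \<omega> = enat (k j)) * (\<Prod>j\<in>J. epow (x j) (N' j \<omega>)) \<partial>M')"
      by (simp only: mult_ac)
  next
    show "0 \<le> W \<omega> * of_bool (N j \<omega> = enat (k j)) \<and> W \<omega> * of_bool (N j \<omega> = enat (k j)) \<le> 1"
      if "\<omega> \<in> space M" for \<omega> using insert.prems(4)[OF that] by simp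
    show "0 \<le> W' \<omega> * of_bool (N' j \<omega> = enat (k j)) \<and> W' \<omega> * of_bool (N' j \<omega> = enat (k j)) \<le> 1"
      if "\<omega> \<in> space M'" for \<omega> using insert.prems(6)[OF that] by simp
    show "(\<lambda>\<omega>. W \<omega> * of_bool (N j \<omega> = enat (k j))) \<in> borel_measurable M"
      "(\<lambda>\<omega>. W' \<omega> * of_bool (N' j \<omega> = enat (k j))) \<in> borel_measurable M'" by measurable
    show "N i \<in> measurable M (count_space UNIV)" "N' i \<in> measurable M' (count_space UNIV)"
      if "i \<in> J" for i using insert.prems(1,2) that by blast+
  qed
  then show ?case using insert.hyps by (simp add: mult.assoc)
qed

section \<open>Poisson processes and their Laplace functionals\<close>

lemma poisson_process_ecard:
  assumes P: "poisson_process M \<mu> I T" and A: "A \<in> sets \<mu>" "emeasure \<mu> A < \<infinity>"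
  shows "(\<lambda>\<omega>. ecard {i \<in> I \<omega>. T i \<omega> \<in> A}) \<in> measurable M (count_space UNIV)"
proof (rule measurable_enat_iff)
  fix k
  have "{\<omega> \<in> space M. \<forall>j\<in>{0::nat}. finite {i \<in> I \<omega>. T i \<omega> \<in> A} \<and> card {i \<in> I \<omega>. T i \<omega> \<in> A} = k} \<in> sets M"
    using P[unfolded poisson_process_def Let_def, THEN conjunct2, THEN spec, of "{0}", THEN spec,
      of "\<lambda>_. A", THEN spec, of "\<lambda>_. k"] A by (simp add: disjoint_family_on_def)
  then show "{\<omega> \<in> space M. ecard {i \<in> I \<omega>. T i \<omega> \<in> A} = enat k} \<in> sets M"
    by (simp add: ecard_eq_enat)
qed

lemma poisson_sums:
  "(\<lambda>n. (m ^ n / fact n * exp (- m)) * x ^ n) sums exp (- (m * (1 - x)))" for m x :: real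
proof -
  have "(\<lambda>n. exp (- m) * ((m * x) ^ n /\<^sub>R fact n)) sums (exp (- m) * exp (m * x))"
    by (intro sums_mult exp_converges)
  moreover have "exp (- m) * ((m * x) ^ n /\<^sub>R fact n) = (m ^ n / fact n * exp (- m)) * x ^ n" for n
    by (simp add: power_mult_distrib divide_inverse mult_ac)
  moreover have "exp (- m) * exp (m * x) = exp (- (m * (1 - x)))"
    by (simp add: mult_exp_exp algebra_simps)
  ultimately show ?thesis by simp
qed

lemma poisson_process_pgf_nat:
  fixes J :: "nat set"
  assumes P: "poisson_process M \<mu> I T" and J: "finite J" and dis: "disjoint_family_on A J"
    and A: "\<And>j. j \<in> J \<Longrightarrow> A j \<in> sets \<mu> \<and> emeasure \<mu> (A j) < \<infinity>"
    and x: "\<And>j. j \<in> J \<Longrightarrow> 0 < x j \<and> x j < 1"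
  shows "(\<integral>\<omega>. (\<Prod>j\<in>J. epow (x j) (ecard {i \<in> I \<omega>. T i \<omega> \<in> A j})) \<partial>M) =
    (\<Prod>j\<in>J. exp (- (measure \<mu> (A j) * (1 - x j))))"
proof -
  interpret prob_space M using P by (simp add: poisson_process_def)
  define N where "N j \<omega> = ecard {i \<in> I \<omega>. T i \<omega> \<in> A j}" for j \<omega>
  define p where "p j n = measure \<mu> (A j) ^ n / fact n * exp (- measure \<mu> (A j))" for j n
  have N[measurable]: "N j \<in> measurable M (count_space UNIV)" if "j \<in> J" for j
    unfolding N_def using poisson_process_ecard[OF P] A[OF that] by blast
  \<comment> \<open>K holds the counts already summed out against powers of x; the others are still
    fixed at k. Quantifying over k inside the induction lets the value at the newly treated index i
    run through all n.\<close>
  have step: "\<forall>k. (\<integral>\<omega>. (\<Prod>j\<in>J-K. of_bool (N j \<omega> = enat (k j))) * (\<Prod>j\<in>K. epow (x j) (N j \<omega>)) \<partial>M) =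
      (\<Prod>j\<in>J-K. p j (k j)) * (\<Prod>j\<in>K. exp (- (measure \<mu> (A j) * (1 - x j))))"
    if "K \<subseteq> J" for K
    using finite_subset[OF that J] that
  proof (induction K rule: finite_induct)
    case empty
    show ?case
    proof
    fix k
    let ?E = "{\<omega> \<in> space M. \<forall>j\<in>J. N j \<omega> = enat (k j)}"
    have E: "?E \<in> sets M" and mE: "measure M ?E = (\<Prod>j\<in>J. p j (k j))"
      using P[unfolded poisson_process_def Let_def, THEN conjunct2, THEN spec, of J, THEN spec,
        of A, THEN spec, of k] J dis A by (simp_all add: N_def p_def ecard_eq_enat)
    have "(\<integral>\<omega>. (\<Prod>j\<in>J. of_bool (N j \<omega> = enat (k j))) \<partial>M) = (\<integral>\<omega>. (indicator ?E \<omega> :: real) \<partial>M)"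
    proof (rule Bochner_Integration.integral_cong[OF refl])
      fix \<omega> assume "\<omega> \<in> space M"
      then show "(\<Prod>j\<in>J. of_bool (N j \<omega> = enat (k j))) = (indicator ?E \<omega> :: real)"
        by (cases "\<forall>j\<in>J. N j \<omega> = enat (k j)") (use J in \<open>auto intro!: prod_zero\<close>)
    qed
    also have "\<dots> = measure M ?E" using E by simp
    finally show "(\<integral>\<omega>. (\<Prod>j\<in>J-{}. of_bool (N j \<omega> = enat (k j))) * (\<Prod>j\<in>{}. epow (x j) (N j \<omega>)) \<partial>M) =
      (\<Prod>j\<in>J-{}. p j (k j)) * (\<Prod>j\<in>{}. exp (- (measure \<mu> (A j) * (1 - x j))))" using mE by simp
    qed
  next
    case (insert i K)
    show ?case
    proof
    fix k
    have iJ: "i \<in> J" "K \<subseteq> J" using insert.prems by auto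
    have eq: "J - K = insert i (J - insert i K)" using insert by auto
    define V where "V \<omega> = (\<Prod>j\<in>J-insert i K. of_bool (N j \<omega> = enat (k j))) * (\<Prod>j\<in>K. epow (x j) (N j \<omega>))" for \<omega>
    let ?R = "(\<Prod>j\<in>J-insert i K. p j (k j)) * (\<Prod>j\<in>K. exp (- (measure \<mu> (A j) * (1 - x j))))"
    have [measurable]: "V \<in> borel_measurable M" unfolding V_def
      using iJ by (intro borel_measurable_times borel_measurable_prod) (auto intro!: measurable_compose[OF N])
    have V01: "0 \<le> V \<omega> \<and> V \<omega> \<le> 1" for \<omega>
      unfolding V_def using iJ x by (intro mult_le_1_real conjI prod_nonneg prod_le_1 epow_prod_bounds) auto
    have "(\<lambda>n. (\<integral>\<omega>. V \<omega> * of_bool (N i \<omega> = enat n) \<partial>M) * x i ^ n) sums (\<integral>\<omega>. V \<omega> * epow (x i) (N i \<omega>) \<partial>M)"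
      by (rule epow_expand) (use V01 N iJ x finite_measure_axioms in auto)
    moreover have "(\<integral>\<omega>. V \<omega> * of_bool (N i \<omega> = enat n) \<partial>M) = p i n * ?R" for n
    proof -
      have "(\<integral>\<omega>. V \<omega> * of_bool (N i \<omega> = enat n) \<partial>M) =
        (\<integral>\<omega>. (\<Prod>j\<in>J-K. of_bool (N j \<omega> = enat ((k(i:=n)) j))) * (\<Prod>j\<in>K. epow (x j) (N j \<omega>)) \<partial>M)"
        unfolding V_def eq using J
        by (intro Bochner_Integration.integral_cong refl) (auto simp: mult_ac intro!: prod.cong)
      also have "\<dots> = (\<Prod>j\<in>J-K. p j ((k(i:=n)) j)) * (\<Prod>j\<in>K. exp (- (measure \<mu> (A j) * (1 - x j))))"
        using insert.IH[OF iJ(2)] by blast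
      also have "(\<Prod>j\<in>J-K. p j ((k(i:=n)) j)) = p i n * (\<Prod>j\<in>J-insert i K. p j (k j))"
        unfolding eq using J by (auto intro!: prod.cong)
      finally show ?thesis by simp
    qed
    moreover have "(\<lambda>n. p i n * ?R * x i ^ n) sums (exp (- (measure \<mu> (A i) * (1 - x i))) * ?R)"
      using sums_mult2[OF poisson_sums[of "measure \<mu> (A i)" "x i"], of ?R] unfolding p_def
      by (simp only: mult_ac)
    ultimately have "(\<integral>\<omega>. V \<omega> * epow (x i) (N i \<omega>) \<partial>M) = exp (- (measure \<mu> (A i) * (1 - x i))) * ?R"
      by (simp add: sums_unique2)
    then show "(\<integral>\<omega>. (\<Prod>j\<in>J-insert i K. of_bool (N j \<omega> = enat (k j))) * (\<Prod>j\<in>insert i K. epow (x j) (N j \<omega>)) \<partial>M) =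
      (\<Prod>j\<in>J-insert i K. p j (k j)) * (\<Prod>j\<in>insert i K. exp (- (measure \<mu> (A j) * (1 - x j))))"
      using insert.hyps by (simp add: V_def mult_ac)
    qed
  qed
  show ?thesis using step[of J] by (simp add: N_def)
qed

text \<open>\<open>poisson_process\<close> quantifies over index sets of naturals; an arbitrary
  finite J is enumerated.\<close>

lemma poisson_process_pgf:
  assumes P: "poisson_process M \<mu> I T" and J: "finite J" and dis: "disjoint_family_on A J"
    and A: "\<And>j. j \<in> J \<Longrightarrow> A j \<in> sets \<mu> \<and> emeasure \<mu> (A j) < \<infinity>"
    and x: "\<And>j. j \<in> J \<Longrightarrow> 0 < x j \<and> x j < 1"
  shows "(\<integral>\<omega>. (\<Prod>j\<in>J. epow (x j) (ecard {i \<in> I \<omega>. T i \<omega> \<in> A j})) \<partial>M) =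
    (\<Prod>j\<in>J. exp (- (measure \<mu> (A j) * (1 - x j))))"
proof -
  obtain f :: "nat \<Rightarrow> _" and n where f: "J = f ` {..<n}" "inj_on f {..<n}"
    using finite_imp_nat_seg_image_inj_on[OF J] by (auto simp: lessThan_def)
  have "disjoint_family_on (A \<circ> f) {..<n}"
    using dis f unfolding disjoint_family_on_def by (auto simp: inj_on_def)
  from poisson_process_pgf_nat[OF P _ this, of "x \<circ> f"] f A x show ?thesis
    by (simp add: prod.reindex)
qed

lemma count_space_sum_simple:
  fixes F :: "'a \<Rightarrow> ennreal"
  assumes "finite (range F)"
  shows "(\<integral>\<^sup>+i. F (t i) \<partial>count_space I) =
    (\<Sum>y\<in>range F - {0}. y * emeasure (count_space I) {i\<in>I. t i \<in> F -` {y}})"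
proof -
  have rep: "F (t i) = (\<Sum>y\<in>range F - {0}. y * indicator {i\<in>I. t i \<in> F -` {y}} i)" if "i \<in> I" for i
  proof -
    have "(\<Sum>y\<in>range F - {0}. y * indicator {i\<in>I. t i \<in> F -` {y}} i) =
      (\<Sum>y\<in>range F - {0}. if y = F (t i) then y else 0)"
      using that by (intro sum.cong) auto
    then show ?thesis using assms by (simp add: sum.delta)
  qed
  have "(\<integral>\<^sup>+i. F (t i) \<partial>count_space I) =
    (\<integral>\<^sup>+i. (\<Sum>y\<in>range F - {0}. y * indicator {i\<in>I. t i \<in> F -` {y}} i) \<partial>count_space I)"
    by (rule nn_integral_cong, rule rep) simp
  also have "\<dots> = (\<Sum>y\<in>range F - {0}. y * emeasure (count_space I) {i\<in>I. t i \<in> F -` {y}})"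
    by (subst nn_integral_sum) (auto intro!: sum.cong nn_integral_cmult_indicator)
  finally show ?thesis .
qed

lemma eneg_less_1: "0 < y \<Longrightarrow> eneg y < 1"
  by (cases y) (auto simp: eneg_def ennreal_less_one_iff)

lemma poisson_laplace_simple:
  assumes P: "poisson_process M \<mu> I T" and sp: "space \<mu> = UNIV"
    and F: "simple_function \<mu> F" "\<And>x. F x < \<infinity>"
    and fin: "(\<integral>\<^sup>+x. (1 - eneg (F x)) \<partial>\<mu>) < \<infinity>"
  shows "(\<lambda>\<omega>. eneg (\<integral>\<^sup>+i. F (T i \<omega>) \<partial>count_space (I \<omega>))) \<in> borel_measurable M"
    and "(\<integral>\<^sup>+\<omega>. eneg (\<integral>\<^sup>+i. F (T i \<omega>) \<partial>count_space (I \<omega>)) \<partial>M) = eneg (\<integral>\<^sup>+x. (1 - eneg (F x)) \<partial>\<mu>)"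
proof -
  interpret prob_space M using P by (simp add: poisson_process_def)
  have finr: "finite (range F)" using F sp by (simp add: simple_function_def)
  \<comment> \<open>The level 0 is left out: its level set may have infinite intensity, about which
    \<open>poisson_process\<close> says nothing, but it contributes nothing to the sum over the
    points.\<close>
  define Y where "Y = range F - {0}"
  define A where "A y = F -` {y}" for y
  define N where "N y \<omega> = ecard {i \<in> I \<omega>. T i \<omega> \<in> A y}" for y \<omega>
  have Y: "finite Y" using finr by (simp add: Y_def)
  have y: "0 < y" "y < \<infinity>" "0 < enn2real y" "ennreal (enn2real y) = y" if "y \<in> Y" for y
    using that F(2) by (auto simp: Y_def enn2real_positive_iff zero_less_iff_neq_zero)
  have As: "A y \<in> sets \<mu>" for y
    using simple_functionD(2)[OF F(1), of "{y}"] sp by (simp add: A_def)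
  have rep: "g (F x) = (\<Sum>y\<in>Y. g y * indicator (A y) x)" if "g 0 = (0::ennreal)" for g x
  proof -
    have "(\<Sum>y\<in>Y. g y * indicator (A y) x) = (\<Sum>y\<in>Y. if y = F x then g y else 0)"
      by (intro sum.cong) (auto simp: A_def)
    then show ?thesis using Y that by (auto simp: sum.delta Y_def)
  qed
  have int: "(\<integral>\<^sup>+x. (1 - eneg (F x)) \<partial>\<mu>) = (\<Sum>y\<in>Y. (1 - eneg y) * emeasure \<mu> (A y))"
    using As by (subst rep[of "\<lambda>y. 1 - eneg y"])
      (auto simp: nn_integral_cmult_indicator intro!: trans[OF nn_integral_sum] sum.cong)
  \<comment> \<open>For a positive level y the factor 1 - exp (- y) is positive, so finiteness of
    the exponent forces the level set to have finite intensity.\<close>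
  have Afin: "emeasure \<mu> (A y) < \<infinity>" if "y \<in> Y" for y
  proof -
    have "(1 - eneg y) * emeasure \<mu> (A y) < \<infinity>"
      using fin that Y unfolding int by (auto simp: ennreal_sum_less_top less_top)
    moreover have "1 - eneg y > 0" using eneg_less_1[OF y(1)[OF that]] by (simp add: diff_gr0_ennreal)
    ultimately show ?thesis by (auto simp: ennreal_mult_less_top)
  qed
  have N[measurable]: "N y \<in> measurable M (count_space UNIV)" if "y \<in> Y" for y
    unfolding N_def using poisson_process_ecard[OF P As Afin[OF that]] .
  have val: "eneg (\<integral>\<^sup>+i. F (T i \<omega>) \<partial>count_space (I \<omega>)) = ennreal (\<Prod>y\<in>Y. epow (exp (- enn2real y)) (N y \<omega>))" for \<omega>
  proof -
    have "eneg (\<integral>\<^sup>+i. F (T i \<omega>) \<partial>count_space (I \<omega>)) =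
      (\<Prod>y\<in>Y. eneg (y * emeasure (count_space (I \<omega>)) {i\<in>I \<omega>. T i \<omega> \<in> A y}))"
      using Y by (simp add: count_space_sum_simple[OF finr] eneg_sum Y_def A_def)
    also have "\<dots> = (\<Prod>y\<in>Y. ennreal (epow (exp (- enn2real y)) (N y \<omega>)))"
    proof (intro prod.cong refl)
      fix z assume z: "z \<in> Y"
      show "eneg (z * emeasure (count_space (I \<omega>)) {i\<in>I \<omega>. T i \<omega> \<in> A z}) = ennreal (epow (exp (- enn2real z)) (N z \<omega>))"
        using eneg_mult_count[OF y(3)[OF z], of "{i\<in>I \<omega>. T i \<omega> \<in> A z}" "I \<omega>"] y(4)[OF z]
        by (simp add: N_def)
    qed
    also have "\<dots> = ennreal (\<Prod>y\<in>Y. epow (exp (- enn2real y)) (N y \<omega>))"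
      by (rule prod_ennreal) (simp add: epow_bounds)
    finally show ?thesis .
  qed
  have m[measurable]: "(\<lambda>\<omega>. \<Prod>y\<in>Y. epow (exp (- enn2real y)) (N y \<omega>)) \<in> borel_measurable M"
    by (intro borel_measurable_prod) (auto intro!: measurable_compose[OF N])
  show "(\<lambda>\<omega>. eneg (\<integral>\<^sup>+i. F (T i \<omega>) \<partial>count_space (I \<omega>))) \<in> borel_measurable M"
    unfolding val by measurable
  have x: "0 < exp (- enn2real y) \<and> exp (- enn2real y) < 1" if "y \<in> Y" for y
    using y[OF that] by simp
  have b: "0 \<le> (\<Prod>y\<in>Y. epow (exp (- enn2real y)) (N y \<omega>)) \<and> (\<Prod>y\<in>Y. epow (exp (- enn2real y)) (N y \<omega>)) \<le> 1" for \<omega>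
    using epow_prod_bounds[of Y "\<lambda>y. exp (- enn2real y)" "\<lambda>y. N y \<omega>"] x by blast
  have "(\<integral>\<^sup>+\<omega>. ennreal (\<Prod>y\<in>Y. epow (exp (- enn2real y)) (N y \<omega>)) \<partial>M) =
    ennreal (\<integral>\<omega>. (\<Prod>y\<in>Y. epow (exp (- enn2real y)) (N y \<omega>)) \<partial>M)"
    by (intro nn_integral_eq_integral integrable_const_bound[of _ 1]) (use b in auto)
  also have "(\<integral>\<omega>. (\<Prod>y\<in>Y. epow (exp (- enn2real y)) (N y \<omega>)) \<partial>M) =
      (\<Prod>y\<in>Y. exp (- (measure \<mu> (A y) * (1 - exp (- enn2real y)))))"
    unfolding N_def by (rule poisson_process_pgf[OF P Y]) (use As Afin x in \<open>auto simp: disjoint_family_on_def A_def\<close>)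
  also have "ennreal \<dots> = (\<Prod>y\<in>Y. ennreal (exp (- (measure \<mu> (A y) * (1 - exp (- enn2real y))))))"
    by (rule prod_ennreal[symmetric]) simp
  also have "\<dots> = (\<Prod>y\<in>Y. eneg ((1 - eneg y) * emeasure \<mu> (A y)))"
  proof (intro prod.cong refl)
    fix z assume z: "z \<in> Y"
    have "1 - eneg z = ennreal (1 - exp (- enn2real z))"
      using y(2)[OF z] by (simp add: eneg_def ennreal_minus flip: ennreal_1)
    moreover have "emeasure \<mu> (A z) = ennreal (measure \<mu> (A z))"
      using Afin[OF z] by (simp add: emeasure_eq_ennreal_measure less_top)
    ultimately have "(1 - eneg z) * emeasure \<mu> (A z) = ennreal (measure \<mu> (A z) * (1 - exp (- enn2real z)))"
      using y(3)[OF z] by (simp add: mult.commute flip: ennreal_mult)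
    then show "ennreal (exp (- (measure \<mu> (A z) * (1 - exp (- enn2real z))))) = eneg ((1 - eneg z) * emeasure \<mu> (A z))"
      using y(3)[OF z] by (simp add: eneg_ennreal)
  qed
  also have "\<dots> = eneg (\<integral>\<^sup>+x. (1 - eneg (F x)) \<partial>\<mu>)" using Y by (simp add: int eneg_sum)
  finally show "(\<integral>\<^sup>+\<omega>. eneg (\<integral>\<^sup>+i. F (T i \<omega>) \<partial>count_space (I \<omega>)) \<partial>M) = eneg (\<integral>\<^sup>+x. (1 - eneg (F x)) \<partial>\<mu>)"
    unfolding val .
qed

text \<open>Simple functions increase to F, so \<open>eneg\<close> decreases on both sides; the left
  side converges because it is bounded by 1 under a probability measure. Finiteness of the exponent
  passes from F to the approximations, whose positive level sets therefore have finite
  intensity.\<close>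

lemma poisson_laplace:
  assumes P: "poisson_process M \<mu> I T" and sp: "space \<mu> = UNIV"
    and F: "F \<in> borel_measurable \<mu>" and fin: "(\<integral>\<^sup>+x. (1 - eneg (F x)) \<partial>\<mu>) < \<infinity>"
  shows "(\<integral>\<^sup>+\<omega>. eneg (\<integral>\<^sup>+i. F (T i \<omega>) \<partial>count_space (I \<omega>)) \<partial>M) = eneg (\<integral>\<^sup>+x. (1 - eneg (F x)) \<partial>\<mu>)"
proof -
  interpret prob_space M using P by (simp add: poisson_process_def)
  obtain G where G: "\<And>n. simple_function \<mu> (G n)" "incseq G" "\<And>n x. G n x < \<infinity>" "\<And>x. (SUP n. G n x) = F x"
    using borel_measurable_implies_simple_function_sequence'[OF F] by auto
  have GF: "G n x \<le> F x" for n x unfolding G(4)[symmetric] by (rule SUP_upper) simp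
  have finG: "(\<integral>\<^sup>+x. (1 - eneg (G n x)) \<partial>\<mu>) < \<infinity>" for n
    by (rule le_less_trans[OF nn_integral_mono fin]) (intro ennreal_minus_mono order_refl eneg_antimono GF)
  note S = poisson_laplace_simple[OF P sp G(1,3) finG]
  have incG: "incseq (\<lambda>n. G n x)" for x using G(2) by (auto simp: incseq_def le_fun_def)
  have Gm: "G n \<in> borel_measurable \<mu>" for n using G(1) by (rule borel_measurable_simple_function)
  have s: "(\<integral>\<^sup>+i. F (T i \<omega>) \<partial>count_space (I \<omega>)) = (SUP n. \<integral>\<^sup>+i. G n (T i \<omega>) \<partial>count_space (I \<omega>))" for \<omega>
    unfolding G(4)[symmetric] by (rule nn_integral_monotone_convergence_SUP)
      (use incG in \<open>auto simp: incseq_def le_fun_def\<close>)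
  have inc: "incseq (\<lambda>n. \<integral>\<^sup>+i. G n (T i \<omega>) \<partial>count_space (I \<omega>))" for \<omega>
    using incG by (auto simp: incseq_def intro!: nn_integral_mono)
  have "(\<integral>\<^sup>+\<omega>. eneg (\<integral>\<^sup>+i. F (T i \<omega>) \<partial>count_space (I \<omega>)) \<partial>M) =
    (\<integral>\<^sup>+\<omega>. (INF n. eneg (\<integral>\<^sup>+i. G n (T i \<omega>) \<partial>count_space (I \<omega>))) \<partial>M)"
    by (simp add: s eneg_SUP[OF inc])
  also have "\<dots> = (INF n. \<integral>\<^sup>+\<omega>. eneg (\<integral>\<^sup>+i. G n (T i \<omega>) \<partial>count_space (I \<omega>)) \<partial>M)"
  proof (rule nn_integral_monotone_convergence_INF_decseq)
    show "decseq (\<lambda>n \<omega>. eneg (\<integral>\<^sup>+i. G n (T i \<omega>) \<partial>count_space (I \<omega>)))"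
      by (intro decseq_SucI le_funI eneg_antimono incseq_SucD[OF inc])
    have "(\<integral>\<^sup>+\<omega>. eneg (\<integral>\<^sup>+i. G 0 (T i \<omega>) \<partial>count_space (I \<omega>)) \<partial>M) \<le> (\<integral>\<^sup>+\<omega>. 1 \<partial>M)"
      by (intro nn_integral_mono eneg_le_1)
    also have "\<dots> < \<infinity>" by (simp add: emeasure_space_1)
    finally show "(\<integral>\<^sup>+\<omega>. eneg (\<integral>\<^sup>+i. G 0 (T i \<omega>) \<partial>count_space (I \<omega>)) \<partial>M) < \<infinity>" .
  qed (use S in auto)
  also have "\<dots> = (INF n. eneg (\<integral>\<^sup>+x. (1 - eneg (G n x)) \<partial>\<mu>))" by (simp add: S)
  also have "\<dots> = eneg (SUP n. \<integral>\<^sup>+x. (1 - eneg (G n x)) \<partial>\<mu>)"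
    by (rule eneg_SUP[symmetric])
       (intro incseq_SucI nn_integral_mono ennreal_minus_mono order_refl eneg_antimono incseq_SucD[OF incG])
  also have "(SUP n. \<integral>\<^sup>+x. (1 - eneg (G n x)) \<partial>\<mu>) = (\<integral>\<^sup>+x. (SUP n. 1 - eneg (G n x)) \<partial>\<mu>)"
  proof (rule nn_integral_monotone_convergence_SUP[symmetric])
    show "incseq (\<lambda>n x. 1 - eneg (G n x))"
      by (intro incseq_SucI le_funI ennreal_minus_mono order_refl eneg_antimono incseq_SucD[OF incG])
  qed (use Gm in measurable)
  also have "\<dots> = (\<integral>\<^sup>+x. (1 - eneg (F x)) \<partial>\<mu>)"
    unfolding G(4)[symmetric] eneg_SUP[OF incG] by (simp add: ennreal_INF_const_minus)
  finally show ?thesis .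
qed

definition poisson_pmf0 :: "real \<Rightarrow> nat pmf" where
  "poisson_pmf0 m = (if 0 < m then poisson_pmf m else return_pmf 0)"

lemma pmf_poisson_pmf0: "0 \<le> m \<Longrightarrow> pmf (poisson_pmf0 m) k = m ^ k / fact k * exp (- m)"
  by (cases "m = 0"; cases k) (auto simp: poisson_pmf0_def)

lemma poisson_pmf0_pgf:
  assumes "0 \<le> m" "0 < x" "x < 1"
  shows "(\<integral>n. epow x (enat n) \<partial>measure_pmf (poisson_pmf0 m)) = exp (- (m * (1 - x)))"
proof -
  have fm: "finite_measure (measure_pmf (poisson_pmf0 m))"
    using measure_pmf.finite_measure_axioms .
  have "(\<integral>n. of_bool (n = k) \<partial>measure_pmf (poisson_pmf0 m)) = pmf (poisson_pmf0 m) k" for k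
  proof -
    have "(\<integral>n. of_bool (n = k) \<partial>measure_pmf (poisson_pmf0 m)) =
      (\<integral>n. indicator {k} n \<partial>measure_pmf (poisson_pmf0 m) :: real)"
      by (intro Bochner_Integration.integral_cong) auto
    then show ?thesis by (simp add: pmf.rep_eq)
  qed
  with epow_expand[OF fm, of "\<lambda>_. 1" "enat" x] assms
  have "(\<lambda>k. pmf (poisson_pmf0 m) k * x ^ k) sums (\<integral>n. epow x (enat n) \<partial>measure_pmf (poisson_pmf0 m))"
    by simp
  with poisson_sums[of m x] assms show ?thesis by (simp add: pmf_poisson_pmf0 sums_unique2)
qed

lemma integral_prod_of_bool:
  fixes N :: "'j \<Rightarrow> 'w \<Rightarrow> enat"
  assumes "finite J" and N: "\<And>j. j \<in> J \<Longrightarrow> N j \<in> measurable M (count_space UNIV)"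
  shows "{\<omega>\<in>space M. \<forall>j\<in>J. N j \<omega> = enat (k j)} \<in> sets M"
    and "(\<integral>\<omega>. (\<Prod>j\<in>J. of_bool (N j \<omega> = enat (k j))) \<partial>M) = measure M {\<omega>\<in>space M. \<forall>j\<in>J. N j \<omega> = enat (k j)}"
proof -
  have "{\<omega>\<in>space M. N j \<omega> = enat (k j)} \<in> sets M" if "j \<in> J" for j
    using measurable_sets[OF N[OF that], of "{enat (k j)}"] by (simp add: vimage_def Int_def conj_commute)
  then show E: "{\<omega>\<in>space M. \<forall>j\<in>J. N j \<omega> = enat (k j)} \<in> sets M" (is "?E \<in> _")
    using assms(1) by (intro sets.sets_Collect_finite_All) auto
  have "(\<integral>\<omega>. (\<Prod>j\<in>J. of_bool (N j \<omega> = enat (k j))) \<partial>M) = (\<integral>\<omega>. (indicator ?E \<omega> :: real) \<partial>M)"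
  proof (rule Bochner_Integration.integral_cong[OF refl])
    fix \<omega> assume "\<omega> \<in> space M"
    then show "(\<Prod>j\<in>J. of_bool (N j \<omega> = enat (k j))) = (indicator ?E \<omega> :: real)"
      by (cases "\<forall>j\<in>J. N j \<omega> = enat (k j)") (use assms(1) in \<open>auto intro!: prod_zero\<close>)
  qed
  then show "(\<integral>\<omega>. (\<Prod>j\<in>J. of_bool (N j \<omega> = enat (k j))) \<partial>M) = measure M ?E"
    using E by simp
qed

text \<open>The counts are compared with independent Poisson variables on a product space, whose
  generating function is the same product of exponentials; \<open>pgf_unique\<close> transfers the
  point probabilities. From here on a process is recognised as Poisson by its generating
  functions.\<close>

lemma poisson_processI:
  assumes M: "prob_space M"
    and m: "\<And>A. A \<in> sets \<mu> \<Longrightarrow> emeasure \<mu> A < \<infinity> \<Longrightarrow> (\<lambda>\<omega>. ecard {i \<in> I \<omega>. T i \<omega> \<in> A}) \<in> measurable M (count_space UNIV)"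
    and pgf: "\<And>(J :: nat set) A x. finite J \<Longrightarrow> disjoint_family_on A J \<Longrightarrow>
      (\<And>j. j \<in> J \<Longrightarrow> A j \<in> sets \<mu> \<and> emeasure \<mu> (A j) < \<infinity>) \<Longrightarrow> (\<And>j. j \<in> J \<Longrightarrow> 0 < x j \<and> x j < 1) \<Longrightarrow>
      (\<integral>\<omega>. (\<Prod>j\<in>J. epow (x j) (ecard {i \<in> I \<omega>. T i \<omega> \<in> A j})) \<partial>M) =
      (\<Prod>j\<in>J. exp (- (measure \<mu> (A j) * (1 - x j))))"
  shows "poisson_process M \<mu> I T"
  unfolding poisson_process_def Let_def
proof (intro conjI allI impI)
  fix J :: "nat set" and A and k :: "nat \<Rightarrow> nat"
  assume J: "finite J" "disjoint_family_on A J" and A: "\<forall>j\<in>J. A j \<in> sets \<mu> \<and> emeasure \<mu> (A j) < \<infinity>"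
  let ?E = "{\<omega> \<in> space M. \<forall>j\<in>J. finite {i \<in> I \<omega>. T i \<omega> \<in> A j} \<and> card {i \<in> I \<omega>. T i \<omega> \<in> A j} = k j}"
  define N where "N j \<omega> = ecard {i \<in> I \<omega>. T i \<omega> \<in> A j}" for j \<omega>
  have E: "?E = {\<omega> \<in> space M. \<forall>j\<in>J. N j \<omega> = enat (k j)}" by (simp add: N_def ecard_eq_enat)
  have N: "N j \<in> measurable M (count_space UNIV)" if "j \<in> J" for j
    unfolding N_def using that A by (intro m) auto
  show "?E \<in> sets M" unfolding E by (rule integral_prod_of_bool[OF J(1) N])
  define q where "q j = measure_pmf (poisson_pmf0 (measure \<mu> (A j)))" for j
  interpret prob_space M by fact
  interpret q: prob_space "q j" for j unfolding q_def by (rule prob_space_measure_pmf)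
  interpret Q: product_prob_space q J ..
  have prod: "(\<integral>\<omega>. (\<Prod>j\<in>J. f j (\<omega> j)) \<partial>PiM J q) = (\<Prod>j\<in>J. \<integral>n. f j n \<partial>q j)"
    if "\<And>j n. j \<in> J \<Longrightarrow> 0 \<le> f j n \<and> f j n \<le> (1::real)" for f
    by (rule Q.product_integral_prod[OF J(1)])
       (use that in \<open>auto intro!: measure_pmf.integrable_const_bound[of _ 1] simp: q_def\<close>)
  have "(\<integral>\<omega>. 1 * (\<Prod>j\<in>J. of_bool (N j \<omega> = enat (k j)) :: real) \<partial>M) =
      (\<integral>\<omega>. 1 * (\<Prod>j\<in>J. of_bool (enat (\<omega> j) = enat (k j))) \<partial>PiM J q)"
  proof (rule pgf_unique[OF J(1)])
    fix x assume x: "\<And>j. j \<in> J \<Longrightarrow> 0 < x j \<and> x j < (1::real)"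
    have "(\<integral>\<omega>. 1 * (\<Prod>j\<in>J. epow (x j) (enat (\<omega> j))) \<partial>PiM J q) = (\<Prod>j\<in>J. \<integral>n. epow (x j) (enat n) \<partial>q j)"
      using prod[of "\<lambda>j n. epow (x j) (enat n)"] x epow_bounds by (auto simp: power_le_one less_imp_le)
    also have "\<dots> = (\<Prod>j\<in>J. exp (- (measure \<mu> (A j) * (1 - x j))))"
      using x by (intro prod.cong refl) (simp add: poisson_pmf0_pgf q_def del: epow_simps)
    finally show "(\<integral>\<omega>. 1 * (\<Prod>j\<in>J. epow (x j) (N j \<omega>)) \<partial>M) = (\<integral>\<omega>. 1 * (\<Prod>j\<in>J. epow (x j) (enat (\<omega> j))) \<partial>PiM J q)"
      using pgf[OF J _ x] A by (simp add: N_def)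
  next
    fix j assume "j \<in> J"
    show "(\<lambda>\<omega>. enat (\<omega> j)) \<in> measurable (PiM J q) (count_space UNIV)"
      by (rule measurable_compose[OF measurable_component_singleton[OF \<open>j \<in> J\<close>]]) (simp add: q_def)
  next
    show "finite_measure (PiM J q)" by (rule Q.P.finite_measure_axioms)
  qed (use N finite_measure_axioms in auto)
  also have "\<dots> = (\<Prod>j\<in>J. \<integral>n. of_bool (n = k j) \<partial>q j)"
    using prod[of "\<lambda>j n. of_bool (n = k j)"] by simp
  also have "\<dots> = (\<Prod>j\<in>J. pmf (poisson_pmf0 (measure \<mu> (A j))) (k j))"
  proof (intro prod.cong refl)
    fix j
    have "(\<integral>n. of_bool (n = k j) \<partial>q j) = (\<integral>n. (indicator {k j} n :: real) \<partial>q j)"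
      by (intro Bochner_Integration.integral_cong) auto
    then show "(\<integral>n. of_bool (n = k j) \<partial>q j) = pmf (poisson_pmf0 (measure \<mu> (A j))) (k j)"
      by (simp add: pmf.rep_eq q_def)
  qed
  finally show "measure M ?E = (\<Prod>j\<in>J. measure \<mu> (A j) ^ k j / fact (k j) * exp (- measure \<mu> (A j)))"
    using integral_prod_of_bool(2)[of J N M k, OF J(1) N] unfolding E by (simp add: pmf_poisson_pmf0)
qed (rule M)

text \<open>The definition covers disjoint sets only. Charging a point with the sum of - ln (x i)
  over the sets containing it makes the Laplace functional equal to the joint generating function of
  counts in overlapping sets. The right side depends on \<mu> alone, which is what uniqueness
  needs.\<close>

lemma poisson_pgf_overlap:
  fixes A :: "nat \<Rightarrow> 'a set"
  assumes P: "poisson_process M \<mu> I T" and sp: "space \<mu> = UNIV" and \<mu>: "finite_measure \<mu>"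
    and A: "\<And>i. i < n \<Longrightarrow> A i \<in> sets \<mu>" and x: "\<And>i. i < n \<Longrightarrow> 0 < x i \<and> x i < 1"
  shows "ennreal (\<integral>\<omega>. (\<Prod>i<n. epow (x i) (ecard {j \<in> I \<omega>. T j \<omega> \<in> A i})) \<partial>M) =
    eneg (\<integral>\<^sup>+y. (1 - eneg (\<Sum>i<n. ennreal (- ln (x i)) * indicator (A i) y)) \<partial>\<mu>)"
proof -
  interpret prob_space M using P by (simp add: poisson_process_def)
  interpret \<mu>: finite_measure \<mu> by fact
  define F where "F y = (\<Sum>i<n. ennreal (- ln (x i)) * indicator (A i) y)" for y
  have [measurable]: "F \<in> borel_measurable \<mu>"
    unfolding F_def using A by (intro borel_measurable_sum borel_measurable_times_ennreal) auto
  have x': "0 < - ln (x i)" "exp (- (- ln (x i))) = x i" if "i < n" for i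
    using x[OF that] by auto
  have "ecard {j \<in> I \<omega>. T j \<omega> \<in> A i} \<in> UNIV" for i \<omega> by simp
  have m: "(\<lambda>\<omega>. ecard {j \<in> I \<omega>. T j \<omega> \<in> A i}) \<in> measurable M (count_space UNIV)" if "i < n" for i
    by (rule poisson_process_ecard[OF P A[OF that]]) (simp add: \<mu>.emeasure_finite less_top[symmetric])
  have val: "eneg (\<integral>\<^sup>+j. F (T j \<omega>) \<partial>count_space (I \<omega>)) = ennreal (\<Prod>i<n. epow (x i) (ecard {j \<in> I \<omega>. T j \<omega> \<in> A i}))" for \<omega>
  proof -
    have "(\<integral>\<^sup>+j. F (T j \<omega>) \<partial>count_space (I \<omega>)) =
      (\<integral>\<^sup>+j. (\<Sum>i<n. ennreal (- ln (x i)) * indicator {j\<in>I \<omega>. T j \<omega> \<in> A i} j) \<partial>count_space (I \<omega>))"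
      by (rule nn_integral_cong) (auto simp: F_def indicator_def intro!: sum.cong)
    also have "\<dots> = (\<Sum>i<n. ennreal (- ln (x i)) * emeasure (count_space (I \<omega>)) {j\<in>I \<omega>. T j \<omega> \<in> A i})"
      by (subst nn_integral_sum) (auto intro!: sum.cong nn_integral_cmult_indicator)
    finally have "eneg (\<integral>\<^sup>+j. F (T j \<omega>) \<partial>count_space (I \<omega>)) =
      (\<Prod>i<n. eneg (ennreal (- ln (x i)) * emeasure (count_space (I \<omega>)) {j\<in>I \<omega>. T j \<omega> \<in> A i}))"
      by (simp add: eneg_sum)
    also have "\<dots> = (\<Prod>i<n. ennreal (epow (x i) (ecard {j \<in> I \<omega>. T j \<omega> \<in> A i})))"
    proof (intro prod.cong refl)
      fix i assume "i \<in> {..<n}"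
      then show "eneg (ennreal (- ln (x i)) * emeasure (count_space (I \<omega>)) {j\<in>I \<omega>. T j \<omega> \<in> A i}) =
        ennreal (epow (x i) (ecard {j \<in> I \<omega>. T j \<omega> \<in> A i}))"
        using eneg_mult_count[OF x'(1), of i "{j \<in> I \<omega>. T j \<omega> \<in> A i}" "I \<omega>"] x'(2)[of i] by auto
    qed
    also have "\<dots> = ennreal (\<Prod>i<n. epow (x i) (ecard {j \<in> I \<omega>. T j \<omega> \<in> A i}))"
      using x by (intro prod_ennreal) (simp add: epow_bounds less_imp_le)
    finally show ?thesis .
  qed
  have b: "0 \<le> (\<Prod>i<n. epow (x i) (ecard {j \<in> I \<omega>. T j \<omega> \<in> A i})) \<and> (\<Prod>i<n. epow (x i) (ecard {j \<in> I \<omega>. T j \<omega> \<in> A i})) \<le> 1" for \<omega>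
    by (rule epow_prod_bounds) (use x in auto)
  have "(\<integral>\<^sup>+y. (1 - eneg (F y)) \<partial>\<mu>) \<le> (\<integral>\<^sup>+y. 1 \<partial>\<mu>)" by (intro nn_integral_mono) simp
  also have "\<dots> < \<infinity>" by (simp add: \<mu>.emeasure_finite less_top[symmetric])
  finally have "(\<integral>\<^sup>+\<omega>. eneg (\<integral>\<^sup>+j. F (T j \<omega>) \<partial>count_space (I \<omega>)) \<partial>M) = eneg (\<integral>\<^sup>+y. (1 - eneg (F y)) \<partial>\<mu>)"
    by (intro poisson_laplace[OF P sp]) auto
  moreover have "(\<integral>\<^sup>+\<omega>. ennreal (\<Prod>i<n. epow (x i) (ecard {j \<in> I \<omega>. T j \<omega> \<in> A i})) \<partial>M) =
    ennreal (\<integral>\<omega>. (\<Prod>i<n. epow (x i) (ecard {j \<in> I \<omega>. T j \<omega> \<in> A i})) \<partial>M)"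
    by (intro nn_integral_eq_integral integrable_const_bound[of _ 1] borel_measurable_prod measurable_compose[OF m])
       (use b in auto)
  ultimately show ?thesis unfolding val unfolding F_def by (simp only:)
qed

section \<open>Uniqueness of the law of a random configuration\<close>

definition config_cylinder :: "'a measure \<Rightarrow> nat \<Rightarrow> (nat \<Rightarrow> 'a set) \<Rightarrow> (nat \<Rightarrow> nat) \<Rightarrow> 'a set set" where
  "config_cylinder S n A k = {X. X \<subseteq> space S \<and> countable X \<and> (\<forall>i<n. ecard (X \<inter> A i) = enat (k i))}"

lemma space_config_space: "space (config_space S) = {X. X \<subseteq> space S \<and> countable X}"
  unfolding config_space_def by (rule space_measure_of) auto

lemma sets_config_space: "sets (config_space S) = sigma_sets {X. X \<subseteq> space S \<and> countable X}
     {{X. X \<subseteq> space S \<and> countable X \<and> finite (X \<inter> A) \<and> card (X \<inter> A) = n} | A n. A \<in> sets S}"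
  unfolding config_space_def by (rule sets_measure_of) auto

lemma measurable_config_spaceI:
  assumes "\<And>\<omega>. \<omega> \<in> space M \<Longrightarrow> R \<omega> \<subseteq> space S \<and> countable (R \<omega>)"
    and "\<And>A. A \<in> sets S \<Longrightarrow> (\<lambda>\<omega>. ecard (R \<omega> \<inter> A)) \<in> measurable M (count_space UNIV)"
  shows "R \<in> measurable M (config_space S)"
  unfolding config_space_def
proof (rule measurable_measure_of)
  fix y assume "y \<in> {{X. X \<subseteq> space S \<and> countable X \<and> finite (X \<inter> A) \<and> card (X \<inter> A) = n} | A n. A \<in> sets S}"
  then obtain A n where y: "A \<in> sets S" "y = {X. X \<subseteq> space S \<and> countable X \<and> finite (X \<inter> A) \<and> card (X \<inter> A) = n}" by auto
  have "R -` y \<inter> space M = (\<lambda>\<omega>. ecard (R \<omega> \<inter> A)) -` {enat n} \<inter> space M"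
    using assms(1) by (auto simp: y ecard_eq_enat)
  also have "\<dots> \<in> sets M" using assms(2)[OF y(1)] by (rule measurable_sets) simp
  finally show "R -` y \<inter> space M \<in> sets M" .
qed (use assms(1) in auto)

lemma measurable_config_count:
  assumes "A \<in> sets S"
  shows "(\<lambda>X. ecard (X \<inter> A)) \<in> measurable (config_space S) (count_space UNIV)"
proof (rule measurable_enat_iff)
  fix k
  have "{X \<in> space (config_space S). ecard (X \<inter> A) = enat k} = {X. X \<subseteq> space S \<and> countable X \<and> finite (X \<inter> A) \<and> card (X \<inter> A) = k}"
    by (auto simp: space_config_space ecard_eq_enat)
  then show "{X \<in> space (config_space S). ecard (X \<inter> A) = enat k} \<in> sets (config_space S)"
    unfolding sets_config_space using assms by (auto intro: sigma_sets.Basic)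
qed

text \<open>The generators of \<open>config_space\<close> constrain one set each and are not closed
  under intersection. Their finite intersections, the cylinders, are; the sets in a cylinder may
  overlap, so cylinder probabilities are compared through
  \<open>poisson_pgf_overlap\<close>.\<close>

lemma config_law_eqI:
  assumes P: "poisson_process P \<mu> (\<lambda>X. X) (\<lambda>x X. x)" "sets P = sets (config_space S)"
    and Q: "poisson_process Q \<mu> (\<lambda>X. X) (\<lambda>x X. x)" "sets Q = sets (config_space S)"
    and \<mu>: "finite_measure \<mu>" "space \<mu> = UNIV" "sets \<mu> = sets S"
  shows "P = Q"
proof -
  interpret P: prob_space P using P by (simp add: poisson_process_def)
  interpret Q: prob_space Q using Q by (simp add: poisson_process_def)
  define \<Omega> where "\<Omega> = {X. X \<subseteq> space S \<and> countable X}"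
  define E where "E = {config_cylinder S n A k | n A k. \<forall>i<n. A i \<in> sets S}"
  have spP: "space P = \<Omega>" and spQ: "space Q = \<Omega>"
    using sets_eq_imp_space_eq[OF P(2)] sets_eq_imp_space_eq[OF Q(2)] by (simp_all add: \<Omega>_def space_config_space)
  have Pn: "(\<lambda>X. ecard (X \<inter> A)) \<in> measurable P (count_space UNIV)"
    and Qn: "(\<lambda>X. ecard (X \<inter> A)) \<in> measurable Q (count_space UNIV)" if "A \<in> sets S" for A
    using measurable_config_count[OF that] measurable_cong_sets[OF P(2) refl] measurable_cong_sets[OF Q(2) refl]
    by blast+
  have cyl: "config_cylinder S n A k = {X \<in> space P. \<forall>i\<in>{..<n}. ecard (X \<inter> A i) = enat (k i)}" for n A k
    by (auto simp: spP \<Omega>_def config_cylinder_def)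
  have cylP: "config_cylinder S n A k \<in> sets P" if "\<forall>i<n. A i \<in> sets S" for n A k
    unfolding cyl by (rule integral_prod_of_bool) (use that Pn in auto)
  show ?thesis
  proof (rule measure_eqI_generator_eq[where E=E and \<Omega>=\<Omega> and A="\<lambda>_. \<Omega>"])
    show "Int_stable E"
    proof (rule Int_stableI)
      fix a b assume "a \<in> E" "b \<in> E"
      then obtain n A k n' A' k' where ab: "a = config_cylinder S n A k" "b = config_cylinder S n' A' k'"
        "\<forall>i<n. A i \<in> sets S" "\<forall>i<n'. A' i \<in> sets S" unfolding E_def by blast
      \<comment> \<open>Two cylinders intersect in the cylinder of the concatenated families; the
        second one is shifted by n.\<close>
      let ?A = "\<lambda>i. if i < n then A i else A' (i - n)" and ?k = "\<lambda>i. if i < n then k i else k' (i - n)"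
      have "(\<forall>i<n. ecard (X \<inter> A i) = enat (k i)) \<and> (\<forall>i<n'. ecard (X \<inter> A' i) = enat (k' i)) \<longleftrightarrow>
        (\<forall>i<n + n'. ecard (X \<inter> ?A i) = enat (?k i))" (is "?L \<longleftrightarrow> ?R") for X
      proof
        assume ?L
        show ?R
        proof (intro allI impI)
          fix i assume "i < n + n'"
          then show "ecard (X \<inter> ?A i) = enat (?k i)"
            using \<open>?L\<close> by (cases "i < n") auto
        qed
      next
        assume R: ?R
        have "ecard (X \<inter> A i) = enat (k i)" if "i < n" for i using R[rule_format, of i] that by simp
        moreover have "ecard (X \<inter> A' i) = enat (k' i)" if "i < n'" for i using R[rule_format, of "n + i"] that by simp
        ultimately show ?L by blast
      qed
      then have "a \<inter> b = config_cylinder S (n + n') ?A ?k"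
        unfolding ab config_cylinder_def by blast
      moreover have "\<forall>i<n + n'. ?A i \<in> sets S" using ab by auto
      ultimately show "a \<inter> b \<in> E" unfolding E_def by blast
    qed
    show "E \<subseteq> Pow \<Omega>" by (auto simp: E_def config_cylinder_def \<Omega>_def)
    show gen: "sets P = sigma_sets \<Omega> E"
    proof
      show "sigma_sets \<Omega> E \<subseteq> sets P"
        unfolding spP[symmetric] by (rule sets.sigma_sets_subset) (use cylP in \<open>auto simp: E_def\<close>)
      show "sets P \<subseteq> sigma_sets \<Omega> E"
        unfolding P(2) sets_config_space \<Omega>_def[symmetric]
      proof (rule sigma_sets_mono, safe)
        fix A n assume "A \<in> sets S"
        then have "{X. X \<subseteq> space S \<and> countable X \<and> finite (X \<inter> A) \<and> card (X \<inter> A) = n} \<in> E"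
          unfolding E_def config_cylinder_def
          by (auto simp: ecard_eq_enat intro!: exI[of _ 1] exI[of _ "\<lambda>_. A"] exI[of _ "\<lambda>_. n"])
        then show "{X. X \<subseteq> space S \<and> countable X \<and> finite (X \<inter> A) \<and> card (X \<inter> A) = n} \<in> sigma_sets \<Omega> E"
          by (rule sigma_sets.Basic)
      qed
    qed
    then show "sets Q = sigma_sets \<Omega> E" using P(2) Q(2) by simp
    \<comment> \<open>The whole space is the cylinder with n = 0.\<close>
    show "range (\<lambda>_. \<Omega>) \<subseteq> E"
      unfolding E_def config_cylinder_def \<Omega>_def by (auto intro!: exI[of _ 0])
    show "(\<Union>i::nat. \<Omega>) = \<Omega>" by simp
    show "emeasure P \<Omega> \<noteq> \<infinity>" by simp
    fix X assume "X \<in> E"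
    then obtain n A k where X: "X = config_cylinder S n A k" and A: "\<forall>i<n. A i \<in> sets S" by (auto simp: E_def)
    have "(\<integral>Z. 1 * (\<Prod>i<n. of_bool (ecard (Z \<inter> A i) = enat (k i)) :: real) \<partial>P) =
      (\<integral>Z. 1 * (\<Prod>i<n. of_bool (ecard (Z \<inter> A i) = enat (k i))) \<partial>Q)"
    proof (rule pgf_unique)
      fix x assume x: "\<And>j. j \<in> {..<n} \<Longrightarrow> 0 < x j \<and> x j < (1::real)"
      have "ennreal (\<integral>Z. (\<Prod>i<n. epow (x i) (ecard {j \<in> Z. j \<in> A i})) \<partial>P) =
        ennreal (\<integral>Z. (\<Prod>i<n. epow (x i) (ecard {j \<in> Z. j \<in> A i})) \<partial>Q)"
        using poisson_pgf_overlap[OF P(1) \<mu>(2,1), of n A x] poisson_pgf_overlap[OF Q(1) \<mu>(2,1), of n A x] x A \<mu>(3)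
        by simp
      moreover have "0 \<le> (\<integral>Z. (\<Prod>i<n. epow (x i) (ecard {j \<in> Z. j \<in> A i})) \<partial>P)" "0 \<le> (\<integral>Z. (\<Prod>i<n. epow (x i) (ecard {j \<in> Z. j \<in> A i})) \<partial>Q)"
        using epow_prod_bounds[of "{..<n}" x] x by (auto intro!: Bochner_Integration.integral_nonneg)
      moreover have "{j \<in> Z. j \<in> A i} = Z \<inter> A i" for Z i by auto
      ultimately show "(\<integral>Z. 1 * (\<Prod>i<n. epow (x i) (ecard (Z \<inter> A i))) \<partial>P) = (\<integral>Z. 1 * (\<Prod>i<n. epow (x i) (ecard (Z \<inter> A i))) \<partial>Q)"
        by simp
    qed (use A Pn Qn P.finite_measure_axioms Q.finite_measure_axioms in auto)
    then have "measure P X = measure Q X"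
      unfolding X cyl mult_1
      by (subst (asm) (1 2) integral_prod_of_bool(2)) (use A Pn Qn spP spQ in auto)
    then show "emeasure P X = emeasure Q X"
      by (simp add: P.emeasure_eq_measure Q.emeasure_eq_measure)
  qed
qed

lemma poisson_process_distr:
  assumes P: "poisson_process M \<mu> R (\<lambda>x \<omega>. x)" and R: "R \<in> measurable M (config_space S)" and s: "sets \<mu> = sets S"
  shows "poisson_process (distr M (config_space S) R) \<mu> (\<lambda>X. X) (\<lambda>x X. x)"
proof -
  interpret prob_space M using P by (simp add: poisson_process_def)
  have eq: "{i \<in> X. i \<in> A} = X \<inter> A" for X A :: "'b set" by auto
  show ?thesis
  proof (rule poisson_processI)
    show "prob_space (distr M (config_space S) R)" by (rule prob_space_distr[OF R])
    show "(\<lambda>\<omega>. ecard {i \<in> \<omega>. i \<in> A}) \<in> measurable (distr M (config_space S) R) (count_space UNIV)" if "A \<in> sets \<mu>" for A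
      using measurable_config_count[of A S] that s by (simp add: eq)
    fix J :: "nat set" and A x
    assume J: "finite J" "disjoint_family_on A J" "\<And>j. j \<in> J \<Longrightarrow> A j \<in> sets \<mu> \<and> emeasure \<mu> (A j) < \<infinity>"
      and x: "\<And>j. j \<in> J \<Longrightarrow> 0 < x j \<and> x j < (1::real)"
    have "(\<integral>X. (\<Prod>j\<in>J. epow (x j) (ecard {i \<in> X. i \<in> A j})) \<partial>distr M (config_space S) R) =
      (\<integral>\<omega>. (\<Prod>j\<in>J. epow (x j) (ecard {i \<in> R \<omega>. i \<in> A j})) \<partial>M)"
      by (rule integral_distr[OF R])
         (use J(3) s in \<open>auto simp: eq intro!: borel_measurable_prod measurable_compose[OF measurable_config_count]\<close>)
    then show "(\<integral>X. (\<Prod>j\<in>J. epow (x j) (ecard {i \<in> X. i \<in> A j})) \<partial>distr M (config_space S) R) =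
      (\<Prod>j\<in>J. exp (- (measure \<mu> (A j) * (1 - x j))))"
      using poisson_process_pgf[OF P J x] by simp
  qed
qed

lemma poisson_process_law_unique:
  assumes "poisson_process M \<mu> R (\<lambda>x \<omega>. x)" "R \<in> measurable M (config_space S)"
    and "poisson_process M' \<mu> R' (\<lambda>x \<omega>. x)" "R' \<in> measurable M' (config_space S)"
    and "finite_measure \<mu>" "space \<mu> = UNIV" "sets \<mu> = sets S"
  shows "distr M (config_space S) R = distr M' (config_space S) R'"
  by (rule config_law_eqI[OF poisson_process_distr[OF assms(1,2,7)] sets_distr poisson_process_distr[OF assms(3,4,7)] sets_distr assms(5-7)])

section \<open>Marking and thinning\<close>

text \<open>Rectangles determine a finite measure on a product space: the pair (T, Y) under the
  weight W and the pair with second component redrawn from the kernel at T under the weight W' have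
  the same image measure. The weights differ because they hold the other marks, before and after
  averaging.\<close>

lemma kernel_integral_eqI:
  assumes T[measurable]: "T \<in> measurable M \<mu>" and Y[measurable]: "Y \<in> measurable M N"
    and \<kappa>: "\<kappa> \<in> measurable \<mu> (prob_algebra N)"
    and W[measurable]: "W \<in> borel_measurable M" and W'[measurable]: "W' \<in> borel_measurable M"
    and fin: "(\<integral>\<^sup>+\<omega>. W \<omega> \<partial>M) < \<infinity>"
    and eq: "\<And>A D. A \<in> sets \<mu> \<Longrightarrow> D \<in> sets N \<Longrightarrow>
      (\<integral>\<^sup>+\<omega>. W \<omega> * (indicator A (T \<omega>) * indicator D (Y \<omega>)) \<partial>M) =
      (\<integral>\<^sup>+\<omega>. W' \<omega> * (indicator A (T \<omega>) * emeasure (\<kappa> (T \<omega>)) D) \<partial>M)"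
    and h[measurable]: "h \<in> borel_measurable (\<mu> \<Otimes>\<^sub>M N)"
  shows "(\<integral>\<^sup>+\<omega>. W \<omega> * h (T \<omega>, Y \<omega>) \<partial>M) = (\<integral>\<^sup>+\<omega>. W' \<omega> * (\<integral>\<^sup>+y. h (T \<omega>, y) \<partial>\<kappa> (T \<omega>)) \<partial>M)"
proof -
  have \<kappa>s[measurable]: "\<kappa> \<in> measurable \<mu> (subprob_algebra N)" using \<kappa> by (rule measurable_prob_algebraD)
  have \<kappa>x: "sets (\<kappa> t) = sets N" "prob_space (\<kappa> t)" "space (\<kappa> t) = space N" if "t \<in> space \<mu>" for t
  proof -
    show "sets (\<kappa> t) = sets N" "prob_space (\<kappa> t)"
      using measurable_space[OF \<kappa> that] by (simp_all add: space_prob_algebra)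
    then show "space (\<kappa> t) = space N" by (intro sets_eq_imp_space_eq)
  qed
  have Ts: "T \<omega> \<in> space \<mu>" if "\<omega> \<in> space M" for \<omega> using that T by (rule measurable_space[rotated])
  define \<alpha> where "\<alpha> = distr (density M W) (\<mu> \<Otimes>\<^sub>M N) (\<lambda>\<omega>. (T \<omega>, Y \<omega>))"
  define L where "L t = distr (\<kappa> t) (\<mu> \<Otimes>\<^sub>M N) (Pair t)" for t
  define \<beta> where "\<beta> = density M W' \<bind> (\<lambda>\<omega>. L (T \<omega>))"
  have L: "L \<in> measurable \<mu> (subprob_algebra (\<mu> \<Otimes>\<^sub>M N))"
    unfolding L_def by (rule measurable_distr2[OF _ \<kappa>s]) simp
  show ?thesis
  proof (cases "space M = {}")
    case True
    then show ?thesis by (simp add: nn_integral_empty)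
  next
    case False
    have LT: "(\<lambda>\<omega>. L (T \<omega>)) \<in> measurable (density M W') (subprob_algebra (\<mu> \<Otimes>\<^sub>M N))"
      by (subst measurable_cong_sets[OF sets_density refl]) (rule measurable_compose[OF T L])
    have sa: "sets \<alpha> = sets (\<mu> \<Otimes>\<^sub>M N)" by (simp add: \<alpha>_def)
    have sb: "sets \<beta> = sets (\<mu> \<Otimes>\<^sub>M N)"
      unfolding \<beta>_def by (rule sets_bind) (use False measurable_space[OF LT] in \<open>auto simp: space_subprob_algebra\<close>)
    have ia: "(\<integral>\<^sup>+z. g z \<partial>\<alpha>) = (\<integral>\<^sup>+\<omega>. W \<omega> * g (T \<omega>, Y \<omega>) \<partial>M)" if [measurable]: "g \<in> borel_measurable (\<mu> \<Otimes>\<^sub>M N)" for g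
      unfolding \<alpha>_def by (subst nn_integral_distr) (auto simp: nn_integral_density)
    have ib: "(\<integral>\<^sup>+z. g z \<partial>\<beta>) = (\<integral>\<^sup>+\<omega>. W' \<omega> * (\<integral>\<^sup>+y. g (T \<omega>, y) \<partial>\<kappa> (T \<omega>)) \<partial>M)"
      if g[measurable]: "g \<in> borel_measurable (\<mu> \<Otimes>\<^sub>M N)" for g
    proof -
      have [measurable]: "(\<lambda>t. \<integral>\<^sup>+z. g z \<partial>L t) \<in> borel_measurable \<mu>"
        by (rule measurable_compose[OF L nn_integral_measurable_subprob_algebra[OF g]])
      have "(\<integral>\<^sup>+z. g z \<partial>\<beta>) = (\<integral>\<^sup>+\<omega>. \<integral>\<^sup>+z. g z \<partial>L (T \<omega>) \<partial>density M W')"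
        unfolding \<beta>_def by (rule nn_integral_bind[OF g LT])
      also have "\<dots> = (\<integral>\<^sup>+\<omega>. W' \<omega> * (\<integral>\<^sup>+z. g z \<partial>L (T \<omega>)) \<partial>M)"
        by (rule nn_integral_density) measurable
      also have "\<dots> = (\<integral>\<^sup>+\<omega>. W' \<omega> * (\<integral>\<^sup>+y. g (T \<omega>, y) \<partial>\<kappa> (T \<omega>)) \<partial>M)"
      proof (intro nn_integral_cong arg_cong2[where f=times] refl)
        fix \<omega> assume "\<omega> \<in> space M"
        from Ts[OF this] have t: "T \<omega> \<in> space \<mu>" .
        have "Pair (T \<omega>) \<in> measurable (\<kappa> (T \<omega>)) (\<mu> \<Otimes>\<^sub>M N)"
          using measurable_Pair1'[OF t, of N] measurable_cong_sets[OF \<kappa>x(1)[OF t] refl] by blast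
        then show "(\<integral>\<^sup>+z. g z \<partial>L (T \<omega>)) = (\<integral>\<^sup>+y. g (T \<omega>, y) \<partial>\<kappa> (T \<omega>))"
          unfolding L_def by (rule nn_integral_distr) simp
      qed
      finally show ?thesis .
    qed
    have "\<alpha> = \<beta>"
    proof (rule measure_eqI_generator_eq[OF Int_stable_pair_measure_generator[of \<mu> N], where \<Omega>="space \<mu> \<times> space N" and A="\<lambda>_. space \<mu> \<times> space N"])
      show "{a \<times> b |a b. a \<in> sets \<mu> \<and> b \<in> sets N} \<subseteq> Pow (space \<mu> \<times> space N)"
        by (rule pair_measure_closed)
      fix X assume "X \<in> {a \<times> b |a b. a \<in> sets \<mu> \<and> b \<in> sets N}"
      then obtain A D where X: "X = A \<times> D" "A \<in> sets \<mu>" "D \<in> sets N" by auto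
      have Xs: "X \<in> sets (\<mu> \<Otimes>\<^sub>M N)" using X by auto
      have "emeasure \<alpha> X = (\<integral>\<^sup>+\<omega>. W \<omega> * (indicator A (T \<omega>) * indicator D (Y \<omega>)) \<partial>M)"
        using ia[OF borel_measurable_indicator[OF Xs]] Xs sa by (simp add: nn_integral_indicator) (simp add: X indicator_times)
      also have "\<dots> = (\<integral>\<^sup>+\<omega>. W' \<omega> * (indicator A (T \<omega>) * emeasure (\<kappa> (T \<omega>)) D) \<partial>M)"
        by (rule eq[OF X(2,3)])
      also have "\<dots> = (\<integral>\<^sup>+\<omega>. W' \<omega> * (\<integral>\<^sup>+y. indicator X (T \<omega>, y) \<partial>\<kappa> (T \<omega>)) \<partial>M)"
        using X \<kappa>x(1)[OF Ts] by (intro nn_integral_cong arg_cong2[where f=times] refl)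
          (simp add: indicator_times, subst nn_integral_cmult_indicator, simp_all)
      also have "\<dots> = emeasure \<beta> X" using ib[OF borel_measurable_indicator[OF Xs]] Xs sb by (simp add: nn_integral_indicator)
      finally show "emeasure \<alpha> X = emeasure \<beta> X" .
    next
      show "sets \<alpha> = sigma_sets (space \<mu> \<times> space N) {a \<times> b |a b. a \<in> sets \<mu> \<and> b \<in> sets N}"
        by (simp add: \<alpha>_def sets_pair_measure)
      show "sets \<beta> = sigma_sets (space \<mu> \<times> space N) {a \<times> b |a b. a \<in> sets \<mu> \<and> b \<in> sets N}"
        by (simp add: sb sets_pair_measure)
      have "(\<integral>\<^sup>+z. 1 \<partial>\<alpha>) < \<infinity>" using fin by (subst ia) simp_all
      then show "emeasure \<alpha> (space \<mu> \<times> space N) \<noteq> \<infinity>"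
        by (simp add: \<alpha>_def space_pair_measure)
    qed auto
    then show ?thesis using ia[OF h] ib[OF h] by simp
  qed
qed

lemma marked_poissonD:
  assumes "marked_poisson_process M \<mu> N \<kappa> I T Y"
  shows "poisson_process M \<mu> I T" "{\<omega> \<in> space M. i \<in> I \<omega>} \<in> sets M" "T i \<in> measurable M \<mu>" "Y i \<in> measurable M N"
  using assms by (simp_all add: marked_poisson_process_def)

text \<open>The definition gives the formula for rectangles only. In the induction an index x moves
  from K to J by replacing its function by a rectangle; \<open>kernel_integral_eqI\<close> then
  passes from rectangles to an arbitrary h. Hence rectangles on J are kept alongside functions on K
  throughout.\<close>

lemma marked_poisson_product:
  fixes \<kappa> :: "'a \<Rightarrow> 'b measure" and h :: "'i \<Rightarrow> 'a \<times> 'b \<Rightarrow> ennreal"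
  assumes P: "marked_poisson_process M \<mu> N \<kappa> I T Y" and \<kappa>: "\<kappa> \<in> measurable \<mu> (prob_algebra N)"
    and "finite K"
    and "\<And>j. j \<in> K \<Longrightarrow> h j \<in> borel_measurable (\<mu> \<Otimes>\<^sub>M N) \<and> (\<forall>z. h j z \<le> 1)"
    and "finite J" "K \<inter> J = {}" "\<And>j. j \<in> J \<Longrightarrow> A j \<in> sets \<mu> \<and> D j \<in> sets N"
  shows "(\<integral>\<^sup>+\<omega>. (\<Prod>j\<in>K. of_bool (j \<in> I \<omega>) * h j (T j \<omega>, Y j \<omega>)) *
      (\<Prod>j\<in>J. of_bool (j \<in> I \<omega>) * (indicator (A j) (T j \<omega>) * indicator (D j) (Y j \<omega>))) \<partial>M) =
    (\<integral>\<^sup>+\<omega>. (\<Prod>j\<in>K. of_bool (j \<in> I \<omega>) * (\<integral>\<^sup>+y. h j (T j \<omega>, y) \<partial>\<kappa> (T j \<omega>))) *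
      (\<Prod>j\<in>J. of_bool (j \<in> I \<omega>) * (indicator (A j) (T j \<omega>) * emeasure (\<kappa> (T j \<omega>)) (D j))) \<partial>M)"
  using assms(3-)
proof (induction K arbitrary: J A D rule: finite_induct)
  case (empty J A D)
  let ?E = "{\<omega> \<in> space M. \<forall>j\<in>J. j \<in> I \<omega> \<and> T j \<omega> \<in> A j \<and> Y j \<omega> \<in> D j}"
  let ?E' = "{\<omega> \<in> space M. \<forall>j\<in>J. j \<in> I \<omega> \<and> T j \<omega> \<in> A j}"
  have I: "{\<omega> \<in> space M. j \<in> I \<omega>} \<in> sets M" and Tm: "T j \<in> measurable M \<mu>" and Ym: "Y j \<in> measurable M N" for j
    using P by (simp_all add: marked_poisson_process_def)
  have E: "?E \<in> sets M"
  proof (rule sets.sets_Collect_finite_All[OF _ empty.prems(2)])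
    fix j assume "j \<in> J"
    have "{\<omega> \<in> space M. j \<in> I \<omega>} \<inter> (T j -` A j \<inter> space M) \<inter> (Y j -` D j \<inter> space M) \<in> sets M"
      using I measurable_sets[OF Tm] measurable_sets[OF Ym] empty.prems(4)[OF \<open>j \<in> J\<close>] by blast
    also have "{\<omega> \<in> space M. j \<in> I \<omega>} \<inter> (T j -` A j \<inter> space M) \<inter> (Y j -` D j \<inter> space M) =
      {\<omega> \<in> space M. j \<in> I \<omega> \<and> T j \<omega> \<in> A j \<and> Y j \<omega> \<in> D j}" by auto
    finally show "{\<omega> \<in> space M. j \<in> I \<omega> \<and> T j \<omega> \<in> A j \<and> Y j \<omega> \<in> D j} \<in> sets M" .
  qed
  have "(\<integral>\<^sup>+\<omega>. (\<Prod>j\<in>J. of_bool (j \<in> I \<omega>) * (indicator (A j) (T j \<omega>) * indicator (D j) (Y j \<omega>))) \<partial>M) =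
     (\<integral>\<^sup>+\<omega>. indicator ?E \<omega> \<partial>M)"
  proof (rule nn_integral_cong)
    fix \<omega> assume "\<omega> \<in> space M"
    then show "(\<Prod>j\<in>J. of_bool (j \<in> I \<omega>) * (indicator (A j) (T j \<omega>) * indicator (D j) (Y j \<omega>))) = (indicator ?E \<omega> :: ennreal)"
      by (cases "\<omega> \<in> ?E") (use empty.prems(2) in \<open>auto simp: indicator_def intro!: prod_zero prod.neutral\<close>)
  qed
  also have "\<dots> = emeasure M ?E" using E by simp
  also have "\<dots> = (\<integral>\<^sup>+\<omega>\<in>?E'. (\<Prod>j\<in>J. emeasure (\<kappa> (T j \<omega>)) (D j)) \<partial>M)"
    using empty.prems by (intro P[unfolded marked_poisson_process_def, THEN conjunct2, THEN conjunct2,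
      THEN spec, of J, THEN spec, of A, THEN spec, of D, rule_format]) auto
  also have "\<dots> = (\<integral>\<^sup>+\<omega>. (\<Prod>j\<in>J. of_bool (j \<in> I \<omega>) * (indicator (A j) (T j \<omega>) * emeasure (\<kappa> (T j \<omega>)) (D j))) \<partial>M)"
  proof (rule nn_integral_cong)
    fix \<omega> assume "\<omega> \<in> space M"
    then show "(\<Prod>j\<in>J. emeasure (\<kappa> (T j \<omega>)) (D j)) * indicator ?E' \<omega> =
      (\<Prod>j\<in>J. of_bool (j \<in> I \<omega>) * (indicator (A j) (T j \<omega>) * emeasure (\<kappa> (T j \<omega>)) (D j)))"
      by (cases "\<omega> \<in> ?E'") (use empty.prems(2) in \<open>auto simp: indicator_def intro!: prod_zero prod.cong\<close>)
  qed
  finally show ?case by simp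
next
  case (insert x K J A D)
  interpret prob_space M using P by (simp add: marked_poisson_process_def poisson_process_def)
  have I: "{\<omega> \<in> space M. j \<in> I \<omega>} \<in> sets M" and Tm[measurable]: "T j \<in> measurable M \<mu>" and Ym[measurable]: "Y j \<in> measurable M N" for j
    using P by (simp_all add: marked_poisson_process_def)
  have o[measurable]: "(\<lambda>\<omega>. of_bool (j \<in> I \<omega>) :: ennreal) \<in> borel_measurable M" for j
    by (rule measurable_compose[of "\<lambda>\<omega>. j \<in> I \<omega>" M "count_space UNIV"]) (use I[of j] in \<open>simp_all add: pred_def\<close>)
  have \<kappa>s: "\<kappa> \<in> measurable \<mu> (subprob_algebra N)" using \<kappa> by (rule measurable_prob_algebraD)
  have hm: "h j \<in> borel_measurable (\<mu> \<Otimes>\<^sub>M N)" if "j \<in> insert x K" for j using insert.prems(1)[OF that] by simp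
  have h1: "h j z \<le> 1" if "j \<in> insert x K" for j z using insert.prems(1)[OF that] by blast
  have him: "(\<lambda>t. \<integral>\<^sup>+y. h j (t, y) \<partial>\<kappa> t) \<in> borel_measurable \<mu>" if "j \<in> insert x K" for j
    using hm[OF that] by (intro nn_integral_measurable_subprob_algebra2[OF _ \<kappa>s]) simp
  have Am: "A j \<in> sets \<mu>" "D j \<in> sets N" if "j \<in> J" for j using insert.prems(4)[OF that] by blast+
  have kD: "(\<lambda>t. emeasure (\<kappa> t) D') \<in> borel_measurable \<mu>" if "D' \<in> sets N" for D'
    by (rule measurable_compose[OF \<kappa>s measurable_emeasure_subprob_algebra[OF that]])
  let ?P = "\<lambda>\<omega>. (\<Prod>j\<in>K. of_bool (j \<in> I \<omega>) * h j (T j \<omega>, Y j \<omega>))"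
  let ?P' = "\<lambda>\<omega>. (\<Prod>j\<in>K. of_bool (j \<in> I \<omega>) * (\<integral>\<^sup>+y. h j (T j \<omega>, y) \<partial>\<kappa> (T j \<omega>)))"
  let ?R = "\<lambda>\<omega>. (\<Prod>j\<in>J. of_bool (j \<in> I \<omega>) * (indicator (A j) (T j \<omega>) * indicator (D j) (Y j \<omega>))) :: ennreal"
  let ?R' = "\<lambda>\<omega>. (\<Prod>j\<in>J. of_bool (j \<in> I \<omega>) * (indicator (A j) (T j \<omega>) * emeasure (\<kappa> (T j \<omega>)) (D j)))"
  define W where "W \<omega> = of_bool (x \<in> I \<omega>) * (?P \<omega> * ?R \<omega>)" for \<omega>
  define W' where "W' \<omega> = of_bool (x \<in> I \<omega>) * (?P' \<omega> * ?R' \<omega>)" for \<omega>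
  have xJ: "x \<notin> J" "K \<inter> J = {}" using insert.prems(3) by auto
  have "(\<integral>\<^sup>+\<omega>. W \<omega> * h x (T x \<omega>, Y x \<omega>) \<partial>M) = (\<integral>\<^sup>+\<omega>. W' \<omega> * (\<integral>\<^sup>+y. h x (T x \<omega>, y) \<partial>\<kappa> (T x \<omega>)) \<partial>M)"
  proof (rule kernel_integral_eqI[OF Tm Ym \<kappa>])
    have ADm: "(\<lambda>\<omega>. indicator (A j) (T j \<omega>) :: ennreal) \<in> borel_measurable M"
      "(\<lambda>\<omega>. indicator (D j) (Y j \<omega>) :: ennreal) \<in> borel_measurable M"
      "(\<lambda>\<omega>. emeasure (\<kappa> (T j \<omega>)) (D j)) \<in> borel_measurable M" if "j \<in> J" for j
      using Am[OF that]
      by (blast intro: measurable_compose[OF Tm borel_measurable_indicator] measurable_compose[OF Ym borel_measurable_indicator]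
        measurable_compose[OF Tm kD])+
    show "W \<in> borel_measurable M" unfolding W_def
      by (intro borel_measurable_times_ennreal borel_measurable_prod_ennreal o ADm measurable_compose[OF measurable_Pair[OF Tm Ym] hm] insertI2)
    show "W' \<in> borel_measurable M" unfolding W'_def
      by (intro borel_measurable_times_ennreal borel_measurable_prod_ennreal o ADm measurable_compose[OF Tm him] insertI2)
    have W1: "W \<omega> \<le> 1" for \<omega>
    proof -
      have "?P \<omega> \<le> 1" by (rule prod_le_1) (use h1 in \<open>auto split: split_of_bool\<close>)
      moreover have "?R \<omega> \<le> 1" by (rule prod_le_1) (auto simp: indicator_def)
      ultimately have "?P \<omega> * ?R \<omega> \<le> 1 * 1" by (intro mult_mono) auto
      then show ?thesis by (auto simp: W_def split: split_of_bool)
    qed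
    have "(\<integral>\<^sup>+\<omega>. W \<omega> \<partial>M) \<le> (\<integral>\<^sup>+\<omega>. 1 \<partial>M)" by (intro nn_integral_mono W1)
    then show "(\<integral>\<^sup>+\<omega>. W \<omega> \<partial>M) < \<infinity>" by (simp add: emeasure_space_1 le_less_trans)
    show "h x \<in> borel_measurable (\<mu> \<Otimes>\<^sub>M N)" by (rule hm) simp
    fix A' D' assume AD: "A' \<in> sets \<mu>" "D' \<in> sets N"
    have eqs: "(\<Prod>j\<in>insert x J. of_bool (j \<in> I \<omega>) * (indicator ((A(x := A')) j) (T j \<omega>) * g \<omega> ((D(x:=D')) j) j)) =
        of_bool (x \<in> I \<omega>) * (indicator A' (T x \<omega>) * g \<omega> D' x) * (\<Prod>j\<in>J. of_bool (j \<in> I \<omega>) * (indicator (A j) (T j \<omega>) * g \<omega> (D j) j))"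
      for \<omega> and g :: "_ \<Rightarrow> _ \<Rightarrow> _ \<Rightarrow> ennreal"
    proof -
      have "(\<Prod>j\<in>J. of_bool (j \<in> I \<omega>) * (indicator ((A(x := A')) j) (T j \<omega>) * g \<omega> ((D(x:=D')) j) j)) =
        (\<Prod>j\<in>J. of_bool (j \<in> I \<omega>) * (indicator (A j) (T j \<omega>) * g \<omega> (D j) j))"
        by (rule prod.cong) (use xJ(1) in auto)
      then show ?thesis using insert.prems(2) xJ(1) by simp
    qed
    have "(\<integral>\<^sup>+\<omega>. W \<omega> * (indicator A' (T x \<omega>) * indicator D' (Y x \<omega>)) \<partial>M) =
      (\<integral>\<^sup>+\<omega>. ?P \<omega> * (\<Prod>j\<in>insert x J. of_bool (j \<in> I \<omega>) * (indicator ((A(x := A')) j) (T j \<omega>) * indicator ((D(x:=D')) j) (Y j \<omega>))) \<partial>M)"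
      unfolding W_def eqs[of _ "\<lambda>\<omega> D j. indicator D (Y j \<omega>)"] by (simp only: mult_ac)
    also have "\<dots> = (\<integral>\<^sup>+\<omega>. ?P' \<omega> * (\<Prod>j\<in>insert x J. of_bool (j \<in> I \<omega>) * (indicator ((A(x := A')) j) (T j \<omega>) * emeasure (\<kappa> (T j \<omega>)) ((D(x:=D')) j))) \<partial>M)"
      by (rule insert.IH) (use insert.prems insert.hyps AD in auto)
    also have "\<dots> = (\<integral>\<^sup>+\<omega>. W' \<omega> * (indicator A' (T x \<omega>) * emeasure (\<kappa> (T x \<omega>)) D') \<partial>M)"
      unfolding W'_def eqs[of _ "\<lambda>\<omega> D j. emeasure (\<kappa> (T j \<omega>)) D"] by (simp only: mult_ac)
    finally show "(\<integral>\<^sup>+\<omega>. W \<omega> * (indicator A' (T x \<omega>) * indicator D' (Y x \<omega>)) \<partial>M) =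
      (\<integral>\<^sup>+\<omega>. W' \<omega> * (indicator A' (T x \<omega>) * emeasure (\<kappa> (T x \<omega>)) D') \<partial>M)" .
  qed
  then show ?case using insert.hyps unfolding W_def W'_def by (simp add: mult_ac)
qed

text \<open>Factors 1 - c occur because an absent index has to contribute 1. They are traded for
  factors c by (1 - c) + c = 1, which moves an index from K2 to K1; since \<open>ennreal\<close> has
  no true subtraction, the identity is kept additive and a finite summand is cancelled.\<close>

lemma marked_poisson_avoid:
  fixes \<kappa> :: "'a \<Rightarrow> 'b measure" and h :: "'a \<times> 'b \<Rightarrow> ennreal"
  assumes P: "marked_poisson_process M \<mu> N \<kappa> I T Y" and \<kappa>: "\<kappa> \<in> measurable \<mu> (prob_algebra N)"
    and h: "h \<in> borel_measurable (\<mu> \<Otimes>\<^sub>M N)" "\<And>z. h z \<le> 1"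
    and "finite K2" "finite K1" "K1 \<inter> K2 = {}"
  shows "(\<integral>\<^sup>+\<omega>. (\<Prod>j\<in>K1. of_bool (j \<in> I \<omega>) * h (T j \<omega>, Y j \<omega>)) *
      (\<Prod>j\<in>K2. 1 - of_bool (j \<in> I \<omega>) * h (T j \<omega>, Y j \<omega>)) \<partial>M) =
    (\<integral>\<^sup>+\<omega>. (\<Prod>j\<in>K1. of_bool (j \<in> I \<omega>) * (\<integral>\<^sup>+y. h (T j \<omega>, y) \<partial>\<kappa> (T j \<omega>))) *
      (\<Prod>j\<in>K2. 1 - of_bool (j \<in> I \<omega>) * (\<integral>\<^sup>+y. h (T j \<omega>, y) \<partial>\<kappa> (T j \<omega>))) \<partial>M)"
  using assms(5-)
proof (induction K2 arbitrary: K1 rule: finite_induct)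
  case (empty K1)
  then show ?case
    using marked_poisson_product[OF P \<kappa>, of K1 "\<lambda>_. h" "{}"] h by simp
next
  case (insert x K K1)
  interpret prob_space M using P by (simp add: marked_poisson_process_def poisson_process_def)
  define a where "a j \<omega> = of_bool (j \<in> I \<omega>) * h (T j \<omega>, Y j \<omega>)" for j \<omega>
  define b where "b j \<omega> = of_bool (j \<in> I \<omega>) * (\<integral>\<^sup>+y. h (T j \<omega>, y) \<partial>\<kappa> (T j \<omega>))" for j \<omega>
  have I: "{\<omega> \<in> space M. j \<in> I \<omega>} \<in> sets M" and Tm: "T j \<in> measurable M \<mu>" and Ym: "Y j \<in> measurable M N" for j
    using P by (simp_all add: marked_poisson_process_def)
  have o: "(\<lambda>\<omega>. of_bool (j \<in> I \<omega>) :: ennreal) \<in> borel_measurable M" for j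
    by (rule measurable_compose[of "\<lambda>\<omega>. j \<in> I \<omega>" M "count_space UNIV"]) (use I[of j] in \<open>simp_all add: pred_def\<close>)
  have \<kappa>s: "\<kappa> \<in> measurable \<mu> (subprob_algebra N)" using \<kappa> by (rule measurable_prob_algebraD)
  have am[measurable]: "a j \<in> borel_measurable M" for j
    unfolding a_def by (intro borel_measurable_times_ennreal o measurable_compose[OF measurable_Pair[OF Tm Ym] h(1)])
  have him: "(\<lambda>t. \<integral>\<^sup>+y. h (t, y) \<partial>\<kappa> t) \<in> borel_measurable \<mu>"
    using h(1) by (intro nn_integral_measurable_subprob_algebra2[OF _ \<kappa>s]) simp
  have bm[measurable]: "b j \<in> borel_measurable M" for j
    unfolding b_def by (intro borel_measurable_times_ennreal o measurable_compose[OF Tm him])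
  have a1: "a j \<omega> \<le> 1" for j \<omega> by (simp add: a_def h(2) split: split_of_bool)
  have b1: "b j \<omega> \<le> 1" if "\<omega> \<in> space M" for j \<omega>
  proof -
    have "T j \<omega> \<in> space \<mu>" using Tm that by (rule measurable_space)
    then have "prob_space (\<kappa> (T j \<omega>))" using measurable_space[OF \<kappa>] by (auto simp: space_prob_algebra)
    then have "(\<integral>\<^sup>+y. h (T j \<omega>, y) \<partial>\<kappa> (T j \<omega>)) \<le> 1"
      using nn_integral_mono[of "\<kappa> (T j \<omega>)" "\<lambda>y. h (T j \<omega>, y)" "\<lambda>_. 1"] h(2) by (simp add: prob_space.emeasure_space_1)
    then show ?thesis by (simp add: b_def split: split_of_bool)
  qed
  have split: "(\<integral>\<^sup>+\<omega>. (\<Prod>j\<in>K1. c j \<omega>) * (\<Prod>j\<in>insert x K. 1 - c j \<omega>) \<partial>M) +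
      (\<integral>\<^sup>+\<omega>. (\<Prod>j\<in>insert x K1. c j \<omega>) * (\<Prod>j\<in>K. 1 - c j \<omega>) \<partial>M) =
      (\<integral>\<^sup>+\<omega>. (\<Prod>j\<in>K1. c j \<omega>) * (\<Prod>j\<in>K. 1 - c j \<omega>) \<partial>M)"
    if [measurable]: "\<And>j. c j \<in> borel_measurable M" and c1: "\<And>j \<omega>. \<omega> \<in> space M \<Longrightarrow> c j \<omega> \<le> (1::ennreal)" for c
  proof -
    have "(\<integral>\<^sup>+\<omega>. (\<Prod>j\<in>K1. c j \<omega>) * (\<Prod>j\<in>insert x K. 1 - c j \<omega>) \<partial>M) +
      (\<integral>\<^sup>+\<omega>. (\<Prod>j\<in>insert x K1. c j \<omega>) * (\<Prod>j\<in>K. 1 - c j \<omega>) \<partial>M) =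
      (\<integral>\<^sup>+\<omega>. (\<Prod>j\<in>K1. c j \<omega>) * (\<Prod>j\<in>insert x K. 1 - c j \<omega>) +
        (\<Prod>j\<in>insert x K1. c j \<omega>) * (\<Prod>j\<in>K. 1 - c j \<omega>) \<partial>M)"
      by (subst nn_integral_add) measurable
    also have "\<dots> = (\<integral>\<^sup>+\<omega>. (\<Prod>j\<in>K1. c j \<omega>) * (\<Prod>j\<in>K. 1 - c j \<omega>) \<partial>M)"
    proof (rule nn_integral_cong)
      fix \<omega> assume "\<omega> \<in> space M"
      then have "(1 - c x \<omega>) + c x \<omega> = 1" using c1 by (simp add: diff_add_cancel_ennreal)
      moreover have "(\<Prod>j\<in>K1. c j \<omega>) * (\<Prod>j\<in>insert x K. 1 - c j \<omega>) + (\<Prod>j\<in>insert x K1. c j \<omega>) * (\<Prod>j\<in>K. 1 - c j \<omega>) =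
        ((1 - c x \<omega>) + c x \<omega>) * ((\<Prod>j\<in>K1. c j \<omega>) * (\<Prod>j\<in>K. 1 - c j \<omega>))"
        using insert.hyps insert.prems by (simp add: distrib_left mult_ac)
      ultimately show "(\<Prod>j\<in>K1. c j \<omega>) * (\<Prod>j\<in>insert x K. 1 - c j \<omega>) + (\<Prod>j\<in>insert x K1. c j \<omega>) * (\<Prod>j\<in>K. 1 - c j \<omega>) =
        (\<Prod>j\<in>K1. c j \<omega>) * (\<Prod>j\<in>K. 1 - c j \<omega>)" by simp
    qed
    finally show ?thesis .
  qed
  have IH: "(\<integral>\<^sup>+\<omega>. (\<Prod>j\<in>L. a j \<omega>) * (\<Prod>j\<in>K. 1 - a j \<omega>) \<partial>M) = (\<integral>\<^sup>+\<omega>. (\<Prod>j\<in>L. b j \<omega>) * (\<Prod>j\<in>K. 1 - b j \<omega>) \<partial>M)"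
    if "finite L" "L \<inter> K = {}" for L unfolding a_def b_def by (rule insert.IH[OF that])
  have "(\<integral>\<^sup>+\<omega>. (\<Prod>j\<in>insert x K1. b j \<omega>) * (\<Prod>j\<in>K. 1 - b j \<omega>) \<partial>M) \<le> (\<integral>\<^sup>+\<omega>. 1 \<partial>M)"
  proof (rule nn_integral_mono)
    fix \<omega> assume w: "\<omega> \<in> space M"
    have "(\<Prod>j\<in>insert x K1. b j \<omega>) * (\<Prod>j\<in>K. 1 - b j \<omega>) \<le> 1 * 1"
      by (intro mult_mono prod_le_1 conjI b1[OF w]) auto
    then show "(\<Prod>j\<in>insert x K1. b j \<omega>) * (\<Prod>j\<in>K. 1 - b j \<omega>) \<le> 1" by simp
  qed
  then have fin: "(\<integral>\<^sup>+\<omega>. (\<Prod>j\<in>insert x K1. b j \<omega>) * (\<Prod>j\<in>K. 1 - b j \<omega>) \<partial>M) \<noteq> \<infinity>"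
    by (auto simp: emeasure_space_1 top_unique)
  have "(\<integral>\<^sup>+\<omega>. (\<Prod>j\<in>K1. a j \<omega>) * (\<Prod>j\<in>insert x K. 1 - a j \<omega>) \<partial>M) +
     (\<integral>\<^sup>+\<omega>. (\<Prod>j\<in>insert x K1. b j \<omega>) * (\<Prod>j\<in>K. 1 - b j \<omega>) \<partial>M) =
     (\<integral>\<^sup>+\<omega>. (\<Prod>j\<in>K1. b j \<omega>) * (\<Prod>j\<in>insert x K. 1 - b j \<omega>) \<partial>M) +
     (\<integral>\<^sup>+\<omega>. (\<Prod>j\<in>insert x K1. b j \<omega>) * (\<Prod>j\<in>K. 1 - b j \<omega>) \<partial>M)"
    using split[of a, OF am a1] split[of b, OF bm b1] IH[of K1] IH[of "insert x K1"] insert.hyps insert.prems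
    by simp
  then have "(\<integral>\<^sup>+\<omega>. (\<Prod>j\<in>K1. a j \<omega>) * (\<Prod>j\<in>insert x K. 1 - a j \<omega>) \<partial>M) =
     (\<integral>\<^sup>+\<omega>. (\<Prod>j\<in>K1. b j \<omega>) * (\<Prod>j\<in>insert x K. 1 - b j \<omega>) \<partial>M)"
    using fin by (simp add: add.commute[of _ "\<integral>\<^sup>+\<omega>. (\<Prod>j\<in>insert x K1. b j \<omega>) * (\<Prod>j\<in>K. 1 - b j \<omega>) \<partial>M"] ennreal_add_left_cancel)
  then show ?case unfolding a_def b_def .
qed

section \<open>The Laplace functional of a marked process\<close>

definition lneg :: "ennreal \<Rightarrow> ennreal" where
  "lneg x = (if x = 0 then \<infinity> else ennreal (- ln (enn2real x)))"

lemma eneg_lneg: "x \<le> 1 \<Longrightarrow> eneg (lneg x) = x"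
proof (cases "x = 0")
  case False
  assume "x \<le> 1"
  then obtain r where r: "x = ennreal r" "0 < r" "r \<le> 1"
    using False by (cases x) (auto simp: ennreal_le_1 top_unique zero_less_iff_neq_zero)
  then have "lneg x = ennreal (- ln r)" by (simp add: lneg_def)
  then show ?thesis using r by (simp add: eneg_ennreal)
qed (simp add: lneg_def)

lemma measurable_lneg [measurable]: "lneg \<in> borel_measurable borel"
  unfolding lneg_def by measurable

lemma one_minus_one_minus: "x \<le> 1 \<Longrightarrow> 1 - (1 - x) = (x::ennreal)"
  by (cases x) (auto simp: ennreal_minus ennreal_le_1 top_unique simp flip: ennreal_1)

text \<open>Exhausting a countable index type by codes turns a sum over a random index set into an
  increasing limit of sums over fixed finite sets, to which the product formulas apply.\<close>

lemma count_space_SUP: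
  fixes g :: "'i::countable \<Rightarrow> ennreal"
  shows "(\<integral>\<^sup>+i. g i \<partial>count_space S) = (SUP n. \<Sum>i | to_nat i < n. of_bool (i \<in> S) * g i)"
proof -
  have fin: "finite {i::'i. to_nat i < n}" for n
    using finite_vimageI[of "{..<n}" "to_nat :: 'i \<Rightarrow> nat"] by (simp add: vimage_def)
  have "(\<integral>\<^sup>+i. g i \<partial>count_space S) = (\<integral>\<^sup>+i. g i * indicator S i \<partial>count_space UNIV)"
    by (simp add: nn_integral_count_space_indicator)
  also have "\<dots> = (\<integral>\<^sup>+i. (SUP n. of_bool (i \<in> S) * g i * of_bool (to_nat i < n)) \<partial>count_space UNIV)"
  proof (rule nn_integral_cong)
    fix i :: 'i
    show "g i * indicator S i = (SUP n. of_bool (i \<in> S) * g i * of_bool (to_nat i < n))"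
    proof (rule antisym)
      show "g i * indicator S i \<le> (SUP n. of_bool (i \<in> S) * g i * of_bool (to_nat i < n))"
        by (rule SUP_upper2[of "Suc (to_nat i)"]) (auto simp: indicator_def)
      show "(SUP n. of_bool (i \<in> S) * g i * of_bool (to_nat i < n)) \<le> g i * indicator S i"
        by (rule SUP_least) (auto simp: indicator_def)
    qed
  qed
  also have "\<dots> = (SUP n. \<integral>\<^sup>+i. of_bool (i \<in> S) * g i * of_bool (to_nat i < n) \<partial>count_space UNIV)"
    by (rule nn_integral_monotone_convergence_SUP) (auto simp: incseq_def le_fun_def split: split_of_bool)
  also have "\<dots> = (SUP n. \<Sum>i | to_nat i < n. of_bool (i \<in> S) * g i)"
  proof (rule SUP_cong[OF refl])
    fix n
    have "(\<integral>\<^sup>+i. of_bool (i \<in> S) * g i * of_bool (to_nat i < n) \<partial>count_space UNIV) =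
      (\<Sum>i | to_nat i < n. of_bool (i \<in> S) * g i * of_bool (to_nat i < n))"
      by (rule nn_integral_count_space') (use fin in auto)
    then show "(\<integral>\<^sup>+i. of_bool (i \<in> S) * g i * of_bool (to_nat i < n) \<partial>count_space UNIV) =
      (\<Sum>i | to_nat i < n. of_bool (i \<in> S) * g i)" by simp
  qed
  finally show ?thesis .
qed

lemma measurable_ecard:
  fixes S :: "'w \<Rightarrow> 'i::countable set"
  assumes E: "\<And>i. {\<omega>\<in>space M. i \<in> S \<omega>} \<in> sets M"
  shows "(\<lambda>\<omega>. ecard (S \<omega>)) \<in> measurable M (count_space UNIV)"
proof (rule measurable_enat_iff)
  fix k
  define c where "c \<omega> = (\<integral>\<^sup>+i. indicator (S \<omega>) i \<partial>count_space UNIV)" for \<omega>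
  have [measurable]: "c \<in> borel_measurable M"
    unfolding c_def count_space_SUP
  proof (intro borel_measurable_SUP borel_measurable_sum borel_measurable_times_ennreal borel_measurable_const countableI_type)
    fix i
    have "indicator {\<omega>\<in>space M. i \<in> S \<omega>} \<in> borel_measurable M" using E by simp
    then show "(\<lambda>\<omega>. indicator (S \<omega>) i :: ennreal) \<in> borel_measurable M"
      by (rule measurable_cong[THEN iffD1, rotated]) (auto simp: indicator_def)
  qed
  have "ecard (S \<omega>) = enat k \<longleftrightarrow> c \<omega> = of_nat k" for \<omega>
    by (cases "finite (S \<omega>)") (simp_all add: c_def ecard_def)
  then show "{\<omega> \<in> space M. ecard (S \<omega>) = enat k} \<in> sets M" by simp
qed

text \<open>Given the points the marks are independent, so the factor exp (- F) at a point t may be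
  replaced by its mean 1 - u t under \<kappa> t. That mean lies in [0, 1] and is written as exp (-
  F') with F' = \<open>lneg (1 - u t)\<close>, possibly infinite; the Laplace functional of the
  unmarked process at F' gives the result.\<close>

lemma marked_poisson_laplace:
  fixes \<kappa> :: "'a \<Rightarrow> 'b measure" and F :: "'a \<times> 'b \<Rightarrow> ennreal" and I :: "'w \<Rightarrow> 'i::countable set"
  assumes P: "marked_poisson_process M \<mu> N \<kappa> I T Y" and \<kappa>: "\<kappa> \<in> measurable \<mu> (prob_algebra N)"
    and sp: "space \<mu> = UNIV" and F[measurable]: "F \<in> borel_measurable (\<mu> \<Otimes>\<^sub>M N)"
    and fin: "(\<integral>\<^sup>+t. \<integral>\<^sup>+y. (1 - eneg (F (t, y))) \<partial>\<kappa> t \<partial>\<mu>) < \<infinity>"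
  shows "(\<integral>\<^sup>+\<omega>. eneg (\<integral>\<^sup>+i. F (T i \<omega>, Y i \<omega>) \<partial>count_space (I \<omega>)) \<partial>M) =
    eneg (\<integral>\<^sup>+t. \<integral>\<^sup>+y. (1 - eneg (F (t, y))) \<partial>\<kappa> t \<partial>\<mu>)"
proof -
  have PP: "poisson_process M \<mu> I T" using P by (simp add: marked_poisson_process_def)
  interpret prob_space M using PP by (simp add: poisson_process_def)
  have I: "{\<omega> \<in> space M. j \<in> I \<omega>} \<in> sets M" and Tm: "T j \<in> measurable M \<mu>" and Ym: "Y j \<in> measurable M N" for j
    using P by (simp_all add: marked_poisson_process_def)
  have o: "(\<lambda>\<omega>. of_bool (j \<in> I \<omega>) :: ennreal) \<in> borel_measurable M" for j
    by (rule measurable_compose[of "\<lambda>\<omega>. j \<in> I \<omega>" M "count_space UNIV"]) (use I[of j] in \<open>simp_all add: pred_def\<close>)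
  have \<kappa>s: "\<kappa> \<in> measurable \<mu> (subprob_algebra N)" using \<kappa> by (rule measurable_prob_algebraD)
  have \<kappa>p: "prob_space (\<kappa> t)" for t
    using measurable_space[OF \<kappa>, of t] by (simp add: sp space_prob_algebra)
  define h where "h z = 1 - eneg (F z)" for z
  have h[measurable]: "h \<in> borel_measurable (\<mu> \<Otimes>\<^sub>M N)" unfolding h_def by measurable
  have h1: "h z \<le> 1" for z by (simp add: h_def)
  define u where "u t = (\<integral>\<^sup>+y. h (t, y) \<partial>\<kappa> t)" for t
  have um: "u \<in> borel_measurable \<mu>"
    unfolding u_def using h by (intro nn_integral_measurable_subprob_algebra2[OF _ \<kappa>s]) simp
  have u1: "u t \<le> 1" for t
    unfolding u_def using nn_integral_mono[of "\<kappa> t" "\<lambda>y. h (t, y)" "\<lambda>_. 1"] h1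
    by (simp add: prob_space.emeasure_space_1[OF \<kappa>p])
  define F' where "F' t = lneg (1 - u t)" for t
  have F': "eneg (F' t) = 1 - u t" for t unfolding F'_def by (rule eneg_lneg) simp
  have F'm: "F' \<in> borel_measurable \<mu>" unfolding F'_def using um by measurable
  have uF': "1 - eneg (F' t) = u t" for t using u1[of t] by (simp add: F' one_minus_one_minus)
  have lim: "(\<integral>\<^sup>+\<omega>. eneg (\<integral>\<^sup>+i. G i \<omega> \<partial>count_space (I \<omega>)) \<partial>M) =
      (INF n. \<integral>\<^sup>+\<omega>. (\<Prod>i | to_nat i < n. 1 - of_bool (i \<in> I \<omega>) * (1 - eneg (G i \<omega>))) \<partial>M)"
    if Gm: "\<And>i. G i \<in> borel_measurable M" for G
  proof -
    have fin: "finite {i::'i. to_nat i < n}" for n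
      using finite_vimageI[of "{..<n}" "to_nat :: 'i \<Rightarrow> nat"] by (simp add: vimage_def)
    define S where "S n \<omega> = (\<Sum>i | to_nat i < n. of_bool (i \<in> I \<omega>) * G i \<omega>)" for n \<omega>
    have inc: "incseq (\<lambda>n. S n \<omega>)" for \<omega>
      unfolding S_def incseq_def using fin by (intro allI impI sum_mono2) auto
    have Sm: "S n \<in> borel_measurable M" for n
      unfolding S_def by (intro borel_measurable_sum borel_measurable_times_ennreal o Gm)
    have prod: "eneg (S n \<omega>) = (\<Prod>i | to_nat i < n. 1 - of_bool (i \<in> I \<omega>) * (1 - eneg (G i \<omega>)))" for n \<omega>
      unfolding S_def eneg_sum[OF fin]
      by (intro prod.cong refl) (simp add: eneg_le_1 one_minus_one_minus split: split_of_bool)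
    have "(\<integral>\<^sup>+\<omega>. eneg (\<integral>\<^sup>+i. G i \<omega> \<partial>count_space (I \<omega>)) \<partial>M) = (\<integral>\<^sup>+\<omega>. (INF n. eneg (S n \<omega>)) \<partial>M)"
      unfolding count_space_SUP S_def[symmetric] eneg_SUP[OF inc] ..
    also have "\<dots> = (INF n. \<integral>\<^sup>+\<omega>. eneg (S n \<omega>) \<partial>M)"
    proof (rule nn_integral_monotone_convergence_INF_decseq)
      show "decseq (\<lambda>n \<omega>. eneg (S n \<omega>))"
        by (intro decseq_SucI le_funI eneg_antimono incseq_SucD[OF inc])
      show "(\<lambda>\<omega>. eneg (S n \<omega>)) \<in> borel_measurable M" for n
        by (rule measurable_compose[OF Sm measurable_eneg])
      have "(\<integral>\<^sup>+\<omega>. eneg (S 0 \<omega>) \<partial>M) \<le> (\<integral>\<^sup>+\<omega>. 1 \<partial>M)" by (intro nn_integral_mono eneg_le_1)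
      then show "(\<integral>\<^sup>+\<omega>. eneg (S 0 \<omega>) \<partial>M) < \<infinity>" by (simp add: emeasure_space_1 le_less_trans)
    qed
    finally show ?thesis unfolding prod .
  qed
  have "(\<integral>\<^sup>+\<omega>. eneg (\<integral>\<^sup>+i. F (T i \<omega>, Y i \<omega>) \<partial>count_space (I \<omega>)) \<partial>M) =
      (INF n. \<integral>\<^sup>+\<omega>. (\<Prod>i | to_nat i < n. 1 - of_bool (i \<in> I \<omega>) * h (T i \<omega>, Y i \<omega>)) \<partial>M)"
    unfolding h_def by (rule lim) (rule measurable_compose[OF measurable_Pair[OF Tm Ym] F])
  also have "\<dots> = (INF n. \<integral>\<^sup>+\<omega>. (\<Prod>i | to_nat i < n. 1 - of_bool (i \<in> I \<omega>) * u (T i \<omega>)) \<partial>M)"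
  proof (rule INF_cong[OF refl])
    fix n
    have fin: "finite {i::'i. to_nat i < n}"
      using finite_vimageI[of "{..<n}" "to_nat :: 'i \<Rightarrow> nat"] by (simp add: vimage_def)
    show "(\<integral>\<^sup>+\<omega>. (\<Prod>i | to_nat i < n. 1 - of_bool (i \<in> I \<omega>) * h (T i \<omega>, Y i \<omega>)) \<partial>M) =
      (\<integral>\<^sup>+\<omega>. (\<Prod>i | to_nat i < n. 1 - of_bool (i \<in> I \<omega>) * u (T i \<omega>)) \<partial>M)"
      using marked_poisson_avoid[OF P \<kappa> h h1 fin, of "{}"] by (simp add: u_def)
  qed
  also have "\<dots> = (\<integral>\<^sup>+\<omega>. eneg (\<integral>\<^sup>+i. F' (T i \<omega>) \<partial>count_space (I \<omega>)) \<partial>M)"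
    unfolding uF'[symmetric] by (rule lim[symmetric]) (rule measurable_compose[OF Tm F'm])
  also have "\<dots> = eneg (\<integral>\<^sup>+t. (1 - eneg (F' t)) \<partial>\<mu>)"
    by (rule poisson_laplace[OF PP sp F'm]) (use fin in \<open>simp add: uF' u_def h_def\<close>)
  finally show ?thesis by (simp add: uF' u_def h_def)
qed

text \<open>Marking, selecting by S and mapping by Z are handled at once: the generating function of
  the new counts is a Laplace functional of the marked process, for the function that charges a
  selected point mapped into A j with - ln (x j).\<close>

lemma marked_poisson_thinning:
  fixes \<kappa> :: "'a \<Rightarrow> 'b measure" and I :: "'w \<Rightarrow> 'i::countable set" and Z :: "'a \<times> 'b \<Rightarrow> 'c"
  assumes P: "marked_poisson_process M \<mu> N \<kappa> I T Y" and \<kappa>: "\<kappa> \<in> measurable \<mu> (prob_algebra N)"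
    and sp: "space \<mu> = UNIV" and S: "S \<in> sets (\<mu> \<Otimes>\<^sub>M N)" and Z: "Z \<in> measurable (\<mu> \<Otimes>\<^sub>M N) \<Lambda>"
    and \<Lambda>: "\<And>D. D \<in> sets \<Lambda> \<Longrightarrow> emeasure \<Lambda> D = (\<integral>\<^sup>+t. emeasure (\<kappa> t) {y \<in> space N. (t, y) \<in> S \<and> Z (t, y) \<in> D} \<partial>\<mu>)"
  shows "poisson_process M \<Lambda> (\<lambda>\<omega>. {i \<in> I \<omega>. (T i \<omega>, Y i \<omega>) \<in> S}) (\<lambda>i \<omega>. Z (T i \<omega>, Y i \<omega>))"
proof -
  have PP: "poisson_process M \<mu> I T" using P by (simp add: marked_poisson_process_def)
  interpret prob_space M using PP by (simp add: poisson_process_def)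
  have I: "{\<omega> \<in> space M. j \<in> I \<omega>} \<in> sets M" and Tm: "T j \<in> measurable M \<mu>" and Ym: "Y j \<in> measurable M N" for j
    using P by (simp_all add: marked_poisson_process_def)
  have \<kappa>s: "\<kappa> \<in> measurable \<mu> (subprob_algebra N)" using \<kappa> by (rule measurable_prob_algebraD)
  have \<kappa>x: "sets (\<kappa> t) = sets N" for t
    using measurable_space[OF \<kappa>, of t] by (simp add: sp space_prob_algebra)
  define B where "B D = S \<inter> (Z -` D \<inter> space (\<mu> \<Otimes>\<^sub>M N))" for D
  have B: "B D \<in> sets (\<mu> \<Otimes>\<^sub>M N)" if "D \<in> sets \<Lambda>" for D
    unfolding B_def using S measurable_sets[OF Z that] by blast
  have spB: "Y i \<omega> \<in> space N" if "\<omega> \<in> space M" for i \<omega> using Ym that by (rule measurable_space)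
  have iB: "{i \<in> {i \<in> I \<omega>. (T i \<omega>, Y i \<omega>) \<in> S}. Z (T i \<omega>, Y i \<omega>) \<in> D} = {i \<in> I \<omega>. (T i \<omega>, Y i \<omega>) \<in> B D}"
    if "\<omega> \<in> space M" for \<omega> D using spB[OF that] by (auto simp: B_def space_pair_measure sp)
  have \<Lambda>B: "emeasure \<Lambda> D = (\<integral>\<^sup>+t. \<integral>\<^sup>+y. indicator (B D) (t, y) \<partial>\<kappa> t \<partial>\<mu>)" if D: "D \<in> sets \<Lambda>" for D
    unfolding \<Lambda>[OF D]
  proof (rule nn_integral_cong)
    fix t
    have "{y \<in> space N. (t, y) \<in> S \<and> Z (t, y) \<in> D} = Pair t -` B D"
      using sets.sets_into_space[OF S] by (auto simp: B_def space_pair_measure sp)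
    moreover have "Pair t -` B D \<in> sets (\<kappa> t)" using sets_Pair1[OF B[OF D], of t] by (simp add: \<kappa>x)
    moreover have "(\<lambda>y. indicator (B D) (t, y) :: ennreal) = indicator (Pair t -` B D)"
      by (auto simp: indicator_def)
    ultimately show "emeasure (\<kappa> t) {y \<in> space N. (t, y) \<in> S \<and> Z (t, y) \<in> D} = (\<integral>\<^sup>+y. indicator (B D) (t, y) \<partial>\<kappa> t)"
      by simp
  qed
  have m: "(\<lambda>\<omega>. ecard {i \<in> I \<omega>. (T i \<omega>, Y i \<omega>) \<in> C}) \<in> measurable M (count_space UNIV)"
    if C: "C \<in> sets (\<mu> \<Otimes>\<^sub>M N)" for C
  proof (rule measurable_ecard)
    fix i
    have "{\<omega> \<in> space M. i \<in> I \<omega>} \<inter> ((\<lambda>\<omega>. (T i \<omega>, Y i \<omega>)) -` C \<inter> space M) \<in> sets M"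
      using I measurable_sets[OF measurable_Pair[OF Tm Ym] C] by blast
    then show "{\<omega> \<in> space M. i \<in> {i \<in> I \<omega>. (T i \<omega>, Y i \<omega>) \<in> C}} \<in> sets M"
      by (simp add: vimage_def Int_def conj_ac cong: conj_cong)
  qed
  show ?thesis
  proof (rule poisson_processI)
    show "prob_space M" by (rule prob_space_axioms)
    show "(\<lambda>\<omega>. ecard {i \<in> {i \<in> I \<omega>. (T i \<omega>, Y i \<omega>) \<in> S}. Z (T i \<omega>, Y i \<omega>) \<in> D}) \<in> measurable M (count_space UNIV)"
      if "D \<in> sets \<Lambda>" for D
      using m[OF B[OF that]] by (rule measurable_cong[THEN iffD1, rotated]) (simp only: iB)
    fix J :: "nat set" and A x
    assume J: "finite J" and dis: "disjoint_family_on A J" and A: "\<And>j. j \<in> J \<Longrightarrow> A j \<in> sets \<Lambda> \<and> emeasure \<Lambda> (A j) < \<infinity>"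
      and x: "\<And>j. j \<in> J \<Longrightarrow> 0 < x j \<and> x j < (1::real)"
    have disB: "i = j" if "z \<in> B (A i)" "z \<in> B (A j)" "i \<in> J" "j \<in> J" for z i j
      using dis that by (auto simp: B_def disjoint_family_on_def)
    have AB: "B (A j) \<in> sets (\<mu> \<Otimes>\<^sub>M N)" if "j \<in> J" for j using A[OF that] B by blast
    define F where "F z = (\<Sum>j\<in>J. ennreal (- ln (x j)) * indicator (B (A j)) z)" for z
    have Fm: "F \<in> borel_measurable (\<mu> \<Otimes>\<^sub>M N)"
      unfolding F_def by (intro borel_measurable_sum borel_measurable_times_ennreal borel_measurable_const borel_measurable_indicator AB)
    have x': "0 < - ln (x j)" "exp (- (- ln (x j))) = x j" if "j \<in> J" for j
      using x[OF that] by auto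
    \<comment> \<open>At most one of the disjoint sets contains the image of z, so the exponential
      has a single nontrivial factor and 1 - exp (- F) becomes linear in the indicators.\<close>
    have hF: "1 - eneg (F z) = (\<Sum>j\<in>J. ennreal (1 - x j) * indicator (B (A j)) z)" for z
    proof (cases "\<exists>j\<in>J. z \<in> B (A j)")
      case True
      then obtain i where i: "i \<in> J" "z \<in> B (A i)" by auto
      have "(\<Sum>j\<in>J. ennreal (c j) * indicator (B (A j)) z) = ennreal (c i)" for c
      proof -
        have "(\<Sum>j\<in>J. ennreal (c j) * indicator (B (A j)) z) = (\<Sum>j\<in>J. if j = i then ennreal (c j) else 0)"
        proof (rule sum.cong[OF refl])
          fix j assume "j \<in> J"
          then have "z \<in> B (A j) \<longleftrightarrow> j = i" using disB[of z j i] i by blast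
          then show "ennreal (c j) * indicator (B (A j)) z = (if j = i then ennreal (c j) else 0)"
            by (simp add: indicator_def)
        qed
        then show ?thesis using J i by (simp add: sum.delta)
      qed
      then show ?thesis using x'[OF i(1)] x[OF i(1)]
        by (simp add: F_def eneg_ennreal ennreal_minus flip: ennreal_1)
    next
      case False
      then have "indicator (B (A j)) z = (0::ennreal)" if "j \<in> J" for j using that by auto
      then show ?thesis by (simp add: F_def)
    qed
    have int: "(\<integral>\<^sup>+t. \<integral>\<^sup>+y. (1 - eneg (F (t, y))) \<partial>\<kappa> t \<partial>\<mu>) = (\<Sum>j\<in>J. ennreal (1 - x j) * emeasure \<Lambda> (A j))"
    proof -
      have im: "(\<lambda>y. indicator (B (A j)) (t, y) :: ennreal) \<in> borel_measurable (\<kappa> t)" if "j \<in> J" for j t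
        using measurable_compose[OF measurable_Pair1'[of t \<mu> N] borel_measurable_indicator[OF AB[OF that]]] sp
          measurable_cong_sets[OF \<kappa>x refl] by blast
      have im2: "(\<lambda>t. \<integral>\<^sup>+y. indicator (B (A j)) (t, y) \<partial>\<kappa> t) \<in> borel_measurable \<mu>" if "j \<in> J" for j
        using AB[OF that] by (intro nn_integral_measurable_subprob_algebra2[OF _ \<kappa>s]) simp
      have "(\<integral>\<^sup>+t. \<integral>\<^sup>+y. (1 - eneg (F (t, y))) \<partial>\<kappa> t \<partial>\<mu>) =
        (\<integral>\<^sup>+t. (\<Sum>j\<in>J. ennreal (1 - x j) * (\<integral>\<^sup>+y. indicator (B (A j)) (t, y) \<partial>\<kappa> t)) \<partial>\<mu>)"
        unfolding hF using im by (intro nn_integral_cong) (simp add: nn_integral_sum nn_integral_cmult)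
      also have "\<dots> = (\<Sum>j\<in>J. ennreal (1 - x j) * (\<integral>\<^sup>+t. \<integral>\<^sup>+y. indicator (B (A j)) (t, y) \<partial>\<kappa> t \<partial>\<mu>))"
        using im2 by (simp add: nn_integral_sum nn_integral_cmult)
      also have "\<dots> = (\<Sum>j\<in>J. ennreal (1 - x j) * emeasure \<Lambda> (A j))"
        using A \<Lambda>B by (intro sum.cong refl) simp
      finally show ?thesis .
    qed
    have "(\<Sum>j\<in>J. ennreal (1 - x j) * emeasure \<Lambda> (A j)) < \<infinity>"
      using J A by (auto simp: ennreal_mult_less_top)
    then have lap: "(\<integral>\<^sup>+\<omega>. eneg (\<integral>\<^sup>+i. F (T i \<omega>, Y i \<omega>) \<partial>count_space (I \<omega>)) \<partial>M) =
        eneg (\<Sum>j\<in>J. ennreal (1 - x j) * emeasure \<Lambda> (A j))"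
      using marked_poisson_laplace[OF P \<kappa> sp Fm] int by simp
    have rhs: "eneg (\<Sum>j\<in>J. ennreal (1 - x j) * emeasure \<Lambda> (A j)) = ennreal (\<Prod>j\<in>J. exp (- (measure \<Lambda> (A j) * (1 - x j))))"
      unfolding eneg_sum[OF J]
    proof (subst prod_ennreal[symmetric], simp, rule prod.cong[OF refl])
      fix j assume j: "j \<in> J"
      have "ennreal (1 - x j) * emeasure \<Lambda> (A j) = ennreal (measure \<Lambda> (A j) * (1 - x j))"
        using A[OF j] x[OF j] by (simp add: emeasure_eq_ennreal_measure less_top mult.commute flip: ennreal_mult)
      then show "eneg (ennreal (1 - x j) * emeasure \<Lambda> (A j)) = ennreal (exp (- (measure \<Lambda> (A j) * (1 - x j))))"
        using x[OF j] by (simp add: eneg_ennreal)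
    qed
    have val: "eneg (\<integral>\<^sup>+i. F (T i \<omega>, Y i \<omega>) \<partial>count_space (I \<omega>)) = ennreal (\<Prod>j\<in>J. epow (x j) (ecard {i \<in> I \<omega>. (T i \<omega>, Y i \<omega>) \<in> B (A j)}))" for \<omega>
    proof -
      have "(\<integral>\<^sup>+i. F (T i \<omega>, Y i \<omega>) \<partial>count_space (I \<omega>)) =
        (\<integral>\<^sup>+i. (\<Sum>j\<in>J. ennreal (- ln (x j)) * indicator {i\<in>I \<omega>. (T i \<omega>, Y i \<omega>) \<in> B (A j)} i) \<partial>count_space (I \<omega>))"
        by (rule nn_integral_cong) (auto simp: F_def indicator_def intro!: sum.cong)
      also have "\<dots> = (\<Sum>j\<in>J. ennreal (- ln (x j)) * emeasure (count_space (I \<omega>)) {i\<in>I \<omega>. (T i \<omega>, Y i \<omega>) \<in> B (A j)})"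
        by (subst nn_integral_sum) (auto intro!: sum.cong nn_integral_cmult_indicator)
      finally have "eneg (\<integral>\<^sup>+i. F (T i \<omega>, Y i \<omega>) \<partial>count_space (I \<omega>)) =
        (\<Prod>j\<in>J. eneg (ennreal (- ln (x j)) * emeasure (count_space (I \<omega>)) {i\<in>I \<omega>. (T i \<omega>, Y i \<omega>) \<in> B (A j)}))"
        using J by (simp add: eneg_sum)
      also have "\<dots> = (\<Prod>j\<in>J. ennreal (epow (x j) (ecard {i\<in>I \<omega>. (T i \<omega>, Y i \<omega>) \<in> B (A j)})))"
      proof (intro prod.cong refl)
        fix j assume j: "j \<in> J"
        show "eneg (ennreal (- ln (x j)) * emeasure (count_space (I \<omega>)) {i\<in>I \<omega>. (T i \<omega>, Y i \<omega>) \<in> B (A j)}) =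
          ennreal (epow (x j) (ecard {i\<in>I \<omega>. (T i \<omega>, Y i \<omega>) \<in> B (A j)}))"
          using eneg_mult_count[OF x'(1)[OF j], of "{i\<in>I \<omega>. (T i \<omega>, Y i \<omega>) \<in> B (A j)}" "I \<omega>"] x'(2)[OF j] by auto
      qed
      also have "\<dots> = ennreal (\<Prod>j\<in>J. epow (x j) (ecard {i\<in>I \<omega>. (T i \<omega>, Y i \<omega>) \<in> B (A j)}))"
        using x by (intro prod_ennreal) (simp add: epow_bounds less_imp_le)
      finally show ?thesis .
    qed
    have b: "0 \<le> (\<Prod>j\<in>J. epow (x j) (n j)) \<and> (\<Prod>j\<in>J. epow (x j) (n j)) \<le> 1" for n
      using epow_prod_bounds[of J x n] x by blast
    have "(\<integral>\<^sup>+\<omega>. ennreal (\<Prod>j\<in>J. epow (x j) (ecard {i\<in>I \<omega>. (T i \<omega>, Y i \<omega>) \<in> B (A j)})) \<partial>M) =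
      ennreal (\<integral>\<omega>. (\<Prod>j\<in>J. epow (x j) (ecard {i\<in>I \<omega>. (T i \<omega>, Y i \<omega>) \<in> B (A j)})) \<partial>M)"
      by (intro nn_integral_eq_integral integrable_const_bound[of _ 1] borel_measurable_prod measurable_compose[OF m[OF AB]])
         (use b in auto)
    with lap have "ennreal (\<integral>\<omega>. (\<Prod>j\<in>J. epow (x j) (ecard {i\<in>I \<omega>. (T i \<omega>, Y i \<omega>) \<in> B (A j)})) \<partial>M) =
      ennreal (\<Prod>j\<in>J. exp (- (measure \<Lambda> (A j) * (1 - x j))))"
      unfolding val rhs by simp
    moreover have "0 \<le> (\<integral>\<omega>. (\<Prod>j\<in>J. epow (x j) (ecard {i\<in>I \<omega>. (T i \<omega>, Y i \<omega>) \<in> B (A j)})) \<partial>M)"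
      using b by (intro Bochner_Integration.integral_nonneg) auto
    moreover have "0 \<le> (\<Prod>j\<in>J. exp (- (measure \<Lambda> (A j) * (1 - x j))))" by (intro prod_nonneg) simp
    ultimately have "(\<integral>\<omega>. (\<Prod>j\<in>J. epow (x j) (ecard {i\<in>I \<omega>. (T i \<omega>, Y i \<omega>) \<in> B (A j)})) \<partial>M) =
      (\<Prod>j\<in>J. exp (- (measure \<Lambda> (A j) * (1 - x j))))" by simp
    moreover have "(\<integral>\<omega>. (\<Prod>j\<in>J. epow (x j) (ecard {i \<in> {i \<in> I \<omega>. (T i \<omega>, Y i \<omega>) \<in> S}. Z (T i \<omega>, Y i \<omega>) \<in> A j})) \<partial>M) =
      (\<integral>\<omega>. (\<Prod>j\<in>J. epow (x j) (ecard {i\<in>I \<omega>. (T i \<omega>, Y i \<omega>) \<in> B (A j)})) \<partial>M)"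
      by (rule Bochner_Integration.integral_cong[OF refl]) (simp only: iB)
    ultimately show "(\<integral>\<omega>. (\<Prod>j\<in>J. epow (x j) (ecard {i \<in> {i \<in> I \<omega>. (T i \<omega>, Y i \<omega>) \<in> S}. Z (T i \<omega>, Y i \<omega>) \<in> A j})) \<partial>M) =
      (\<Prod>j\<in>J. exp (- (measure \<Lambda> (A j) * (1 - x j))))" by simp
  qed
qed

section \<open>The offspring law\<close>

lemma ecard_bij: "bij_betw f A B \<Longrightarrow> ecard A = ecard B"
  by (auto simp: ecard_def bij_betw_finite dest: bij_betw_same_card)

text \<open>Several indices may produce the same point, which a set counts once. Each point is
  represented by its index of least code, so the points in A are counted by counting such indices;
  measurability of the diagonal makes the coincidence of two indices an event.\<close>

lemma measurable_image_config:
  fixes I :: "'w \<Rightarrow> 'i::countable set" and Z :: "'i \<Rightarrow> 'w \<Rightarrow> 'c"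
  assumes I: "\<And>i. {\<omega>\<in>space M. i \<in> I \<omega>} \<in> sets M" and Z: "\<And>i. Z i \<in> measurable M S"
    and diag: "{p \<in> space (S \<Otimes>\<^sub>M S). fst p = snd p} \<in> sets (S \<Otimes>\<^sub>M S)"
  shows "(\<lambda>\<omega>. (\<lambda>i. Z i \<omega>) ` I \<omega>) \<in> measurable M (config_space S)"
proof (rule measurable_config_spaceI)
  fix \<omega> assume "\<omega> \<in> space M"
  then show "(\<lambda>i. Z i \<omega>) ` I \<omega> \<subseteq> space S \<and> countable ((\<lambda>i. Z i \<omega>) ` I \<omega>)"
    using measurable_space[OF Z] by auto
next
  fix A assume A: "A \<in> sets S"
  define K where "K \<omega> = {i \<in> I \<omega>. Z i \<omega> \<in> A \<and> (\<forall>j. to_nat j < to_nat i \<longrightarrow> j \<in> I \<omega> \<longrightarrow> Z j \<omega> \<noteq> Z i \<omega>)}" for \<omega>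
  have "bij_betw (\<lambda>i. Z i \<omega>) (K \<omega>) ((\<lambda>i. Z i \<omega>) ` I \<omega> \<inter> A)" for \<omega>
  proof (rule bij_betw_imageI)
    show "inj_on (\<lambda>i. Z i \<omega>) (K \<omega>)"
    proof (rule inj_onI)
      fix i j assume "i \<in> K \<omega>" "j \<in> K \<omega>" "Z i \<omega> = Z j \<omega>"
      then have "\<not> to_nat i < to_nat j" "\<not> to_nat j < to_nat i" by (auto simp: K_def)
      then have "to_nat i = to_nat j" by simp
      then show "i = j" by simp
    qed
    show "(\<lambda>i. Z i \<omega>) ` K \<omega> = (\<lambda>i. Z i \<omega>) ` I \<omega> \<inter> A"
    proof (intro equalityI subsetI)
      fix y assume "y \<in> (\<lambda>i. Z i \<omega>) ` I \<omega> \<inter> A"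
      then obtain i where i: "i \<in> I \<omega>" "y = Z i \<omega>" "y \<in> A" by auto
      obtain k where k: "k \<in> I \<omega> \<and> Z k \<omega> = y" "\<And>j. to_nat j < to_nat k \<Longrightarrow> \<not> (j \<in> I \<omega> \<and> Z j \<omega> = y)"
        using ex_has_least_nat[of "\<lambda>j. j \<in> I \<omega> \<and> Z j \<omega> = y" i to_nat] i by (meson not_less)
      then have "k \<in> K \<omega>" using i by (auto simp: K_def)
      then show "y \<in> (\<lambda>i. Z i \<omega>) ` K \<omega>" using k by blast
    qed (auto simp: K_def)
  qed
  then have eq: "ecard ((\<lambda>i. Z i \<omega>) ` I \<omega> \<inter> A) = ecard (K \<omega>)" for \<omega> by (metis ecard_bij)
  show "(\<lambda>\<omega>. ecard ((\<lambda>i. Z i \<omega>) ` I \<omega> \<inter> A)) \<in> measurable M (count_space UNIV)"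
    unfolding eq
  proof (rule measurable_ecard)
    fix i
    have E: "{\<omega>\<in>space M. Z j \<omega> = Z i \<omega>} \<in> sets M" for j
    proof -
      have "(\<lambda>\<omega>. (Z j \<omega>, Z i \<omega>)) -` {p \<in> space (S \<Otimes>\<^sub>M S). fst p = snd p} \<inter> space M \<in> sets M"
        by (rule measurable_sets[OF measurable_Pair[OF Z Z] diag])
      also have "(\<lambda>\<omega>. (Z j \<omega>, Z i \<omega>)) -` {p \<in> space (S \<Otimes>\<^sub>M S). fst p = snd p} \<inter> space M = {\<omega>\<in>space M. Z j \<omega> = Z i \<omega>}"
        using measurable_space[OF Z] by (auto simp: space_pair_measure)
      finally show ?thesis .
    qed
    have "{\<omega>\<in>space M. i \<in> K \<omega>} = {\<omega>\<in>space M. i \<in> I \<omega>} \<inter> (Z i -` A \<inter> space M) -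
      (\<Union>j\<in>{j. to_nat j < to_nat i}. {\<omega>\<in>space M. j \<in> I \<omega>} \<inter> {\<omega>\<in>space M. Z j \<omega> = Z i \<omega>})"
      by (auto simp: K_def)
    also have "\<dots> \<in> sets M"
    proof (rule sets.Diff[OF sets.Int[OF I measurable_sets[OF Z A]]])
      show "(\<Union>j\<in>{j. to_nat j < to_nat i}. {\<omega>\<in>space M. j \<in> I \<omega>} \<inter> {\<omega>\<in>space M. Z j \<omega> = Z i \<omega>}) \<in> sets M"
        by (intro sets.countable_UN'' sets.Int I E) auto
    qed
    finally show "{\<omega>\<in>space M. i \<in> K \<omega>} \<in> sets M" .
  qed
qed

text \<open>\<open>poisson_process\<close> counts indices, a configuration counts distinct values;
  injectivity makes the two agree almost surely, which suffices for generating functions.\<close>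

lemma poisson_process_image:
  assumes P: "poisson_process M \<Lambda> I Z" and inj: "AE \<omega> in M. inj_on (\<lambda>i. Z i \<omega>) (I \<omega>)"
    and R: "(\<lambda>\<omega>. (\<lambda>i. Z i \<omega>) ` I \<omega>) \<in> measurable M (config_space S)" and s: "sets \<Lambda> = sets S"
  shows "poisson_process M \<Lambda> (\<lambda>\<omega>. (\<lambda>i. Z i \<omega>) ` I \<omega>) (\<lambda>x \<omega>. x)"
proof (rule poisson_processI)
  show "prob_space M" using P by (simp add: poisson_process_def)
  have eq: "{x \<in> X. x \<in> A} = X \<inter> A" for X A :: "'b set" by auto
  show m: "(\<lambda>\<omega>. ecard {x \<in> (\<lambda>i. Z i \<omega>) ` I \<omega>. x \<in> A}) \<in> measurable M (count_space UNIV)" if "A \<in> sets \<Lambda>" for A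
    unfolding eq using measurable_compose[OF R measurable_config_count] that s by blast
  fix J :: "nat set" and A x
  assume J: "finite J" "disjoint_family_on A J" "\<And>j. j \<in> J \<Longrightarrow> A j \<in> sets \<Lambda> \<and> emeasure \<Lambda> (A j) < \<infinity>"
    and x: "\<And>j. j \<in> J \<Longrightarrow> 0 < x j \<and> x j < (1::real)"
  have "(\<integral>\<omega>. (\<Prod>j\<in>J. epow (x j) (ecard {y \<in> (\<lambda>i. Z i \<omega>) ` I \<omega>. y \<in> A j})) \<partial>M) =
    (\<integral>\<omega>. (\<Prod>j\<in>J. epow (x j) (ecard {i \<in> I \<omega>. Z i \<omega> \<in> A j})) \<partial>M)"
  proof (rule integral_cong_AE)
    show "(\<lambda>\<omega>. \<Prod>j\<in>J. epow (x j) (ecard {y \<in> (\<lambda>i. Z i \<omega>) ` I \<omega>. y \<in> A j})) \<in> borel_measurable M"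
      by (intro borel_measurable_prod measurable_compose[OF m]) (use J in auto)
    show "(\<lambda>\<omega>. \<Prod>j\<in>J. epow (x j) (ecard {i \<in> I \<omega>. Z i \<omega> \<in> A j})) \<in> borel_measurable M"
      by (intro borel_measurable_prod measurable_compose[OF poisson_process_ecard[OF P]]) (use J in auto)
    show "AE \<omega> in M. (\<Prod>j\<in>J. epow (x j) (ecard {y \<in> (\<lambda>i. Z i \<omega>) ` I \<omega>. y \<in> A j})) =
      (\<Prod>j\<in>J. epow (x j) (ecard {i \<in> I \<omega>. Z i \<omega> \<in> A j}))"
      using inj
    proof eventually_elim
      case (elim \<omega>)
      have "ecard {i \<in> I \<omega>. Z i \<omega> \<in> A j} = ecard {y \<in> (\<lambda>i. Z i \<omega>) ` I \<omega>. y \<in> A j}" for j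
        by (rule ecard_bij[of "\<lambda>i. Z i \<omega>"]) (use elim in \<open>auto simp: bij_betw_def inj_on_def\<close>)
      then show ?case by simp
    qed
  qed
  then show "(\<integral>\<omega>. (\<Prod>j\<in>J. epow (x j) (ecard {y \<in> (\<lambda>i. Z i \<omega>) ` I \<omega>. y \<in> A j})) \<partial>M) =
      (\<Prod>j\<in>J. exp (- (measure \<Lambda> (A j) * (1 - x j))))"
    using poisson_process_pgf[OF P J x] by simp
qed

lemma prod_epow_ecard:
  fixes n :: nat
  assumes "finite J"
  shows "(\<Prod>j\<in>J. epow (x j) (ecard {i \<in> {..<n}. t i \<in> A j})) = (\<Prod>i<n. \<Prod>j\<in>J. if t i \<in> A j then x j else 1)"
proof -
  have "(\<Prod>i<n. if t i \<in> A j then x j else 1) = epow (x j) (ecard {i \<in> {..<n}. t i \<in> A j})" for j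
  proof -
    have "(\<Prod>i<n. if t i \<in> A j then x j else 1) = (\<Prod>i\<in>{i \<in> {..<n}. t i \<in> A j}. x j)"
      by (rule prod.inter_filter[symmetric]) simp
    then show ?thesis by (simp add: ecard_def)
  qed
  then show ?thesis by (subst prod.swap) simp
qed

text \<open>Given n points, independence makes the generating function c ^ n with c the mean of a
  single factor; averaging over the Poisson number of points gives exp (- (a * (1 - c))). Since 1 -
  c is the sum of (1 - x j) \<nu>(A j), this is the required product.\<close>

lemma iid_poisson_process:
  fixes \<nu> :: "real measure"
  assumes \<nu>: "prob_space \<nu>" "sets \<nu> = sets borel" and a: "0 \<le> a"
    and \<mu>: "sets \<mu> = sets borel" "\<And>A. A \<in> sets borel \<Longrightarrow> emeasure \<mu> A = ennreal a * emeasure \<nu> A"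
  shows "poisson_process (measure_pmf (poisson_pmf0 a) \<Otimes>\<^sub>M PiM UNIV (\<lambda>_::nat. \<nu>)) \<mu> (\<lambda>\<omega>. {..<fst \<omega>}) (\<lambda>i \<omega>. snd \<omega> i)"
proof -
  interpret \<nu>: prob_space \<nu> by fact
  interpret Pi: product_prob_space "\<lambda>_::nat. \<nu>" UNIV ..
  interpret N: prob_space "measure_pmf (poisson_pmf0 a)" by (rule prob_space_measure_pmf)
  let ?M = "measure_pmf (poisson_pmf0 a) \<Otimes>\<^sub>M PiM UNIV (\<lambda>_::nat. \<nu>)"
  interpret PP: pair_prob_space "measure_pmf (poisson_pmf0 a)" "PiM UNIV (\<lambda>_::nat. \<nu>)" ..
  have sm: "(\<lambda>\<omega>. snd \<omega> i) \<in> measurable ?M \<nu>" for i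
    by (rule measurable_compose[OF measurable_snd measurable_component_singleton]) simp
  have fm: "fst \<in> measurable ?M (count_space UNIV)"
    by (rule measurable_compose[where g="\<lambda>n. n", OF measurable_fst]) simp
  have m: "(\<lambda>\<omega>. ecard {i \<in> {..<fst \<omega>}. snd \<omega> i \<in> A}) \<in> measurable ?M (count_space UNIV)" if "A \<in> sets borel" for A
  proof (rule measurable_ecard)
    fix i
    have "(fst -` {i<..} \<inter> space ?M) \<inter> ((\<lambda>\<omega>. snd \<omega> i) -` A \<inter> space ?M) \<in> sets ?M"
      by (rule sets.Int[OF measurable_sets[OF fm] measurable_sets[OF sm]]) (use that \<nu>(2) in auto)
    also have "(fst -` {i<..} \<inter> space ?M) \<inter> ((\<lambda>\<omega>. snd \<omega> i) -` A \<inter> space ?M) = {\<omega> \<in> space ?M. i \<in> {i \<in> {..<fst \<omega>}. snd \<omega> i \<in> A}}" by auto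
    finally show "{\<omega> \<in> space ?M. i \<in> {i \<in> {..<fst \<omega>}. snd \<omega> i \<in> A}} \<in> sets ?M" .
  qed
  show ?thesis
  proof (rule poisson_processI)
    show "prob_space ?M" by (rule PP.prob_space_axioms)
    show "(\<lambda>\<omega>. ecard {i \<in> {..<fst \<omega>}. snd \<omega> i \<in> A}) \<in> measurable ?M (count_space UNIV)" if "A \<in> sets \<mu>" for A
      using that \<mu>(1) m by simp
    fix J :: "nat set" and A x
    assume J: "finite J" "disjoint_family_on A J" and A: "\<And>j. j \<in> J \<Longrightarrow> A j \<in> sets \<mu> \<and> emeasure \<mu> (A j) < \<infinity>"
      and x: "\<And>j. j \<in> J \<Longrightarrow> 0 < x j \<and> x j < (1::real)"
    have A': "A j \<in> sets \<nu>" if "j \<in> J" for j using A[OF that] \<mu>(1) \<nu>(2) by simp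
    define g where "g y = (\<Prod>j\<in>J. if y \<in> A j then x j else 1)" for y
    have g01: "0 \<le> g y \<and> g y \<le> 1" for y
      unfolding g_def using x by (auto intro!: prod_nonneg prod_le_1 simp: less_imp_le)
    have gm[measurable]: "g \<in> borel_measurable \<nu>"
      unfolding g_def using A' by (intro borel_measurable_prod measurable_If_set) auto
    have g_eq: "g y = 1 - (\<Sum>j\<in>J. (1 - x j) * indicator (A j) y)" for y
    proof (cases "\<exists>i\<in>J. y \<in> A i")
      case True
      then obtain i where i: "i \<in> J" "y \<in> A i" by auto
      have ne: "y \<in> A j \<longleftrightarrow> j = i" if "j \<in> J" for j
        using J(2) i that by (auto simp: disjoint_family_on_def)
      have "g y = (\<Prod>j\<in>J. if j = i then x j else 1)" unfolding g_def using ne by (intro prod.cong) auto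
      moreover have "(\<Sum>j\<in>J. (1 - x j) * indicator (A j) y) = (\<Sum>j\<in>J. if j = i then 1 - x j else 0)"
        using ne by (intro sum.cong) (auto simp: indicator_def)
      ultimately show ?thesis using J(1) i(1) by (simp add: prod.delta sum.delta)
    next
      case False
      then have "g y = 1" unfolding g_def by (intro prod.neutral) auto
      moreover have "(\<Sum>j\<in>J. (1 - x j) * indicator (A j) y) = 0" using False by (intro sum.neutral) auto
      ultimately show ?thesis by simp
    qed
    define c where "c = (\<integral>y. g y \<partial>\<nu>)"
    have c_eq: "c = 1 - (\<Sum>j\<in>J. (1 - x j) * measure \<nu> (A j))"
    proof -
      have i: "integrable \<nu> (\<lambda>y. (1 - x j) * indicator (A j) y)" if "j \<in> J" for j
        using A'[OF that] by (intro integrable_mult_right integrable_real_indicator) (auto simp: less_top[symmetric])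
      have "c = (\<integral>y. 1 \<partial>\<nu>) - (\<integral>y. (\<Sum>j\<in>J. (1 - x j) * indicator (A j) y) \<partial>\<nu>)"
        unfolding c_def g_eq using i by (intro Bochner_Integration.integral_diff integrable_sum) auto
      also have "(\<integral>y. (\<Sum>j\<in>J. (1 - x j) * indicator (A j) y) \<partial>\<nu>) = (\<Sum>j\<in>J. (1 - x j) * measure \<nu> (A j))"
        using i A' by (subst Bochner_Integration.integral_sum) auto
      finally show ?thesis by (simp add: \<nu>.prob_space)
    qed
    have "0 \<le> (1 - x j) * measure \<nu> (A j)" if "j \<in> J" for j using x[OF that] by simp
    then have c1: "c \<le> 1" by (simp add: c_eq sum_nonneg)
    \<comment> \<open>The series for the Poisson number is available for 0 < c < 1. Positivity of c
      follows since g is at least the product of all x j; the value c = 1 is treated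
      separately.\<close>
    have gpos: "g y \<ge> (\<Prod>j\<in>J. x j)" for y
      unfolding g_def using x by (intro prod_mono) (auto simp: less_imp_le)
    have gint: "integrable \<nu> g" by (rule \<nu>.integrable_const_bound[of _ 1]) (use g01 in auto)
    have "(\<integral>y. (\<Prod>j\<in>J. x j) \<partial>\<nu>) \<le> c" unfolding c_def using gint gpos by (intro integral_mono) auto
    moreover have "0 < (\<Prod>j\<in>J. x j)" using x by (intro prod_pos) auto
    ultimately have c0: "0 < c" by (simp add: \<nu>.prob_space)
    have prod: "(\<integral>t. (\<Prod>i<n. g (t i)) \<partial>PiM UNIV (\<lambda>_::nat. \<nu>)) = c ^ n" for n
    proof -
      have "(\<integral>t. (\<Prod>i<n. g (t i)) \<partial>PiM UNIV (\<lambda>_::nat. \<nu>)) =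
        (\<integral>t. (\<Prod>i<n. g (t i)) \<partial>distr (PiM UNIV (\<lambda>_::nat. \<nu>)) (PiM {..<n} (\<lambda>_. \<nu>)) (\<lambda>t. restrict t {..<n}))"
      proof (subst integral_distr)
        show "(\<lambda>t. \<Prod>i<n. g (t i)) \<in> borel_measurable (PiM {..<n} (\<lambda>_. \<nu>))"
          by (intro borel_measurable_prod) measurable
        show "(\<lambda>t. restrict t {..<n}) \<in> measurable (PiM UNIV (\<lambda>_::nat. \<nu>)) (PiM {..<n} (\<lambda>_. \<nu>))"
          by (rule measurable_restrict_subset) simp
      qed simp
      also have "\<dots> = (\<integral>t. (\<Prod>i<n. g (t i)) \<partial>PiM {..<n} (\<lambda>_. \<nu>))"
        by (subst Pi.distr_PiM_restrict_finite) auto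
      also have "\<dots> = (\<Prod>i<n. c)"
        unfolding c_def by (rule Pi.product_integral_prod) (use gint in auto)
      finally show ?thesis by simp
    qed
    have Gm: "(\<lambda>\<omega>. \<Prod>j\<in>J. epow (x j) (ecard {i \<in> {..<fst \<omega>}. snd \<omega> i \<in> A j})) \<in> borel_measurable ?M"
      by (intro borel_measurable_prod measurable_compose[OF m]) (use A' \<nu>(2) in auto)
    have b: "0 \<le> (\<Prod>j\<in>J. epow (x j) (N j)) \<and> (\<Prod>j\<in>J. epow (x j) (N j)) \<le> 1" for N
      using epow_prod_bounds[of J x N] x by blast
    have "(\<integral>\<omega>. (\<Prod>j\<in>J. epow (x j) (ecard {i \<in> {..<fst \<omega>}. snd \<omega> i \<in> A j})) \<partial>?M) =
      (\<integral>n. \<integral>t. (\<Prod>j\<in>J. epow (x j) (ecard {i \<in> {..<n}. t i \<in> A j})) \<partial>PiM UNIV (\<lambda>_::nat. \<nu>) \<partial>measure_pmf (poisson_pmf0 a))"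
    proof -
      have "integrable ?M (\<lambda>\<omega>. \<Prod>j\<in>J. epow (x j) (ecard {i \<in> {..<fst \<omega>}. snd \<omega> i \<in> A j}))"
        by (rule PP.integrable_const_bound[of _ 1, OF _ Gm]) (use b in auto)
      then show ?thesis
        using PP.integral_fst[of "\<lambda>n t. \<Prod>j\<in>J. epow (x j) (ecard {i \<in> {..<n}. t i \<in> A j})"]
        by (simp only: case_prod_unfold)
    qed
    also have "\<dots> = (\<integral>n. c ^ n \<partial>measure_pmf (poisson_pmf0 a))"
      unfolding prod_epow_ecard[OF J(1)] g_def[symmetric] prod ..
    also have "\<dots> = exp (- (a * (1 - c)))"
    proof (cases "c = 1")
      case False
      then show ?thesis using poisson_pmf0_pgf[OF a, of c] c0 c1 by simp
    qed simp
    also have "\<dots> = (\<Prod>j\<in>J. exp (- (measure \<mu> (A j) * (1 - x j))))"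
    proof -
      have "measure \<mu> (A j) = a * measure \<nu> (A j)" if "j \<in> J" for j
        using \<mu>(2)[of "A j"] A'[OF that] \<nu>(2) a by (simp add: measure_def enn2real_mult)
      then have "a * (1 - c) = (\<Sum>j\<in>J. measure \<mu> (A j) * (1 - x j))"
        by (simp add: c_eq sum_distrib_left mult_ac)
      then show ?thesis using J(1) by (simp add: exp_sum flip: sum_negf)
    qed
    finally show "(\<integral>\<omega>. (\<Prod>j\<in>J. epow (x j) (ecard {i \<in> {..<fst \<omega>}. snd \<omega> i \<in> A j})) \<partial>?M) =
      (\<Prod>j\<in>J. exp (- (measure \<mu> (A j) * (1 - x j))))" .
  qed
qed

lemma iid_distinct:
  fixes \<nu> :: "real measure"
  assumes \<nu>: "prob_space \<nu>" "sets \<nu> = sets borel" and atomless: "\<And>x. emeasure \<nu> {x} = 0"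
  shows "AE t in PiM UNIV (\<lambda>_::nat. \<nu>). inj t"
proof -
  interpret \<nu>: prob_space \<nu> by fact
  interpret Pi: product_prob_space "\<lambda>_::nat. \<nu>" UNIV ..
  have ne: "AE t in PiM UNIV (\<lambda>_::nat. \<nu>). t i \<noteq> t j" if "i \<noteq> j" for i j
  proof -
    have sp: "space \<nu> = UNIV" using sets_eq_imp_space_eq[OF \<nu>(2)] by simp
    let ?D = "{p \<in> space (\<nu> \<Otimes>\<^sub>M \<nu>). fst p = snd p}"
    have sets2: "sets (\<nu> \<Otimes>\<^sub>M \<nu>) = sets (borel \<Otimes>\<^sub>M borel)" using \<nu>(2) by (intro sets_pair_measure_cong)
    have D: "?D \<in> sets (\<nu> \<Otimes>\<^sub>M \<nu>)"
      unfolding sets2 sets_eq_imp_space_eq[OF sets2] by measurable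
    have "(\<integral>\<^sup>+t. indicator ?D (t i, t j) \<partial>PiM UNIV (\<lambda>_::nat. \<nu>)) =
      (\<integral>\<^sup>+t. indicator ?D (t i, t j) \<partial>distr (PiM UNIV (\<lambda>_::nat. \<nu>)) (PiM {i, j} (\<lambda>_. \<nu>)) (\<lambda>t. restrict t {i, j}))"
      using D by (subst nn_integral_distr) (auto intro!: measurable_restrict_subset measurable_compose[OF measurable_Pair[OF measurable_component_singleton measurable_component_singleton] borel_measurable_indicator])
    also have "\<dots> = (\<integral>\<^sup>+t. indicator ?D (t i, t j) \<partial>PiM {i, j} (\<lambda>_. \<nu>))"
      by (subst Pi.distr_PiM_restrict_finite) auto
    also have "\<dots> = (\<integral>\<^sup>+z. indicator ?D (fst z, snd z) \<partial>(\<nu> \<Otimes>\<^sub>M \<nu>))"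
      using D by (intro Pi.product_nn_integral_pair[OF _ that]) (simp add: split_beta)
    also have "\<dots> = emeasure (\<nu> \<Otimes>\<^sub>M \<nu>) ?D" using D by simp
    also have "\<dots> = (\<integral>\<^sup>+x. emeasure \<nu> (Pair x -` ?D) \<partial>\<nu>)" by (rule \<nu>.emeasure_pair_measure_alt[OF D])
    also have "\<dots> = 0"
    proof -
      have "Pair x -` ?D = {x}" for x by (auto simp: space_pair_measure sp)
      then show ?thesis by (simp add: atomless)
    qed
    finally have "AE t in PiM UNIV (\<lambda>_::nat. \<nu>). (indicator ?D (t i, t j) :: ennreal) = 0"
      using D by (subst (asm) nn_integral_0_iff_AE) (auto intro!: measurable_compose[OF measurable_Pair[OF measurable_component_singleton measurable_component_singleton] borel_measurable_indicator])
    then show ?thesis by eventually_elim (auto simp: indicator_def space_pair_measure sp split: if_splits)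
  qed
  have "AE t in PiM UNIV (\<lambda>_::nat. \<nu>). \<forall>i j. i \<noteq> j \<longrightarrow> t i \<noteq> t j"
    by (simp add: AE_all_countable ne)
  then show ?thesis by eventually_elim (auto simp: inj_def)
qed

text \<open>\<open>poisson_law\<close> is defined by \<open>THE\<close>. The witness is a Poisson
  number of independent points with density \<phi>, almost surely distinct as their law has no
  atoms; uniqueness is \<open>config_law_eqI\<close>. The explicit representation is recorded
  because integrals under the offspring law are computed from it.\<close>

lemma offspring_law:
  assumes \<phi>: "is_density \<phi>" and a: "0 \<le> a"
  defines "\<mu> \<equiv> density lborel (\<lambda>t. ennreal (a * \<phi> t) * indicator {0..} t)"
  shows "sets (offspring_law a \<phi>) = sets (config_space borel)"
    and "poisson_process (offspring_law a \<phi>) \<mu> (\<lambda>X. X) (\<lambda>x X. x)"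
    and "finite_measure \<mu>" and "emeasure \<mu> UNIV = ennreal a"
    and "offspring_law a \<phi> = distr (measure_pmf (poisson_pmf0 a) \<Otimes>\<^sub>M
        PiM UNIV (\<lambda>_::nat. density lborel (\<lambda>t. ennreal (\<phi> t) * indicator {0..} t))) (config_space borel)
      (\<lambda>\<omega>. snd \<omega> ` {..<fst \<omega>})" (is ?repr)
    and "(\<lambda>\<omega>. snd \<omega> ` {..<fst \<omega>}) \<in> measurable (measure_pmf (poisson_pmf0 a) \<Otimes>\<^sub>M
        PiM UNIV (\<lambda>_::nat. density lborel (\<lambda>t. ennreal (\<phi> t) * indicator {0..} t))) (config_space borel)"
    and "AE \<omega> in measure_pmf (poisson_pmf0 a) \<Otimes>\<^sub>M
        PiM UNIV (\<lambda>_::nat. density lborel (\<lambda>t. ennreal (\<phi> t) * indicator {0..} t)). inj (snd \<omega>)"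
    and "prob_space (density lborel (\<lambda>t. ennreal (\<phi> t) * indicator {0..} t))"
proof -
  have [measurable]: "\<phi> \<in> borel_measurable borel" using \<phi> by (simp add: is_density_def)
  define \<nu> where "\<nu> = density lborel (\<lambda>t. ennreal (\<phi> t) * indicator {0..} t)"
  have \<nu>1: "prob_space \<nu>"
    by (rule prob_spaceI) (use \<phi> in \<open>simp add: \<nu>_def emeasure_density is_density_def\<close>)
  have s\<nu>: "sets \<nu> = sets borel" and s\<mu>: "sets \<mu> = sets borel" by (simp_all add: \<nu>_def \<mu>_def)
  have \<mu>\<nu>: "emeasure \<mu> A = ennreal a * emeasure \<nu> A" if A[measurable]: "A \<in> sets borel" for A
  proof -
    have "emeasure \<mu> A = (\<integral>\<^sup>+t. ennreal a * (ennreal (\<phi> t) * indicator {0..} t * indicator A t) \<partial>lborel)"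
      unfolding \<mu>_def by (simp add: emeasure_density, intro nn_integral_cong)
        (use a \<phi> in \<open>auto simp: indicator_def ennreal_mult is_density_def mult_ac\<close>)
    also have "\<dots> = ennreal a * emeasure \<nu> A"
      by (simp add: nn_integral_cmult \<nu>_def emeasure_density)
    finally show ?thesis .
  qed
  have at: "emeasure \<nu> {x} = 0" for x
  proof -
    have "(\<integral>\<^sup>+t. ennreal (\<phi> t) * indicator {0..} t * indicator {x} t \<partial>lborel) = 0"
      by (subst nn_integral_0_iff_AE) (auto intro!: AE_I[of _ _ "{x}"] simp: indicator_def)
    then show ?thesis by (simp add: \<nu>_def emeasure_density)
  qed
  show total: "emeasure \<mu> UNIV = ennreal a"
    using \<mu>\<nu>[of UNIV] prob_space.emeasure_space_1[OF \<nu>1] by (simp add: \<nu>_def)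
  show fin: "finite_measure \<mu>" by (rule finite_measureI) (simp add: total \<mu>_def[symmetric], simp add: \<mu>_def total[unfolded \<mu>_def])
  let ?M = "measure_pmf (poisson_pmf0 a) \<Otimes>\<^sub>M PiM UNIV (\<lambda>_::nat. \<nu>)"
  interpret \<nu>: prob_space \<nu> by fact
  interpret Pi: product_prob_space "\<lambda>_::nat. \<nu>" UNIV ..
  interpret N: prob_space "measure_pmf (poisson_pmf0 a)" by (rule prob_space_measure_pmf)
  interpret PP: pair_prob_space "measure_pmf (poisson_pmf0 a)" "PiM UNIV (\<lambda>_::nat. \<nu>)" ..
  define R where "R \<omega> = (\<lambda>i. snd \<omega> i) ` {..<fst \<omega>}" for \<omega> :: "nat \<times> (nat \<Rightarrow> real)"
  have fm: "fst \<in> measurable ?M (count_space UNIV)"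
    by (rule measurable_compose[where g="\<lambda>n. n", OF measurable_fst]) simp
  have R: "R \<in> measurable ?M (config_space borel)"
    unfolding R_def
  proof (rule measurable_image_config)
    show "{\<omega> \<in> space ?M. i \<in> {..<fst \<omega>}} \<in> sets ?M" for i
      using measurable_sets[OF fm, of "{i<..}"] by (simp add: vimage_def Int_def conj_commute)
    show "(\<lambda>\<omega>. snd \<omega> i) \<in> measurable ?M borel" for i
      unfolding measurable_cong_sets[OF refl s\<nu>[symmetric]]
      by (rule measurable_compose[OF measurable_snd measurable_component_singleton]) simp
    show "{p \<in> space (borel \<Otimes>\<^sub>M borel :: (real \<times> real) measure). fst p = snd p} \<in> sets (borel \<Otimes>\<^sub>M borel)"
      by measurable
  qed
  show "prob_space (density lborel (\<lambda>t. ennreal (\<phi> t) * indicator {0..} t))"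
    using \<nu>1 unfolding \<nu>_def .
  show "(\<lambda>\<omega>. snd \<omega> ` {..<fst \<omega>}) \<in> measurable (measure_pmf (poisson_pmf0 a) \<Otimes>\<^sub>M
        PiM UNIV (\<lambda>_::nat. density lborel (\<lambda>t. ennreal (\<phi> t) * indicator {0..} t))) (config_space borel)"
    using R by (simp add: \<nu>_def R_def[abs_def])
  have inj': "AE \<omega> in ?M. inj (snd \<omega>)"
  proof -
    from iid_distinct[OF \<nu>1 s\<nu> at] obtain Z
      where Z: "{t \<in> space (PiM UNIV (\<lambda>_::nat. \<nu>)). \<not> inj t} \<subseteq> Z" "Z \<in> null_sets (PiM UNIV (\<lambda>_::nat. \<nu>))"
      by (auto elim!: AE_E)
    have "UNIV \<times> Z \<in> null_sets ?M"
      using Z(2) by (intro Pi.P.times_in_null_sets2) auto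
    then show ?thesis
      by (rule AE_I') (use Z(1) in \<open>auto simp: space_pair_measure\<close>)
  qed
  then show "AE \<omega> in measure_pmf (poisson_pmf0 a) \<Otimes>\<^sub>M
        PiM UNIV (\<lambda>_::nat. density lborel (\<lambda>t. ennreal (\<phi> t) * indicator {0..} t)). inj (snd \<omega>)"
    unfolding \<nu>_def .
  from inj' have inj: "AE \<omega> in ?M. inj_on (\<lambda>i. snd \<omega> i) {..<fst \<omega>}"
    by eventually_elim (auto intro: inj_on_subset)
  have "poisson_process ?M \<mu> R (\<lambda>x \<omega>. x)"
    unfolding R_def
    by (rule poisson_process_image[OF iid_poisson_process[OF \<nu>1 s\<nu> a s\<mu> \<mu>\<nu>] inj R[unfolded R_def] s\<mu>])
  from poisson_process_distr[OF this R s\<mu>]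
  have ex: "poisson_process (distr ?M (config_space borel) R) \<mu> (\<lambda>X. X) (\<lambda>x X. x)" .
  have c: "config_space \<mu> = config_space borel" unfolding config_space_def by (simp add: \<mu>_def)
  have sp: "space \<mu> = UNIV" by (simp add: \<mu>_def)
  have uniq: "Q = distr ?M (config_space borel) R"
    if "sets Q = sets (config_space \<mu>) \<and> poisson_process Q \<mu> (\<lambda>X. X) (\<lambda>x X. x)" for Q
    using that ex c by (intro config_law_eqI[OF _ _ _ _ fin sp s\<mu>]) auto
  have *: "sets (poisson_law \<mu>) = sets (config_space \<mu>) \<and> poisson_process (poisson_law \<mu>) \<mu> (\<lambda>X. X) (\<lambda>x X. x)"
    unfolding poisson_law_def
  proof (rule theI)
    show "sets (distr ?M (config_space borel) R) = sets (config_space \<mu>) \<and>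
      poisson_process (distr ?M (config_space borel) R) \<mu> (\<lambda>X. X) (\<lambda>x X. x)"
      using ex c by simp
  qed (rule uniq)
  then show ?repr
    using uniq[OF *] unfolding offspring_law_def \<mu>_def[symmetric] by (simp add: R_def[abs_def] \<nu>_def[symmetric])
  from * show "sets (offspring_law a \<phi>) = sets (config_space borel)"
    and "poisson_process (offspring_law a \<phi>) \<mu> (\<lambda>X. X) (\<lambda>x X. x)"
    unfolding offspring_law_def \<mu>_def[symmetric] c by auto
qed

section \<open>Order statistics and measurable functionals of a configuration\<close>

lemma sorted_nth_le_iff:
  fixes l :: "'a::linorder list"
  shows "sorted l \<Longrightarrow> i < length l \<Longrightarrow> l ! i \<le> c \<longleftrightarrow> i < length (filter (\<lambda>x. x \<le> c) l)"
proof (induction l arbitrary: i)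
  case (Cons x xs)
  show ?case
  proof (cases "x \<le> c")
    case True
    with Cons show ?thesis by (cases i) auto
  next
    case False
    then have *: "\<not> y \<le> c" if "y \<in> set (x # xs)" for y
      using Cons.prems that by auto
    then have "filter (\<lambda>x. x \<le> c) (x # xs) = []" by (simp add: filter_empty_conv)
    then show ?thesis using *[OF nth_mem[OF Cons.prems(2)]] by simp
  qed
qed simp

text \<open>A measurable enumeration of a finite set of points, through which sums, products and the
  sorted lists of \<open>explore\<close> become measurable functions of the configuration. Since
  \<open>card\<close> of an infinite set is 0, the default 0 also covers infinite sets.\<close>

definition order_stat :: "nat \<Rightarrow> real set \<Rightarrow> real" where
  "order_stat i X = (if i < card X then sorted_list_of_set X ! i else 0)"

lemma measurable_card_config:
  assumes "A \<in> sets S"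
  shows "(\<lambda>X. card (X \<inter> A)) \<in> measurable (config_space S) (count_space UNIV)"
proof -
  have "(\<lambda>X. case ecard (X \<inter> A) of enat n \<Rightarrow> n | \<infinity> \<Rightarrow> 0) \<in> measurable (config_space S) (count_space UNIV)"
    by (rule measurable_compose[OF measurable_config_count[OF assms]]) simp
  moreover have "(case ecard (X \<inter> A) of enat n \<Rightarrow> n | \<infinity> \<Rightarrow> 0) = card (X \<inter> A)" for X
    by (simp add: ecard_def)
  ultimately show ?thesis by simp
qed

lemma measurable_card_config_UNIV [measurable]:
  "card \<in> measurable (config_space (borel :: real measure)) (count_space UNIV)"
  using measurable_card_config[of UNIV borel] by simp

lemma order_stat_le_iff: "i < card X \<Longrightarrow> order_stat i X \<le> c \<longleftrightarrow> i < card (X \<inter> {..c})"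
proof -
  assume i: "i < card X"
  then have fin: "finite X" by (intro card_ge_0_finite) simp
  let ?l = "sorted_list_of_set X"
  have "card (X \<inter> {..c}) = card (set (filter (\<lambda>x. x \<le> c) ?l))"
    using fin by (intro arg_cong[where f=card]) auto
  also have "\<dots> = length (filter (\<lambda>x. x \<le> c) ?l)" using fin by (intro distinct_card) simp
  finally show ?thesis using sorted_nth_le_iff[of ?l i c] i fin by (simp add: order_stat_def)
qed

lemma measurable_order_stat [measurable]: "order_stat i \<in> borel_measurable (config_space borel)"
proof (rule borel_measurable_iff_le[THEN iffD2], rule allI)
  fix c :: real
  have [measurable]: "(\<lambda>X. card (X \<inter> {..c})) \<in> measurable (config_space borel) (count_space UNIV)"
    by (rule measurable_card_config) simp
  have "{X \<in> space (config_space borel). order_stat i X \<le> c} =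
    {X \<in> space (config_space borel). (i < card X \<and> i < card (X \<inter> {..c})) \<or> (\<not> i < card X \<and> 0 \<le> c)}"
    using order_stat_le_iff[of i _ c] by (auto simp: order_stat_def)
  also have "\<dots> \<in> sets (config_space borel)" by measurable
  finally show "{X \<in> space (config_space borel). order_stat i X \<le> c} \<in> sets (config_space borel)" .
qed

lemma bij_order_stat: "finite X \<Longrightarrow> bij_betw (\<lambda>i. order_stat i X) {..<card X} X"
proof -
  assume X: "finite X"
  have "bij_betw ((!) (sorted_list_of_set X)) {..<card X} X"
    using bij_betw_nth[of "sorted_list_of_set X" "{..<card X}" X] X by simp
  then show ?thesis by (rule bij_betw_cong[THEN iffD1, rotated]) (simp add: order_stat_def)
qed

lemma prod_order_stat: "(\<Prod>x\<in>X. u x) = (\<Prod>i<card X. u (order_stat i X))"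
  by (cases "finite X") (simp_all add: prod.reindex_bij_betw[OF bij_order_stat])

lemma sum_order_stat: "(\<Sum>x\<in>X. u x) = (\<Sum>i<card X. u (order_stat i X))"
  by (cases "finite X") (simp_all add: sum.reindex_bij_betw[OF bij_order_stat])

lemma measurable_config_prod:
  fixes u :: "real \<Rightarrow> ennreal"
  assumes [measurable]: "u \<in> borel_measurable borel"
  shows "(\<lambda>X. \<Prod>x\<in>X. u x) \<in> borel_measurable (config_space borel)"
  unfolding prod_order_stat
  by (rule measurable_compose_countable[where f="\<lambda>n X. \<Prod>i<n. u (order_stat i X)" and g=card]) measurable

lemma measurable_config_sum [measurable]:
  "(\<lambda>X. \<Sum>x\<in>X. x) \<in> borel_measurable (config_space (borel :: real measure))"
  unfolding sum_order_stat
  by (rule measurable_compose_countable[where f="\<lambda>n X. \<Sum>i<n. order_stat i X" and g=card]) measurable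

section \<open>Integrals under the offspring law\<close>

lemma poisson_pmf0_nn_integral:
  assumes "0 \<le> a"
  shows "(\<integral>\<^sup>+n. f n \<partial>measure_pmf (poisson_pmf0 a)) = (\<Sum>n. ennreal (a ^ n / fact n * exp (- a)) * f n)"
  by (simp add: nn_integral_measure_pmf nn_integral_count_space_nat pmf_poisson_pmf0[OF assms])

lemma offspring_nn_integral:
  fixes H :: "real set \<Rightarrow> ennreal"
  assumes \<phi>: "is_density \<phi>" and a: "0 \<le> a" and H: "H \<in> borel_measurable (config_space borel)"
  shows "(\<integral>\<^sup>+X. H X \<partial>offspring_law a \<phi>) = (\<Sum>n. ennreal (a ^ n / fact n * exp (- a)) *
    (\<integral>\<^sup>+t. H (t ` {..<n}) \<partial>PiM UNIV (\<lambda>_::nat. density lborel (\<lambda>t. ennreal (\<phi> t) * indicator {0..} t))))"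
proof -
  note L = offspring_law[OF \<phi> a]
  define \<nu> where "\<nu> = density lborel (\<lambda>t. ennreal (\<phi> t) * indicator {0..} t)"
  interpret \<nu>: prob_space \<nu> unfolding \<nu>_def by (rule L)
  interpret Pi: product_prob_space "\<lambda>_::nat. \<nu>" UNIV ..
  have "(\<integral>\<^sup>+X. H X \<partial>offspring_law a \<phi>) =
    (\<integral>\<^sup>+\<omega>. H (snd \<omega> ` {..<fst \<omega>}) \<partial>(measure_pmf (poisson_pmf0 a) \<Otimes>\<^sub>M PiM UNIV (\<lambda>_::nat. \<nu>)))"
    unfolding L(5) \<nu>_def by (rule nn_integral_distr[OF L(6)]) (use H in simp)
  also have "\<dots> = (\<integral>\<^sup>+n. \<integral>\<^sup>+t. H (t ` {..<n}) \<partial>PiM UNIV (\<lambda>_::nat. \<nu>) \<partial>measure_pmf (poisson_pmf0 a))"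
    using Pi.P.nn_integral_fst[of "\<lambda>\<omega>. H (snd \<omega> ` {..<fst \<omega>})" "measure_pmf (poisson_pmf0 a)"]
      measurable_compose[OF L(6) H] by (simp add: \<nu>_def)
  finally show ?thesis unfolding \<nu>_def poisson_pmf0_nn_integral[OF a] .
qed

lemma iid_inj_AE:
  assumes \<phi>: "is_density \<phi>"
  shows "AE t in PiM UNIV (\<lambda>_::nat. density lborel (\<lambda>t. ennreal (\<phi> t) * indicator {0..} t)). inj t"
proof (rule iid_distinct)
  show "prob_space (density lborel (\<lambda>t. ennreal (\<phi> t) * indicator {0..} t))"
    using offspring_law(8)[OF \<phi>, of 0] by simp
  have [measurable]: "\<phi> \<in> borel_measurable borel" using \<phi> by (simp add: is_density_def)
  fix x
  have "(\<integral>\<^sup>+t. ennreal (\<phi> t) * indicator {0..} t * indicator {x} t \<partial>lborel) = 0"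
    by (subst nn_integral_0_iff_AE) (auto intro!: AE_I[of _ _ "{x}"] simp: indicator_def)
  then show "emeasure (density lborel (\<lambda>t. ennreal (\<phi> t) * indicator {0..} t)) {x} = 0"
    by (simp add: emeasure_density)
qed simp

text \<open>The product over the set is a product over indices because the points are almost surely
  distinct; n independent factors give an n-th power.\<close>

lemma offspring_prod:
  fixes u :: "real \<Rightarrow> ennreal"
  assumes \<phi>: "is_density \<phi>" and a: "0 \<le> a" and u[measurable]: "u \<in> borel_measurable borel"
  shows "(\<integral>\<^sup>+X. (\<Prod>x\<in>X. u x) \<partial>offspring_law a \<phi>) =
    (\<Sum>n. ennreal (a ^ n / fact n * exp (- a)) * (\<integral>\<^sup>+t\<in>{0..}. u t * ennreal (\<phi> t) \<partial>lborel) ^ n)"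
proof -
  have [measurable]: "\<phi> \<in> borel_measurable borel" using \<phi> by (simp add: is_density_def)
  define \<nu> where "\<nu> = density lborel (\<lambda>t. ennreal (\<phi> t) * indicator {0..} t)"
  interpret \<nu>: prob_space \<nu> unfolding \<nu>_def by (rule offspring_law(8)[OF \<phi> a])
  interpret Pi: product_prob_space "\<lambda>_::nat. \<nu>" UNIV ..
  have um[measurable]: "u \<in> borel_measurable \<nu>" by (simp add: \<nu>_def)
  have v: "(\<integral>\<^sup>+t. u t \<partial>\<nu>) = (\<integral>\<^sup>+t\<in>{0..}. u t * ennreal (\<phi> t) \<partial>lborel)"
    unfolding \<nu>_def by (subst nn_integral_density) (auto intro!: nn_integral_cong simp: mult_ac)
  have "(\<integral>\<^sup>+t. (\<Prod>x\<in>t ` {..<n}. u x) \<partial>PiM UNIV (\<lambda>_::nat. \<nu>)) = (\<integral>\<^sup>+t. u t \<partial>\<nu>) ^ n" for n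
  proof -
    have "(\<integral>\<^sup>+t. (\<Prod>x\<in>t ` {..<n}. u x) \<partial>PiM UNIV (\<lambda>_::nat. \<nu>)) = (\<integral>\<^sup>+t. (\<Prod>i<n. u (t i)) \<partial>PiM UNIV (\<lambda>_::nat. \<nu>))"
    proof (rule nn_integral_cong_AE)
      show "AE t in PiM UNIV (\<lambda>_::nat. \<nu>). (\<Prod>x\<in>t ` {..<n}. u x) = (\<Prod>i<n. u (t i))"
        using iid_inj_AE[OF \<phi>] unfolding \<nu>_def[symmetric]
        by eventually_elim (simp add: prod.reindex inj_on_subset)
    qed
    also have "\<dots> = (\<integral>\<^sup>+t. (\<Prod>i<n. u (t i)) \<partial>distr (PiM UNIV (\<lambda>_::nat. \<nu>)) (PiM {..<n} (\<lambda>_. \<nu>)) (\<lambda>t. restrict t {..<n}))"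
    proof -
      have m1: "(\<lambda>t. \<Prod>i<n. u (t i)) \<in> borel_measurable (PiM {..<n} (\<lambda>_. \<nu>))"
        by (intro borel_measurable_prod_ennreal) measurable
      have m2: "(\<lambda>t. restrict t {..<n}) \<in> measurable (PiM UNIV (\<lambda>_::nat. \<nu>)) (PiM {..<n} (\<lambda>_. \<nu>))"
        by (rule measurable_restrict_subset) simp
      show ?thesis using m1 by (subst nn_integral_distr[OF m2]) simp_all
    qed
    also have "\<dots> = (\<integral>\<^sup>+t. (\<Prod>i<n. u (t i)) \<partial>PiM {..<n} (\<lambda>_. \<nu>))"
      by (subst Pi.distr_PiM_restrict_finite) auto
    also have "\<dots> = (\<Prod>i<n. \<integral>\<^sup>+t. u t \<partial>\<nu>)"
      by (rule Pi.product_nn_integral_prod) auto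
    finally show ?thesis by simp
  qed
  then show ?thesis
    using offspring_nn_integral[OF \<phi> a measurable_config_prod[OF u]] by (simp add: \<nu>_def[symmetric] v)
qed

lemma exp_series_ennreal:
  assumes "0 \<le> a" "0 \<le> r"
  shows "(\<Sum>n. ennreal (a ^ n / fact n * exp (- a)) * ennreal r ^ n) = ennreal (exp (a * (r - 1)))"
proof -
  have s: "(\<lambda>n. (a ^ n / fact n * exp (- a)) * r ^ n) sums exp (- (a * (1 - r)))" by (rule poisson_sums)
  have "(\<Sum>n. ennreal (a ^ n / fact n * exp (- a)) * ennreal r ^ n) = (\<Sum>n. ennreal ((a ^ n / fact n * exp (- a)) * r ^ n))"
    using assms by (intro suminf_cong) (subst ennreal_mult, simp_all add: ennreal_power)
  also have "\<dots> = ennreal (\<Sum>n. (a ^ n / fact n * exp (- a)) * r ^ n)"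
    using assms sums_summable[OF s] by (intro suminf_ennreal2) auto
  also have "(\<Sum>n. (a ^ n / fact n * exp (- a)) * r ^ n) = exp (a * (r - 1))"
    using sums_unique[OF s] by (simp add: algebra_simps)
  finally show ?thesis .
qed

lemma offspring_prod_finite:
  fixes u :: "real \<Rightarrow> ennreal"
  assumes "is_density \<phi>" "0 \<le> a" "u \<in> borel_measurable borel" "0 \<le> r"
    "(\<integral>\<^sup>+t\<in>{0..}. u t * ennreal (\<phi> t) \<partial>lborel) = ennreal r"
  shows "(\<integral>\<^sup>+X. (\<Prod>x\<in>X. u x) \<partial>offspring_law a \<phi>) = ennreal (exp (a * (r - 1)))"
  unfolding offspring_prod[OF assms(1-3)] assms(5) by (rule exp_series_ennreal[OF assms(2,4)])

text \<open>The term with a single child is already infinite, as a > 0.\<close>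

lemma offspring_prod_infinite:
  fixes u :: "real \<Rightarrow> ennreal"
  assumes "is_density \<phi>" "0 < a" "u \<in> borel_measurable borel"
    "(\<integral>\<^sup>+t\<in>{0..}. u t * ennreal (\<phi> t) \<partial>lborel) = top"
  shows "(\<integral>\<^sup>+X. (\<Prod>x\<in>X. u x) \<partial>offspring_law a \<phi>) = top"
proof -
  have "top = ennreal (a ^ 1 / fact 1 * exp (- a)) * (top :: ennreal) ^ 1"
    using assms(2) by (simp add: ennreal_mult_top)
  also have "\<dots> \<le> (\<Sum>n. ennreal (a ^ n / fact n * exp (- a)) * (top :: ennreal) ^ n)"
    using sum_le_suminf[of "\<lambda>n. ennreal (a ^ n / fact n * exp (- a)) * (top :: ennreal) ^ n" "{1}"] by simp
  finally show ?thesis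
    using offspring_prod[of \<phi> a u] assms by (simp add: top_unique)
qed

lemma poisson_mean_series:
  assumes "0 \<le> a"
  shows "(\<Sum>n. ennreal (a ^ n / fact n * exp (- a)) * of_nat n) = ennreal a"
proof -
  have "(\<Sum>n. ennreal (a ^ n / fact n * exp (- a)) * of_nat n) =
      (\<Sum>n. ennreal (a ^ Suc n / fact (Suc n) * exp (- a)) * of_nat (Suc n))"
    using suminf_offset[of "\<lambda>n. ennreal (a ^ n / fact n * exp (- a)) * of_nat n" 1] by (simp del: of_nat_Suc fact_Suc power_Suc)
  also have "\<dots> = (\<Sum>n. ennreal a * (ennreal (a ^ n / fact n * exp (- a)) * ennreal 1 ^ n))"
  proof (intro suminf_cong)
    fix n
    have "a ^ Suc n / fact (Suc n) * exp (- a) * real (Suc n) = a * (a ^ n / fact n * exp (- a))"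
      by (simp add: divide_simps)
    then show "ennreal (a ^ Suc n / fact (Suc n) * exp (- a)) * of_nat (Suc n) = ennreal a * (ennreal (a ^ n / fact n * exp (- a)) * ennreal 1 ^ n)"
      using assms by (simp add: ennreal_of_nat_eq_real_of_nat del: of_nat_Suc flip: ennreal_mult)
  qed
  also have "\<dots> = ennreal a"
    using exp_series_ennreal[OF assms, of 1] by (simp add: ennreal_suminf_cmult)
  finally show ?thesis .
qed

lemma offspring_mean:
  assumes \<phi>: "is_density \<phi>" and a: "0 \<le> a"
  shows "(\<integral>\<^sup>+X. of_nat (card X) \<partial>offspring_law a \<phi>) = ennreal a"
proof -
  let ?\<nu> = "density lborel (\<lambda>t. ennreal (\<phi> t) * indicator {0..} t)"
  interpret \<nu>: prob_space ?\<nu> by (rule offspring_law(8)[OF \<phi> a])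
  interpret Pi: product_prob_space "\<lambda>_::nat. ?\<nu>" UNIV ..
  have "(\<integral>\<^sup>+t. of_nat (card (t ` {..<n})) \<partial>PiM UNIV (\<lambda>_::nat. ?\<nu>)) = (of_nat n :: ennreal)" for n
  proof -
    have "(\<integral>\<^sup>+t. of_nat (card (t ` {..<n})) \<partial>PiM UNIV (\<lambda>_::nat. ?\<nu>)) = (\<integral>\<^sup>+t. of_nat n \<partial>PiM UNIV (\<lambda>_::nat. ?\<nu>) :: ennreal)"
    proof (rule nn_integral_cong_AE)
      show "AE t in PiM UNIV (\<lambda>_::nat. ?\<nu>). of_nat (card (t ` {..<n})) = (of_nat n :: ennreal)"
        using iid_inj_AE[OF \<phi>] by eventually_elim (simp add: card_image inj_on_subset)
    qed
    then show ?thesis by (simp add: Pi.P.emeasure_space_1)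
  qed
  then have "(\<integral>\<^sup>+X. of_nat (card X) \<partial>offspring_law a \<phi>) = (\<Sum>n. ennreal (a ^ n / fact n * exp (- a)) * of_nat n)"
    using offspring_nn_integral[OF \<phi> a, of "\<lambda>X. of_nat (card X)"] by simp
  also have "\<dots> = ennreal a" by (rule poisson_mean_series[OF a])
  finally show ?thesis .
qed

lemma offspring_prob_space: "is_density \<phi> \<Longrightarrow> 0 \<le> a \<Longrightarrow> prob_space (offspring_law a \<phi>)"
  using offspring_law(2) by (auto simp: poisson_process_def)

lemma offspring_AE:
  assumes \<phi>: "is_density \<phi>" and a: "0 \<le> a"
  shows "AE X in offspring_law a \<phi>. finite X \<and> X \<subseteq> {0..}"
proof -
  note L = offspring_law[OF \<phi> a]
  interpret prob_space "offspring_law a \<phi>" by (rule offspring_prob_space[OF \<phi> a])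
  let ?H = "\<lambda>X::real set. of_bool (ecard X = \<infinity> \<or> ecard (X \<inter> {..<0}) \<noteq> enat 0) :: ennreal"
  have [measurable]: "ecard \<in> measurable (config_space (borel :: real measure)) (count_space UNIV)"
    "(\<lambda>X. ecard (X \<inter> {..<0})) \<in> measurable (config_space (borel :: real measure)) (count_space UNIV)"
    using measurable_config_count[of UNIV "borel :: real measure"] measurable_config_count[of "{..<0}" "borel :: real measure"] by simp_all
  have [measurable]: "?H \<in> borel_measurable (config_space borel)"
    by measurable
  have Hm: "?H \<in> borel_measurable (offspring_law a \<phi>)"
    by (subst measurable_cong_sets[OF L(1) refl]) measurable
  have neg: "AE t in PiM UNIV (\<lambda>_::nat. density lborel (\<lambda>t. ennreal (\<phi> t) * indicator {0..} t)). \<forall>i. 0 \<le> t i"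
  proof -
    have [measurable]: "\<phi> \<in> borel_measurable borel" using \<phi> by (simp add: is_density_def)
    have "AE t in density lborel (\<lambda>t. ennreal (\<phi> t) * indicator {0..} t). 0 \<le> t"
      by (subst AE_density) (auto simp: indicator_def intro!: AE_I2)
    then have "AE t in PiM UNIV (\<lambda>_::nat. density lborel (\<lambda>t. ennreal (\<phi> t) * indicator {0..} t)). 0 \<le> t i" for i
      by (intro AE_PiM_component[where P="\<lambda>x. 0 \<le> x"] L(8)) auto
    then show ?thesis by (simp add: AE_all_countable)
  qed
  have "(\<integral>\<^sup>+t. ?H (t ` {..<n}) \<partial>PiM UNIV (\<lambda>_::nat. density lborel (\<lambda>t. ennreal (\<phi> t) * indicator {0..} t))) =
    (\<integral>\<^sup>+t. 0 \<partial>PiM UNIV (\<lambda>_::nat. density lborel (\<lambda>t. ennreal (\<phi> t) * indicator {0..} t)))" for n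
  proof (rule nn_integral_cong_AE)
    show "AE t in PiM UNIV (\<lambda>_::nat. density lborel (\<lambda>t. ennreal (\<phi> t) * indicator {0..} t)). ?H (t ` {..<n}) = 0"
      using neg
    proof eventually_elim
      case (elim t)
      then have "t ` {..<n} \<inter> {..<0} = {}" by (metis (mono_tags, lifting) disjoint_iff image_iff lessThan_iff not_less)
      then show ?case by (simp add: ecard_def)
    qed
  qed
  then have "(\<integral>\<^sup>+X. ?H X \<partial>offspring_law a \<phi>) = 0"
    using offspring_nn_integral[OF \<phi> a, of ?H] by simp
  then have "AE X in offspring_law a \<phi>. ?H X = 0"
    by (subst (asm) nn_integral_0_iff_AE) (simp_all add: Hm)
  then show ?thesis
  proof eventually_elim
    case (elim X)
    then have "ecard X \<noteq> \<infinity>" "ecard (X \<inter> {..<0}) = enat 0" by auto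
    then have "finite X" "X \<inter> {..<0} = {}"
      by (auto simp: ecard_def ecard_eq_enat simp del: enat_0_iff split: if_splits)
    then show ?case by (auto simp: not_less)
  qed
qed

text \<open>Likelihood ratio of two Poisson processes. Under the reweighted law the expectation of a
  product of g over the points is again exponential in the integral of g, now with intensity a
  \<phi>; \<open>poisson_processI\<close> and uniqueness then identify this law.\<close>

lemma offspring_density:
  fixes k :: "real \<Rightarrow> real"
  assumes \<phi>: "is_density \<phi>" "is_density \<phi>'" and a: "0 \<le> a" "0 \<le> a'"
    and k[measurable]: "k \<in> borel_measurable borel" and k0: "\<And>t. 0 \<le> k t"
    and eq: "\<And>t. 0 \<le> t \<Longrightarrow> a * \<phi> t = k t * (a' * \<phi>' t)"
  shows "offspring_law a \<phi> = density (offspring_law a' \<phi>') (\<lambda>X. ennreal (exp (a' - a)) * (\<Prod>x\<in>X. ennreal (k x)))"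
    (is "_ = ?Q")
proof -
  note L = offspring_law[OF \<phi>(1) a(1)] and L' = offspring_law[OF \<phi>(2) a(2)]
  have [measurable]: "\<phi> \<in> borel_measurable borel" "\<phi>' \<in> borel_measurable borel" using \<phi> by (simp_all add: is_density_def)
  define \<mu> where "\<mu> = density lborel (\<lambda>t. ennreal (a * \<phi> t) * indicator {0..} t)"
  have sQ: "sets ?Q = sets (config_space borel)" using L'(1) by simp
  let ?r = "\<lambda>X. ennreal (exp (a' - a)) * (\<Prod>x\<in>X. ennreal (k x))"
  have rm: "?r \<in> borel_measurable (config_space borel)"
    by (intro borel_measurable_times_ennreal measurable_config_prod) measurable
  have mQ: "(\<integral>\<^sup>+X. H X \<partial>?Q) = (\<integral>\<^sup>+X. ?r X * H X \<partial>offspring_law a' \<phi>')"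
    if "H \<in> borel_measurable (config_space borel)" for H
    using that rm measurable_cong_sets[OF L'(1) refl] by (intro nn_integral_density) auto
  have key: "(\<integral>\<^sup>+X. (\<Prod>x\<in>X. ennreal (g x)) \<partial>?Q) = ennreal (exp (- (a - r)))"
    if [measurable]: "g \<in> borel_measurable borel" and g0: "\<And>t. 0 \<le> g t" and r0: "0 \<le> r"
      and r: "(\<integral>\<^sup>+t. ennreal (g t) \<partial>\<mu>) = ennreal r" for g r
  proof -
    have "(\<integral>\<^sup>+X. (\<Prod>x\<in>X. ennreal (g x)) \<partial>?Q) = (\<integral>\<^sup>+X. ennreal (exp (a' - a)) * (\<Prod>x\<in>X. ennreal (k x * g x)) \<partial>offspring_law a' \<phi>')"
      by (subst mQ) (auto intro!: measurable_config_prod simp: mult.assoc ennreal_mult g0 k0 prod.distrib)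
    also have "\<dots> = ennreal (exp (a' - a)) * (\<integral>\<^sup>+X. (\<Prod>x\<in>X. ennreal (k x * g x)) \<partial>offspring_law a' \<phi>')"
      by (rule nn_integral_cmult) (use measurable_cong_sets[OF L'(1) refl] measurable_config_prod[of "\<lambda>x. ennreal (k x * g x)"] in auto)
    finally have *: "(\<integral>\<^sup>+X. (\<Prod>x\<in>X. ennreal (g x)) \<partial>?Q) =
      ennreal (exp (a' - a)) * (\<integral>\<^sup>+X. (\<Prod>x\<in>X. ennreal (k x * g x)) \<partial>offspring_law a' \<phi>')" .
    define v where "v = (\<integral>\<^sup>+t\<in>{0..}. ennreal (k t * g t) * ennreal (\<phi>' t) \<partial>lborel)"
    have av: "ennreal a' * v = ennreal r"
    proof -
      have "ennreal a' * v = (\<integral>\<^sup>+t. ennreal a' * (ennreal (k t * g t) * ennreal (\<phi>' t) * indicator {0..} t) \<partial>lborel)"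
        unfolding v_def by (rule nn_integral_cmult[symmetric]) measurable
      also have "\<dots> = (\<integral>\<^sup>+t. ennreal (a * \<phi> t) * indicator {0..} t * ennreal (g t) \<partial>lborel)"
      proof (rule nn_integral_cong)
        fix t
        show "ennreal a' * (ennreal (k t * g t) * ennreal (\<phi>' t) * indicator {0..} t) = ennreal (a * \<phi> t) * indicator {0..} t * ennreal (g t)"
        proof (cases "0 \<le> t")
          case True
          then have "0 \<le> \<phi>' t" using \<phi>(2) by (simp add: is_density_def)
          then show ?thesis using True eq[OF True] a(2) k0[of t] g0[of t]
            by (simp add: ennreal_mult mult_ac)
        qed simp
      qed
      also have "\<dots> = (\<integral>\<^sup>+t. ennreal (g t) \<partial>\<mu>)" unfolding \<mu>_def by (simp add: nn_integral_density)
      finally show ?thesis using r by simp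
    qed
    \<comment> \<open>If a' = 0, the equation a' v = r forces r = 0 but leaves v free, even
      infinite. Only the term without points remains then, and the expectation is 1.\<close>
    show ?thesis
    proof (cases "a' = 0")
      case True
      then have "r = 0" using av r0 by simp
      have "(\<integral>\<^sup>+X. (\<Prod>x\<in>X. ennreal (k x * g x)) \<partial>offspring_law a' \<phi>') = 1"
        by (subst offspring_prod[OF \<phi>(2) a(2)], measurable)
           (subst suminf_finite[of "{0}"], auto simp: True power_0_left)
      then show ?thesis using * True \<open>r = 0\<close> by simp
    next
      case False
      then have "v \<noteq> top" using av a(2) by (auto simp: ennreal_mult_top)
      then obtain w where w: "v = ennreal w" "0 \<le> w" by (cases v) auto
      then have "a' * w = r" using av a(2) r0 by (simp flip: ennreal_mult)
      then show ?thesis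
        using * offspring_prod_finite[OF \<phi>(2) a(2) _ w(2), of "\<lambda>t. ennreal (k t * g t)"] w(1)
        by (simp add: v_def algebra_simps flip: exp_add ennreal_mult)
    qed
  qed
  have total: "emeasure \<mu> UNIV = ennreal a" using L(4) by (simp add: \<mu>_def)
  have fin: "finite_measure \<mu>" using L(3) by (simp add: \<mu>_def)
  have "(\<integral>\<^sup>+X. (\<Prod>x\<in>X. ennreal 1) \<partial>?Q) = ennreal (exp (- (a - a)))"
    by (rule key) (use a total in \<open>auto simp: \<mu>_def\<close>)
  \<comment> \<open>The constant g = 1 has r = a, which makes the total mass 1.\<close>
  then have "emeasure ?Q (space ?Q) = 1" by simp
  then have prQ: "prob_space ?Q" by (rule prob_spaceI)
  have "poisson_process ?Q \<mu> (\<lambda>X. X) (\<lambda>x X. x)"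
  proof (rule poisson_processI[OF prQ])
    have e: "{i \<in> X. i \<in> A} = X \<inter> A" for X A :: "real set" by auto
    show m: "(\<lambda>X. ecard {i \<in> X. i \<in> A}) \<in> measurable ?Q (count_space UNIV)" if "A \<in> sets \<mu>" for A
      unfolding e measurable_cong_sets[OF sQ refl] using that by (intro measurable_config_count) (simp add: \<mu>_def)
    fix J :: "nat set" and A x
    assume J: "finite J" "disjoint_family_on A J" and A: "\<And>j. j \<in> J \<Longrightarrow> A j \<in> sets \<mu> \<and> emeasure \<mu> (A j) < \<infinity>"
      and x: "\<And>j. j \<in> J \<Longrightarrow> 0 < x j \<and> x j < (1::real)"
    have A': "A j \<in> sets borel" if "j \<in> J" for j using A[OF that] by (simp add: \<mu>_def)
    interpret \<mu>: finite_measure \<mu> by fact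
    define g where "g y = (\<Prod>j\<in>J. if y \<in> A j then x j else 1)" for y
    have gm[measurable]: "g \<in> borel_measurable borel"
      unfolding g_def using A' by (intro borel_measurable_prod measurable_If_set) auto
    have g0: "0 \<le> g y" for y unfolding g_def using x by (auto intro!: prod_nonneg simp: less_imp_le)
    have g_eq: "ennreal (g y) + (\<Sum>j\<in>J. ennreal (1 - x j) * indicator (A j) y) = 1" for y
    proof (cases "\<exists>i\<in>J. y \<in> A i")
      case True
      then obtain i where i: "i \<in> J" "y \<in> A i" by auto
      have ne: "y \<in> A j \<longleftrightarrow> j = i" if "j \<in> J" for j
        using J(2) i that by (auto simp: disjoint_family_on_def)
      have "g y = (\<Prod>j\<in>J. if j = i then x j else 1)" unfolding g_def using ne by (intro prod.cong) auto
      moreover have "(\<Sum>j\<in>J. ennreal (1 - x j) * indicator (A j) y) = (\<Sum>j\<in>J. if j = i then ennreal (1 - x j) else 0)"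
        using ne by (intro sum.cong) (auto simp: indicator_def)
      ultimately show ?thesis using J(1) i(1) x[OF i(1)] by (simp add: prod.delta sum.delta flip: ennreal_plus)
    next
      case False
      then have "g y = 1" unfolding g_def by (intro prod.neutral) auto
      moreover have "(\<Sum>j\<in>J. ennreal (1 - x j) * indicator (A j) y) = 0" using False by (intro sum.neutral) auto
      ultimately show ?thesis by simp
    qed
    define d where "d = (\<Sum>j\<in>J. measure \<mu> (A j) * (1 - x j))"
    have d0: "0 \<le> d" unfolding d_def using x by (intro sum_nonneg mult_nonneg_nonneg) (auto simp: less_imp_le)
    have "(\<integral>\<^sup>+y. ennreal (g y) \<partial>\<mu>) + ennreal d = ennreal a"
    proof -
      have "(\<integral>\<^sup>+y. (\<Sum>j\<in>J. ennreal (1 - x j) * indicator (A j) y) \<partial>\<mu>) = (\<Sum>j\<in>J. ennreal (1 - x j) * emeasure \<mu> (A j))"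
      proof (subst nn_integral_sum)
        show "(\<lambda>y. ennreal (1 - x j) * indicator (A j) y) \<in> borel_measurable \<mu>" if "j \<in> J" for j
          by (intro borel_measurable_times_ennreal borel_measurable_const borel_measurable_indicator) (use A that in blast)
        show "(\<Sum>j\<in>J. \<integral>\<^sup>+y. ennreal (1 - x j) * indicator (A j) y \<partial>\<mu>) = (\<Sum>j\<in>J. ennreal (1 - x j) * emeasure \<mu> (A j))"
          using A by (intro sum.cong refl nn_integral_cmult_indicator) blast
      qed
      also have "\<dots> = (\<Sum>j\<in>J. ennreal (measure \<mu> (A j) * (1 - x j)))"
        using x by (intro sum.cong refl) (simp add: \<mu>.emeasure_eq_measure mult.commute less_imp_le flip: ennreal_mult)
      also have "\<dots> = ennreal d"
        unfolding d_def using x by (intro sum_ennreal) (auto simp: less_imp_le)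
      finally have "(\<integral>\<^sup>+y. ennreal (g y) \<partial>\<mu>) + ennreal d =
        (\<integral>\<^sup>+y. ennreal (g y) + (\<Sum>j\<in>J. ennreal (1 - x j) * indicator (A j) y) \<partial>\<mu>)"
      proof (subst nn_integral_add)
        show "(\<lambda>y. \<Sum>j\<in>J. ennreal (1 - x j) * indicator (A j) y) \<in> borel_measurable \<mu>"
          by (intro borel_measurable_sum borel_measurable_times_ennreal borel_measurable_const borel_measurable_indicator) (use A in blast)
      qed (simp_all add: \<mu>_def)
      then show ?thesis by (simp add: g_eq total) (simp add: \<mu>_def total[unfolded \<mu>_def])
    qed
    moreover from this have "(\<integral>\<^sup>+y. ennreal (g y) \<partial>\<mu>) \<noteq> top" by auto
    ultimately obtain r where r: "(\<integral>\<^sup>+y. ennreal (g y) \<partial>\<mu>) = ennreal r" "0 \<le> r" "r + d = a"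
      using d0 a(1) by (cases "\<integral>\<^sup>+y. ennreal (g y) \<partial>\<mu>") (auto simp flip: ennreal_plus)
    have 1: "(\<integral>\<^sup>+X. (\<Prod>x\<in>X. ennreal (g x)) \<partial>?Q) = ennreal (exp (- d))"
      using key[OF gm g0 r(2,1)] r(3) by (simp add: algebra_simps)
    \<comment> \<open>Finiteness of X matters: a product over an infinite set defaults to 1, whereas
      \<open>epow\<close> gives 0 for an infinite count.\<close>
    have 2: "AE X in ?Q. (\<Prod>x\<in>X. ennreal (g x)) = ennreal (\<Prod>j\<in>J. epow (x j) (ecard {i \<in> X. i \<in> A j}))"
    proof -
      have "AE X in ?Q. finite X"
        using offspring_AE[OF \<phi>(2) a(2)] rm measurable_cong_sets[OF L'(1) refl, of borel]
        by (subst AE_density) (auto elim: eventually_mono)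
      then show ?thesis
      proof eventually_elim
        case (elim X)
        have "(\<Prod>y\<in>X. if y \<in> A j then x j else 1) = epow (x j) (ecard {i \<in> X. i \<in> A j})" for j
          using prod.inter_filter[OF elim, of "\<lambda>_. x j" "\<lambda>y. y \<in> A j"] elim by (simp add: ecard_def)
        then have "(\<Prod>y\<in>X. g y) = (\<Prod>j\<in>J. epow (x j) (ecard {i \<in> X. i \<in> A j}))"
          unfolding g_def by (subst prod.swap) simp
        then show ?case using prod_ennreal[of X g] g0 by simp
      qed
    qed
    have b: "0 \<le> (\<Prod>j\<in>J. epow (x j) (N j)) \<and> (\<Prod>j\<in>J. epow (x j) (N j)) \<le> 1" for N
      using epow_prod_bounds[of J x N] x by blast
    interpret Q: prob_space ?Q by fact
    have "ennreal (exp (- d)) = (\<integral>\<^sup>+X. ennreal (\<Prod>j\<in>J. epow (x j) (ecard {i \<in> X. i \<in> A j})) \<partial>?Q)"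
      unfolding 1[symmetric] by (rule nn_integral_cong_AE[OF 2])
    also have "\<dots> = ennreal (\<integral>X. (\<Prod>j\<in>J. epow (x j) (ecard {i \<in> X. i \<in> A j})) \<partial>?Q)"
      by (intro nn_integral_eq_integral Q.integrable_const_bound[of _ 1] borel_measurable_prod measurable_compose[OF m])
         (use b A in auto)
    finally have "(\<integral>X. (\<Prod>j\<in>J. epow (x j) (ecard {i \<in> X. i \<in> A j})) \<partial>?Q) = exp (- d)"
      using b by (subst (asm) ennreal_inj) (auto intro!: Bochner_Integration.integral_nonneg)
    then show "(\<integral>X. (\<Prod>j\<in>J. epow (x j) (ecard {i \<in> X. i \<in> A j})) \<partial>?Q) = (\<Prod>j\<in>J. exp (- (measure \<mu> (A j) * (1 - x j))))"
      using J(1) by (simp add: d_def exp_sum flip: sum_negf)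
  qed
  then show ?thesis
    using L(1,2) sQ by (intro config_law_eqI[OF _ _ _ _ fin]) (auto simp: \<mu>_def)
qed

section \<open>Clusters as measurable lists\<close>

lemma in_listset_iff: "xs \<in> listset As \<longleftrightarrow> length xs = length As \<and> (\<forall>i<length As. xs ! i \<in> As ! i)"
proof (induction As arbitrary: xs)
  case (Cons A As)
  show ?case
  proof (cases xs)
    case (Cons y ys)
    have "(\<forall>i<Suc n. P i) \<longleftrightarrow> P 0 \<and> (\<forall>i<n. P (Suc i))" for n P
      by (metis less_Suc_eq_0_disj not_less_eq)
    then show ?thesis using Cons.IH[of ys] Cons by (auto simp: set_Cons_def)
  qed (simp add: set_Cons_def)
qed simp

lemma in_lists_iff_nth: "xs \<in> lists A \<longleftrightarrow> (\<forall>i<length xs. xs ! i \<in> A)"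
  by (simp add: in_lists_conv_set all_set_conv_all_nth)

lemma listset_subset: "listset ` lists (sets S) \<subseteq> Pow (lists (space S))"
proof (intro subsetI PowI)
  fix Y xs assume "Y \<in> listset ` lists (sets S)" "xs \<in> Y"
  then obtain As where As: "As \<in> lists (sets S)" "xs \<in> listset As" by auto
  have "xs ! i \<in> space S" if "i < length xs" for i
  proof -
    have "xs ! i \<in> As ! i" "As ! i \<in> sets S" using that As by (auto simp: in_listset_iff in_lists_iff_nth)
    then show ?thesis using sets.sets_into_space by blast
  qed
  then show "xs \<in> lists (space S)" by (simp add: in_lists_iff_nth)
qed

lemma space_list_space: "space (list_space S) = lists (space S)"
  unfolding list_space_def by (rule space_measure_of[OF listset_subset])

lemma sets_list_space: "sets (list_space S) = sigma_sets (lists (space S)) (listset ` lists (sets S))"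
  unfolding list_space_def by (rule sets_measure_of[OF listset_subset])

lemma measurable_list_spaceI:
  assumes sp: "\<And>\<omega>. \<omega> \<in> space M \<Longrightarrow> h \<omega> \<in> lists (space S)"
    and len: "(\<lambda>\<omega>. length (h \<omega>)) \<in> measurable M (count_space UNIV)"
    and nth: "\<And>i A. A \<in> sets S \<Longrightarrow> {\<omega> \<in> space M. i < length (h \<omega>) \<and> h \<omega> ! i \<in> A} \<in> sets M"
  shows "h \<in> measurable M (list_space S)"
  unfolding list_space_def
proof (rule measurable_measure_of[OF listset_subset])
  fix y assume "y \<in> listset ` lists (sets S)"
  then obtain As where As: "y = listset As" "As \<in> lists (sets S)" by auto
  have "h -` y \<inter> space M = {\<omega> \<in> space M. length (h \<omega>) = length As} \<inter>
    {\<omega> \<in> space M. \<forall>i\<in>{..<length As}. i < length (h \<omega>) \<and> h \<omega> ! i \<in> As ! i}"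
    by (auto simp: As in_listset_iff)
  also have "\<dots> \<in> sets M"
  proof (rule sets.Int)
    show "{\<omega> \<in> space M. length (h \<omega>) = length As} \<in> sets M"
      using measurable_sets[OF len, of "{length As}"] by (simp add: vimage_def Int_def conj_commute)
    show "{\<omega> \<in> space M. \<forall>i\<in>{..<length As}. i < length (h \<omega>) \<and> h \<omega> ! i \<in> As ! i} \<in> sets M"
      by (rule sets.sets_Collect_finite_All) (use As(2) nth in \<open>auto simp: in_lists_conv_set\<close>)
  qed
  finally show "h -` y \<inter> space M \<in> sets M" .
qed (use sp in auto)

lemma measurable_length [measurable]: "length \<in> measurable (list_space S) (count_space UNIV)"
proof (subst measurable_count_space_eq2_countable, simp, safe)
  fix n
  have "length -` {n} \<inter> space (list_space S) = listset (replicate n (space S))"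
    unfolding space_list_space set_eq_iff Int_iff in_listset_iff in_lists_iff_nth by auto
  also have "\<dots> \<in> sets (list_space S)"
    unfolding sets_list_space by (rule sigma_sets.Basic) (auto simp: in_lists_conv_set)
  finally show "length -` {n} \<inter> space (list_space S) \<in> sets (list_space S)" .
qed

lemma sets_list_nth:
  assumes A: "A \<in> sets S"
  shows "{xs \<in> space (list_space S). i < length xs \<and> xs ! i \<in> A} \<in> sets (list_space S)"
proof -
  have "{xs \<in> space (list_space S). i < length xs \<and> xs ! i \<in> A} = (\<Union>n\<in>{i<..}. listset ((replicate n (space S))[i := A]))"
  proof (intro equalityI subsetI)
    fix xs assume "xs \<in> {xs \<in> space (list_space S). i < length xs \<and> xs ! i \<in> A}"
    then have "xs \<in> listset ((replicate (length xs) (space S))[i := A])" "i < length xs"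
      by (simp_all add: space_list_space in_listset_iff in_lists_iff_nth nth_list_update)
    then show "xs \<in> (\<Union>n\<in>{i<..}. listset ((replicate n (space S))[i := A]))" by blast
  next
    fix xs assume "xs \<in> (\<Union>n\<in>{i<..}. listset ((replicate n (space S))[i := A]))"
    then have xs: "i < length xs" "\<And>j. j < length xs \<Longrightarrow> xs ! j \<in> (if j = i then A else space S)"
      by (auto simp: in_listset_iff nth_list_update)
    have "xs ! j \<in> space S" if "j < length xs" for j
      using xs(2)[OF that] sets.sets_into_space[OF A] by (auto split: if_splits)
    then show "xs \<in> {xs \<in> space (list_space S). i < length xs \<and> xs ! i \<in> A}"
      using xs(1) xs(2)[of i] by (simp add: space_list_space in_lists_iff_nth)
  qed
  also have "\<dots> \<in> sets (list_space S)"
  proof (rule sets.countable_UN'')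
    fix n assume "n \<in> {i<..}"
    then have "(replicate n (space S))[i := A] \<in> lists (sets S)"
      using A by (auto simp: in_lists_iff_nth nth_list_update)
    then show "listset ((replicate n (space S))[i := A]) \<in> sets (list_space S)"
      unfolding sets_list_space by (intro sigma_sets.Basic) auto
  qed simp
  finally show ?thesis .
qed

text \<open>Beyond the end of a list the value of \<open>!\<close> depends only on the overshoot, so
  a coordinate is a measurable function on all lists and not just on the long ones.\<close>

lemma nth_beyond: "length xs \<le> i \<Longrightarrow> xs ! i = [] ! (i - length xs)"
proof (induction xs arbitrary: i)
  case (Cons x xs)
  then show ?case by (cases i) auto
qed simp

lemma measurable_list_nth:
  assumes S: "space S = UNIV"
  shows "(\<lambda>xs. xs ! i) \<in> measurable (list_space S) S"
proof (rule measurableI)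
  fix A assume A: "A \<in> sets S"
  have "(\<lambda>xs. xs ! i) -` A \<inter> space (list_space S) = {xs \<in> space (list_space S). i < length xs \<and> xs ! i \<in> A} \<union>
    (length -` {n. n \<le> i \<and> [] ! (i - n) \<in> A} \<inter> space (list_space S))"
  proof (rule set_eqI)
    fix xs
    show "xs \<in> (\<lambda>xs. xs ! i) -` A \<inter> space (list_space S) \<longleftrightarrow>
      xs \<in> {xs \<in> space (list_space S). i < length xs \<and> xs ! i \<in> A} \<union>
        (length -` {n. n \<le> i \<and> [] ! (i - n) \<in> A} \<inter> space (list_space S))"
      by (cases "i < length xs") (auto simp add: nth_beyond[of xs i])
  qed
  also have "\<dots> \<in> sets (list_space S)"
    using sets_list_nth[OF A] measurable_sets[OF measurable_length] by (intro sets.Un) auto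
  finally show "(\<lambda>xs. xs ! i) -` A \<inter> space (list_space S) \<in> sets (list_space S)" .
qed (simp add: S)

lemma space_cluster_space [simp]: "space cluster_space = UNIV"
  by (simp add: cluster_space_def space_list_space space_pair_measure)

lemma measurable_cluster_length' [measurable]: "length \<in> measurable cluster_space (count_space UNIV)"
  unfolding cluster_space_def by (rule measurable_length)

lemma measurable_cluster_nth [measurable]:
  "(\<lambda>C. C ! i) \<in> measurable cluster_space (borel \<Otimes>\<^sub>M count_space UNIV)"
  unfolding cluster_space_def by (rule measurable_list_nth) (simp add: space_pair_measure)

lemma measurable_event_time [measurable]: "(\<lambda>C. event_time C k) \<in> borel_measurable cluster_space"
  unfolding event_time_def by measurable

lemma measurable_event_parent [measurable]: "(\<lambda>C. event_parent C k) \<in> measurable cluster_space (count_space UNIV)"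
  unfolding event_parent_def by measurable

lemma measurable_arrival_time [measurable]: "arrival_time \<in> borel_measurable cluster_space"
  unfolding arrival_time_def[abs_def] by measurable

lemma measurable_birth_time [measurable]: "(\<lambda>C. birth_time C k) \<in> borel_measurable cluster_space"
  unfolding birth_time_def
  by (intro borel_measurable_diff measurable_event_time
      measurable_compose_countable[OF measurable_event_time measurable_event_parent])

lemma measurable_total_birth_time [measurable]: "total_birth_time \<in> borel_measurable cluster_space"
  unfolding total_birth_time_def[abs_def]
  by (rule measurable_compose_countable[where f="\<lambda>n C. \<Sum>k=2..n. birth_time C k" and g=length, OF _ measurable_cluster_length']) measurable

lemma measurable_departure_time [measurable]: "departure_time \<in> borel_measurable cluster_space"
  unfolding departure_time_def[abs_def]
proof (rule measurable_compose_countable[where f="\<lambda>n C. Max (event_time C ` {1..n})" and g=length])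
  show "(\<lambda>C. Max (event_time C ` {1..n})) \<in> borel_measurable cluster_space" for n
    by (cases "n = 0") (auto intro!: borel_measurable_Max)
qed (rule measurable_cluster_length')

lemma measurable_cluster_length [measurable]: "cluster_length \<in> borel_measurable cluster_space"
  unfolding cluster_length_def[abs_def] by measurable

lemma measurable_cluster_size [measurable]: "cluster_size \<in> borel_measurable cluster_space"
proof -
  have "(\<lambda>C. (\<lambda>n. if n = 0 then \<infinity> else of_nat n :: ennreal) (length C)) \<in> borel_measurable cluster_space"
    by (rule measurable_compose[OF measurable_cluster_length']) simp
  moreover have "(\<lambda>C. (\<lambda>n. if n = 0 then \<infinity> else of_nat n :: ennreal) (length C)) = cluster_size"
    by (auto simp: cluster_size_def)
  ultimately show ?thesis by simp
qed

text \<open>This is the diagonal condition of \<open>measurable_image_config\<close> for clusters: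
  equality of lists is equality of lengths and of countably many entries.\<close>

lemma cluster_space_diag:
  "{p \<in> space (cluster_space \<Otimes>\<^sub>M cluster_space). fst p = snd p} \<in> sets (cluster_space \<Otimes>\<^sub>M cluster_space)"
proof -
  have f: "(\<lambda>C. fst (C ! i)) \<in> borel_measurable cluster_space"
    and s: "(\<lambda>C. snd (C ! i)) \<in> measurable cluster_space (count_space UNIV)" for i by measurable
  note [measurable] = measurable_compose[OF measurable_fst f] measurable_compose[OF measurable_snd f]
    measurable_compose[OF measurable_fst s] measurable_compose[OF measurable_snd s]
    measurable_compose[OF measurable_fst measurable_cluster_length'] measurable_compose[OF measurable_snd measurable_cluster_length']
  have "{p \<in> space (cluster_space \<Otimes>\<^sub>M cluster_space). fst p = snd p} =
    {p \<in> space (cluster_space \<Otimes>\<^sub>M cluster_space). length (fst p) = length (snd p) \<and>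
      (\<forall>i. fst (fst p ! i) = fst (snd p ! i) \<and> snd (fst p ! i) = snd (snd p ! i) \<or> \<not> i < length (fst p))}"
    by (auto simp: list_eq_iff_nth_eq prod_eq_iff)
  also have "\<dots> \<in> sets (cluster_space \<Otimes>\<^sub>M cluster_space)"
  proof -
    let ?P = "cluster_space \<Otimes>\<^sub>M cluster_space"
    \<comment> \<open>Equality of two naturals is tested by their integer difference being
      0.\<close>
    have 1: "Measurable.pred ?P (\<lambda>p. length (fst p) = length (snd p))"
      by (rule pred_count_space_const1[where f="\<lambda>p. int (length (fst p)) - int (length (snd p))" and c=0, simplified]) measurable
    have 2: "Measurable.pred ?P (\<lambda>p. fst (fst p ! i) = fst (snd p ! i))" for i by measurable
    have 3: "Measurable.pred ?P (\<lambda>p. snd (fst p ! i) = snd (snd p ! i))" for i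
      by (rule pred_count_space_const1[where f="\<lambda>p. int (snd (fst p ! i)) - int (snd (snd p ! i))" and c=0, simplified]) measurable
    have 4: "Measurable.pred ?P (\<lambda>p. \<not> i < length (fst p))" for i by measurable
    have "Measurable.pred ?P (\<lambda>p. length (fst p) = length (snd p) \<and>
      (\<forall>i. fst (fst p ! i) = fst (snd p ! i) \<and> snd (fst p ! i) = snd (snd p ! i) \<or> \<not> i < length (fst p)))"
      by (intro pred_intros_logic pred_intros_countable 1 2 3 4)
    then show ?thesis by (rule predE)
  qed
  finally show ?thesis .
qed

lemma measurable_cluster_spaceI:
  assumes len: "(\<lambda>\<omega>. length (h \<omega>)) \<in> measurable M (count_space UNIV)"
    and nth: "\<And>i A. A \<in> sets (borel \<Otimes>\<^sub>M count_space UNIV) \<Longrightarrow> {\<omega> \<in> space M. i < length (h \<omega>) \<and> h \<omega> ! i \<in> A} \<in> sets M"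
  shows "h \<in> measurable M cluster_space"
  unfolding cluster_space_def
  by (rule measurable_list_spaceI) (use assms in \<open>auto simp: space_pair_measure in_lists_conv_set\<close>)

lemma measurable_cluster_append:
  assumes f[measurable]: "f \<in> measurable M cluster_space" and g[measurable]: "g \<in> measurable M cluster_space"
  shows "(\<lambda>\<omega>. f \<omega> @ g \<omega>) \<in> measurable M cluster_space"
proof (rule measurable_cluster_spaceI)
  have [measurable]: "(\<lambda>\<omega>. length (f \<omega>)) \<in> measurable M (count_space UNIV)" "(\<lambda>\<omega>. length (g \<omega>)) \<in> measurable M (count_space UNIV)"
    by measurable
  show "(\<lambda>\<omega>. length (f \<omega> @ g \<omega>)) \<in> measurable M (count_space UNIV)"
    by (simp only: length_append) measurable
  note len = this
  fix i and A :: "(real \<times> nat) set" assume A[measurable]: "A \<in> sets (borel \<Otimes>\<^sub>M count_space UNIV)"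
  have g2: "(\<lambda>\<omega>. g \<omega> ! (i - length (f \<omega>))) \<in> measurable M (borel \<Otimes>\<^sub>M count_space UNIV)"
    by (rule measurable_compose_countable[where f="\<lambda>n \<omega>. g \<omega> ! (i - n)" and g="\<lambda>\<omega>. length (f \<omega>)"]) measurable
  have "(\<lambda>\<omega>. (f \<omega> @ g \<omega>) ! i) \<in> measurable M (borel \<Otimes>\<^sub>M count_space UNIV)"
    unfolding nth_append by (intro measurable_If g2) measurable
  from measurable_sets[OF this A]
  have "(\<lambda>\<omega>. (f \<omega> @ g \<omega>) ! i) -` A \<inter> space M \<inter> ((\<lambda>\<omega>. length (f \<omega> @ g \<omega>)) -` {i<..} \<inter> space M) \<in> sets M"
    by (rule sets.Int[OF _ measurable_sets[OF len]]) simp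
  also have "(\<lambda>\<omega>. (f \<omega> @ g \<omega>) ! i) -` A \<inter> space M \<inter> ((\<lambda>\<omega>. length (f \<omega> @ g \<omega>)) -` {i<..} \<inter> space M) =
    {\<omega> \<in> space M. i < length (f \<omega> @ g \<omega>) \<and> (f \<omega> @ g \<omega>) ! i \<in> A}" by auto
  finally show "{\<omega> \<in> space M. i < length (f \<omega> @ g \<omega>) \<and> (f \<omega> @ g \<omega>) ! i \<in> A} \<in> sets M" .
qed

lemma nth_sorted_list_of_set: "i < card X \<Longrightarrow> sorted_list_of_set X ! i = order_stat i X"
  by (simp add: order_stat_def)

lemma measurable_cluster_children:
  assumes e[measurable]: "e \<in> borel_measurable M" and X[measurable]: "X \<in> measurable M (config_space borel)"
  shows "(\<lambda>\<omega>. map (\<lambda>x. (e \<omega> + x, m :: nat)) (sorted_list_of_set (X \<omega>))) \<in> measurable M cluster_space"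
proof (rule measurable_cluster_spaceI)
  show "(\<lambda>\<omega>. length (map (\<lambda>x. (e \<omega> + x, m)) (sorted_list_of_set (X \<omega>)))) \<in> measurable M (count_space UNIV)"
    by simp
  fix i and A :: "(real \<times> nat) set" assume A[measurable]: "A \<in> sets (borel \<Otimes>\<^sub>M count_space UNIV)"
  have "{\<omega> \<in> space M. i < length (map (\<lambda>x. (e \<omega> + x, m)) (sorted_list_of_set (X \<omega>))) \<and>
      map (\<lambda>x. (e \<omega> + x, m)) (sorted_list_of_set (X \<omega>)) ! i \<in> A} =
    {\<omega> \<in> space M. i < card (X \<omega>) \<and> (e \<omega> + order_stat i (X \<omega>), m) \<in> A}"
    by (auto simp: nth_sorted_list_of_set)
  also have "\<dots> \<in> sets M" by measurable
  finally show "{\<omega> \<in> space M. i < length (map (\<lambda>x. (e \<omega> + x, m)) (sorted_list_of_set (X \<omega>))) \<and>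
      map (\<lambda>x. (e \<omega> + x, m)) (sorted_list_of_set (X \<omega>)) ! i \<in> A} \<in> sets M" .
qed

abbreviation seq_space :: "(nat \<Rightarrow> real set) measure" where
  "seq_space \<equiv> PiM UNIV (\<lambda>_::nat. config_space borel)"

text \<open>Measurability is joint in the immigrant time and the offspring sets, because
  \<open>cluster_law\<close> has to be a kernel in the time.\<close>

lemma measurable_explore [measurable]:
  "(\<lambda>(t, G). explore t G k) \<in> measurable (borel \<Otimes>\<^sub>M seq_space) cluster_space"
proof (induction k)
  case 0
  have "(\<lambda>p. [(fst p, 0)]) \<in> measurable (borel \<Otimes>\<^sub>M seq_space) cluster_space"
  proof (rule measurable_cluster_spaceI)
    fix i and A :: "(real \<times> nat) set" assume A[measurable]: "A \<in> sets (borel \<Otimes>\<^sub>M count_space UNIV)"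
    show "{p \<in> space (borel \<Otimes>\<^sub>M seq_space). i < length [(fst p, 0)] \<and> [(fst p, 0)] ! i \<in> A} \<in> sets (borel \<Otimes>\<^sub>M seq_space)"
      by (cases i) simp_all
  qed simp
  then show ?case by (simp add: case_prod_unfold)
next
  case (Suc k)
  have E[measurable]: "(\<lambda>p. explore (fst p) (snd p) k) \<in> measurable (borel \<Otimes>\<^sub>M seq_space) cluster_space"
    using Suc by (simp add: case_prod_unfold)
  have G[measurable]: "(\<lambda>p. snd p (Suc k)) \<in> measurable (borel \<Otimes>\<^sub>M seq_space) (config_space borel)"
    by (rule measurable_compose[OF measurable_snd measurable_component_singleton]) simp
  have "(\<lambda>p. if k < length (explore (fst p) (snd p) k)
      then explore (fst p) (snd p) k @ map (\<lambda>x. (event_time (explore (fst p) (snd p) k) (Suc k) + x, Suc k)) (sorted_list_of_set (snd p (Suc k)))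
      else explore (fst p) (snd p) k) \<in> measurable (borel \<Otimes>\<^sub>M seq_space) cluster_space"
    by (intro measurable_If measurable_cluster_append measurable_cluster_children E G) measurable
  then show ?case by (simp add: case_prod_unfold Let_def)
qed

lemma measurable_grow_cluster [measurable]:
  "(\<lambda>(t, G). grow_cluster t G) \<in> measurable (borel \<Otimes>\<^sub>M seq_space) cluster_space"
proof -
  let ?P = "\<lambda>k p. length (explore (fst p) (snd p) k) \<le> k"
  have E[measurable]: "(\<lambda>p. explore (fst p) (snd p) k) \<in> measurable (borel \<Otimes>\<^sub>M seq_space) cluster_space" for k
    using measurable_explore[of k] by (simp add: case_prod_unfold)
  have P[measurable]: "Measurable.pred (borel \<Otimes>\<^sub>M seq_space) (?P k)" for k by measurable
  have L: "(\<lambda>p. LEAST k. ?P k p) \<in> measurable (borel \<Otimes>\<^sub>M seq_space) (count_space UNIV)" by measurable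
  have nil: "(\<lambda>p. []) \<in> measurable (borel \<Otimes>\<^sub>M seq_space) cluster_space" by simp
  have "(\<lambda>p. if \<exists>k. ?P k p then explore (fst p) (snd p) (LEAST k. ?P k p) else []) \<in> measurable (borel \<Otimes>\<^sub>M seq_space) cluster_space"
    by (intro measurable_If nil measurable_compose_countable[OF E L]) measurable
  then show ?thesis by (simp add: grow_cluster_def case_prod_unfold)
qed

lemma measurable_grow_cluster' [measurable]: "grow_cluster t \<in> measurable seq_space cluster_space"
  using measurable_compose[OF measurable_Pair1' measurable_grow_cluster, of t] by simp

section \<open>Deterministic properties of a single exploration\<close>

definition valid_cluster :: "real \<Rightarrow> cluster \<Rightarrow> bool" where
  "valid_cluster t C \<longleftrightarrow> C \<noteq> [] \<and> event_time C 1 = t \<and>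
     (\<forall>k\<in>{2..length C}. 1 \<le> event_parent C k \<and> event_parent C k < k)"

lemma event_time_append: "1 \<le> k \<Longrightarrow> k \<le> length C \<Longrightarrow> event_time (C @ D) k = event_time C k"
  and event_parent_append: "1 \<le> k \<Longrightarrow> k \<le> length C \<Longrightarrow> event_parent (C @ D) k = event_parent C k"
proof -
  assume "1 \<le> k" "k \<le> length C"
  then have "k - 1 < length C" by linarith
  then show "event_time (C @ D) k = event_time C k" "event_parent (C @ D) k = event_parent C k"
    by (simp_all add: event_time_def event_parent_def nth_append)
qed

lemma birth_time_append:
  assumes "valid_cluster t C" "2 \<le> k" "k \<le> length C"
  shows "birth_time (C @ D) k = birth_time C k"
proof -
  have "1 \<le> event_parent C k" "event_parent C k < k" using assms by (auto simp: valid_cluster_def)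
  then show ?thesis using assms by (simp add: birth_time_def event_time_append event_parent_append)
qed

text \<open>The queue of untreated events is nonempty before each of the first k steps. The
  condition is expressed by child counts alone, which makes the stopping time the same for all
  immigrant times and an event of a random walk.\<close>

definition alive :: "(nat \<Rightarrow> real set) \<Rightarrow> nat \<Rightarrow> bool" where
  "alive G k \<longleftrightarrow> (\<forall>j<k. j < 1 + (\<Sum>i=1..j. card (G i)))"

text \<open>While the queue is nonempty, step i treats event i and appends one event per point of G
  i, whose birth time is that point. Infinite sets fit in by default values: they append nothing,
  and sum and \<open>card\<close> over them are 0.\<close>

lemma explore_alive:
  "alive G k \<Longrightarrow> length (explore t G k) = 1 + (\<Sum>i=1..k. card (G i)) \<and> valid_cluster t (explore t G k) \<and>
    total_birth_time (explore t G k) = (\<Sum>i=1..k. \<Sum>x\<in>G i. x) \<and>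
    ((\<forall>i\<in>{1..k}. G i \<subseteq> {0..}) \<longrightarrow> (\<forall>i\<in>{2..length (explore t G k)}. 0 \<le> birth_time (explore t G k) i))"
proof (induction k)
  case 0
  then show ?case by (simp add: valid_cluster_def event_time_def total_birth_time_def)
next
  case (Suc k)
  have al: "alive G k" "k < 1 + (\<Sum>i=1..k. card (G i))" using Suc.prems by (auto simp: alive_def)
  define C where "C = explore t G k"
  define D where "D = map (\<lambda>x. (event_time C (Suc k) + x, Suc k)) (sorted_list_of_set (G (Suc k)))"
  have IH: "length C = 1 + (\<Sum>i=1..k. card (G i))" "valid_cluster t C" "total_birth_time C = (\<Sum>i=1..k. \<Sum>x\<in>G i. x)"
    "(\<forall>i\<in>{1..k}. G i \<subseteq> {0..}) \<Longrightarrow> i\<in>{2..length C} \<Longrightarrow> 0 \<le> birth_time C i" for i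
    using Suc.IH[OF al(1)] by (auto simp: C_def)
  have k: "k < length C" using al(2) IH(1) by simp
  have E: "explore t G (Suc k) = C @ D" using k by (simp add: C_def[symmetric] D_def Let_def)
  have lD: "length D = card (G (Suc k))" by (simp add: D_def)
  have pa: "event_parent (C @ D) (length C + Suc i) = Suc k"
    and et: "event_time (C @ D) (length C + Suc i) = event_time C (Suc k) + order_stat i (G (Suc k))" if "i < length D" for i
    using that by (simp_all add: event_parent_def event_time_def nth_append D_def nth_sorted_list_of_set)
  have new: "birth_time (C @ D) (length C + Suc i) = order_stat i (G (Suc k))" if "i < length D" for i
    using pa[OF that] et[OF that] k by (simp add: birth_time_def event_time_append)
  have pos: "1 \<le> length C" using IH(2) by (cases C) (auto simp: valid_cluster_def)
  have cases: "i \<in> {2..length C} \<or> (\<exists>j<length D. i = length C + Suc j)" if "i \<in> {2..length (C @ D)}" for i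
  proof (cases "i \<le> length C")
    case False
    then have "i = length C + Suc (i - length C - 1)" "i - length C - 1 < length D" using that by auto
    then show ?thesis by blast
  qed (use that in auto)
  have 1: "length (C @ D) = 1 + (\<Sum>i=1..Suc k. card (G i))" using IH(1) lD by simp
  have 2: "valid_cluster t (C @ D)"
    unfolding valid_cluster_def
  proof (intro conjI ballI)
    show "C @ D \<noteq> []" "event_time (C @ D) 1 = t" using IH(2) pos by (auto simp: valid_cluster_def event_time_append)
    fix i assume "i \<in> {2..length (C @ D)}"
    from cases[OF this] show "1 \<le> event_parent (C @ D) i" "event_parent (C @ D) i < i"
      using IH(2) pa k by (auto simp: valid_cluster_def event_parent_append)
  qed
  have "total_birth_time (C @ D) = (\<Sum>i=2..length C. birth_time (C @ D) i) + (\<Sum>i=length C + 1..length C + length D. birth_time (C @ D) i)"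
    unfolding total_birth_time_def length_append
    by (rule sum.ub_add_nat) (use pos in simp)
  also have "(\<Sum>i=2..length C. birth_time (C @ D) i) = total_birth_time C"
    unfolding total_birth_time_def by (intro sum.cong refl birth_time_append[OF IH(2)]) auto
  also have "(\<Sum>i=length C + 1..length C + length D. birth_time (C @ D) i) = (\<Sum>i<length D. birth_time (C @ D) (length C + Suc i))"
    by (rule sum.reindex_bij_witness[of _ "\<lambda>i. length C + Suc i" "\<lambda>i. i - length C - 1"]) auto
  also have "\<dots> = (\<Sum>x\<in>G (Suc k). x)" unfolding sum_order_stat lD[symmetric] by (intro sum.cong refl new) simp
  finally have 3: "total_birth_time (C @ D) = (\<Sum>i=1..Suc k. \<Sum>x\<in>G i. x)" by (simp add: IH(3))
  have 4: "0 \<le> birth_time (C @ D) i" if G0: "\<forall>i\<in>{1..Suc k}. G i \<subseteq> {0..}" and i: "i \<in> {2..length (C @ D)}" for i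
    using cases[OF i]
  proof
    assume "i \<in> {2..length C}"
    then show ?thesis using IH(4)[of i] G0 birth_time_append[OF IH(2), of i] by simp
  next
    assume "\<exists>j<length D. i = length C + Suc j"
    then obtain j where j: "j < length D" "i = length C + Suc j" by auto
    have "finite (G (Suc k))" using j(1) lD by (intro card_ge_0_finite) simp
    then have "order_stat j (G (Suc k)) \<in> G (Suc k)"
      using bij_order_stat[of "G (Suc k)"] j(1) lD by (auto simp: bij_betw_def)
    then show ?thesis using new[OF j(1)] j(2) G0 by auto
  qed
  show ?case unfolding E using 1 2 3 4 by blast
qed

text \<open>The length formula holds only up to the first step with an empty queue; afterwards
  \<open>explore\<close> ignores G while the counts may go on. So the first times of the two
  conditions are compared, both being preceded by a nonempty queue.\<close>

lemma explore_stop_iff: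
  "(\<exists>k. length (explore t G k) \<le> k) \<longleftrightarrow> (\<exists>k. 1 + (\<Sum>i=1..k. card (G i)) \<le> k)"
  "(\<exists>k. 1 + (\<Sum>i=1..k. card (G i)) \<le> k) \<Longrightarrow>
    (LEAST k. length (explore t G k) \<le> k) = (LEAST k. 1 + (\<Sum>i=1..k. card (G i)) \<le> k)"
proof -
  have al: "alive G k" if "\<forall>j<k. \<not> length (explore t G j) \<le> j" for k
    using that
  proof (induction k)
    case (Suc k)
    then have a: "alive G k" by simp
    have "k < 1 + (\<Sum>i=1..k. card (G i))" using explore_alive[OF a, of t] Suc.prems by auto
    then show ?case using a by (auto simp: alive_def less_Suc_eq)
  qed (simp add: alive_def)
  have al': "alive G k" if "\<forall>j<k. \<not> 1 + (\<Sum>i=1..j. card (G i)) \<le> j" for k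
    using that by (auto simp: alive_def not_le)
  have A: "1 + (\<Sum>i=1..k. card (G i)) \<le> k \<and> (\<forall>j<k. \<not> 1 + (\<Sum>i=1..j. card (G i)) \<le> j)"
    if "length (explore t G k) \<le> k" "\<forall>j<k. \<not> length (explore t G j) \<le> j" for k
    using explore_alive[OF al[OF that(2)], of t] that al[OF that(2)] by (auto simp: alive_def not_le)
  have B: "length (explore t G k) \<le> k"
    if "1 + (\<Sum>i=1..k. card (G i)) \<le> k" "\<forall>j<k. \<not> 1 + (\<Sum>i=1..j. card (G i)) \<le> j" for k
    using explore_alive[OF al'[OF that(2)], of t] that by auto
  show ex: "(\<exists>k. length (explore t G k) \<le> k) \<longleftrightarrow> (\<exists>k. 1 + (\<Sum>i=1..k. card (G i)) \<le> k)"
  proof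
    assume "\<exists>k. length (explore t G k) \<le> k"
    then obtain k where "length (explore t G k) \<le> k" "\<forall>j<k. \<not> length (explore t G j) \<le> j"
      by (subst (asm) exists_least_iff) blast
    from A[OF this] show "\<exists>k. 1 + (\<Sum>i=1..k. card (G i)) \<le> k" by blast
  next
    assume "\<exists>k. 1 + (\<Sum>i=1..k. card (G i)) \<le> k"
    then obtain k where "1 + (\<Sum>i=1..k. card (G i)) \<le> k" "\<forall>j<k. \<not> 1 + (\<Sum>i=1..j. card (G i)) \<le> j"
      by (subst (asm) exists_least_iff) blast
    from B[OF this] show "\<exists>k. length (explore t G k) \<le> k" by blast
  qed
  assume "\<exists>k. 1 + (\<Sum>i=1..k. card (G i)) \<le> k"
  with ex have e: "\<exists>k. length (explore t G k) \<le> k" by blast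
  define k where "k = (LEAST k. length (explore t G k) \<le> k)"
  have k: "length (explore t G k) \<le> k" unfolding k_def using e by (rule LeastI_ex)
  have "\<forall>j<k. \<not> length (explore t G j) \<le> j" unfolding k_def using not_less_Least by blast
  from A[OF k this] have "(LEAST k. 1 + (\<Sum>i=1..k. card (G i)) \<le> k) = k"
    by (intro Least_equality) (auto simp: not_less[symmetric])
  then show "(LEAST k. length (explore t G k) \<le> k) = (LEAST k. 1 + (\<Sum>i=1..k. card (G i)) \<le> k)" by (simp add: k_def)
qed

definition stop_at :: "(nat \<Rightarrow> real set) \<Rightarrow> nat \<Rightarrow> bool" where
  "stop_at G n \<longleftrightarrow> 1 + (\<Sum>i=1..n. card (G i)) \<le> n \<and> alive G n"

lemma stop_at_unique: "stop_at G n \<Longrightarrow> stop_at G m \<Longrightarrow> n = m"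
  by (metis alive_def linorder_neqE_nat not_less stop_at_def)

lemma grow_cluster_stop:
  assumes "stop_at G n"
  shows "grow_cluster t G = explore t G n" "length (grow_cluster t G) = n" "0 < n"
    "(\<Sum>i=1..n. card (G i)) = n - 1"
    "valid_cluster t (grow_cluster t G)"
    "total_birth_time (grow_cluster t G) = (\<Sum>i=1..n. \<Sum>x\<in>G i. x)"
    "\<forall>i\<in>{1..n}. G i \<subseteq> {0..} \<Longrightarrow> k \<in> {2..n} \<Longrightarrow> 0 \<le> birth_time (grow_cluster t G) k"
proof -
  have s: "1 + (\<Sum>i=1..n. card (G i)) \<le> n" "alive G n" using assms by (auto simp: stop_at_def)
  show n: "0 < n" using s(1) by auto
  have least: "(LEAST k. 1 + (\<Sum>i=1..k. card (G i)) \<le> k) = n"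
    using s by (intro Least_equality) (auto simp: alive_def not_less[symmetric])
  show g: "grow_cluster t G = explore t G n"
    unfolding grow_cluster_def using explore_stop_iff[where t=t and G=G] s(1) least by auto
  \<comment> \<open>The queue shrinks by at most one per step and was nonempty one step before, so
    at time n it is exactly empty and the number of listed events is n.\<close>
  obtain m where m: "n = Suc m" using n by (cases n) auto
  have "m < 1 + (\<Sum>i=1..m. card (G i))" using s(2) by (auto simp: alive_def m)
  then have eq: "1 + (\<Sum>i=1..n. card (G i)) = n" using s(1) by (simp add: m)
  then show "(\<Sum>i=1..n. card (G i)) = n - 1" by simp
  note E = explore_alive[OF s(2), of t]
  show len: "length (grow_cluster t G) = n" using E eq by (simp add: g)
  show "valid_cluster t (grow_cluster t G)" "total_birth_time (grow_cluster t G) = (\<Sum>i=1..n. \<Sum>x\<in>G i. x)"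
    using E by (simp_all add: g)
  show "\<forall>i\<in>{1..n}. G i \<subseteq> {0..} \<Longrightarrow> k \<in> {2..n} \<Longrightarrow> 0 \<le> birth_time (grow_cluster t G) k"
    using E len by (simp add: g)
qed

lemma grow_cluster_nil_iff: "grow_cluster t G = [] \<longleftrightarrow> (\<forall>n. \<not> stop_at G n)"
proof
  assume "grow_cluster t G = []"
  then show "\<forall>n. \<not> stop_at G n" using grow_cluster_stop(2)[of G _ t] grow_cluster_stop(3)[of G] by (metis list.size(3) less_irrefl)
next
  assume n: "\<forall>n. \<not> stop_at G n"
  have "\<not> (\<exists>k. 1 + (\<Sum>i=1..k. card (G i)) \<le> k)"
  proof
    assume "\<exists>k. 1 + (\<Sum>i=1..k. card (G i)) \<le> k"
    then obtain k where "1 + (\<Sum>i=1..k. card (G i)) \<le> k" "\<forall>j<k. \<not> 1 + (\<Sum>i=1..j. card (G i)) \<le> j"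
      by (subst (asm) exists_least_iff) blast
    then have "stop_at G k" by (auto simp: stop_at_def alive_def not_le)
    then show False using n by blast
  qed
  then show "grow_cluster t G = []" unfolding grow_cluster_def using explore_stop_iff(1)[where t=t and G=G] by auto
qed

lemma explore_shift: "explore t G k = map (\<lambda>(s, p). (t + s, p)) (explore 0 G k)"
proof (induction k)
  case (Suc k)
  have "event_time (map (\<lambda>(s, p). (t + s, p)) (explore 0 G k)) (Suc k) = t + event_time (explore 0 G k) (Suc k)"
    if "k < length (explore 0 G k)"
    using that by (simp add: event_time_def case_prod_unfold)
  then show ?case using Suc by (simp add: Let_def case_prod_unfold add.assoc)
qed simp

lemma grow_cluster_shift: "grow_cluster t G = map (\<lambda>(s, p). (t + s, p)) (grow_cluster 0 G)"
proof -
  have "length (explore t G k) = length (explore 0 G k)" for k by (subst explore_shift) simp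
  then show ?thesis unfolding grow_cluster_def by (auto simp: explore_shift[of t])
qed

lemma cluster_length_shift: "cluster_length (grow_cluster t G) = cluster_length (grow_cluster 0 G)"
proof (cases "grow_cluster 0 G = []")
  case True
  then show ?thesis by (subst grow_cluster_shift) simp
next
  case False
  let ?C = "grow_cluster 0 G" and ?D = "map (\<lambda>(s, p). (t + s, p)) (grow_cluster 0 G)"
  have et: "event_time ?D k = t + event_time ?C k" if "k \<in> {1..length ?C}" for k
  proof -
    have "k - 1 < length ?C" using that by auto
    then show ?thesis by (simp add: event_time_def case_prod_unfold)
  qed
  have "event_time ?D ` {1..length ?D} = (+) t ` (event_time ?C ` {1..length ?C})"
    using et by (auto simp: image_image)
  moreover have "Max ((+) t ` (event_time ?C ` {1..length ?C})) = t + Max (event_time ?C ` {1..length ?C})"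
    using False by (intro mono_Max_commute[symmetric]) (auto simp: mono_def Suc_le_eq)
  ultimately have "departure_time ?D = t + departure_time ?C" by (simp add: departure_time_def)
  moreover have "arrival_time ?D = t + arrival_time ?C"
  proof -
    have "0 < length ?C" using False by blast
    then have "1 \<in> {1..length ?C}" by (simp add: Suc_le_eq)
    then show ?thesis using et by (simp add: arrival_time_def)
  qed
  ultimately show ?thesis by (subst grow_cluster_shift) (simp add: cluster_length_def)
qed

text \<open>An arrival time is the immigrant time plus the birth times along the ancestral line.
  Parents precede children in the list, so these are among the births up to index k, and the
  remaining ones are nonnegative.\<close>

lemma event_time_le_births:
  assumes v: "valid_cluster t C" and b: "\<And>i. i \<in> {2..length C} \<Longrightarrow> 0 \<le> birth_time C i"
  shows "1 \<le> k \<Longrightarrow> k \<le> length C \<Longrightarrow> event_time C k \<le> t + (\<Sum>i=2..k. birth_time C i)"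
proof (induction k rule: less_induct)
  case (less k)
  show ?case
  proof (cases "k = 1")
    case True
    then show ?thesis using v by (simp add: valid_cluster_def)
  next
    case False
    then have k: "k \<in> {2..length C}" using less.prems by auto
    then have p: "1 \<le> event_parent C k" "event_parent C k < k" using v by (auto simp: valid_cluster_def)
    have "event_time C k = event_time C (event_parent C k) + birth_time C k" by (simp add: birth_time_def)
    also have "\<dots> \<le> t + (\<Sum>i=2..event_parent C k. birth_time C i) + birth_time C k"
      using less.IH[OF p(2,1)] p less.prems by simp
    also have "(\<Sum>i=2..event_parent C k. birth_time C i) \<le> (\<Sum>i=2..k - 1. birth_time C i)"
      using p less.prems by (intro sum_mono2) (auto intro!: b)
    also have "t + (\<Sum>i=2..k - 1. birth_time C i) + birth_time C k = t + (\<Sum>i=2..k. birth_time C i)"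
      using k by (cases k) (auto simp: not_le)
    finally show ?thesis by simp
  qed
qed

lemma cluster_length_le_births:
  assumes v: "valid_cluster t C" and b: "\<And>i. i \<in> {2..length C} \<Longrightarrow> 0 \<le> birth_time C i"
  shows "cluster_length C \<le> total_birth_time C"
proof -
  have ne: "event_time C ` {1..length C} \<noteq> {}" using v by (cases C) (auto simp: valid_cluster_def)
  have "event_time C k \<le> t + total_birth_time C" if "k \<in> {1..length C}" for k
  proof -
    have "event_time C k \<le> t + (\<Sum>i=2..k. birth_time C i)" using event_time_le_births[OF v b] that by simp
    also have "\<dots> \<le> t + total_birth_time C"
      unfolding total_birth_time_def using that by (intro add_left_mono sum_mono2) (auto intro!: b)
    finally show ?thesis .
  qed
  then have "departure_time C \<le> t + total_birth_time C"
    unfolding departure_time_def using ne by (subst Max_le_iff) auto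
  then show ?thesis using v by (simp add: cluster_length_def arrival_time_def valid_cluster_def)
qed

section \<open>The exploration as a random walk\<close>

text \<open>The number of listed but untreated events is a walk with increments \<open>card X - 1\<close>, absorbed at 0. Here
  \<open>z\<close> is its current value and \<open>w\<close> a weight collected at each step, so that products along the walk
  are multiplicative in \<open>z\<close>. Since \<^const>\<open>explore\<close> never reads \<open>G 0\<close>, the walk runs over \<open>\<lambda>k. G (Suc k)\<close>.\<close>

primrec walk_sum :: "(real set \<Rightarrow> ennreal) \<Rightarrow> nat \<Rightarrow> nat \<Rightarrow> (nat \<Rightarrow> real set) \<Rightarrow> ennreal" where
  "walk_sum w 0 z H = of_bool (z = 0)"
| "walk_sum w (Suc n) z H = (if z = 0 then 1 else w (H 0) * walk_sum w n (z - 1 + card (H 0)) (\<lambda>k. H (Suc k)))"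

primrec walk_len :: "nat \<Rightarrow> nat \<Rightarrow> (nat \<Rightarrow> real set) \<Rightarrow> nat" where
  "walk_len 0 z H = 0"
| "walk_len (Suc n) z H = (if z = 0 then 0 else Suc (walk_len n (z - 1 + card (H 0)) (\<lambda>k. H (Suc k))))"

text \<open>First time at which the walk started at z with increments \<open>card (H j) - 1\<close>
  reaches 0.\<close>

definition walk_stop :: "nat \<Rightarrow> (nat \<Rightarrow> real set) \<Rightarrow> nat \<Rightarrow> bool" where
  "walk_stop z H n \<longleftrightarrow> z + (\<Sum>j<n. card (H j)) \<le> n \<and> (\<forall>j<n. j < z + (\<Sum>i<j. card (H i)))"

lemma walk_stop_0 [simp]: "walk_stop 0 H n \<longleftrightarrow> n = 0"
  by (cases n) (auto simp: walk_stop_def)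

lemma walk_stop_Suc:
  assumes "z \<noteq> 0"
  shows "walk_stop z H 0 \<longleftrightarrow> False"
    and "walk_stop z H (Suc n) \<longleftrightarrow> walk_stop (z - 1 + card (H 0)) (\<lambda>k. H (Suc k)) n"
proof -
  obtain y where z: "z = Suc y" using assms by (cases z) auto
  show "walk_stop z H 0 \<longleftrightarrow> False" by (simp add: walk_stop_def z)
  have "(\<forall>j<Suc n. j < z + (\<Sum>i<j. card (H i))) \<longleftrightarrow> (\<forall>j<n. j < y + card (H 0) + (\<Sum>i<j. card (H (Suc i))))"
    by (simp add: All_less_Suc2 z sum.lessThan_Suc_shift flip: add.assoc del: sum.lessThan_Suc)
  then show "walk_stop z H (Suc n) \<longleftrightarrow> walk_stop (z - 1 + card (H 0)) (\<lambda>k. H (Suc k)) n"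
    by (simp add: walk_stop_def sum.lessThan_Suc_shift z del: sum.lessThan_Suc) (simp add: add.assoc)
qed

text \<open>At most one n contributes: the truncated recursion is the weight of the path if it is
  absorbed by time N and 0 otherwise.\<close>

lemma walk_sum_eq: "walk_sum w N z H = (\<Sum>n\<le>N. of_bool (walk_stop z H n) * (\<Prod>j<n. w (H j)))"
proof (induction N arbitrary: z H)
  case 0
  then show ?case by (simp add: walk_stop_def)
next
  case (Suc N)
  show ?case
  proof (cases "z = 0")
    case True
    then show ?thesis by (simp add: sum.atMost_Suc_shift del: sum.atMost_Suc)
  next
    case False
    have "walk_sum w (Suc N) z H = w (H 0) * (\<Sum>n\<le>N. of_bool (walk_stop (z - 1 + card (H 0)) (\<lambda>k. H (Suc k)) n) * (\<Prod>j<n. w (H (Suc j))))"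
      using False Suc[of "z - 1 + card (H 0)" "\<lambda>k. H (Suc k)"] by (simp only: walk_sum.simps if_False)
    also have "\<dots> = (\<Sum>n\<le>N. of_bool (walk_stop z H (Suc n)) * (\<Prod>j<Suc n. w (H j)))"
      unfolding sum_distrib_left
      by (intro sum.cong refl) (simp only: walk_stop_Suc(2)[OF False] prod.lessThan_Suc_shift mult.left_commute)
    also have "\<dots> = (\<Sum>n\<le>Suc N. of_bool (walk_stop z H n) * (\<Prod>j<n. w (H j)))"
      unfolding sum.atMost_Suc_shift by (simp only: walk_stop_Suc(1)[OF False] of_bool_eq mult_zero_left add_0)
    finally show ?thesis .
  qed
qed

lemma all_le_Suc: "(\<forall>n\<le>Suc N. P n) \<longleftrightarrow> P 0 \<and> (\<forall>n\<le>N. P (Suc n))"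
  using All_less_Suc2[of "Suc N" P] by (simp add: less_Suc_eq_le)

lemma walk_len_eq: "walk_len N z H = (if \<exists>n\<le>N. walk_stop z H n then THE n. walk_stop z H n else N)"
proof -
  have uniq: "n = m" if "walk_stop z H n" "walk_stop z H m" for z H n m
    using that unfolding walk_stop_def by (metis linorder_neqE_nat not_less)
  have "(\<forall>n\<le>N. walk_stop z H n \<longrightarrow> walk_len N z H = n) \<and> ((\<forall>n\<le>N. \<not> walk_stop z H n) \<longrightarrow> walk_len N z H = N)"
  proof (induction N arbitrary: z H)
    case (Suc N)
    show ?case
    proof (cases "z = 0")
      case False
      note S = walk_stop_Suc[OF False]
      show ?thesis
        using Suc[of "z - 1 + card (H 0)" "\<lambda>k. H (Suc k)"] False
        by (simp add: S all_le_Suc)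
    qed auto
  qed auto
  then show ?thesis using uniq by (auto intro!: the_equality[symmetric])
qed

lemma stop_at_walk: "stop_at G n \<longleftrightarrow> walk_stop 1 (\<lambda>k. G (Suc k)) n"
proof -
  have "(\<Sum>i=1..m. card (G i)) = (\<Sum>j<m. card (G (Suc j)))" for m
    by (simp add: sum.atLeast1_atMost_eq)
  then show ?thesis by (simp add: stop_at_def alive_def walk_stop_def)
qed

lemma explore_cong: "(\<And>i. 1 \<le> i \<Longrightarrow> i \<le> k \<Longrightarrow> G i = G' i) \<Longrightarrow> explore t G k = explore t G' k"
  by (induction k) (simp_all add: Let_def)

lemma grow_cluster_cong: "(\<And>i. 1 \<le> i \<Longrightarrow> G i = G' i) \<Longrightarrow> grow_cluster t G = grow_cluster t G'"
  using explore_cong[of _ G G' t] by (simp add: grow_cluster_def)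

abbreviation rooted :: "(nat \<Rightarrow> real set) \<Rightarrow> nat \<Rightarrow> real set" where
  "rooted H \<equiv> case_nat {} H"

lemma SUP_Suc: "incseq X \<Longrightarrow> (SUP n. X (Suc n)) = (SUP n. X n :: ennreal)"
proof (rule antisym)
  assume X: "incseq X"
  show "(SUP n. X (Suc n)) \<le> (SUP n. X n)" by (rule SUP_least) (rule SUP_upper, simp)
  show "(SUP n. X n) \<le> (SUP n. X (Suc n))"
  proof (rule SUP_least)
    fix n
    have "X n \<le> X (Suc n)" using X by (rule incseq_SucD)
    also have "\<dots> \<le> (SUP n. X (Suc n))" by (rule SUP_upper) simp
    finally show "X n \<le> (SUP n. X (Suc n))" .
  qed
qed

text \<open>Only a probability law on configurations is fixed, because the original and the tilted
  offspring laws are both inserted later.\<close>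

locale offspring =
  fixes Q :: "real set measure"
  assumes prob_Q: "prob_space Q" and sets_Q: "sets Q = sets (config_space borel)"
begin

sublocale Q: prob_space Q by (rule prob_Q)
sublocale S: sequence_space Q ..

abbreviation QS :: "(nat \<Rightarrow> real set) measure" where "QS \<equiv> PiM UNIV (\<lambda>_. Q)"

lemma sets_QS: "sets QS = sets seq_space"
  by (rule sets_PiM_cong) (simp_all add: sets_Q)

lemma measurable_Q: "measurable Q N = measurable (config_space borel) N"
  by (rule measurable_cong_sets[OF sets_Q refl])

lemma measurable_QS: "measurable QS N = measurable seq_space N"
  by (rule measurable_cong_sets[OF sets_QS refl])

lemma space_Q: "space Q = {X. countable X}"
  using sets_eq_imp_space_eq[OF sets_Q] by (simp add: space_config_space)

lemma measurable_cons: "(\<lambda>(X, \<omega>). case_nat X \<omega>) \<in> measurable (Q \<Otimes>\<^sub>M QS) QS"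
  by (simp add: case_prod_unfold) measurable

lemma measurable_cons': "X \<in> space Q \<Longrightarrow> case_nat X \<in> measurable QS QS"
  using measurable_compose[OF measurable_Pair1' measurable_cons] by simp

lemma integral_cons:
  assumes F: "F \<in> borel_measurable QS"
  shows "(\<integral>\<^sup>+\<omega>. F \<omega> \<partial>QS) = (\<integral>\<^sup>+X. \<integral>\<^sup>+\<omega>. F (case_nat X \<omega>) \<partial>QS \<partial>Q)"
proof -
  have "(\<integral>\<^sup>+\<omega>. F \<omega> \<partial>QS) = (\<integral>\<^sup>+\<omega>. F \<omega> \<partial>distr (Q \<Otimes>\<^sub>M QS) QS (\<lambda>(X, \<omega>). case_nat X \<omega>))"
    by (simp add: S.PiM_iter)
  also have "\<dots> = (\<integral>\<^sup>+p. F (case_nat (fst p) (snd p)) \<partial>(Q \<Otimes>\<^sub>M QS))"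
    using F by (subst nn_integral_distr[OF measurable_cons]) (simp_all add: case_prod_unfold)
  also have "\<dots> = (\<integral>\<^sup>+X. \<integral>\<^sup>+\<omega>. F (case_nat X \<omega>) \<partial>QS \<partial>Q)"
    using S.P.nn_integral_fst[of "\<lambda>p. F (case_nat (fst p) (snd p))" Q] measurable_compose[OF measurable_cons F]
    by (simp add: case_prod_unfold)
  finally show ?thesis .
qed

lemma measurable_tail: "(\<lambda>H k. H (Suc k)) \<in> measurable seq_space seq_space"
  by (rule measurable_PiM_single') (auto simp: space_PiM PiE_iff)

lemma measurable_walk_sum:
  assumes w: "w \<in> borel_measurable (config_space borel)"
  shows "walk_sum w n z \<in> borel_measurable seq_space"
proof (induction n arbitrary: z)
  case (Suc n)
  have h[measurable]: "(\<lambda>H. H 0) \<in> measurable seq_space (config_space borel)" by simp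
  have c: "(\<lambda>H. card (H 0)) \<in> measurable seq_space (count_space UNIV)" by measurable
  have "(\<lambda>H. walk_sum w n (z - 1 + card (H 0)) (\<lambda>k. H (Suc k))) \<in> borel_measurable seq_space"
    by (rule measurable_compose_countable[where f="\<lambda>m H. walk_sum w n (z - 1 + m) (\<lambda>k. H (Suc k))", OF _ c])
       (rule measurable_compose[OF measurable_tail Suc])
  then have m: "(\<lambda>H. if z = 0 then 1 else w (H 0) * walk_sum w n (z - 1 + card (H 0)) (\<lambda>k. H (Suc k))) \<in> borel_measurable seq_space"
    by (cases "z = 0") (auto intro!: borel_measurable_times_ennreal measurable_compose[OF h w])
  have "walk_sum w (Suc n) z = (\<lambda>H. if z = 0 then 1 else w (H 0) * walk_sum w n (z - 1 + card (H 0)) (\<lambda>k. H (Suc k)))"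
    by (rule ext) simp
  with m show ?case by (simp only:)
next
  case 0
  have "walk_sum w 0 z = (\<lambda>H. of_bool (z = 0))" by (rule ext) simp
  then show ?case by (simp only: borel_measurable_const)
qed

text \<open>First-step analysis: the expectation of \<open>walk_sum\<close> without the sequence
  space, so that its properties follow by induction on n.\<close>

primrec walk_val :: "(real set \<Rightarrow> ennreal) \<Rightarrow> nat \<Rightarrow> nat \<Rightarrow> ennreal" where
  "walk_val w 0 z = of_bool (z = 0)"
| "walk_val w (Suc n) z = (if z = 0 then 1 else \<integral>\<^sup>+X. w X * walk_val w n (z - 1 + card X) \<partial>Q)"

lemma walk_val_integral:
  assumes w: "w \<in> borel_measurable (config_space borel)"
  shows "(\<integral>\<^sup>+H. walk_sum w n z H \<partial>QS) = walk_val w n z"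
proof (induction n arbitrary: z)
  case (Suc n)
  show ?case
  proof (cases "z = 0")
    case False
    have "(\<integral>\<^sup>+H. walk_sum w (Suc n) z H \<partial>QS) = (\<integral>\<^sup>+X. \<integral>\<^sup>+H. walk_sum w (Suc n) z (case_nat X H) \<partial>QS \<partial>Q)"
      using measurable_walk_sum[OF w, of "Suc n" z] by (intro integral_cons) (simp only: measurable_QS)
    also have "\<dots> = (\<integral>\<^sup>+X. w X * walk_val w n (z - 1 + card X) \<partial>Q)"
    proof (rule nn_integral_cong)
      fix X
      have "(\<integral>\<^sup>+H. walk_sum w (Suc n) z (case_nat X H) \<partial>QS) = (\<integral>\<^sup>+H. w X * walk_sum w n (z - 1 + card X) H \<partial>QS)"
        using False by simp
      also have "\<dots> = w X * walk_val w n (z - 1 + card X)"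
        using measurable_walk_sum[OF w] by (subst nn_integral_cmult) (simp_all only: measurable_QS Suc)
      finally show "(\<integral>\<^sup>+H. walk_sum w (Suc n) z (case_nat X H) \<partial>QS) = w X * walk_val w n (z - 1 + card X)" .
    qed
    finally show ?thesis using False by simp
  qed (simp add: S.P.emeasure_space_1)
next
  case 0
  have "walk_sum w 0 z = (\<lambda>H. of_bool (z = 0))" by (rule ext) simp
  then show ?case by (simp only: nn_integral_const S.P.emeasure_space_1 mult_1_right walk_val.simps)
qed

lemma measurable_nat_fun [measurable]: "(\<lambda>X. g (card X)) \<in> borel_measurable Q" for g :: "nat \<Rightarrow> ennreal"
  unfolding measurable_Q by (rule measurable_compose[OF measurable_card_config_UNIV]) simp

lemma walk_val_mono: "walk_val w n z \<le> walk_val w (Suc n) z"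
proof (induction n arbitrary: z)
  case (Suc n)
  show ?case
  proof (cases "z = 0")
    case False
    have "(\<integral>\<^sup>+X. w X * walk_val w n (z - 1 + card X) \<partial>Q) \<le> (\<integral>\<^sup>+X. w X * walk_val w (Suc n) (z - 1 + card X) \<partial>Q)"
      by (intro nn_integral_mono mult_left_mono Suc) simp
    then show ?thesis by (subst (1 2) walk_val.simps(2)) (simp only: False if_False)
  qed simp
qed simp

lemma walk_val_incseq: "incseq (\<lambda>n. walk_val w n z)"
  by (intro incseq_SucI walk_val_mono)

definition walk_lim :: "(real set \<Rightarrow> ennreal) \<Rightarrow> nat \<Rightarrow> ennreal" where
  "walk_lim w z = (SUP n. walk_val w n z)"

lemma walk_val_le_lim: "walk_val w n z \<le> walk_lim w z"
  unfolding walk_lim_def by (rule SUP_upper) simp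

lemma walk_val_0 [simp]: "walk_val w n 0 = 1"
  by (cases n) simp_all

lemma walk_lim_0 [simp]: "walk_lim w 0 = 1"
  by (simp add: walk_lim_def)

text \<open>To bring y + z down to 0 the walk has to come down by y and then starts afresh from z.
  Here the second leg gets unlimited time; in the companion lower bound the two legs get separate
  budgets. In the limit the bounds meet, which gives multiplicativity in the starting value.\<close>

lemma walk_val_split_le:
  assumes w: "w \<in> borel_measurable (config_space borel)"
  shows "walk_val w n (y + z) \<le> walk_val w n y * walk_lim w z"
proof (induction n arbitrary: y)
  case (Suc n)
  show ?case
  proof (cases "y = 0")
    case False
    have "walk_val w (Suc n) (y + z) = (\<integral>\<^sup>+X. w X * walk_val w n ((y - 1 + card X) + z) \<partial>Q)"
      using False by (simp add: ac_simps)
    also have "\<dots> \<le> (\<integral>\<^sup>+X. (w X * walk_val w n (y - 1 + card X)) * walk_lim w z \<partial>Q)"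
      using Suc by (intro nn_integral_mono) (simp add: mult.assoc mult_left_mono)
    also have "\<dots> = (\<integral>\<^sup>+X. w X * walk_val w n (y - 1 + card X) \<partial>Q) * walk_lim w z"
      using w by (intro nn_integral_multc borel_measurable_times_ennreal measurable_nat_fun) (simp add: measurable_Q)
    finally show ?thesis using False by simp
  qed (use walk_val_le_lim[of w "Suc n" z] in \<open>simp del: walk_val.simps(2)\<close>)
qed auto

lemma walk_val_split_ge:
  assumes w: "w \<in> borel_measurable (config_space borel)"
  shows "walk_val w n y * walk_val w m z \<le> walk_val w (n + m) (y + z)"
proof (induction n arbitrary: y)
  case 0
  then show ?case by simp
next
  case (Suc n)
  show ?case
  proof (cases "y = 0")
    case True
    then show ?thesis using incseqD[OF walk_val_incseq, of m "Suc n + m" w z] by (simp del: walk_val.simps(2))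
  next
    case False
    have "walk_val w (Suc n) y * walk_val w m z = (\<integral>\<^sup>+X. w X * walk_val w n (y - 1 + card X) \<partial>Q) * walk_val w m z"
      using False by simp
    also have "\<dots> = (\<integral>\<^sup>+X. (w X * walk_val w n (y - 1 + card X)) * walk_val w m z \<partial>Q)"
      using w by (intro nn_integral_multc[symmetric] borel_measurable_times_ennreal measurable_nat_fun) (simp add: measurable_Q)
    also have "\<dots> \<le> (\<integral>\<^sup>+X. w X * walk_val w (n + m) ((y - 1 + card X) + z) \<partial>Q)"
      using Suc by (intro nn_integral_mono) (simp add: mult.assoc mult_left_mono)
    also have "\<dots> = walk_val w (Suc n + m) (y + z)" using False by (simp add: ac_simps)
    finally show ?thesis .
  qed
qed

lemma walk_lim_add:
  assumes w: "w \<in> borel_measurable (config_space borel)"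
  shows "walk_lim w (y + z) = walk_lim w y * walk_lim w z"
proof (rule antisym)
  show "walk_lim w (y + z) \<le> walk_lim w y * walk_lim w z"
    unfolding walk_lim_def[of w "y + z"]
  proof (rule SUP_least)
    fix n
    have "walk_val w n (y + z) \<le> walk_val w n y * walk_lim w z" by (rule walk_val_split_le[OF w])
    also have "\<dots> \<le> walk_lim w y * walk_lim w z" by (intro mult_right_mono walk_val_le_lim) simp
    finally show "walk_val w n (y + z) \<le> walk_lim w y * walk_lim w z" .
  qed
  have "walk_lim w y * walk_lim w z = (SUP n. SUP m. walk_val w n y * walk_val w m z)"
    unfolding walk_lim_def by (simp add: SUP_mult_right_ennreal SUP_mult_left_ennreal) (rule SUP_commute)
  also have "\<dots> \<le> walk_lim w (y + z)"
    by (intro SUP_least order_trans[OF walk_val_split_ge[OF w] walk_val_le_lim])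
  finally show "walk_lim w y * walk_lim w z \<le> walk_lim w (y + z)" .
qed

lemma walk_lim_power:
  assumes "w \<in> borel_measurable (config_space borel)"
  shows "walk_lim w z = walk_lim w 1 ^ z"
proof (induction z)
  case (Suc z)
  then show ?case using walk_lim_add[OF assms, of 1 z] by simp
qed simp

text \<open>After one step from 1 the walk stands at \<open>card X\<close>, and from there the limit
  is a power by multiplicativity.\<close>

lemma walk_lim_fixpoint:
  assumes w: "w \<in> borel_measurable (config_space borel)"
  shows "walk_lim w 1 = (\<integral>\<^sup>+X. w X * walk_lim w 1 ^ card X \<partial>Q)"
proof -
  have "walk_lim w 1 = (SUP n. walk_val w (Suc n) 1)"
    unfolding walk_lim_def by (rule SUP_Suc[symmetric]) (rule walk_val_incseq)
  also have "\<dots> = (SUP n. \<integral>\<^sup>+X. w X * walk_val w n (card X) \<partial>Q)" by simp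
  also have "\<dots> = (\<integral>\<^sup>+X. (SUP n. w X * walk_val w n (card X)) \<partial>Q)"
  proof (rule nn_integral_monotone_convergence_SUP[symmetric])
    show "incseq (\<lambda>n X. w X * walk_val w n (card X))"
      by (intro incseq_SucI le_funI mult_left_mono walk_val_mono) simp
    show "(\<lambda>X. w X * walk_val w n (card X)) \<in> borel_measurable Q" for n
      using w by (intro borel_measurable_times_ennreal measurable_nat_fun) (simp add: measurable_Q)
  qed
  also have "\<dots> = (\<integral>\<^sup>+X. w X * walk_lim w 1 ^ card X \<partial>Q)"
  proof (rule nn_integral_cong)
    fix X
    have "(SUP n. w X * walk_val w n (card X)) = w X * walk_lim w (card X)"
      by (simp add: walk_lim_def SUP_mult_left_ennreal)
    also have "\<dots> = w X * walk_lim w 1 ^ card X" by (simp only: walk_lim_power[OF w, of "card X"])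
    finally show "(SUP n. w X * walk_val w n (card X)) = w X * walk_lim w 1 ^ card X" .
  qed
  finally show ?thesis .
qed

text \<open>The bound x ^ z holds at n = 0 and is preserved by each step because x is a
  supersolution. With the fixed point equation this makes the expectation the least
  solution.\<close>

lemma walk_lim_minimal:
  assumes w: "w \<in> borel_measurable (config_space borel)" and x: "(\<integral>\<^sup>+X. w X * x ^ card X \<partial>Q) \<le> x"
  shows "walk_lim w 1 \<le> x"
proof -
  have "walk_val w n z \<le> x ^ z" for n z
  proof (induction n arbitrary: z)
    case (Suc n)
    show ?case
    proof (cases z)
      case (Suc y)
      have "walk_val w (Suc n) z = (\<integral>\<^sup>+X. w X * walk_val w n (y + card X) \<partial>Q)" using Suc by simp
      also have "\<dots> \<le> (\<integral>\<^sup>+X. x ^ y * (w X * x ^ card X) \<partial>Q)"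
        using Suc.IH by (intro nn_integral_mono order_trans[OF mult_left_mono[OF Suc.IH]]) (simp_all add: power_add mult_ac)
      also have "\<dots> = x ^ y * (\<integral>\<^sup>+X. w X * x ^ card X \<partial>Q)"
        using w by (intro nn_integral_cmult borel_measurable_times_ennreal measurable_nat_fun) (simp add: measurable_Q)
      also have "\<dots> \<le> x ^ y * x" by (intro mult_left_mono x) simp
      finally show ?thesis using Suc by (simp add: mult.commute)
    qed simp
  qed auto
  from this[of _ 1] show ?thesis unfolding walk_lim_def by (auto intro: SUP_least)
qed

text \<open>The coordinate G 0 is integrated out as a dummy, so that the walk is indexed from 0
  while events are indexed from 1.\<close>

lemma integral_rooted:
  assumes F: "F \<in> borel_measurable QS" and indep: "\<And>G G'. (\<And>i. 1 \<le> i \<Longrightarrow> G i = G' i) \<Longrightarrow> F G = F G'"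
  shows "(\<integral>\<^sup>+G. F G \<partial>QS) = (\<integral>\<^sup>+H. F (rooted H) \<partial>QS)"
proof -
  have eq: "F (case_nat X H) = F (rooted H)" for X H by (rule indep) (auto split: nat.splits)
  have "(\<integral>\<^sup>+G. F G \<partial>QS) = (\<integral>\<^sup>+X. \<integral>\<^sup>+H. F (case_nat X H) \<partial>QS \<partial>Q)" by (rule integral_cons[OF F])
  also have "\<dots> = (\<integral>\<^sup>+X. \<integral>\<^sup>+H. F (rooted H) \<partial>QS \<partial>Q)" by (intro nn_integral_cong) (rule eq)
  finally show ?thesis by (simp add: Q.emeasure_space_1)
qed

lemma integral_stop:
  assumes w: "w \<in> borel_measurable (config_space borel)"
  shows "(\<integral>\<^sup>+H. (\<Sum>n. of_bool (stop_at (rooted H) n) * (\<Prod>j<n. w (H j))) \<partial>QS) = walk_lim w 1"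
proof -
  have "(\<Sum>n. of_bool (stop_at (rooted H) n) * (\<Prod>j<n. w (H j))) = (SUP n. walk_sum w n 1 H)" for H
  proof -
    let ?f = "\<lambda>n. of_bool (stop_at (rooted H) n) * (\<Prod>j<n. w (H j))"
    have "(\<Sum>n. ?f n) = (SUP n. \<Sum>i<Suc n. ?f i)"
      unfolding suminf_eq_SUP by (rule SUP_Suc[symmetric]) (intro incseq_SucI sum_mono2, auto)
    then show ?thesis by (simp add: walk_sum_eq stop_at_walk lessThan_Suc_atMost del: sum.lessThan_Suc)
  qed
  then have "(\<integral>\<^sup>+H. (\<Sum>n. of_bool (stop_at (rooted H) n) * (\<Prod>j<n. w (H j))) \<partial>QS) = (\<integral>\<^sup>+H. (SUP n. walk_sum w n 1 H) \<partial>QS)"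
    by simp
  also have "\<dots> = (SUP n. \<integral>\<^sup>+H. walk_sum w n 1 H \<partial>QS)"
  proof (rule nn_integral_monotone_convergence_SUP)
    show "incseq (\<lambda>n. walk_sum w n 1)"
      by (intro incseq_SucI le_funI) (simp add: walk_sum_eq)
  qed (use measurable_walk_sum[OF w] in \<open>simp add: measurable_QS\<close>)
  also have "\<dots> = walk_lim w 1" by (simp add: walk_val_integral[OF w] walk_lim_def)
  finally show ?thesis .
qed

end

section \<open>Expected size and change of measure\<close>

context offspring
begin

lemma measurable_walk_len: "walk_len n z \<in> measurable seq_space (count_space UNIV)"
proof (induction n arbitrary: z)
  case (Suc n)
  have h[measurable]: "(\<lambda>H. H 0) \<in> measurable seq_space (config_space borel)" by simp
  have c: "(\<lambda>H. card (H 0)) \<in> measurable seq_space (count_space UNIV)" by measurable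
  have "(\<lambda>H. walk_len n (z - 1 + card (H 0)) (\<lambda>k. H (Suc k))) \<in> measurable seq_space (count_space UNIV)"
    by (rule measurable_compose_countable[where f="\<lambda>m H. walk_len n (z - 1 + m) (\<lambda>k. H (Suc k))", OF _ c])
       (rule measurable_compose[OF measurable_tail Suc])
  then have m: "(\<lambda>H. if z = 0 then 0 else Suc (walk_len n (z - 1 + card (H 0)) (\<lambda>k. H (Suc k)))) \<in> measurable seq_space (count_space UNIV)"
    by (cases "z = 0") (auto intro: measurable_compose)
  have "walk_len (Suc n) z = (\<lambda>H. if z = 0 then 0 else Suc (walk_len n (z - 1 + card (H 0)) (\<lambda>k. H (Suc k))))"
    by (rule ext) simp
  with m show ?case by (simp only:)
next
  case 0
  have "walk_len 0 z = (\<lambda>H. 0)" by (rule ext) simp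
  then show ?case by simp
qed

text \<open>Expected absorption time truncated at n, again by first-step analysis. Its limit is
  additive in z where that of \<open>walk_val\<close> is multiplicative.\<close>

primrec len_val :: "nat \<Rightarrow> nat \<Rightarrow> ennreal" where
  "len_val 0 z = 0"
| "len_val (Suc n) z = (if z = 0 then 0 else 1 + (\<integral>\<^sup>+X. len_val n (z - 1 + card X) \<partial>Q))"

lemma len_val_0 [simp]: "len_val n 0 = 0"
  by (cases n) simp_all

lemma len_val_integral: "(\<integral>\<^sup>+H. of_nat (walk_len n z H) \<partial>QS) = len_val n z"
proof (induction n arbitrary: z)
  case (Suc n)
  show ?case
  proof (cases "z = 0")
    case False
    have m: "(\<lambda>H. of_nat (walk_len n z H) :: ennreal) \<in> borel_measurable QS" for n z
      unfolding measurable_QS by (rule measurable_compose[OF measurable_walk_len]) simp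
    have "(\<integral>\<^sup>+H. of_nat (walk_len (Suc n) z H) \<partial>QS) = (\<integral>\<^sup>+X. \<integral>\<^sup>+H. of_nat (walk_len (Suc n) z (case_nat X H)) \<partial>QS \<partial>Q)"
      by (rule integral_cons[OF m])
    also have "\<dots> = (\<integral>\<^sup>+X. 1 + len_val n (z - 1 + card X) \<partial>Q)"
    proof (rule nn_integral_cong)
      fix X
      have "(\<integral>\<^sup>+H. of_nat (walk_len (Suc n) z (case_nat X H)) \<partial>QS) = (\<integral>\<^sup>+H. 1 + of_nat (walk_len n (z - 1 + card X) H) \<partial>QS)"
        using False by simp
      also have "\<dots> = 1 + len_val n (z - 1 + card X)"
      proof -
        have "(\<integral>\<^sup>+H. 1 + of_nat (walk_len n (z - 1 + card X) H) \<partial>QS) = (\<integral>\<^sup>+H. 1 \<partial>QS) + (\<integral>\<^sup>+H. of_nat (walk_len n (z - 1 + card X) H) \<partial>QS)"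
          by (rule nn_integral_add[OF borel_measurable_const m])
        then show ?thesis by (simp only: Suc nn_integral_const S.P.emeasure_space_1 mult_1)
      qed
      finally show "(\<integral>\<^sup>+H. of_nat (walk_len (Suc n) z (case_nat X H)) \<partial>QS) = 1 + len_val n (z - 1 + card X)" .
    qed
    also have "\<dots> = len_val (Suc n) z"
    proof -
      have "(\<integral>\<^sup>+X. 1 + len_val n (z - 1 + card X) \<partial>Q) = (\<integral>\<^sup>+X. 1 \<partial>Q) + (\<integral>\<^sup>+X. len_val n (z - 1 + card X) \<partial>Q)"
        by (rule nn_integral_add[OF borel_measurable_const measurable_nat_fun])
      then show ?thesis using False by (simp only: len_val.simps if_False nn_integral_const Q.emeasure_space_1 mult_1)
    qed
    finally show ?thesis .
  qed simp
qed simp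

lemma len_val_mono: "len_val n z \<le> len_val (Suc n) z"
proof (induction n arbitrary: z)
  case (Suc n)
  show ?case
  proof (cases "z = 0")
    case False
    have "1 + (\<integral>\<^sup>+X. len_val n (z - 1 + card X) \<partial>Q) \<le> 1 + (\<integral>\<^sup>+X. len_val (Suc n) (z - 1 + card X) \<partial>Q)"
      by (intro nn_integral_mono add_left_mono Suc)
    then show ?thesis by (subst (1 2) len_val.simps(2)) (simp only: False if_False)
  qed simp
qed simp

lemma len_val_incseq: "incseq (\<lambda>n. len_val n z)"
  by (intro incseq_SucI len_val_mono)

lemma len_val_mono2: "len_val n z \<le> len_val n (y + z)"
proof (induction n arbitrary: z)
  case (Suc n)
  show ?case
  proof (cases "z = 0")
    case False
    have "1 + (\<integral>\<^sup>+X. len_val n (z - 1 + card X) \<partial>Q) \<le> 1 + (\<integral>\<^sup>+X. len_val n (y + (z - 1 + card X)) \<partial>Q)"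
      by (intro nn_integral_mono add_left_mono Suc)
    then show ?thesis using False by (simp add: ac_simps)
  qed simp
qed simp

definition len_lim :: "nat \<Rightarrow> ennreal" where
  "len_lim z = (SUP n. len_val n z)"

lemma len_val_le_lim: "len_val n z \<le> len_lim z"
  unfolding len_lim_def by (rule SUP_upper) simp

lemma len_val_split_le: "len_val n (y + z) \<le> len_val n y + len_lim z"
proof (induction n arbitrary: y)
  case (Suc n)
  show ?case
  proof (cases "y = 0")
    case False
    have "len_val (Suc n) (y + z) = 1 + (\<integral>\<^sup>+X. len_val n ((y - 1 + card X) + z) \<partial>Q)"
      using False by (simp add: ac_simps)
    also have "\<dots> \<le> 1 + (\<integral>\<^sup>+X. len_val n (y - 1 + card X) + len_lim z \<partial>Q)"
      by (intro add_left_mono nn_integral_mono Suc)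
    also have "\<dots> = len_val (Suc n) y + len_lim z"
      using False measurable_nat_fun[of "\<lambda>c. len_val n (y - 1 + c)"]
      by (subst nn_integral_add) (simp_all add: Q.emeasure_space_1 add.assoc)
    finally show ?thesis .
  qed (use len_val_le_lim[of "Suc n" z] in \<open>simp del: len_val.simps(2)\<close>)
qed simp

lemma len_val_split_ge: "len_val n y + len_val m z \<le> len_val (n + m) (y + z)"
proof (induction n arbitrary: y)
  case 0
  \<comment> \<open>A truncated time counts steps even if the walk is not absorbed, so the case n =
    0 requires monotonicity in the starting value.\<close>
  then show ?case using len_val_mono2[of m z y] by simp
next
  case (Suc n)
  show ?case
  proof (cases "y = 0")
    case True
    then show ?thesis using incseqD[OF len_val_incseq, of m "Suc n + m" z] by (simp del: len_val.simps(2))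
  next
    case False
    have "len_val (Suc n) y + len_val m z = 1 + (\<integral>\<^sup>+X. len_val n (y - 1 + card X) + len_val m z \<partial>Q)"
      using False measurable_nat_fun[of "\<lambda>c. len_val n (y - 1 + c)"]
      by (subst nn_integral_add) (simp_all add: Q.emeasure_space_1 add.assoc)
    also have "\<dots> \<le> 1 + (\<integral>\<^sup>+X. len_val (n + m) ((y - 1 + card X) + z) \<partial>Q)"
      by (intro add_left_mono nn_integral_mono Suc)
    also have "\<dots> = len_val (Suc n + m) (y + z)" using False by (simp add: ac_simps)
    finally show ?thesis .
  qed
qed

lemma len_lim_add: "len_lim (y + z) = len_lim y + len_lim z"
proof (rule antisym)
  show "len_lim (y + z) \<le> len_lim y + len_lim z"
    unfolding len_lim_def[of "y + z"]
  proof (rule SUP_least)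
    fix n
    have "len_val n (y + z) \<le> len_val n y + len_lim z" by (rule len_val_split_le)
    also have "\<dots> \<le> len_lim y + len_lim z" by (intro add_right_mono len_val_le_lim)
    finally show "len_val n (y + z) \<le> len_lim y + len_lim z" .
  qed
  have "len_lim y + len_lim z = (SUP n. len_val n y + len_val n z)"
    unfolding len_lim_def by (rule ennreal_SUP_add[symmetric]) (rule len_val_incseq)+
  also have "\<dots> \<le> len_lim (y + z)"
    by (intro SUP_least order_trans[OF len_val_split_ge len_val_le_lim])
  finally show "len_lim y + len_lim z \<le> len_lim (y + z)" .
qed

lemma len_lim_mult: "len_lim z = of_nat z * len_lim 1"
proof (induction z)
  case (Suc z)
  then show ?case using len_lim_add[of 1 z] by (simp add: distrib_right)
qed (simp add: len_lim_def)

text \<open>The equation l = 1 + a l is also solved by l = \<infinity>. The bound z / (1 - a),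
  proved by induction for the truncated times, excludes that solution.\<close>

lemma len_lim_value:
  assumes mean: "(\<integral>\<^sup>+X. of_nat (card X) \<partial>Q) = ennreal a" and a: "0 \<le> a" "a < 1"
  shows "len_lim 1 = ennreal (1 / (1 - a))"
proof -
  let ?c = "1 / (1 - a)"
  have c: "0 \<le> ?c" "1 + a * ?c = ?c" using a by (simp_all add: field_simps)
  have bound: "len_val n z \<le> of_nat z * ennreal ?c" for n z
  proof (induction n arbitrary: z)
    case (Suc n)
    show ?case
    proof (cases z)
      case (Suc y)
      have "len_val (Suc n) z = 1 + (\<integral>\<^sup>+X. len_val n (y + card X) \<partial>Q)" using Suc by simp
      also have "\<dots> \<le> 1 + (\<integral>\<^sup>+X. of_nat y * ennreal ?c + of_nat (card X) * ennreal ?c \<partial>Q)"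
        by (intro add_left_mono nn_integral_mono order_trans[OF Suc.IH]) (simp add: distrib_right)
      also have "\<dots> = 1 + (of_nat y * ennreal ?c + ennreal a * ennreal ?c)"
        using measurable_nat_fun[of of_nat] measurable_nat_fun[of "\<lambda>c. of_nat c * ennreal ?c"]
        by (subst nn_integral_add) (simp_all add: Q.emeasure_space_1 nn_integral_multc mean)
      also have "\<dots> = (1 + ennreal a * ennreal ?c) + of_nat y * ennreal ?c" by (simp add: ac_simps)
      also have "1 + ennreal a * ennreal ?c = ennreal ?c"
        using c a by (simp flip: ennreal_mult ennreal_1 ennreal_plus)
      also have "ennreal ?c + of_nat y * ennreal ?c = of_nat z * ennreal ?c" using Suc by (simp add: distrib_right)
      finally show ?thesis .
    qed simp
  qed simp
  have "len_lim 1 \<le> ennreal ?c" unfolding len_lim_def by (rule SUP_least) (use bound[of _ 1] in simp)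
  then obtain l where l: "len_lim 1 = ennreal l" "0 \<le> l" by (cases "len_lim 1") (auto simp: top_unique)
  have "len_lim 1 = (SUP n. len_val (Suc n) 1)"
    unfolding len_lim_def by (rule SUP_Suc[symmetric]) (rule len_val_incseq)
  also have "\<dots> = (SUP n. 1 + (\<integral>\<^sup>+X. len_val n (card X) \<partial>Q))" by simp
  also have "\<dots> = (SUP n. \<integral>\<^sup>+X. 1 + len_val n (card X) \<partial>Q)"
    using measurable_nat_fun by (subst nn_integral_add) (simp_all add: Q.emeasure_space_1)
  also have "\<dots> = (\<integral>\<^sup>+X. (SUP n. 1 + len_val n (card X)) \<partial>Q)"
  proof (rule nn_integral_monotone_convergence_SUP[symmetric])
    show "incseq (\<lambda>n X. 1 + len_val n (card X))"
      by (intro incseq_SucI le_funI add_left_mono len_val_mono)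
    show "(\<lambda>X. 1 + len_val n (card X)) \<in> borel_measurable Q" for n
      by (rule measurable_nat_fun[of "\<lambda>c. 1 + len_val n c"])
  qed
  also have "\<dots> = (\<integral>\<^sup>+X. 1 + of_nat (card X) * ennreal l \<partial>Q)"
  proof (rule nn_integral_cong)
    fix X
    have "(SUP n. 1 + len_val n (card X)) = 1 + len_lim (card X)"
      unfolding len_lim_def using ennreal_SUP_add[of "\<lambda>_. 1" "\<lambda>n. len_val n (card X)"] len_val_incseq
      by (simp add: incseq_const)
    then show "(SUP n. 1 + len_val n (card X)) = 1 + of_nat (card X) * ennreal l"
      using len_lim_mult[of "card X"] l by simp
  qed
  also have "\<dots> = 1 + ennreal a * ennreal l"
    using measurable_nat_fun[of of_nat] measurable_nat_fun[of "\<lambda>c. of_nat c * ennreal l"]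
    by (subst nn_integral_add) (simp_all add: Q.emeasure_space_1 nn_integral_multc mean)
  finally have e: "len_lim 1 = 1 + ennreal a * ennreal l" .
  have "1 + ennreal a * ennreal l = ennreal (1 + a * l)"
    using l(2) a by (simp flip: ennreal_mult ennreal_1 ennreal_plus)
  with e[unfolded l(1)] have "ennreal l = ennreal (1 + a * l)" by (rule trans)
  then have "l = 1 + a * l" using l(2) a by (subst (asm) ennreal_inj) auto
  then have d: "l - a * l = 1" by linarith
  have "l * (1 - a) = l - a * l" by (simp add: algebra_simps)
  from this d have "l * (1 - a) = 1" by (rule trans)
  then have "l = ?c" using a(2) by (simp add: eq_divide_eq)
  then show ?thesis unfolding l(1) by (rule arg_cong)
qed

text \<open>The two encodings of non-termination agree: the truncated length is then N for every N,
  and \<open>cluster_size []\<close> is \<infinity>.\<close>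

lemma cluster_size_SUP: "cluster_size (grow_cluster t (rooted H)) = (SUP n. of_nat (walk_len n 1 H))"
proof (cases "\<exists>n. stop_at (rooted H) n")
  case True
  then obtain n where n: "stop_at (rooted H) n" by auto
  have w: "walk_stop 1 H n" using n by (simp add: stop_at_walk)
  have uniq: "m = n" if "walk_stop 1 H m" for m
    using that w stop_at_unique[of "rooted H" m n] by (simp add: stop_at_walk)
  have the: "(THE m. walk_stop 1 H m) = n" by (rule the_equality[where P="walk_stop 1 H", OF w uniq])
  have len: "walk_len N 1 H = (if n \<le> N then n else N)" for N
  proof (cases "n \<le> N")
    case True
    then have "\<exists>m\<le>N. walk_stop 1 H m" using w by blast
    then show ?thesis unfolding walk_len_eq using True the by simp
  next
    case False
    then have eq: "(\<exists>m\<le>N. walk_stop 1 H m) = False" using uniq by blast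
    show ?thesis unfolding walk_len_eq eq using False by simp
  qed
  have "(SUP N. of_nat (walk_len N 1 H)) = (of_nat n :: ennreal)"
  proof (rule antisym)
    show "(SUP N. of_nat (walk_len N 1 H)) \<le> (of_nat n :: ennreal)"
      by (rule SUP_least, subst len) simp
    show "(of_nat n :: ennreal) \<le> (SUP N. of_nat (walk_len N 1 H))"
      by (rule SUP_upper2[of n], simp, subst len) simp
  qed
  moreover have "length (grow_cluster t (rooted H)) = n" "0 < n" using grow_cluster_stop(2)[OF n, of t] grow_cluster_stop(3)[OF n] by auto
  moreover from this have "grow_cluster t (rooted H) \<noteq> []" by auto
  ultimately show ?thesis by (simp add: cluster_size_def)
next
  case False
  then have "walk_len N 1 H = N" for N by (auto simp: walk_len_eq stop_at_walk)
  moreover have "grow_cluster t (rooted H) = []" using False by (simp add: grow_cluster_nil_iff)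
  ultimately show ?thesis by (simp add: cluster_size_def ennreal_SUP_of_nat_eq_top)
qed

lemma cluster_integral:
  assumes \<Phi>: "\<Phi> \<in> borel_measurable cluster_space"
  shows "(\<integral>\<^sup>+C. \<Phi> C \<partial>distr QS cluster_space (grow_cluster t)) = (\<integral>\<^sup>+H. \<Phi> (grow_cluster t (rooted H)) \<partial>QS)"
proof -
  have g: "grow_cluster t \<in> measurable QS cluster_space" unfolding measurable_QS by (rule measurable_grow_cluster')
  have "(\<integral>\<^sup>+C. \<Phi> C \<partial>distr QS cluster_space (grow_cluster t)) = (\<integral>\<^sup>+G. \<Phi> (grow_cluster t G) \<partial>QS)"
    using \<Phi> by (intro nn_integral_distr[OF g]) simp
  also have "\<dots> = (\<integral>\<^sup>+H. \<Phi> (grow_cluster t (rooted H)) \<partial>QS)"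
    by (rule integral_rooted[OF measurable_compose[OF g \<Phi>]]) (rule arg_cong[where f=\<Phi>], rule grow_cluster_cong, blast)
  finally show ?thesis .
qed

lemma measurable_rooted: "rooted \<in> measurable seq_space seq_space"
proof -
  have "rooted \<in> measurable QS QS" by (rule measurable_cons') (simp add: space_Q)
  then show ?thesis by (simp only: measurable_QS measurable_cong_sets[OF refl sets_QS])
qed

lemma measurable_grow_rooted: "(\<lambda>H. grow_cluster t (rooted H)) \<in> measurable QS cluster_space"
  unfolding measurable_QS by (rule measurable_compose[OF measurable_rooted measurable_grow_cluster'])

lemma expected_cluster_size:
  assumes "(\<integral>\<^sup>+X. of_nat (card X) \<partial>Q) = ennreal a" "0 \<le> a" "a < 1"
  shows "(\<integral>\<^sup>+C. cluster_size C \<partial>distr QS cluster_space (grow_cluster t)) = ennreal (1 / (1 - a))"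
proof -
  have inc: "walk_len n z H \<le> walk_len (Suc n) z H" for n z H
  proof (induction n arbitrary: z H)
    case (Suc n)
    show ?case
    proof (cases "z = 0")
      case False
      then show ?thesis
        using Suc[of "z - 1 + card (H 0)" "\<lambda>k. H (Suc k)"]
        by (subst (1 2) walk_len.simps(2)) (simp only: if_False Suc_le_mono)
    qed simp
  qed simp
  have "(\<integral>\<^sup>+C. cluster_size C \<partial>distr QS cluster_space (grow_cluster t)) = (\<integral>\<^sup>+H. (SUP n. of_nat (walk_len n 1 H)) \<partial>QS)"
    by (simp only: cluster_integral[OF measurable_cluster_size] cluster_size_SUP)
  also have "\<dots> = (SUP n. \<integral>\<^sup>+H. of_nat (walk_len n 1 H) \<partial>QS)"
  proof (rule nn_integral_monotone_convergence_SUP)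
    show "incseq (\<lambda>n H. of_nat (walk_len n 1 H) :: ennreal)"
      by (intro incseq_SucI le_funI of_nat_mono inc)
    show "(\<lambda>H. of_nat (walk_len n 1 H) :: ennreal) \<in> borel_measurable QS" for n
      unfolding measurable_QS by (rule measurable_compose[OF measurable_walk_len]) simp
  qed
  also have "\<dots> = ennreal (1 / (1 - a))"
    unfolding len_val_integral len_lim_def[symmetric] by (rule len_lim_value[OF assms])
  finally show ?thesis .
qed

lemma measurable_stop: "Measurable.pred QS (\<lambda>H. stop_at (rooted H) n)"
proof -
  have h: "(\<lambda>H. H j) \<in> measurable seq_space (config_space borel)" for j by simp
  have c: "(\<lambda>H. card (H j)) \<in> measurable seq_space (count_space UNIV)" for j
    by (rule measurable_compose[OF h measurable_card_config_UNIV])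
  have s: "(\<lambda>H. \<Sum>i<j. card (H i)) \<in> measurable seq_space (count_space UNIV)" for j
  proof (induction j)
    case (Suc j)
    note [measurable] = Suc c[of j]
    show ?case unfolding sum.lessThan_Suc by measurable
  qed simp
  have le: "Measurable.pred seq_space (\<lambda>H. k + (\<Sum>i<j. card (H i)) \<le> m)"
    and less: "Measurable.pred seq_space (\<lambda>H. m < k + (\<Sum>i<j. card (H i)))" for k j m
    by (rule measurable_compose[OF s, of "\<lambda>x. k + x \<le> m"], simp)
       (rule measurable_compose[OF s, of "\<lambda>x. m < k + x"], simp)
  have "Measurable.pred seq_space (\<lambda>H. 1 + (\<Sum>j<n. card (H j)) \<le> n \<and> (\<forall>j\<in>{..<n}. j < 1 + (\<Sum>i<j. card (H i))))"
    by (intro pred_intros_logic pred_intros_finite finite_lessThan le less)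
  then show ?thesis unfolding stop_at_walk walk_stop_def measurable_QS by simp
qed

lemma sum_stop: "stop_at G n \<Longrightarrow> (\<Sum>m. of_bool (stop_at G m) * f m) = (f n :: ennreal)"
proof -
  assume st: "stop_at G n"
  then have "\<not> stop_at G m" if "m \<noteq> n" for m using that stop_at_unique[of G m n] by auto
  then have "(\<Sum>m. of_bool (stop_at G m) * f m) = (\<Sum>m\<in>{n}. of_bool (stop_at G m) * f m)"
    by (intro suminf_finite) auto
  then show ?thesis using st by simp
qed

lemma nonempty_expand:
  "of_bool (grow_cluster t (rooted H) \<noteq> []) * (c::ennreal) = (\<Sum>n. of_bool (stop_at (rooted H) n) * c)"
proof (cases "\<exists>n. stop_at (rooted H) n")
  case True
  then obtain n where "stop_at (rooted H) n" by auto
  then show ?thesis using sum_stop[of "rooted H" n "\<lambda>_. c"] grow_cluster_nil_iff[of t "rooted H"] by auto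
next
  case False
  then show ?thesis using grow_cluster_nil_iff[of t "rooted H"] by simp
qed

end

text \<open>On infinite sequences the two product laws need not be absolutely continuous. The ratio
  is therefore applied to functions of the first n coordinates, where it is a finite
  product.\<close>

lemma seq_change_of_measure:
  assumes Q: "offspring Q" and P: "offspring P" and PQ: "P = density Q r"
    and r: "r \<in> borel_measurable (config_space borel)"
    and F: "F \<in> borel_measurable seq_space" and dep: "\<And>H H'. (\<And>k. k < n \<Longrightarrow> H k = H' k) \<Longrightarrow> F H = F H'"
  shows "(\<integral>\<^sup>+H. F H \<partial>PiM UNIV (\<lambda>_::nat. P)) = (\<integral>\<^sup>+H. F H * (\<Prod>k<n. r (H k)) \<partial>PiM UNIV (\<lambda>_::nat. Q))"
  using F dep
proof (induction n arbitrary: F)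
  case 0
  interpret Q: offspring Q by fact
  interpret P: offspring P by fact
  have "F H = F (\<lambda>_. {})" for H by (rule 0) simp
  then have "F = (\<lambda>_. F (\<lambda>_. {}))" by blast
  then obtain c where "F = (\<lambda>_. c)" by blast
  then show ?case by (simp add: Q.S.P.emeasure_space_1 P.S.P.emeasure_space_1)
next
  case (Suc n)
  interpret Q: offspring Q by fact
  interpret P: offspring P by fact
  have rQ: "r \<in> borel_measurable Q" using r by (simp add: Q.measurable_Q)
  have FX: "(\<lambda>H. F (case_nat X H)) \<in> borel_measurable seq_space" if "X \<in> space Q" for X
    using measurable_compose[OF Q.measurable_cons'[OF that], of F borel] Suc.prems(1) by (simp add: Q.measurable_QS)
  have prm: "(\<lambda>H. \<Prod>k<m. r (H k)) \<in> borel_measurable seq_space" for m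
    by (intro borel_measurable_prod_ennreal measurable_compose[OF _ r]) simp
  have "(\<integral>\<^sup>+H. F H \<partial>PiM UNIV (\<lambda>_::nat. P)) = (\<integral>\<^sup>+X. \<integral>\<^sup>+H. F (case_nat X H) \<partial>PiM UNIV (\<lambda>_::nat. P) \<partial>P)"
    by (rule P.integral_cons) (use Suc.prems(1) in \<open>simp add: P.measurable_QS\<close>)
  also have "\<dots> = (\<integral>\<^sup>+X. \<integral>\<^sup>+H. F (case_nat X H) * (\<Prod>k<n. r (H k)) \<partial>PiM UNIV (\<lambda>_::nat. Q) \<partial>P)"
  proof (rule nn_integral_cong)
    fix X assume "X \<in> space P"
    then have X: "X \<in> space Q" by (simp add: P.space_Q Q.space_Q)
    show "(\<integral>\<^sup>+H. F (case_nat X H) \<partial>PiM UNIV (\<lambda>_::nat. P)) = (\<integral>\<^sup>+H. F (case_nat X H) * (\<Prod>k<n. r (H k)) \<partial>PiM UNIV (\<lambda>_::nat. Q))"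
      by (rule Suc.IH[OF FX[OF X]], rule Suc.prems(2)) (auto split: nat.split)
  qed
  also have "\<dots> = (\<integral>\<^sup>+X. r X * (\<integral>\<^sup>+H. F (case_nat X H) * (\<Prod>k<n. r (H k)) \<partial>PiM UNIV (\<lambda>_::nat. Q)) \<partial>Q)"
    unfolding PQ
  proof (rule nn_integral_density[OF rQ])
    have "(\<lambda>p. F (case_nat (fst p) (snd p)) * (\<Prod>k<n. r (snd p k))) \<in> borel_measurable (Q \<Otimes>\<^sub>M PiM UNIV (\<lambda>_::nat. Q))"
    proof (intro borel_measurable_times_ennreal)
      show "(\<lambda>p. F (case_nat (fst p) (snd p))) \<in> borel_measurable (Q \<Otimes>\<^sub>M PiM UNIV (\<lambda>_::nat. Q))"
        using measurable_compose[OF Q.measurable_cons, of F borel] Suc.prems(1)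
        by (simp add: Q.measurable_QS case_prod_unfold)
      show "(\<lambda>p. \<Prod>k<n. r (snd p k)) \<in> borel_measurable (Q \<Otimes>\<^sub>M PiM UNIV (\<lambda>_::nat. Q))"
        by (rule measurable_compose[OF measurable_snd]) (simp only: Q.measurable_QS prm)
    qed
    then show "(\<lambda>X. \<integral>\<^sup>+H. F (case_nat X H) * (\<Prod>k<n. r (H k)) \<partial>PiM UNIV (\<lambda>_::nat. Q)) \<in> borel_measurable Q"
      by (intro Q.S.P.borel_measurable_nn_integral) (simp add: case_prod_unfold)
  qed
  also have "\<dots> = (\<integral>\<^sup>+X. \<integral>\<^sup>+H. F (case_nat X H) * (\<Prod>k<Suc n. r (case_nat X H k)) \<partial>PiM UNIV (\<lambda>_::nat. Q) \<partial>Q)"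
  proof (rule nn_integral_cong)
    fix X assume X: "X \<in> space Q"
    have "r X * (\<integral>\<^sup>+H. F (case_nat X H) * (\<Prod>k<n. r (H k)) \<partial>PiM UNIV (\<lambda>_::nat. Q)) =
      (\<integral>\<^sup>+H. r X * (F (case_nat X H) * (\<Prod>k<n. r (H k))) \<partial>PiM UNIV (\<lambda>_::nat. Q))"
      by (rule nn_integral_cmult[symmetric]) (intro borel_measurable_times_ennreal, simp_all only: Q.measurable_QS prm FX[OF X])
    also have "\<dots> = (\<integral>\<^sup>+H. F (case_nat X H) * (\<Prod>k<Suc n. r (case_nat X H k)) \<partial>PiM UNIV (\<lambda>_::nat. Q))"
      by (intro nn_integral_cong) (simp add: prod.lessThan_Suc_shift mult_ac del: prod.lessThan_Suc)
    finally show "r X * (\<integral>\<^sup>+H. F (case_nat X H) * (\<Prod>k<n. r (H k)) \<partial>PiM UNIV (\<lambda>_::nat. Q)) =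
      (\<integral>\<^sup>+H. F (case_nat X H) * (\<Prod>k<Suc n. r (case_nat X H k)) \<partial>PiM UNIV (\<lambda>_::nat. Q))" .
  qed
  also have "\<dots> = (\<integral>\<^sup>+H. F H * (\<Prod>k<Suc n. r (H k)) \<partial>PiM UNIV (\<lambda>_::nat. Q))"
    by (rule Q.integral_cons[symmetric], intro borel_measurable_times_ennreal)
       (simp_all only: Q.measurable_QS prm Suc.prems(1))
  finally show ?case .
qed

lemma offspring_offspring_law: "is_density \<phi> \<Longrightarrow> 0 \<le> a \<Longrightarrow> offspring (offspring_law a \<phi>)"
  by (simp add: offspring_def offspring_prob_space offspring_law(1))

lemma stop_at_rooted_cong: "(\<And>k. k < n \<Longrightarrow> H k = H' k) \<Longrightarrow> stop_at (rooted H) n \<longleftrightarrow> stop_at (rooted H') n"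
proof -
  assume eq: "\<And>k. k < n \<Longrightarrow> H k = H' k"
  have "(\<Sum>i<j. card (H i)) = (\<Sum>i<j. card (H' i))" if "j \<le> n" for j
    using that eq by (intro sum.cong) auto
  then show ?thesis by (auto simp: stop_at_walk walk_stop_def)
qed

text \<open>Terminated clusters are split by their number n of events, since on
  \<open>stop_at (rooted H) n\<close> only the first n offspring sets matter. The product of the n
  one-step ratios then no longer involves n. Nothing is claimed about constructions that do not
  stop.\<close>

lemma cluster_law_tilt:
  fixes \<phi> \<phi>' :: "real \<Rightarrow> real"
  assumes \<phi>: "is_density \<phi>" "is_density \<phi>'" and a: "0 \<le> a" "0 \<le> a'" and \<psi>: "\<psi> = a' - a"
    and eq: "\<And>t. 0 \<le> t \<Longrightarrow> a * \<phi> t = exp (- \<psi> - \<eta> * t) * (a' * \<phi>' t)"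
    and \<Phi>: "\<Phi> \<in> borel_measurable cluster_space"
  shows "(\<integral>\<^sup>+C. of_bool (C \<noteq> []) * \<Phi> C \<partial>cluster_law a \<phi> t) =
    (\<integral>\<^sup>+C. of_bool (C \<noteq> []) * (\<Phi> C * ennreal (exp (\<psi> - \<eta> * total_birth_time C))) \<partial>cluster_law a' \<phi>' t)"
proof -
  let ?P = "offspring_law a \<phi>" and ?Q = "offspring_law a' \<phi>'"
  interpret P: offspring ?P by (rule offspring_offspring_law[OF \<phi>(1) a(1)])
  interpret Q: offspring ?Q by (rule offspring_offspring_law[OF \<phi>(2) a(2)])
  define r where "r X = ennreal (exp (a' - a)) * (\<Prod>x\<in>X. ennreal (exp (- \<psi> - \<eta> * x)))" for X
  have PQ: "?P = density ?Q r"
    unfolding r_def by (rule offspring_density[OF \<phi> a]) (auto simp: eq)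
  have r[measurable]: "r \<in> borel_measurable (config_space borel)"
    unfolding r_def by (intro borel_measurable_times_ennreal measurable_config_prod) measurable
  have rX: "r X = ennreal (exp (\<psi> - \<psi> * real (card X) - \<eta> * (\<Sum>x\<in>X. x)))" for X
  proof -
    have "(\<Prod>x\<in>X. exp (- \<psi> - \<eta> * x)) = exp (- \<psi> * real (card X) - \<eta> * (\<Sum>x\<in>X. x))"
    proof (cases "finite X")
      case True
      then have "(\<Prod>x\<in>X. exp (- \<psi> - \<eta> * x)) = exp (\<Sum>x\<in>X. - \<psi> - \<eta> * x)" by (simp add: exp_sum)
      then show ?thesis by (simp add: sum_subtractf sum_distrib_left mult.commute)
    qed simp
    then show ?thesis
      unfolding r_def \<psi>[symmetric] by (simp add: prod_ennreal mult_exp_exp algebra_simps flip: ennreal_mult)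
  qed
  have rn: "(\<Prod>k<n. r (H k)) = ennreal (exp (\<psi> - \<eta> * total_birth_time (grow_cluster t (rooted H))))"
    if st: "stop_at (rooted H) n" for H n
  proof -
    note g = grow_cluster_stop[OF st]
    have s1: "(\<Sum>k<n. card (H k)) = n - 1" using g(4) by (simp add: sum.atLeast1_atMost_eq)
    have s2: "total_birth_time (grow_cluster t (rooted H)) = (\<Sum>k<n. \<Sum>x\<in>H k. x)" using g(6) by (simp add: sum.atLeast1_atMost_eq)
    have "(\<Prod>k<n. r (H k)) = ennreal (\<Prod>k<n. exp (\<psi> - \<psi> * real (card (H k)) - \<eta> * (\<Sum>x\<in>H k. x)))"
      unfolding rX by (rule prod_ennreal) simp
    also have "(\<Prod>k<n. exp (\<psi> - \<psi> * real (card (H k)) - \<eta> * (\<Sum>x\<in>H k. x))) =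
      exp (\<Sum>k<n. \<psi> - \<psi> * real (card (H k)) - \<eta> * (\<Sum>x\<in>H k. x))" by (simp add: exp_sum)
    also have "(\<Sum>k<n. \<psi> - \<psi> * real (card (H k)) - \<eta> * (\<Sum>x\<in>H k. x)) =
      real n * \<psi> - \<psi> * real (\<Sum>k<n. card (H k)) - \<eta> * (\<Sum>k<n. \<Sum>x\<in>H k. x)"
      by (simp add: sum_subtractf sum_distrib_left)
    \<comment> \<open>A cluster with n events has n - 1 births, so n \<psi> - (n - 1) \<psi> =
      \<psi>; this is why the ratio depends on the cluster only through its total birth
      time.\<close>
    also have "real n * \<psi> - \<psi> * real (\<Sum>k<n. card (H k)) = \<psi>"
      using g(3) unfolding s1 by (simp add: of_nat_diff algebra_simps)
    finally show ?thesis unfolding s2 .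
  qed
  have bm: "(\<lambda>C. of_bool (C \<noteq> []) * \<Psi> C :: ennreal) \<in> borel_measurable cluster_space"
    if "\<Psi> \<in> borel_measurable cluster_space" for \<Psi>
  proof -
    have "Measurable.pred cluster_space (\<lambda>C. length C \<noteq> 0)" by measurable
    then have "Measurable.pred cluster_space (\<lambda>C. C \<noteq> [])" by simp
    then show ?thesis using that by measurable
  qed
  have gm: "(\<lambda>H. grow_cluster t (rooted H)) \<in> measurable seq_space cluster_space"
    using P.measurable_grow_rooted by (simp add: P.measurable_QS)
  have stm: "(\<lambda>H. of_bool (stop_at (rooted H) n) :: ennreal) \<in> borel_measurable seq_space" for n
    using P.measurable_stop[of n] unfolding P.measurable_QS by measurable
  have Fm: "(\<lambda>H. of_bool (stop_at (rooted H) n) * (\<Psi> (grow_cluster t (rooted H)) :: ennreal)) \<in> borel_measurable seq_space"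
    if "\<Psi> \<in> borel_measurable cluster_space" for n \<Psi>
    by (intro borel_measurable_times_ennreal stm measurable_compose[OF gm that])
  have dep: "of_bool (stop_at (rooted H) n) * \<Phi> (grow_cluster t (rooted H)) = of_bool (stop_at (rooted H') n) * \<Phi> (grow_cluster t (rooted H'))"
    if eq: "\<And>k. k < n \<Longrightarrow> H k = H' k" for H H' n
  proof (cases "stop_at (rooted H) n")
    case True
    then have T': "stop_at (rooted H') n" using stop_at_rooted_cong[of n H H'] eq by simp
    have "explore t (rooted H) n = explore t (rooted H') n"
      by (rule explore_cong) (use eq in \<open>auto split: nat.split\<close>)
    then show ?thesis using True T' grow_cluster_stop(1)[OF True, of t] grow_cluster_stop(1)[OF T', of t] by simp
  qed (use stop_at_rooted_cong[of n H H'] eq in simp)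
  have \<Psi>: "(\<lambda>C. \<Phi> C * ennreal (exp (\<psi> - \<eta> * total_birth_time C))) \<in> borel_measurable cluster_space" (is "?\<Psi> \<in> _")
    using \<Phi> by measurable
  have "(\<integral>\<^sup>+C. of_bool (C \<noteq> []) * \<Phi> C \<partial>cluster_law a \<phi> t) =
    (\<integral>\<^sup>+H. (\<Sum>n. of_bool (stop_at (rooted H) n) * \<Phi> (grow_cluster t (rooted H))) \<partial>P.QS)"
    unfolding cluster_law_def by (simp only: P.cluster_integral[OF bm[OF \<Phi>]] P.nonempty_expand)
  also have "\<dots> = (\<Sum>n. \<integral>\<^sup>+H. of_bool (stop_at (rooted H) n) * \<Phi> (grow_cluster t (rooted H)) \<partial>P.QS)"
    by (rule nn_integral_suminf) (simp only: P.measurable_QS Fm[OF \<Phi>])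
  also have "\<dots> = (\<Sum>n. \<integral>\<^sup>+H. of_bool (stop_at (rooted H) n) * \<Phi> (grow_cluster t (rooted H)) * (\<Prod>k<n. r (H k)) \<partial>Q.QS)"
    by (intro suminf_cong seq_change_of_measure[OF Q.offspring_axioms P.offspring_axioms PQ r Fm[OF \<Phi>] dep])
  also have "\<dots> = (\<Sum>n. \<integral>\<^sup>+H. of_bool (stop_at (rooted H) n) * ?\<Psi> (grow_cluster t (rooted H)) \<partial>Q.QS)"
  proof (intro suminf_cong nn_integral_cong)
    fix n H
    show "of_bool (stop_at (rooted H) n) * \<Phi> (grow_cluster t (rooted H)) * (\<Prod>k<n. r (H k)) =
      of_bool (stop_at (rooted H) n) * ?\<Psi> (grow_cluster t (rooted H))"
      using rn[of H n] by (cases "stop_at (rooted H) n") (simp_all add: mult.assoc)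
  qed
  also have "\<dots> = (\<integral>\<^sup>+H. (\<Sum>n. of_bool (stop_at (rooted H) n) * ?\<Psi> (grow_cluster t (rooted H))) \<partial>Q.QS)"
    by (rule nn_integral_suminf[symmetric]) (simp only: Q.measurable_QS Fm[OF \<Psi>])
  also have "\<dots> = (\<integral>\<^sup>+C. of_bool (C \<noteq> []) * ?\<Psi> C \<partial>cluster_law a' \<phi>' t)"
    unfolding cluster_law_def by (simp only: Q.cluster_integral[OF bm[OF \<Psi>]] Q.nonempty_expand)
  finally show ?thesis .
qed

section \<open>Exponential moments of the total birth time\<close>

text \<open>Non-terminating constructions, encoded by \<open>[]\<close>, must not contribute: their \<^const>\<open>total_birth_time\<close>
  is the junk value 0.\<close>

definition cluster_mgf :: "real \<Rightarrow> (real \<Rightarrow> real) \<Rightarrow> real \<Rightarrow> real \<Rightarrow> ennreal" where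
  "cluster_mgf a \<phi> t \<theta> = (\<integral>\<^sup>+C. of_bool (C \<noteq> []) * ennreal (exp (\<theta> * total_birth_time C)) \<partial>cluster_law a \<phi> t)"

lemma measurable_nonempty:
  "\<Psi> \<in> borel_measurable cluster_space \<Longrightarrow> (\<lambda>C. of_bool (C \<noteq> []) * \<Psi> C :: ennreal) \<in> borel_measurable cluster_space"
proof -
  assume \<Psi>: "\<Psi> \<in> borel_measurable cluster_space"
  have "Measurable.pred cluster_space (\<lambda>C. length C \<noteq> 0)" by measurable
  then have "Measurable.pred cluster_space (\<lambda>C. C \<noteq> [])" by simp
  then show ?thesis using \<Psi> by measurable
qed

text \<open>The total birth time is the sum of all points used by the exploration, so its
  exponential is a product of weights along the walk.\<close>

lemma cluster_mgf_walk:
  assumes \<phi>: "is_density \<phi>" and a: "0 \<le> a"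
  shows "cluster_mgf a \<phi> t \<theta> = offspring.walk_lim (offspring_law a \<phi>) (\<lambda>X. \<Prod>x\<in>X. ennreal (exp (\<theta> * x))) 1"
proof -
  interpret P: offspring "offspring_law a \<phi>" by (rule offspring_offspring_law[OF \<phi> a])
  let ?w = "\<lambda>X. \<Prod>x\<in>X. ennreal (exp (\<theta> * x))"
  have w: "?w \<in> borel_measurable (config_space borel)" by (rule measurable_config_prod) measurable
  have wX: "?w X = ennreal (exp (\<theta> * (\<Sum>x\<in>X. x)))" for X
  proof (cases "finite X")
    case True
    then show ?thesis by (simp add: prod_ennreal exp_sum sum_distrib_left)
  qed simp
  have "cluster_mgf a \<phi> t \<theta> = (\<integral>\<^sup>+H. (\<Sum>n. of_bool (stop_at (rooted H) n) *
      ennreal (exp (\<theta> * total_birth_time (grow_cluster t (rooted H))))) \<partial>P.QS)"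
    unfolding cluster_mgf_def cluster_law_def
    by (subst P.cluster_integral[OF measurable_nonempty]) (measurable, simp only: P.nonempty_expand)
  also have "\<dots> = (\<integral>\<^sup>+H. (\<Sum>n. of_bool (stop_at (rooted H) n) * (\<Prod>j<n. ?w (H j))) \<partial>P.QS)"
  proof (intro nn_integral_cong suminf_cong)
    fix H n
    show "of_bool (stop_at (rooted H) n) * ennreal (exp (\<theta> * total_birth_time (grow_cluster t (rooted H)))) =
      of_bool (stop_at (rooted H) n) * (\<Prod>j<n. ?w (H j))"
    proof (cases "stop_at (rooted H) n")
      case True
      have "total_birth_time (grow_cluster t (rooted H)) = (\<Sum>k<n. \<Sum>x\<in>H k. x)"
        using grow_cluster_stop(6)[OF True, of t] by (simp add: sum.atLeast1_atMost_eq)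
      moreover have "(\<Prod>j<n. ?w (H j)) = ennreal (exp (\<theta> * (\<Sum>k<n. \<Sum>x\<in>H k. x)))"
        unfolding wX by (simp add: prod_ennreal exp_sum sum_distrib_left)
      ultimately show ?thesis by simp
    qed simp
  qed
  also have "\<dots> = P.walk_lim ?w 1" by (rule P.integral_stop[OF w])
  finally show ?thesis .
qed

lemma prod_mult_power_card:
  fixes c :: ennreal
  shows "(\<Prod>x\<in>X. u x) * c ^ card X = (\<Prod>x\<in>X. u x * c)"
  by (simp add: prod.distrib)

lemma cluster_mgf_fixpoint:
  assumes \<phi>: "is_density \<phi>" and a: "0 \<le> a"
  shows "cluster_mgf a \<phi> t \<theta> = (\<integral>\<^sup>+X. (\<Prod>x\<in>X. ennreal (exp (\<theta> * x)) * cluster_mgf a \<phi> t \<theta>) \<partial>offspring_law a \<phi>)"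
proof -
  interpret P: offspring "offspring_law a \<phi>" by (rule offspring_offspring_law[OF \<phi> a])
  have w: "(\<lambda>X. \<Prod>x\<in>X. ennreal (exp (\<theta> * x))) \<in> borel_measurable (config_space borel)"
    by (rule measurable_config_prod) measurable
  show ?thesis
    using P.walk_lim_fixpoint[OF w] unfolding cluster_mgf_walk[OF \<phi> a, symmetric, of \<theta> t] prod_mult_power_card .
qed

lemma cluster_mgf_minimal:
  assumes \<phi>: "is_density \<phi>" and a: "0 \<le> a"
    and y: "(\<integral>\<^sup>+X. (\<Prod>x\<in>X. ennreal (exp (\<theta> * x)) * y) \<partial>offspring_law a \<phi>) \<le> y"
  shows "cluster_mgf a \<phi> t \<theta> \<le> y"
proof -
  interpret P: offspring "offspring_law a \<phi>" by (rule offspring_offspring_law[OF \<phi> a])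
  have w: "(\<lambda>X. \<Prod>x\<in>X. ennreal (exp (\<theta> * x))) \<in> borel_measurable (config_space borel)"
    by (rule measurable_config_prod) measurable
  show ?thesis
    unfolding cluster_mgf_walk[OF \<phi> a] by (rule P.walk_lim_minimal[OF w]) (use y in \<open>simp only: prod_mult_power_card\<close>)
qed

section \<open>The cluster law as a kernel, and its almost sure properties\<close>

lemma sets_cluster_law [simp]: "sets (cluster_law a \<phi> t) = sets cluster_space"
  by (simp add: cluster_law_def)

lemma prob_space_cluster_law:
  assumes "is_density \<phi>" "0 \<le> a"
  shows "prob_space (cluster_law a \<phi> t)"
proof -
  interpret P: offspring "offspring_law a \<phi>" by (rule offspring_offspring_law[OF assms])
  show ?thesis unfolding cluster_law_def
    by (rule P.S.P.prob_space_distr) (simp only: P.measurable_QS measurable_grow_cluster')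
qed

lemma cluster_kernel:
  assumes "is_density \<phi>" "0 \<le> a"
  shows "cluster_law a \<phi> \<in> measurable borel (prob_algebra cluster_space)"
proof (rule measurable_prob_algebraI)
  interpret P: offspring "offspring_law a \<phi>" by (rule offspring_offspring_law[OF assms])
  show "prob_space (cluster_law a \<phi> t)" for t by (rule prob_space_cluster_law[OF assms])
  have s: "sets (borel \<Otimes>\<^sub>M P.QS) = sets (borel \<Otimes>\<^sub>M seq_space)" by (rule sets_pair_measure_cong[OF refl P.sets_QS])
  have "(\<lambda>t. distr P.QS cluster_space (grow_cluster t)) \<in> measurable borel (subprob_algebra cluster_space)"
  proof (rule measurable_distr2)
    show "(\<lambda>(t, G). grow_cluster t G) \<in> measurable (borel \<Otimes>\<^sub>M P.QS) cluster_space"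
      unfolding measurable_cong_sets[OF s refl] by (rule measurable_grow_cluster)
    have "P.QS \<in> space (subprob_algebra P.QS)"
      by (simp add: space_subprob_algebra) (rule P.S.P.prob_space_axioms[THEN prob_space_imp_subprob_space])
    then show "(\<lambda>t. P.QS) \<in> measurable borel (subprob_algebra P.QS)" by simp
  qed
  then show "cluster_law a \<phi> \<in> measurable borel (subprob_algebra cluster_space)"
    by (simp add: cluster_law_def[abs_def])
qed

lemma is_density_total:
  "is_density \<phi> \<Longrightarrow> (\<integral>\<^sup>+t\<in>{0..}. c * ennreal (\<phi> t) \<partial>lborel) = c"
proof -
  assume \<phi>: "is_density \<phi>"
  then have [measurable]: "\<phi> \<in> borel_measurable borel" by (simp add: is_density_def)
  have "(\<integral>\<^sup>+t\<in>{0..}. c * ennreal (\<phi> t) \<partial>lborel) = (\<integral>\<^sup>+t. c * (ennreal (\<phi> t) * indicator {0..} t) \<partial>lborel)"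
    by (simp add: mult.assoc)
  also have "\<dots> = c * (\<integral>\<^sup>+t\<in>{0..}. ennreal (\<phi> t) \<partial>lborel)" by (rule nn_integral_cmult) measurable
  finally show ?thesis using \<phi> by (simp add: is_density_def)
qed

text \<open>At \<theta> = 0 the moment is the termination probability q, and the fixed point
  equation reads q = exp (a (q - 1)). With exp u \<ge> 1 + u this gives (1 - q) (1 - a) \<le> 0,
  hence q = 1.\<close>

lemma cluster_nonempty_AE:
  assumes \<phi>: "is_density \<phi>" and a: "0 \<le> a" "a < 1"
  shows "AE C in cluster_law a \<phi> t. C \<noteq> []"
proof -
  interpret K: prob_space "cluster_law a \<phi> t" by (rule prob_space_cluster_law[OF \<phi> a(1)])
  have m: "Measurable.pred cluster_space (\<lambda>C. C \<noteq> [])"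
  proof -
    have "Measurable.pred cluster_space (\<lambda>C. length C \<noteq> 0)" by measurable
    then show ?thesis by simp
  qed
  then have S: "{C \<in> space cluster_space. C \<noteq> []} \<in> sets cluster_space" by (rule predE)
  let ?E = "{C \<in> space (cluster_law a \<phi> t). C \<noteq> []}"
  have E: "?E \<in> sets (cluster_law a \<phi> t)" using S sets_eq_imp_space_eq[OF sets_cluster_law] by simp
  define q where "q = K.prob ?E"
  have q: "cluster_mgf a \<phi> t 0 = ennreal q"
  proof -
    have "cluster_mgf a \<phi> t 0 = (\<integral>\<^sup>+C. indicator ?E C \<partial>cluster_law a \<phi> t)"
      unfolding cluster_mgf_def by (intro nn_integral_cong) (simp add: indicator_def)
    then show ?thesis using E by (simp add: q_def K.emeasure_eq_measure)
  qed
  have q0: "0 \<le> q" "q \<le> 1" by (simp_all add: q_def)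
  have "ennreal q = (\<integral>\<^sup>+X. (\<Prod>x\<in>X. ennreal q) \<partial>offspring_law a \<phi>)"
    using cluster_mgf_fixpoint[OF \<phi> a(1), of t 0] unfolding q by (simp del: prod_constant)
  also have "\<dots> = ennreal (exp (a * (q - 1)))"
    by (rule offspring_prod_finite[OF \<phi> a(1) _ q0(1) is_density_total[OF \<phi>]]) simp
  finally have "q = exp (a * (q - 1))" using q0(1) by (subst (asm) ennreal_inj) auto
  then have "1 + a * (q - 1) \<le> q" using exp_ge_add_one_self[of "a * (q - 1)"] by linarith
  then have "(1 - q) * (1 - a) \<le> 0" by (simp add: algebra_simps)
  then have "q = 1" using a q0 by (smt (verit) mult_pos_pos)
  then show ?thesis using E unfolding q_def by (subst (asm) K.prob_eq_1) auto
qed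

text \<open>Termination makes the list a valid cluster, and births are nonnegative since almost
  every offspring set lies in \<open>{0..}\<close>. The rest is deterministic.\<close>

lemma cluster_props_AE:
  assumes \<phi>: "is_density \<phi>" and a: "0 \<le> a" "a < 1"
  shows "AE C in cluster_law a \<phi> t. C \<noteq> [] \<and> arrival_time C = t \<and> 0 \<le> cluster_length C \<and> cluster_length C \<le> total_birth_time C"
proof -
  interpret P: offspring "offspring_law a \<phi>" by (rule offspring_offspring_law[OF \<phi> a(1)])
  have g: "grow_cluster t \<in> measurable P.QS cluster_space" by (simp only: P.measurable_QS measurable_grow_cluster')
  have ne: "AE G in P.QS. grow_cluster t G \<noteq> []"
    using cluster_nonempty_AE[OF \<phi> a, of t] unfolding cluster_law_def by (rule AE_distrD[OF g])
  have "AE G in P.QS. \<forall>i. G i \<subseteq> {0..}"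
  proof -
    have "AE X in offspring_law a \<phi>. X \<subseteq> {0..}" using offspring_AE[OF \<phi> a(1)] by eventually_elim simp
    then have "AE G in P.QS. G i \<subseteq> {0..}" for i
      by (intro AE_PiM_component[where P="\<lambda>X. X \<subseteq> {0..}"]) (auto simp: P.prob_Q)
    then show ?thesis by (simp add: AE_all_countable)
  qed
  with ne have AE: "AE G in P.QS. grow_cluster t G \<noteq> [] \<and> arrival_time (grow_cluster t G) = t \<and>
    0 \<le> cluster_length (grow_cluster t G) \<and> cluster_length (grow_cluster t G) \<le> total_birth_time (grow_cluster t G)"
  proof eventually_elim
    case (elim G)
    let ?C = "grow_cluster t G"
    obtain n where n: "stop_at G n" using elim(1) grow_cluster_nil_iff[of t G] by blast
    have v: "valid_cluster t ?C" by (rule grow_cluster_stop(5)[OF n])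
    have b: "0 \<le> birth_time ?C i" if "i \<in> {2..length ?C}" for i
      using grow_cluster_stop(7)[OF n, of i t] that grow_cluster_stop(2)[OF n, of t] elim(2) by auto
    have arr: "arrival_time ?C = t" using v by (simp add: valid_cluster_def arrival_time_def)
    have "1 \<in> {1..length ?C}" using elim(1) by (simp add: Suc_le_eq)
    then have "event_time ?C 1 \<le> departure_time ?C" unfolding departure_time_def by (intro Max_ge) auto
    then have "0 \<le> cluster_length ?C" by (simp add: cluster_length_def arrival_time_def)
    then show ?case using elim(1) arr cluster_length_le_births[OF v b] by simp
  qed
  have m: "Measurable.pred cluster_space (\<lambda>C. C \<noteq> [] \<and> arrival_time C = t \<and> 0 \<le> cluster_length C \<and> cluster_length C \<le> total_birth_time C)"
  proof -
    have "Measurable.pred cluster_space (\<lambda>C. length C \<noteq> 0 \<and> arrival_time C = t \<and> 0 \<le> cluster_length C \<and> cluster_length C \<le> total_birth_time C)"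
      by measurable
    then show ?thesis by simp
  qed
  show ?thesis unfolding cluster_law_def
    by (subst AE_distr_iff[OF g]) (use predE[OF m] AE in auto)
qed

lemma expected_cluster_size_law:
  assumes \<phi>: "is_density \<phi>" and a: "0 \<le> a" "a < 1"
  shows "(\<integral>\<^sup>+C. cluster_size C \<partial>cluster_law a \<phi> t) = ennreal (1 / (1 - a))"
proof -
  interpret P: offspring "offspring_law a \<phi>" by (rule offspring_offspring_law[OF \<phi> a(1)])
  show ?thesis unfolding cluster_law_def
    by (rule P.expected_cluster_size[OF offspring_mean[OF \<phi> a(1)] a])
qed

lemma cluster_tail_shift:
  assumes \<phi>: "is_density \<phi>" and a: "0 \<le> a"
  shows "emeasure (cluster_law a \<phi> t) {C \<in> space cluster_space. cluster_length C > s} = ennreal (length_tail a \<phi> s)"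
proof -
  interpret P: offspring "offspring_law a \<phi>" by (rule offspring_offspring_law[OF \<phi> a])
  interpret K: prob_space "cluster_law a \<phi> 0" by (rule prob_space_cluster_law[OF \<phi> a])
  have g: "grow_cluster t \<in> measurable P.QS cluster_space" for t by (simp only: P.measurable_QS measurable_grow_cluster')
  have S: "{C \<in> space cluster_space. cluster_length C > s} \<in> sets cluster_space" by measurable
  have "emeasure (cluster_law a \<phi> t) {C \<in> space cluster_space. cluster_length C > s} =
    emeasure (cluster_law a \<phi> 0) {C \<in> space cluster_space. cluster_length C > s}"
    unfolding cluster_law_def emeasure_distr[OF g S] by (simp add: vimage_def cluster_length_shift[of t])
  then show ?thesis by (simp add: length_tail_def K.emeasure_eq_measure)
qed

text \<open>The bound \<open>h1 * (m * g) \<le> 1\<close> comes from minimality: \<open>g\<close> is the least \<open>y\<close> with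
  \<open>exp (h1 * (m * y - 1)) \<le> y\<close>, and if \<open>b = h1 * m * g > 1\<close>, then \<open>g / b\<close> satisfies this inequality as well.\<close>

lemma mgf_parameters:
  assumes f: "is_density f" and h: "0 < h1" "h1 < 1"
    and int: "integrable (cluster_law h1 f 0) (\<lambda>c. exp (\<theta> * total_birth_time c))"
  obtains g m where "0 < g" "0 < m" "cluster_mgf h1 f 0 \<theta> = ennreal g" "psi_B h1 f \<theta> = ln g"
    "(\<integral>\<^sup>+t\<in>{0..}. ennreal (exp (\<theta> * t)) * ennreal (f t) \<partial>lborel) = ennreal m" "psi_f f \<theta> = ln m"
    "ln g = h1 * (m * g) - h1" "h1 * (m * g) \<le> 1"
proof -
  have h0: "0 \<le> h1" using h by simp
  have [measurable]: "f \<in> borel_measurable borel" and f0: "\<And>t. 0 \<le> t \<Longrightarrow> 0 \<le> f t" using f by (simp_all add: is_density_def)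
  interpret K: prob_space "cluster_law h1 f 0" by (rule prob_space_cluster_law[OF f h0])
  define g where "g = (\<integral>C. exp (\<theta> * total_birth_time C) \<partial>cluster_law h1 f 0)"
  have "cluster_mgf h1 f 0 \<theta> = (\<integral>\<^sup>+C. ennreal (exp (\<theta> * total_birth_time C)) \<partial>cluster_law h1 f 0)"
    unfolding cluster_mgf_def using cluster_nonempty_AE[OF f h0 h(2), of 0] by (intro nn_integral_cong_AE) (auto elim: eventually_mono)
  also have "\<dots> = ennreal g" unfolding g_def by (rule nn_integral_eq_integral[OF int]) simp
  finally have mg: "cluster_mgf h1 f 0 \<theta> = ennreal g" .
  have g0: "0 \<le> g" unfolding g_def by (rule Bochner_Integration.integral_nonneg) simp
  define v where "v = (\<integral>\<^sup>+t\<in>{0..}. ennreal (exp (\<theta> * t)) * ennreal (f t) \<partial>lborel)"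
  have vy: "(\<integral>\<^sup>+t\<in>{0..}. ennreal (exp (\<theta> * t)) * ennreal y * ennreal (f t) \<partial>lborel) = v * ennreal y" for y
  proof -
    have "(\<integral>\<^sup>+t\<in>{0..}. ennreal (exp (\<theta> * t)) * ennreal y * ennreal (f t) \<partial>lborel) =
      (\<integral>\<^sup>+t. (ennreal (exp (\<theta> * t)) * ennreal (f t) * indicator {0..} t) * ennreal y \<partial>lborel)"
      by (intro nn_integral_cong) (simp add: mult_ac)
    also have "\<dots> = v * ennreal y" unfolding v_def by (rule nn_integral_multc) measurable
    finally show ?thesis .
  qed
  have fp: "ennreal g = (\<integral>\<^sup>+X. (\<Prod>x\<in>X. ennreal (exp (\<theta> * x)) * ennreal g) \<partial>offspring_law h1 f)"
    using cluster_mgf_fixpoint[OF f h0, of 0 \<theta>] unfolding mg .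
  have um: "(\<lambda>x. ennreal (exp (\<theta> * x)) * ennreal y) \<in> borel_measurable borel" for y by measurable
  \<comment> \<open>An infinite value would make the offspring expectation infinite, against the
    fixed point equation and the finiteness of g. With g > 0 this also yields that the exponential
    moment v of f at \<theta> is finite.\<close>
  have "v * ennreal g \<noteq> top"
  proof
    assume "v * ennreal g = top"
    then have "ennreal g = top" using offspring_prod_infinite[OF f h(1) um[of g]] fp vy[of g] by simp
    then show False by simp
  qed
  then obtain r where r: "v * ennreal g = ennreal r" "0 \<le> r" by (cases "v * ennreal g") auto
  have e: "(\<integral>\<^sup>+X. (\<Prod>x\<in>X. ennreal (exp (\<theta> * x)) * ennreal g) \<partial>offspring_law h1 f) = ennreal (exp (h1 * (r - 1)))"
    by (rule offspring_prod_finite[OF f h0 um r(2)]) (rule trans[OF vy r(1)])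
  have "ennreal g = ennreal (exp (h1 * (r - 1)))" by (rule trans[OF fp e])
  then have ge: "g = exp (h1 * (r - 1))" using g0 by (subst (asm) ennreal_inj) auto
  then have gpos: "0 < g" by simp
  have "v \<noteq> top" using r gpos by (auto simp: ennreal_top_mult)
  then obtain m where m: "v = ennreal m" "0 \<le> m" by (cases v) auto
  have rmg: "r = m * g" using r(1) m g0 r(2) by (simp flip: ennreal_mult)
  have "v \<noteq> 0"
  proof
    assume "v = 0"
    then have "AE t in lborel. ennreal (exp (\<theta> * t)) * ennreal (f t) * indicator {0..} t = 0"
      unfolding v_def by (subst (asm) nn_integral_0_iff_AE) auto
    then have "AE t in lborel. ennreal (f t) * indicator {0..} t = 0"
      by eventually_elim (auto simp: indicator_def)
    then have "(\<integral>\<^sup>+t\<in>{0..}. ennreal (f t) \<partial>lborel) = 0"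
      by (subst nn_integral_0_iff_AE) auto
    then show False using f by (simp add: is_density_def)
  qed
  then have mpos: "0 < m" using m by (cases "m = 0") auto
  have psif: "psi_f f \<theta> = ln m"
  proof -
    have "(LINT t:{0..}|lborel. exp (\<theta> * t) * f t) = enn2real (\<integral>\<^sup>+t. ennreal (indicator {0..} t *\<^sub>R (exp (\<theta> * t) * f t)) \<partial>lborel)"
      unfolding set_lebesgue_integral_def using f0
      by (intro integral_eq_nn_integral) (auto simp: indicator_def)
    also have "(\<integral>\<^sup>+t. ennreal (indicator {0..} t *\<^sub>R (exp (\<theta> * t) * f t)) \<partial>lborel) = v"
      unfolding v_def by (intro nn_integral_cong) (auto simp: indicator_def ennreal_mult f0)
    finally show ?thesis using m by (simp add: psi_f_def)
  qed
  have lng: "ln g = h1 * (m * g) - h1"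
  proof -
    have "ln g = ln (exp (h1 * (r - 1)))" by (rule arg_cong[OF ge])
    also have "\<dots> = h1 * r - h1" by (simp only: ln_exp) (simp add: right_diff_distrib)
    finally show ?thesis unfolding rmg .
  qed
  have "h1 * r \<le> 1"
  proof (rule ccontr)
    assume "\<not> h1 * r \<le> 1"
    then have b: "1 < h1 * r" by simp
    define b where "b = h1 * r"
    have b1: "1 < b" using b by (simp add: b_def)
    have y0: "0 \<le> g / b" using gpos b1 by simp
    have "v * ennreal (g / b) = ennreal (r / b)"
      using m y0 b1 by (simp add: rmg flip: ennreal_mult)
    then have "(\<integral>\<^sup>+X. (\<Prod>x\<in>X. ennreal (exp (\<theta> * x)) * ennreal (g / b)) \<partial>offspring_law h1 f) = ennreal (exp (h1 * (r / b - 1)))"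
      using b1 r(2) by (intro offspring_prod_finite[OF f h0 um]) (simp_all add: vy)
    also have "exp (h1 * (r / b - 1)) = g * exp (1 - b)"
    proof -
      \<comment> \<open>Passing from g to g / b turns h1 r = b into 1, so the exponent h1 r - h1
        changes by 1 - b.\<close>
      have "r \<noteq> 0" using b by auto
      then have "h1 * (r / b) = 1" using h(1) by (simp add: b_def)
      then have "h1 * (r / b - 1) = h1 * (r - 1) + (1 - b)" by (simp add: b_def algebra_simps)
      then have "exp (h1 * (r / b - 1)) = exp (h1 * (r - 1)) * exp (1 - b)" by (simp only: exp_add)
      then show ?thesis unfolding ge[symmetric] .
    qed
    \<comment> \<open>Since b exp (1 - b) \<le> 1, the number g / b is a supersolution strictly
      below the least one.\<close>
    also have "\<dots> \<le> g / b"
    proof -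
      have "b \<le> exp (b - 1)" using exp_ge_add_one_self[of "b - 1"] by simp
      then have "b * exp (1 - b) \<le> exp (b - 1) * exp (1 - b)" by (intro mult_right_mono) auto
      then have "b * exp (1 - b) \<le> 1" by (simp add: mult_exp_exp)
      then have "exp (1 - b) \<le> 1 / b" using b1 by (simp add: field_simps)
      then have "g * exp (1 - b) \<le> g * (1 / b)" using gpos by (intro mult_left_mono) auto
      then show ?thesis by simp
    qed
    finally have "(\<integral>\<^sup>+X. (\<Prod>x\<in>X. ennreal (exp (\<theta> * x)) * ennreal (g / b)) \<partial>offspring_law h1 f) \<le> ennreal (g / b)"
      by (simp add: ennreal_leI)
    from cluster_mgf_minimal[OF f h0 this, of 0] have "g \<le> g / b" unfolding mg using y0 by (simp add: ennreal_le_iff)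
    then show False using gpos b1 by (simp add: field_simps)
  qed
  then show thesis
    using gpos mpos mg m(1) psif lng by (intro that[of g m]) (auto simp: psi_B_def g_def v_def rmg)
qed

text \<open>Strictness in \<open>h1 + psi_B h1 f \<eta> < 1\<close> is gained by comparing \<open>\<eta>\<close> with some \<open>\<theta>\<close> between \<open>\<eta>\<close> and \<open>\<theta>1\<close>.\<close>

lemma tilt_parameters:
  assumes f: "is_density f" and h: "0 < h1" "h1 < 1" and \<eta>: "0 < \<eta>" "\<eta> < \<theta>1"
    and int: "\<And>\<theta>. 0 < \<theta> \<Longrightarrow> \<theta> < \<theta>1 \<Longrightarrow> integrable (cluster_law h1 f 0) (\<lambda>c. exp (\<theta> * total_birth_time c))"
  shows "h1 * exp (psi_f f \<eta> + psi_B h1 f \<eta>) = h1 + psi_B h1 f \<eta>"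
    and "h1 + psi_B h1 f \<eta> < 1" and "0 < h1 + psi_B h1 f \<eta>"
    and "is_density (tilted_density f \<eta>)"
proof -
  have h0: "0 \<le> h1" using h by simp
  have [measurable]: "f \<in> borel_measurable borel" and f0: "\<And>t. 0 \<le> t \<Longrightarrow> 0 \<le> f t" using f by (simp_all add: is_density_def)
  define \<theta> where "\<theta> = (\<eta> + \<theta>1) / 2"
  have \<theta>: "\<eta> < \<theta>" "0 < \<theta>" "\<theta> < \<theta>1" using \<eta> by (simp_all add: \<theta>_def)
  obtain g m where g: "0 < g" "0 < m" "cluster_mgf h1 f 0 \<eta> = ennreal g" "psi_B h1 f \<eta> = ln g"
    "(\<integral>\<^sup>+t\<in>{0..}. ennreal (exp (\<eta> * t)) * ennreal (f t) \<partial>lborel) = ennreal m" "psi_f f \<eta> = ln m"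
    "ln g = h1 * (m * g) - h1" "h1 * (m * g) \<le> 1"
    by (rule mgf_parameters[OF f h int[OF \<eta>]])
  obtain g' m' where g': "0 < g'" "0 < m'" "cluster_mgf h1 f 0 \<theta> = ennreal g'" "psi_B h1 f \<theta> = ln g'"
    "(\<integral>\<^sup>+t\<in>{0..}. ennreal (exp (\<theta> * t)) * ennreal (f t) \<partial>lborel) = ennreal m'" "psi_f f \<theta> = ln m'"
    "ln g' = h1 * (m' * g') - h1" "h1 * (m' * g') \<le> 1"
    by (rule mgf_parameters[OF f h int[OF \<theta>(2,3)]])
  \<comment> \<open>Weak monotonicity is enough for the moments of B, which is almost surely
    nonnegative; strictness comes from the moments of f.\<close>
  have "cluster_mgf h1 f 0 \<eta> \<le> cluster_mgf h1 f 0 \<theta>"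
    unfolding cluster_mgf_def
  proof (rule nn_integral_mono_AE)
    show "AE C in cluster_law h1 f 0. of_bool (C \<noteq> []) * ennreal (exp (\<eta> * total_birth_time C)) \<le> of_bool (C \<noteq> []) * ennreal (exp (\<theta> * total_birth_time C))"
      using cluster_props_AE[OF f h0 h(2), of 0]
    proof eventually_elim
      case (elim C)
      then have "0 \<le> total_birth_time C" by linarith
      then show ?case using \<theta>(1) by (intro mult_left_mono ennreal_leI) (auto intro: mult_right_mono)
    qed
  qed
  then have gg: "g \<le> g'" using g g' by (simp add: ennreal_le_iff)
  \<comment> \<open>The integrands coincide only at t = 0, a Lebesgue null set, or where f vanishes.
    Equality of the moments would make the density f vanish almost everywhere.\<close>
  have "m < m'"
  proof (rule ccontr)
    assume "\<not> m < m'"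
    let ?F = "\<lambda>\<theta> t. ennreal (exp (\<theta> * t)) * ennreal (f t) * indicator {0..} t"
    have le: "?F \<eta> t \<le> ?F \<theta> t" for t
      using \<theta>(1) by (cases "0 \<le> t") (auto intro!: mult_right_mono ennreal_leI)
    have "(\<integral>\<^sup>+t. ?F \<theta> t - ?F \<eta> t \<partial>lborel) = (\<integral>\<^sup>+t. ?F \<theta> t \<partial>lborel) - (\<integral>\<^sup>+t. ?F \<eta> t \<partial>lborel)"
      by (rule nn_integral_diff) (use g(5) le in auto)
    also have "\<dots> = 0" using g(5) g'(5) \<open>\<not> m < m'\<close> g(2) g'(2) by (simp only: ennreal_minus) (simp add: ennreal_neg)
    finally have "AE t in lborel. ?F \<theta> t - ?F \<eta> t = 0" by (subst (asm) nn_integral_0_iff_AE) auto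
    moreover have "AE t in lborel. t \<noteq> (0::real)" by (rule AE_lborel_singleton)
    ultimately have "AE t in lborel. ennreal (f t) * indicator {0..} t = 0"
    proof eventually_elim
      case (elim t)
      show ?case
      proof (cases "0 \<le> t \<and> f t \<noteq> 0")
        case True
        then have t: "0 < t" "0 < f t" using elim(2) f0[of t] by auto
        then have "exp (\<eta> * t) * f t < exp (\<theta> * t) * f t" using \<theta>(1) by simp
        then have "?F \<eta> t < ?F \<theta> t" using t by (simp add: ennreal_less_iff flip: ennreal_mult)
        then have "?F \<theta> t - ?F \<eta> t \<noteq> 0" using diff_gr0_ennreal by (metis less_irrefl)
        then show ?thesis using elim(1) by simp
      qed auto
    qed
    then have "(\<integral>\<^sup>+t\<in>{0..}. ennreal (f t) \<partial>lborel) = 0"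
      by (subst nn_integral_0_iff_AE) auto
    then show False using f by (simp add: is_density_def)
  qed
  \<comment> \<open>The bound h1 m' g' \<le> 1 at \<theta> thus becomes strict at \<eta>.\<close>
  then have "m * g < m' * g'" using gg g(1,2) by (intro mult_less_le_imp_less) auto
  then have "h1 * (m * g) < 1" using g'(8) h(1) by (smt (verit) mult_strict_left_mono)
  then show "h1 + psi_B h1 f \<eta> < 1" using g(4,7) by simp
  have "exp (psi_f f \<eta> + psi_B h1 f \<eta>) = m * g"
    unfolding g(4,6) exp_add using g(1,2) by simp
  then show "h1 * exp (psi_f f \<eta> + psi_B h1 f \<eta>) = h1 + psi_B h1 f \<eta>"
    using g(4,7) by simp
  have "h1 + psi_B h1 f \<eta> = h1 * (m * g)" using g(4,7) by simp
  also have "0 < \<dots>" using h(1) g(1,2) by simp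
  finally show "0 < h1 + psi_B h1 f \<eta>" .
  show "is_density (tilted_density f \<eta>)"
    unfolding is_density_def
  proof (intro conjI allI impI)
    show "tilted_density f \<eta> \<in> borel_measurable borel" unfolding tilted_density_def[abs_def] by measurable
    show "0 \<le> tilted_density f \<eta> t" if "0 \<le> t" for t using f0[OF that] by (simp add: tilted_density_def)
    have "(\<integral>\<^sup>+t\<in>{0..}. ennreal (tilted_density f \<eta> t) \<partial>lborel) =
      (\<integral>\<^sup>+t. (ennreal (exp (\<eta> * t)) * ennreal (f t) * indicator {0..} t) * ennreal (1 / m) \<partial>lborel)"
    proof (rule nn_integral_cong)
      fix t
      have "exp (\<eta> * t - psi_f f \<eta>) = exp (\<eta> * t) * (1 / m)" using g(2,6) by (simp add: exp_diff)
      then show "ennreal (tilted_density f \<eta> t) * indicator {0..} t = (ennreal (exp (\<eta> * t)) * ennreal (f t) * indicator {0..} t) * ennreal (1 / m)"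
        using f0[of t] g(2) by (cases "0 \<le> t") (simp_all add: tilted_density_def mult_ac flip: ennreal_mult)
    qed
    also have "\<dots> = ennreal m * ennreal (1 / m)" unfolding g(5)[symmetric] by (rule nn_integral_multc) measurable
    also have "\<dots> = 1" using g(2) by (simp flip: ennreal_mult)
    finally show "(\<integral>\<^sup>+t\<in>{0..}. ennreal (tilted_density f \<eta> t) \<partial>lborel) = 1" .
  qed
qed

section \<open>Simplicity of Poisson processes on the line\<close>

lemma poisson_process_count:
  assumes P: "poisson_process M \<mu> I T" and A: "A \<in> sets \<mu>" "emeasure \<mu> A < \<infinity>"
  shows "measure M {\<omega> \<in> space M. ecard {i \<in> I \<omega>. T i \<omega> \<in> A} = enat k} =
    measure \<mu> A ^ k / fact k * exp (- measure \<mu> A)"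
  using P[unfolded poisson_process_def Let_def, THEN conjunct2, THEN spec, of "{0}", THEN spec,
    of "\<lambda>_. A", THEN spec, of "\<lambda>_. k"] A by (simp add: disjoint_family_on_def ecard_eq_enat)

lemma poisson_process_mean:
  assumes P: "poisson_process M \<mu> I T" and A: "A \<in> sets \<mu>" "emeasure \<mu> A < \<infinity>"
    and fin: "\<And>\<omega>. finite {i \<in> I \<omega>. T i \<omega> \<in> A}"
  shows "(\<integral>\<^sup>+\<omega>. of_nat (card {i \<in> I \<omega>. T i \<omega> \<in> A}) \<partial>M) = emeasure \<mu> A"
proof -
  interpret prob_space M using P by (simp add: poisson_process_def)
  define N where "N \<omega> = card {i \<in> I \<omega>. T i \<omega> \<in> A}" for \<omega>
  have ec: "ecard {i \<in> I \<omega>. T i \<omega> \<in> A} = enat n \<longleftrightarrow> N \<omega> = n" for \<omega> n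
    using fin by (simp add: ecard_eq_enat N_def)
  have Nm: "{\<omega> \<in> space M. N \<omega> = n} \<in> sets M" for n
  proof -
    have "{\<omega> \<in> space M. ecard {i \<in> I \<omega>. T i \<omega> \<in> A} = enat n} \<in> sets M"
      using measurable_sets[OF poisson_process_ecard[OF P A], of "{enat n}"] by (simp add: vimage_def Int_def conj_commute)
    then show ?thesis unfolding ec .
  qed
  have "(\<integral>\<^sup>+\<omega>. of_nat (N \<omega>) \<partial>M) = (\<integral>\<^sup>+\<omega>. (\<Sum>n. of_nat n * indicator {\<omega> \<in> space M. N \<omega> = n} \<omega>) \<partial>M)"
  proof (rule nn_integral_cong)
    fix \<omega> assume "\<omega> \<in> space M"
    then show "of_nat (N \<omega>) = (\<Sum>n. of_nat n * indicator {\<omega> \<in> space M. N \<omega> = n} \<omega> :: ennreal)"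
      by (subst suminf_finite[of "{N \<omega>}"]) (auto simp: indicator_def)
  qed
  also have "\<dots> = (\<Sum>n. \<integral>\<^sup>+\<omega>. of_nat n * indicator {\<omega> \<in> space M. N \<omega> = n} \<omega> \<partial>M)"
    by (rule nn_integral_suminf) (use Nm in measurable)
  also have "\<dots> = (\<Sum>n. ennreal (measure \<mu> A ^ n / fact n * exp (- measure \<mu> A)) * of_nat n)"
  proof (rule suminf_cong)
    fix n
    have "(\<integral>\<^sup>+\<omega>. of_nat n * indicator {\<omega> \<in> space M. N \<omega> = n} \<omega> \<partial>M) = of_nat n * emeasure M {\<omega> \<in> space M. N \<omega> = n}"
      by (rule nn_integral_cmult_indicator[OF Nm])
    then show "(\<integral>\<^sup>+\<omega>. of_nat n * indicator {\<omega> \<in> space M. N \<omega> = n} \<omega> \<partial>M) = ennreal (measure \<mu> A ^ n / fact n * exp (- measure \<mu> A)) * of_nat n"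
      using poisson_process_count[OF P A, of n] unfolding ec by (simp add: emeasure_eq_measure mult.commute)
  qed
  also have "\<dots> = ennreal (measure \<mu> A)" by (rule poisson_mean_series) simp
  also have "\<dots> = emeasure \<mu> A" using A(2) by (simp add: emeasure_eq_ennreal_measure less_top)
  finally show ?thesis unfolding N_def .
qed

lemma poisson_process_map:
  assumes P: "poisson_process M \<Lambda> I Z" and sp: "space \<Lambda> = UNIV" and g: "g \<in> measurable \<Lambda> \<Lambda>'"
    and \<Lambda>': "\<And>A. A \<in> sets \<Lambda>' \<Longrightarrow> emeasure \<Lambda>' A = emeasure \<Lambda> (g -` A)"
  shows "poisson_process M \<Lambda>' I (\<lambda>i \<omega>. g (Z i \<omega>))"
  unfolding poisson_process_def
proof (intro conjI allI impI)
  show "prob_space M" using P by (simp add: poisson_process_def)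
  fix J :: "nat set" and A k
  assume J: "finite J" "disjoint_family_on A J" "\<forall>j\<in>J. A j \<in> sets \<Lambda>' \<and> emeasure \<Lambda>' (A j) < \<infinity>"
  have B: "\<forall>j\<in>J. g -` A j \<in> sets \<Lambda> \<and> emeasure \<Lambda> (g -` A j) < \<infinity>"
    using J(3) measurable_sets[OF g] \<Lambda>' by (auto simp: sp)
  have d: "disjoint_family_on (\<lambda>j. g -` A j) J" using J(2) by (auto simp: disjoint_family_on_def)
  have m: "measure \<Lambda>' (A j) = measure \<Lambda> (g -` A j)" if "j \<in> J" for j
    using J(3) that \<Lambda>' by (simp add: measure_def)
  have pm: "(\<Prod>j\<in>J. measure \<Lambda>' (A j) ^ k j / fact (k j) * exp (- measure \<Lambda>' (A j))) =
      (\<Prod>j\<in>J. measure \<Lambda> (g -` A j) ^ k j / fact (k j) * exp (- measure \<Lambda> (g -` A j)))"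
    by (rule prod.cong[OF refl]) (simp add: m)
  show "let E = {\<omega> \<in> space M. \<forall>j\<in>J. finite {i \<in> I \<omega>. g (Z i \<omega>) \<in> A j} \<and> card {i \<in> I \<omega>. g (Z i \<omega>) \<in> A j} = k j}
     in E \<in> sets M \<and> measure M E = (\<Prod>j\<in>J. measure \<Lambda>' (A j) ^ k j / fact (k j) * exp (- measure \<Lambda>' (A j)))"
    unfolding pm
    using P[unfolded poisson_process_def, THEN conjunct2, THEN spec, of J, THEN spec,
      of "\<lambda>j. g -` A j", THEN spec, of k] J(1) d B by (simp only: vimage_eq simp_thms)
qed

lemma poisson_process_cong:
  assumes "\<And>\<omega>. \<omega> \<in> space M \<Longrightarrow> I \<omega> = I' \<omega>"
  shows "poisson_process M \<mu> I T \<longleftrightarrow> poisson_process M \<mu> I' T"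
proof -
  have "{\<omega> \<in> space M. \<forall>j\<in>J. finite {i \<in> I \<omega>. T i \<omega> \<in> A j} \<and> card {i \<in> I \<omega>. T i \<omega> \<in> A j} = k j} =
    {\<omega> \<in> space M. \<forall>j\<in>J. finite {i \<in> I' \<omega>. T i \<omega> \<in> A j} \<and> card {i \<in> I' \<omega>. T i \<omega> \<in> A j} = k j}" for J :: "nat set" and A k
    using assms by auto
  then show ?thesis unfolding poisson_process_def by simp
qed

text \<open>A single index, but h may be unbounded, as the size of a proposed cluster is. Finiteness
  is required only of the weight, here an indicator.\<close>

lemma marked_poisson_single:
  assumes P: "marked_poisson_process M \<mu> N \<kappa> I T Y" and \<kappa>: "\<kappa> \<in> measurable \<mu> (prob_algebra N)"
    and h: "h \<in> borel_measurable (\<mu> \<Otimes>\<^sub>M N)"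
  shows "(\<integral>\<^sup>+\<omega>. of_bool (i \<in> I \<omega>) * h (T i \<omega>, Y i \<omega>) \<partial>M) =
    (\<integral>\<^sup>+\<omega>. of_bool (i \<in> I \<omega>) * (\<integral>\<^sup>+y. h (T i \<omega>, y) \<partial>\<kappa> (T i \<omega>)) \<partial>M)"
proof -
  interpret prob_space M using P by (simp add: marked_poisson_process_def poisson_process_def)
  have I: "{\<omega> \<in> space M. i \<in> I \<omega>} \<in> sets M" and T: "T i \<in> measurable M \<mu>" and Y: "Y i \<in> measurable M N"
    using P by (simp_all add: marked_poisson_process_def)
  have W: "(\<lambda>\<omega>. of_bool (i \<in> I \<omega>) :: ennreal) \<in> borel_measurable M"
  proof -
    have "Measurable.pred M (\<lambda>\<omega>. i \<in> I \<omega>)" using I by (simp add: pred_def)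
    then show ?thesis by measurable
  qed
  show ?thesis
  proof (rule kernel_integral_eqI[OF T Y \<kappa> W W _ _ h])
    have "(\<integral>\<^sup>+\<omega>. of_bool (i \<in> I \<omega>) \<partial>M) \<le> (\<integral>\<^sup>+\<omega>. 1 \<partial>M)" by (rule nn_integral_mono) auto
    also have "\<dots> < \<infinity>" by (simp add: emeasure_space_1)
    finally show "(\<integral>\<^sup>+\<omega>. of_bool (i \<in> I \<omega>) \<partial>M) < \<infinity>" .
    fix A D assume AD: "A \<in> sets \<mu>" "D \<in> sets N"
    have E: "{\<omega> \<in> space M. i \<in> I \<omega> \<and> T i \<omega> \<in> A \<and> Y i \<omega> \<in> D} \<in> sets M"
    proof -
      have "{\<omega> \<in> space M. i \<in> I \<omega> \<and> T i \<omega> \<in> A \<and> Y i \<omega> \<in> D} =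
        {\<omega> \<in> space M. i \<in> I \<omega>} \<inter> (T i -` A \<inter> space M) \<inter> (Y i -` D \<inter> space M)" by auto
      then show ?thesis using I measurable_sets[OF T AD(1)] measurable_sets[OF Y AD(2)] by simp
    qed
    have "(\<integral>\<^sup>+\<omega>. of_bool (i \<in> I \<omega>) * (indicator A (T i \<omega>) * indicator D (Y i \<omega>)) \<partial>M) =
      (\<integral>\<^sup>+\<omega>. indicator {\<omega> \<in> space M. i \<in> I \<omega> \<and> T i \<omega> \<in> A \<and> Y i \<omega> \<in> D} \<omega> \<partial>M)"
      by (rule nn_integral_cong) (simp add: indicator_def)
    also have "\<dots> = emeasure M {\<omega> \<in> space M. \<forall>j\<in>{i}. j \<in> I \<omega> \<and> T j \<omega> \<in> A \<and> Y j \<omega> \<in> D}"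
      using E by simp
    also have "\<dots> = (\<integral>\<^sup>+\<omega>\<in>{\<omega> \<in> space M. \<forall>j\<in>{i}. j \<in> I \<omega> \<and> T j \<omega> \<in> A}. (\<Prod>j\<in>{i}. emeasure (\<kappa> (T j \<omega>)) D) \<partial>M)"
      by (rule P[unfolded marked_poisson_process_def, THEN conjunct2, THEN conjunct2, THEN spec, of "{i}", THEN spec,
        of "\<lambda>_. A", THEN spec, of "\<lambda>_. D", THEN mp, THEN mp]) (use AD in auto)
    also have "\<dots> = (\<integral>\<^sup>+\<omega>. of_bool (i \<in> I \<omega>) * (indicator A (T i \<omega>) * emeasure (\<kappa> (T i \<omega>)) D) \<partial>M)"
      by (rule nn_integral_cong) (simp add: indicator_def)
    finally show "(\<integral>\<^sup>+\<omega>. of_bool (i \<in> I \<omega>) * (indicator A (T i \<omega>) * indicator D (Y i \<omega>)) \<partial>M) =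
      (\<integral>\<^sup>+\<omega>. of_bool (i \<in> I \<omega>) * (indicator A (T i \<omega>) * emeasure (\<kappa> (T i \<omega>)) D) \<partial>M)" .
  qed
qed

lemma poisson_process_pair_bound:
  assumes P: "poisson_process M \<mu> I T" and A: "A \<in> sets \<mu>" "emeasure \<mu> A < \<infinity>"
  defines "E \<equiv> {\<omega> \<in> space M. ecard {i \<in> I \<omega>. T i \<omega> \<in> A} \<noteq> enat 0 \<and> ecard {i \<in> I \<omega>. T i \<omega> \<in> A} \<noteq> enat 1}"
  shows "E \<in> sets M" and "measure M E \<le> (measure \<mu> A)\<^sup>2"
proof -
  interpret prob_space M using P by (simp add: poisson_process_def)
  let ?m = "measure \<mu> A"
  define F where "F k = {\<omega> \<in> space M. ecard {i \<in> I \<omega>. T i \<omega> \<in> A} = enat k}" for k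
  have F: "F k \<in> sets M" for k
    using measurable_sets[OF poisson_process_ecard[OF P A], of "{enat k}"] by (simp add: F_def vimage_def Int_def conj_commute)
  have E: "E = space M - (F 0 \<union> F 1)" by (auto simp: E_def F_def)
  show "E \<in> sets M" unfolding E using F by auto
  have "measure M (F 0 \<union> F 1) = measure M (F 0) + measure M (F 1)"
    using F by (intro finite_measure_Union) (auto simp: F_def)
  also have "\<dots> = (1 + ?m) * exp (- ?m)"
    unfolding F_def poisson_process_count[OF P A] by (simp add: algebra_simps)
  \<comment> \<open>From exp (- m) \<ge> 1 - m the probability of at most one point is at least (1 +
    m) (1 - m), which leaves m squared for two or more.\<close>
  also have "\<dots> \<ge> (1 + ?m) * (1 - ?m)"
    using exp_ge_add_one_self[of "- ?m"] by (intro mult_left_mono) auto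
  finally have "measure M (F 0 \<union> F 1) \<ge> 1 - ?m\<^sup>2" by (simp add: algebra_simps power2_eq_square)
  then show "measure M E \<le> ?m\<^sup>2" unfolding E using F by (subst prob_compl) auto
qed

text \<open>Cut \<open>[- R, R)\<close> into \<open>2 R n\<close> cells of length \<open>1 / n\<close>: some cell contains two points with
  probability at most \<open>2 R n (c / n)\<^sup>2\<close>, which tends to 0.\<close>

lemma poisson_process_distinct:
  assumes P: "poisson_process M \<mu> I T" and \<mu>: "sets \<mu> = sets borel" "0 \<le> c"
    and le: "\<And>A. A \<in> sets borel \<Longrightarrow> emeasure \<mu> A \<le> ennreal c * emeasure lborel A"
  shows "AE \<omega> in M. inj_on (\<lambda>i. T i \<omega> :: real) (I \<omega>)"
proof -
  interpret prob_space M using P by (simp add: poisson_process_def)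
  define A where "A R n k = {real k / real (Suc n) - real R ..< real (Suc k) / real (Suc n) - real R}" for R n k :: nat
  define E where "E R n k = {\<omega> \<in> space M. ecard {i \<in> I \<omega>. T i \<omega> \<in> A R n k} \<noteq> enat 0 \<and> ecard {i \<in> I \<omega>. T i \<omega> \<in> A R n k} \<noteq> enat 1}" for R n k
  define B where "B R n = (\<Union>k<2 * R * Suc n. E R n k)" for R n
  have As: "A R n k \<in> sets \<mu>" for R n k by (simp add: A_def \<mu>)
  have eA: "emeasure \<mu> (A R n k) \<le> ennreal (c / real (Suc n))" for R n k
  proof -
    have "real k / real (Suc n) \<le> real (Suc k) / real (Suc n)" by (intro divide_right_mono) auto
    then have "emeasure lborel (A R n k) = ennreal (1 / real (Suc n))"
      unfolding A_def by (subst emeasure_lborel_Ico) (auto simp: diff_divide_distrib[symmetric])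
    then show ?thesis using le[of "A R n k"] \<mu> by (simp add: A_def flip: ennreal_mult)
  qed
  have fA: "emeasure \<mu> (A R n k) < \<infinity>" for R n k by (rule le_less_trans[OF eA]) simp
  have mA: "measure \<mu> (A R n k) \<le> c / real (Suc n)" for R n k
    unfolding measure_def using enn2real_mono[OF eA[of R n k]] \<mu>(2) by simp
  have Es: "E R n k \<in> sets M" for R n k unfolding E_def by (rule poisson_process_pair_bound(1)[OF P As fA])
  have Em: "measure M (E R n k) \<le> (c / real (Suc n))\<^sup>2" for R n k
    using poisson_process_pair_bound(2)[OF P As fA, of R n k] power_mono[OF mA[of R n k] measure_nonneg, of 2]
    unfolding E_def[symmetric] by linarith
  have Bs: "B R n \<in> sets M" for R n unfolding B_def using Es by auto
  have Bm: "measure M (B R n) \<le> 2 * real R * c\<^sup>2 / real (Suc n)" for R n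
  proof -
    have "measure M (B R n) \<le> (\<Sum>k<2 * R * Suc n. measure M (E R n k))"
      unfolding B_def by (rule finite_measure_subadditive_finite) (use Es in auto)
    also have "\<dots> \<le> (\<Sum>k<2 * R * Suc n. (c / real (Suc n))\<^sup>2)" by (rule sum_mono[OF Em])
    also have "\<dots> = 2 * real R * real (Suc n) * (c / real (Suc n))\<^sup>2" by (simp, simp add: distrib_left)
    also have "\<dots> = 2 * real R * c\<^sup>2 / real (Suc n)" by (simp add: power2_eq_square divide_simps del: of_nat_Suc)
    finally show ?thesis .
  qed
  have null: "AE \<omega> in M. \<omega> \<notin> (\<Inter>n. B R n)" for R
  proof -
    have s: "(\<Inter>n. B R n) \<in> sets M" using Bs by auto
    have "measure M (\<Inter>n. B R n) \<le> 0"
    proof (rule LIMSEQ_le_const)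
      show "(\<lambda>n. 2 * real R * c\<^sup>2 / real (Suc n)) \<longlonglongrightarrow> 0" by (rule LIMSEQ_Suc[OF lim_const_over_n])
      show "\<exists>N. \<forall>n\<ge>N. measure M (\<Inter>n. B R n) \<le> 2 * real R * c\<^sup>2 / real (Suc n)"
        using order_trans[OF finite_measure_mono Bm] Bs by (metis INF_lower UNIV_I)
    qed
    then have "emeasure M (\<Inter>n. B R n) = 0" by (simp add: emeasure_eq_measure measure_le_0_iff)
    then have "(\<Inter>n. B R n) \<in> null_sets M" using s by (rule null_setsI)
    then show ?thesis by (rule AE_not_in)
  qed
  then have "AE \<omega> in M. \<forall>R. \<omega> \<notin> (\<Inter>n. B R n)" by (subst AE_all_countable) blast
  with AE_space show ?thesis
  proof eventually_elim
    case (elim \<omega>)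
    show ?case
    proof (rule inj_onI, rule ccontr)
      fix i j assume ij: "i \<in> I \<omega>" "j \<in> I \<omega>" "T i \<omega> = T j \<omega>" "i \<noteq> j"
      define x where "x = T i \<omega>"
      obtain R where R: "\<bar>x\<bar> < real R" using reals_Archimedean2 by blast
      have "\<omega> \<in> B R n" for n
      proof -
        \<comment> \<open>Rounding down locates the half-open cell of x. Two indices with this
          common value put \<omega> into \<open>B R n\<close> for every n, hence into a null
          set.\<close>
        define k where "k = nat \<lfloor>(x + real R) * real (Suc n)\<rfloor>"
        have "0 \<le> (x + real R) * real (Suc n)" using R by (intro mult_nonneg_nonneg) auto
        then have k: "real k \<le> (x + real R) * real (Suc n)" "(x + real R) * real (Suc n) < real k + 1"
          unfolding k_def by (auto simp: of_nat_nat)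
        have x: "x \<in> A R n k" using k by (auto simp: A_def field_simps)
        have "(x + real R) * real (Suc n) < (2 * real R) * real (Suc n)" using R by (intro mult_strict_right_mono) auto
        from le_less_trans[OF k(1) this] have "real k < real (2 * R * Suc n)" by (simp only: of_nat_mult of_nat_numeral)
        then have kb: "k < 2 * R * Suc n" by (simp only: of_nat_less_iff)
        have "ecard {i \<in> I \<omega>. T i \<omega> \<in> A R n k} \<noteq> enat m" if "m \<le> 1" for m
        proof
          assume "ecard {i \<in> I \<omega>. T i \<omega> \<in> A R n k} = enat m"
          then have f: "finite {i \<in> I \<omega>. T i \<omega> \<in> A R n k}" "card {i \<in> I \<omega>. T i \<omega> \<in> A R n k} = m"
            by (simp_all add: ecard_eq_enat)
          have "{i, j} \<subseteq> {i \<in> I \<omega>. T i \<omega> \<in> A R n k}" using ij x by (auto simp: x_def)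
          from card_mono[OF f(1) this] f(2) ij(4) that show False by simp
        qed
        from this[of 0] this[of 1] have "\<omega> \<in> E R n k" using elim by (simp add: E_def)
        then show ?thesis using kb by (auto simp: B_def)
      qed
      then show False using elim(2) by blast
    qed
  qed
qed

section \<open>The acceptance step\<close>

lemma marked_poisson_AE:
  fixes I :: "'w \<Rightarrow> 'i::countable set"
  assumes P: "marked_poisson_process M \<mu> N \<kappa> I T Y" and \<kappa>: "\<kappa> \<in> measurable \<mu> (prob_algebra N)"
    and S: "S \<in> sets (\<mu> \<Otimes>\<^sub>M N)" and AE: "\<And>t. t \<in> space \<mu> \<Longrightarrow> AE y in \<kappa> t. (t, y) \<in> S"
  shows "AE \<omega> in M. \<forall>i\<in>I \<omega>. (T i \<omega>, Y i \<omega>) \<in> S"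
proof -
  have "AE \<omega> in M. i \<in> I \<omega> \<longrightarrow> (T i \<omega>, Y i \<omega>) \<in> S" for i
  proof -
    have I: "{\<omega> \<in> space M. i \<in> I \<omega>} \<in> sets M" and T: "T i \<in> measurable M \<mu>" and Y: "Y i \<in> measurable M N"
      using P by (simp_all add: marked_poisson_process_def)
    have h: "(\<lambda>p. of_bool (p \<notin> S) :: ennreal) \<in> borel_measurable (\<mu> \<Otimes>\<^sub>M N)"
    proof -
      have "Measurable.pred (\<mu> \<Otimes>\<^sub>M N) (\<lambda>p. p \<in> S)" using S by measurable
      then show ?thesis by measurable
    qed
    have Im: "Measurable.pred M (\<lambda>\<omega>. i \<in> I \<omega>)" using I by (simp add: pred_def)
    have TY: "(\<lambda>\<omega>. (T i \<omega>, Y i \<omega>)) \<in> measurable M (\<mu> \<Otimes>\<^sub>M N)" using T Y by measurable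
    have m: "(\<lambda>\<omega>. of_bool (i \<in> I \<omega>) * (of_bool ((T i \<omega>, Y i \<omega>) \<notin> S) :: ennreal)) \<in> borel_measurable M"
      using Im measurable_compose[OF TY h] by measurable
    have "(\<integral>\<^sup>+\<omega>. of_bool (i \<in> I \<omega>) * of_bool ((T i \<omega>, Y i \<omega>) \<notin> S) \<partial>M) =
      (\<integral>\<^sup>+\<omega>. of_bool (i \<in> I \<omega>) * (\<integral>\<^sup>+y. of_bool ((T i \<omega>, y) \<notin> S) \<partial>\<kappa> (T i \<omega>)) \<partial>M)"
      by (rule marked_poisson_single[OF P \<kappa> h])
    also have "\<dots> = (\<integral>\<^sup>+\<omega>. 0 \<partial>M)"
    proof (rule nn_integral_cong)
      fix \<omega> assume "\<omega> \<in> space M"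
      then have "T i \<omega> \<in> space \<mu>" by (rule measurable_space[OF T])
      from AE[OF this] have "(\<integral>\<^sup>+y. of_bool ((T i \<omega>, y) \<notin> S) \<partial>\<kappa> (T i \<omega>)) = (\<integral>\<^sup>+y. 0 \<partial>\<kappa> (T i \<omega>))"
        by (intro nn_integral_cong_AE) (auto elim: eventually_mono)
      then show "of_bool (i \<in> I \<omega>) * (\<integral>\<^sup>+y. of_bool ((T i \<omega>, y) \<notin> S) \<partial>\<kappa> (T i \<omega>)) = 0" by simp
    qed
    finally have "(\<integral>\<^sup>+\<omega>. of_bool (i \<in> I \<omega>) * (of_bool ((T i \<omega>, Y i \<omega>) \<notin> S)) \<partial>M) = 0" by simp
    then have "AE \<omega> in M. of_bool (i \<in> I \<omega>) * (of_bool ((T i \<omega>, Y i \<omega>) \<notin> S) :: ennreal) = 0"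
      using nn_integral_0_iff_AE[OF m] by blast
    then show ?thesis by eventually_elim (auto simp: of_bool_def split: if_splits)
  qed
  then have "AE \<omega> in M. \<forall>i. i \<in> I \<omega> \<longrightarrow> (T i \<omega>, Y i \<omega>) \<in> S" by (subst AE_all_countable) blast
  then show ?thesis by eventually_elim blast
qed

text \<open>The image of a point determines the point through its arrival time, and points of an
  intensity bounded by a multiple of Lebesgue measure are almost surely distinct. So passing to the
  set of images loses no multiplicity. Both \<open>N0\<close> and the output of the algorithm are of
  this form.\<close>

lemma thinned_cluster_process:
  fixes I :: "'w \<Rightarrow> 'i::countable set" and \<mu> :: "real measure" and Z :: "real \<times> 'b \<Rightarrow> cluster"
  assumes P: "marked_poisson_process M \<mu> N \<kappa> I T Y" and \<kappa>: "\<kappa> \<in> measurable \<mu> (prob_algebra N)"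
    and s\<mu>: "sets \<mu> = sets borel" and c: "0 \<le> c" and le: "\<And>A. A \<in> sets borel \<Longrightarrow> emeasure \<mu> A \<le> ennreal c * emeasure lborel A"
    and S: "S \<in> sets (\<mu> \<Otimes>\<^sub>M N)" and Z: "Z \<in> measurable (\<mu> \<Otimes>\<^sub>M N) cluster_space"
    and arr: "\<And>t. AE y in \<kappa> t. arrival_time (Z (t, y)) = t"
    and s\<Lambda>: "sets \<Lambda> = sets cluster_space"
    and \<Lambda>: "\<And>D. D \<in> sets \<Lambda> \<Longrightarrow> emeasure \<Lambda> D = (\<integral>\<^sup>+t. emeasure (\<kappa> t) {y \<in> space N. (t, y) \<in> S \<and> Z (t, y) \<in> D} \<partial>\<mu>)"
  defines "R \<equiv> \<lambda>\<omega>. (\<lambda>i. Z (T i \<omega>, Y i \<omega>)) ` {i \<in> I \<omega>. (T i \<omega>, Y i \<omega>) \<in> S}"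
  shows "R \<in> measurable M (config_space cluster_space)" and "poisson_process M \<Lambda> R (\<lambda>x \<omega>. x)"
proof -
  have sp: "space \<mu> = UNIV" using sets_eq_imp_space_eq[OF s\<mu>] by simp
  have PP: "poisson_process M \<mu> I T" using P by (simp add: marked_poisson_process_def)
  have I: "{\<omega> \<in> space M. i \<in> I \<omega>} \<in> sets M" and T: "T i \<in> measurable M \<mu>" and Y: "Y i \<in> measurable M N" for i
    using P by (simp_all add: marked_poisson_process_def)
  have TY: "(\<lambda>\<omega>. (T i \<omega>, Y i \<omega>)) \<in> measurable M (\<mu> \<Otimes>\<^sub>M N)" for i using T Y by measurable
  have IS: "{\<omega> \<in> space M. i \<in> {i \<in> I \<omega>. (T i \<omega>, Y i \<omega>) \<in> S}} \<in> sets M" for i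
  proof -
    have "{\<omega> \<in> space M. i \<in> {i \<in> I \<omega>. (T i \<omega>, Y i \<omega>) \<in> S}} =
      {\<omega> \<in> space M. i \<in> I \<omega>} \<inter> ((\<lambda>\<omega>. (T i \<omega>, Y i \<omega>)) -` S \<inter> space M)" by auto
    then show ?thesis using I measurable_sets[OF TY S] by simp
  qed
  show R: "R \<in> measurable M (config_space cluster_space)"
    unfolding R_def by (rule measurable_image_config[OF IS measurable_compose[OF TY Z] cluster_space_diag])
  have Z': "Z \<in> measurable (\<mu> \<Otimes>\<^sub>M N) \<Lambda>" using Z measurable_cong_sets[OF refl s\<Lambda>] by blast
  have "AE \<omega> in M. \<forall>i\<in>I \<omega>. (T i \<omega>, Y i \<omega>) \<in> {p \<in> space (\<mu> \<Otimes>\<^sub>M N). arrival_time (Z p) = fst p}"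
  proof (rule marked_poisson_AE[OF P \<kappa>])
    have f: "(\<lambda>p. arrival_time (Z p)) \<in> borel_measurable (\<mu> \<Otimes>\<^sub>M N)" by (rule measurable_compose[OF Z measurable_arrival_time])
    have g: "fst \<in> borel_measurable (\<mu> \<Otimes>\<^sub>M N)" using measurable_fst measurable_cong_sets[OF refl s\<mu>] by blast
    show "{p \<in> space (\<mu> \<Otimes>\<^sub>M N). arrival_time (Z p) = fst p} \<in> sets (\<mu> \<Otimes>\<^sub>M N)"
      by (rule borel_measurable_eq[OF f g])
    fix t
    have "sets (\<kappa> t) = sets N" using measurable_space[OF \<kappa>, of t] sp by (simp add: space_prob_algebra)
    then have sk: "space (\<kappa> t) = space N" by (rule sets_eq_imp_space_eq)
    show "AE y in \<kappa> t. (t, y) \<in> {p \<in> space (\<mu> \<Otimes>\<^sub>M N). arrival_time (Z p) = fst p}"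
      by (rule AE_mp[OF arr[of t] AE_I2]) (simp add: space_pair_measure sp sk)
  qed
  moreover have "AE \<omega> in M. inj_on (\<lambda>i. T i \<omega>) (I \<omega>)"
    by (rule poisson_process_distinct[OF PP s\<mu> c le])
  ultimately have inj: "AE \<omega> in M. inj_on (\<lambda>i. Z (T i \<omega>, Y i \<omega>)) {i \<in> I \<omega>. (T i \<omega>, Y i \<omega>) \<in> S}"
  proof eventually_elim
    case (elim \<omega>)
    have "T i \<omega> = arrival_time (Z (T i \<omega>, Y i \<omega>))" if "i \<in> I \<omega>" for i using elim(1) that by simp
    then show ?case using elim(2) by (intro inj_onI) (metis (no_types, lifting) inj_onD mem_Collect_eq)
  qed
  show "poisson_process M \<Lambda> R (\<lambda>x \<omega>. x)"
    unfolding R_def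
    by (rule poisson_process_image[OF marked_poisson_thinning[OF P \<kappa> sp S Z' \<Lambda>] inj R[unfolded R_def] s\<Lambda>])
qed

lemma uniform_prob_atMost:
  assumes "0 \<le> e" "e \<le> 1"
  shows "emeasure (uniform_measure lborel {0..1 :: real}) {..e} = ennreal e"
proof -
  have "{0..1} \<inter> {..e} = {0..e}" using assms by auto
  then show ?thesis using assms by (subst emeasure_uniform_measure) (auto simp: divide_ennreal_def)
qed

lemma emeasure_exponential_intensity:
  assumes "0 \<le> c" "0 < \<eta>"
  shows "emeasure (density lborel (\<lambda>t. ennreal (c * exp (\<psi> + \<eta> * t)) * indicator {..0} t)) UNIV = ennreal (c * exp \<psi> / \<eta>)"
proof -
  have "emeasure (density lborel (\<lambda>t. ennreal (c * exp (\<psi> + \<eta> * t)) * indicator {..0} t)) UNIV =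
    (\<integral>\<^sup>+t. ennreal (c * exp (\<psi> + \<eta> * t)) * indicator {..0} t \<partial>lborel)"
    by (subst emeasure_density) auto
  also have "\<dots> = (\<integral>\<^sup>+t. ennreal (c * exp (\<psi> + \<eta> * (0 + (-1) * t))) * indicator {..0} (0 + (-1) * t) \<partial>lborel)"
    by (subst nn_integral_real_affine[where c="-1" and t=0]) auto
  also have "\<dots> = (\<integral>\<^sup>+t. ennreal (c * exp (\<psi> - \<eta> * t)) * indicator {0..} t \<partial>lborel)"
    by (intro nn_integral_cong) (simp add: indicator_def)
  also have "\<dots> = ennreal (0 - (- (c * exp (\<psi> - \<eta> * 0) / \<eta>)))"
  proof (rule nn_integral_FTC_atLeast)
    show "(\<lambda>t. c * exp (\<psi> - \<eta> * t)) \<in> borel_measurable borel" by measurable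
    show "((\<lambda>t. - (c * exp (\<psi> - \<eta> * t) / \<eta>)) has_real_derivative c * exp (\<psi> - \<eta> * t)) (at t)" for t
      using assms by (auto intro!: derivative_eq_intros)
    show "0 \<le> c * exp (\<psi> - \<eta> * t)" for t using assms by simp
    have "filterlim (\<lambda>t. \<eta> * t) at_top at_top"
      using assms(2) by (intro filterlim_tendsto_pos_mult_at_top[OF tendsto_const]) (auto simp: filterlim_ident)
    then have "filterlim (\<lambda>t. \<eta> * t - \<psi>) at_top at_top"
      using filterlim_tendsto_add_at_top[OF tendsto_const[of "- \<psi>"]] by (simp add: add.commute)
    then have "((\<lambda>t. exp (- (\<eta> * t - \<psi>))) \<longlongrightarrow> 0) at_top"
      by (intro filterlim_compose[OF exp_at_bot]) (simp only: filterlim_uminus_at_top[symmetric])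
    then have "((\<lambda>t. - (c * exp (- (\<eta> * t - \<psi>)) / \<eta>)) \<longlongrightarrow> - (c * 0 / \<eta>)) at_top"
      by (intro tendsto_intros) (use assms in auto)
    then show "((\<lambda>t. - (c * exp (\<psi> - \<eta> * t) / \<eta>)) \<longlongrightarrow> 0) at_top" by simp
  qed
  finally show ?thesis by simp
qed

section \<open>The returned clusters, \<open>N0\<close> and their common intensity\<close>

locale hawkes_tilt =
  fixes lam0 h1 \<eta> \<theta>1 :: real and f :: "real \<Rightarrow> real"
  assumes lam0: "0 < lam0" and h1: "0 < h1" "h1 < 1" and f: "is_density f"
    and int: "\<And>\<theta>. 0 < \<theta> \<Longrightarrow> \<theta> < \<theta>1 \<Longrightarrow> integrable (cluster_law h1 f 0) (\<lambda>c. exp (\<theta> * total_birth_time c))"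
    and \<eta>: "0 < \<eta>" "\<eta> < \<theta>1"
begin

abbreviation "\<psi> \<equiv> psi_B h1 f \<eta>"
abbreviation "a' \<equiv> h1 * exp (psi_f f \<eta> + psi_B h1 f \<eta>)"
abbreviation "\<kappa> \<equiv> cluster_law h1 f"
abbreviation "\<kappa>' \<equiv> cluster_law a' (tilted_density f \<eta>)"
abbreviation "unif \<equiv> uniform_measure lborel {0..1 :: real}"

lemma h1_nonneg: "0 \<le> h1" using h1 by simp

lemma tilt: "a' = h1 + \<psi>" "h1 + \<psi> < 1" "0 < h1 + \<psi>" "is_density (tilted_density f \<eta>)"
  by (rule tilt_parameters[OF f h1 \<eta>], erule (1) int)+

lemma a': "0 \<le> a'" "a' < 1" using tilt(2,3) unfolding tilt(1) by simp_all

lemma prob_unif: "prob_space unif" by (rule prob_space_uniform_measure) auto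

lemma sets_\<kappa>: "sets (\<kappa> t) = sets cluster_space" and sets_\<kappa>': "sets (\<kappa>' t) = sets cluster_space"
  by simp_all

lemma tilted_kernel: "(\<lambda>t. \<kappa>' t \<Otimes>\<^sub>M unif) \<in> measurable borel (prob_algebra (cluster_space \<Otimes>\<^sub>M borel))"
proof (rule measurable_pair_prob[OF cluster_kernel[OF tilt(4) a'(1)]])
  show "(\<lambda>t. unif) \<in> measurable borel (prob_algebra borel)"
    using prob_unif by (intro measurable_const) (simp add: space_prob_algebra)
qed

definition proposal_accept :: "(real \<times> cluster \<times> real) set" where
  "proposal_accept = {(t, C, x). cluster_length C > - t \<and> x \<le> exp (- \<eta> * (total_birth_time C + t))}"

lemma proposal_accept_sets: "proposal_accept \<in> sets (borel \<Otimes>\<^sub>M (cluster_space \<Otimes>\<^sub>M borel))"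
proof -
  have "{p \<in> space (borel \<Otimes>\<^sub>M (cluster_space \<Otimes>\<^sub>M borel)). cluster_length (fst (snd p)) > - fst p \<and>
      snd (snd p) \<le> exp (- \<eta> * (total_birth_time (fst (snd p)) + fst p))} \<in> sets (borel \<Otimes>\<^sub>M (cluster_space \<Otimes>\<^sub>M borel))"
    by measurable
  then show ?thesis by (simp add: proposal_accept_def space_pair_measure case_prod_beta')
qed

lemma proposal_accept_section:
  assumes D: "D \<in> sets cluster_space"
  shows "{y. (t, y) \<in> proposal_accept \<and> fst y \<in> D} \<in> sets (\<kappa>' t \<Otimes>\<^sub>M unif)"
proof -
  have "Pair t -` proposal_accept \<inter> (fst -` D \<inter> space (cluster_space \<Otimes>\<^sub>M borel)) \<in> sets (cluster_space \<Otimes>\<^sub>M borel)"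
    by (intro sets.Int sets_Pair1[OF proposal_accept_sets] measurable_sets[OF measurable_fst D])
  then show ?thesis using sets_pair_measure_cong[of "\<kappa>' t" cluster_space unif borel]
    by (simp add: space_pair_measure vimage_def Int_def)
qed

lemma longer_sets: "D \<in> sets cluster_space \<Longrightarrow> {C \<in> D. cluster_length C > - t} \<in> sets cluster_space"
proof -
  assume D: "D \<in> sets cluster_space"
  have "{C \<in> space cluster_space. cluster_length C > - t} \<in> sets cluster_space" by measurable
  from sets.Int[OF D this] show ?thesis by (simp add: Int_def)
qed

text \<open>The uniform variable is integrated out first; for a cluster longer than - t the
  threshold lies in [0, 1] and is itself the acceptance probability. The factor for
  \<open>C \<noteq> []\<close> is inserted to apply the change of measure and removed afterwards,
  both times by almost sure termination.\<close>

lemma acceptance_probability: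
  assumes D: "D \<in> sets cluster_space"
  shows "emeasure (\<kappa>' t \<Otimes>\<^sub>M unif) {y. (t, y) \<in> proposal_accept \<and> fst y \<in> D} =
    ennreal (exp (- \<psi> - \<eta> * t)) * emeasure (\<kappa> t) {C \<in> D. cluster_length C > - t}"
proof -
  interpret U: prob_space unif by (rule prob_unif)
  let ?D = "{C \<in> D. cluster_length C > - t}"
  have D': "?D \<in> sets cluster_space" by (rule longer_sets[OF D])
  have "emeasure (\<kappa>' t \<Otimes>\<^sub>M unif) {y. (t, y) \<in> proposal_accept \<and> fst y \<in> D} =
    (\<integral>\<^sup>+C. emeasure unif (Pair C -` {y. (t, y) \<in> proposal_accept \<and> fst y \<in> D}) \<partial>\<kappa>' t)"
    by (rule U.emeasure_pair_measure_alt[OF proposal_accept_section[OF D]])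
  \<comment> \<open>The acceptance probability exp (- \<eta> (B + t)) is split into a constant and
    exp (\<psi> - \<eta> B), the ratio of the original to the tilted law.\<close>
  also have "\<dots> = (\<integral>\<^sup>+C. of_bool (C \<noteq> []) * ((ennreal (exp (- \<psi> - \<eta> * t)) * indicator ?D C) * ennreal (exp (\<psi> - \<eta> * total_birth_time C))) \<partial>\<kappa>' t)"
  proof (rule nn_integral_cong_AE)
    show "AE C in \<kappa>' t. emeasure unif (Pair C -` {y. (t, y) \<in> proposal_accept \<and> fst y \<in> D}) =
      of_bool (C \<noteq> []) * ((ennreal (exp (- \<psi> - \<eta> * t)) * indicator ?D C) * ennreal (exp (\<psi> - \<eta> * total_birth_time C)))"
      using cluster_props_AE[OF tilt(4) a', of t]
    proof eventually_elim
      case (elim C)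
      let ?e = "exp (- \<eta> * (total_birth_time C + t))"
      show ?case
      proof (cases "C \<in> ?D")
        case True
        then have "Pair C -` {y. (t, y) \<in> proposal_accept \<and> fst y \<in> D} = {..?e}" by (auto simp: proposal_accept_def)
        moreover have "?e \<le> 1" using True elim \<eta>(1) by simp
        moreover have "exp (- \<psi> - \<eta> * t) * exp (\<psi> - \<eta> * total_birth_time C) = ?e"
          by (simp add: mult_exp_exp algebra_simps)
        ultimately show ?thesis using True elim
          by (simp only: uniform_prob_atMost[OF exp_ge_zero]) (simp flip: ennreal_mult)
      next
        case False
        then have e: "Pair C -` {y. (t, y) \<in> proposal_accept \<and> fst y \<in> D} = {}" by (auto simp: proposal_accept_def)
        show ?thesis unfolding e using False by simp
      qed
    qed
  qed
  also have "\<dots> = (\<integral>\<^sup>+C. of_bool (C \<noteq> []) * (ennreal (exp (- \<psi> - \<eta> * t)) * indicator ?D C) \<partial>\<kappa> t)"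
  proof (rule cluster_law_tilt[OF f tilt(4) h1_nonneg a'(1), symmetric])
    show "\<psi> = a' - h1" unfolding tilt(1) by simp
    show "h1 * f s = exp (- \<psi> - \<eta> * s) * (a' * tilted_density f \<eta> s)" if "0 \<le> s" for s
    proof -
      have "exp (- \<psi> - \<eta> * s) * exp (psi_f f \<eta> + \<psi>) * exp (\<eta> * s - psi_f f \<eta>) = 1"
        unfolding mult_exp_exp by simp
      then have "h1 * f s * (exp (- \<psi> - \<eta> * s) * exp (psi_f f \<eta> + \<psi>) * exp (\<eta> * s - psi_f f \<eta>)) = h1 * f s" by simp
      then show ?thesis by (simp only: tilted_density_def mult_ac)
    qed
    show "(\<lambda>C. ennreal (exp (- \<psi> - \<eta> * t)) * indicator ?D C) \<in> borel_measurable cluster_space"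
      using D' by measurable
  qed
  also have "\<dots> = (\<integral>\<^sup>+C. ennreal (exp (- \<psi> - \<eta> * t)) * indicator ?D C \<partial>\<kappa> t)"
    by (rule nn_integral_cong_AE[OF eventually_mono[OF cluster_nonempty_AE[OF f h1_nonneg h1(2), of t]]]) simp
  also have "\<dots> = ennreal (exp (- \<psi> - \<eta> * t)) * emeasure (\<kappa> t) ?D"
    by (rule nn_integral_cmult_indicator) (use D' sets_\<kappa> in simp)
  finally show ?thesis .
qed

text \<open>The common intensity of the returned clusters and of \<^const>\<open>N0\<close>.\<close>

definition longer_measure :: "cluster measure" where
  "longer_measure = measure_of UNIV (sets cluster_space)
     (\<lambda>D. \<integral>\<^sup>+t. ennreal lam0 * indicator {..0} t * emeasure (\<kappa> t) {C \<in> D. cluster_length C > - t} \<partial>lborel)"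

lemma longer_measurable:
  assumes D: "D \<in> sets cluster_space"
  shows "(\<lambda>t. emeasure (\<kappa> t) {C \<in> D. cluster_length C > - t}) \<in> borel_measurable borel"
proof -
  have [measurable]: "Measurable.pred cluster_space (\<lambda>C. C \<in> D)" using D by measurable
  have m: "(\<lambda>(t, C). of_bool (C \<in> D \<and> cluster_length C > - t) :: ennreal) \<in> borel_measurable (borel \<Otimes>\<^sub>M cluster_space)"
    by measurable
  have k: "\<kappa> \<in> measurable borel (subprob_algebra cluster_space)"
    by (rule measurable_prob_algebraD[OF cluster_kernel[OF f h1_nonneg]])
  have "emeasure (\<kappa> t) {C \<in> D. cluster_length C > - t} = (\<integral>\<^sup>+C. of_bool (C \<in> D \<and> cluster_length C > - t) \<partial>\<kappa> t)" for t
  proof -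
    have "(\<integral>\<^sup>+C. of_bool (C \<in> D \<and> cluster_length C > - t) \<partial>\<kappa> t) = (\<integral>\<^sup>+C. indicator {C \<in> D. cluster_length C > - t} C \<partial>\<kappa> t)"
      by (intro nn_integral_cong) (simp add: indicator_def)
    then show ?thesis using longer_sets[OF D] sets_\<kappa> by simp
  qed
  then show ?thesis using nn_integral_measurable_subprob_algebra2[OF m k] by simp
qed

lemma sets_longer_measure: "sets longer_measure = sets cluster_space"
proof -
  have "sets cluster_space \<subseteq> Pow UNIV" by simp
  then show ?thesis unfolding longer_measure_def
    by (subst sets_measure_of) (use sets.sigma_sets_eq[of cluster_space] in simp_all)
qed

lemma space_longer_measure: "space longer_measure = UNIV"
  using sets_eq_imp_space_eq[OF sets_longer_measure] by simp

lemma emeasure_longer_measure: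
  assumes D: "D \<in> sets cluster_space"
  shows "emeasure longer_measure D = (\<integral>\<^sup>+t. ennreal lam0 * indicator {..0} t * emeasure (\<kappa> t) {C \<in> D. cluster_length C > - t} \<partial>lborel)"
proof (rule emeasure_measure_of[OF longer_measure_def])
  show "sets cluster_space \<subseteq> Pow UNIV" by simp
  show "D \<in> sets longer_measure" using D by (simp add: sets_longer_measure)
  show "positive (sets longer_measure) (\<lambda>D. \<integral>\<^sup>+t. ennreal lam0 * indicator {..0} t * emeasure (\<kappa> t) {C \<in> D. cluster_length C > - t} \<partial>lborel)"
    by (simp add: positive_def)
  show "countably_additive (sets longer_measure) (\<lambda>D. \<integral>\<^sup>+t. ennreal lam0 * indicator {..0} t * emeasure (\<kappa> t) {C \<in> D. cluster_length C > - t} \<partial>lborel)"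
    unfolding sets_longer_measure
  proof (rule countably_additiveI)
    fix A :: "nat \<Rightarrow> cluster set"
    assume A: "range A \<subseteq> sets cluster_space" "disjoint_family A"
    have As: "A i \<in> sets cluster_space" for i using A(1) by auto
    have [measurable]: "(\<lambda>t. emeasure (\<kappa> t) {C \<in> A i. cluster_length C > - t}) \<in> borel_measurable borel" for i
      by (rule longer_measurable[OF As])
    have "(\<Sum>i. \<integral>\<^sup>+t. ennreal lam0 * indicator {..0} t * emeasure (\<kappa> t) {C \<in> A i. cluster_length C > - t} \<partial>lborel) =
      (\<integral>\<^sup>+t. (\<Sum>i. ennreal lam0 * indicator {..0} t * emeasure (\<kappa> t) {C \<in> A i. cluster_length C > - t}) \<partial>lborel)"
      by (rule nn_integral_suminf[symmetric]) measurable
    also have "\<dots> = (\<integral>\<^sup>+t. ennreal lam0 * indicator {..0} t * emeasure (\<kappa> t) {C \<in> \<Union>(range A). cluster_length C > - t} \<partial>lborel)"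
    proof (rule nn_integral_cong)
      fix t
      have "(\<Sum>i. emeasure (\<kappa> t) {C \<in> A i. cluster_length C > - t}) = emeasure (\<kappa> t) (\<Union>i. {C \<in> A i. cluster_length C > - t})"
        using A(2) longer_sets[OF As] sets_\<kappa> by (intro suminf_emeasure) (auto simp: disjoint_family_on_def)
      moreover have "(\<Union>i. {C \<in> A i. cluster_length C > - t}) = {C \<in> \<Union>(range A). cluster_length C > - t}" by auto
      ultimately show "(\<Sum>i. ennreal lam0 * indicator {..0} t * emeasure (\<kappa> t) {C \<in> A i. cluster_length C > - t}) =
        ennreal lam0 * indicator {..0} t * emeasure (\<kappa> t) {C \<in> \<Union>(range A). cluster_length C > - t}"
        by (simp only: ennreal_suminf_cmult)
    qed
    finally show "(\<Sum>i. \<integral>\<^sup>+t. ennreal lam0 * indicator {..0} t * emeasure (\<kappa> t) {C \<in> A i. cluster_length C > - t} \<partial>lborel) =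
      (\<integral>\<^sup>+t. ennreal lam0 * indicator {..0} t * emeasure (\<kappa> t) {C \<in> \<Union>(range A). cluster_length C > - t} \<partial>lborel)" .
  qed
qed

abbreviation "\<mu>1 \<equiv> density lborel (\<lambda>t. ennreal (lam0 * exp (\<psi> + \<eta> * t)) * indicator {..0} t)"

lemma sets_proposal: "sets (\<mu>1 \<Otimes>\<^sub>M N) = sets (borel \<Otimes>\<^sub>M N)"
  by (rule sets_pair_measure_cong) simp_all

lemma proposal_le: "A \<in> sets borel \<Longrightarrow> emeasure \<mu>1 A \<le> ennreal (lam0 * exp \<psi>) * emeasure lborel A"
proof -
  assume A: "A \<in> sets borel"
  have "emeasure \<mu>1 A = (\<integral>\<^sup>+t. ennreal (lam0 * exp (\<psi> + \<eta> * t)) * indicator {..0} t * indicator A t \<partial>lborel)"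
    using A by (subst emeasure_density) auto
  also have "\<dots> \<le> (\<integral>\<^sup>+t. ennreal (lam0 * exp \<psi>) * indicator A t \<partial>lborel)"
  proof (rule nn_integral_mono)
    fix t
    show "ennreal (lam0 * exp (\<psi> + \<eta> * t)) * indicator {..0} t * indicator A t \<le> ennreal (lam0 * exp \<psi>) * indicator A t"
    proof (cases "t \<le> 0")
      case True
      then have "exp (\<psi> + \<eta> * t) \<le> exp \<psi>" using \<eta>(1) by (simp add: mult_nonneg_nonpos)
      then have "ennreal (lam0 * exp (\<psi> + \<eta> * t)) \<le> ennreal (lam0 * exp \<psi>)" using lam0 by (intro ennreal_leI mult_left_mono) auto
      then show ?thesis using True by (simp add: mult_right_mono)
    qed simp
  qed
  also have "\<dots> = ennreal (lam0 * exp \<psi>) * emeasure lborel A" by (rule nn_integral_cmult_indicator) (use A in simp)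
  finally show ?thesis .
qed

lemma longer_measure_proposal:
  assumes D: "D \<in> sets cluster_space"
  shows "emeasure longer_measure D = (\<integral>\<^sup>+t. emeasure (\<kappa>' t \<Otimes>\<^sub>M unif) {y. (t, y) \<in> proposal_accept \<and> fst y \<in> D} \<partial>\<mu>1)"
proof -
  have m: "(\<lambda>t. emeasure (\<kappa> t) {C \<in> D. cluster_length C > - t}) \<in> borel_measurable borel" by (rule longer_measurable[OF D])
  have "(\<integral>\<^sup>+t. emeasure (\<kappa>' t \<Otimes>\<^sub>M unif) {y. (t, y) \<in> proposal_accept \<and> fst y \<in> D} \<partial>\<mu>1) =
    (\<integral>\<^sup>+t. (ennreal (lam0 * exp (\<psi> + \<eta> * t)) * indicator {..0} t) * (ennreal (exp (- \<psi> - \<eta> * t)) * emeasure (\<kappa> t) {C \<in> D. cluster_length C > - t}) \<partial>lborel)"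
    unfolding acceptance_probability[OF D] by (rule nn_integral_density) (use m in measurable)
  also have "\<dots> = (\<integral>\<^sup>+t. ennreal lam0 * indicator {..0} t * emeasure (\<kappa> t) {C \<in> D. cluster_length C > - t} \<partial>lborel)"
  proof (rule nn_integral_cong)
    fix t
    have "lam0 * exp (\<psi> + \<eta> * t) * exp (- \<psi> - \<eta> * t) = lam0" by (simp add: mult.assoc mult_exp_exp)
    then have "ennreal (lam0 * exp (\<psi> + \<eta> * t)) * ennreal (exp (- \<psi> - \<eta> * t)) = ennreal lam0"
      using lam0 by (simp flip: ennreal_mult)
    moreover have "(p * i) * (q * e) = (p * q) * i * e" for p i q e :: ennreal by (simp only: mult_ac)
    ultimately show "(ennreal (lam0 * exp (\<psi> + \<eta> * t)) * indicator {..0} t) * (ennreal (exp (- \<psi> - \<eta> * t)) * emeasure (\<kappa> t) {C \<in> D. cluster_length C > - t}) =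
      ennreal lam0 * indicator {..0} t * emeasure (\<kappa> t) {C \<in> D. cluster_length C > - t}" by simp
  qed
  finally show ?thesis unfolding emeasure_longer_measure[OF D] by simp
qed

text \<open>The total mass is \<open>lam0\<close> times the mean cluster length. Its finiteness is
  read off from the proposals, whose total intensity dominates it.\<close>

lemma finite_longer_measure: "finite_measure longer_measure"
proof (rule finite_measureI)
  have U: "UNIV \<in> sets cluster_space" using sets.top[of cluster_space] by simp
  have pr: "prob_space (\<kappa>' t \<Otimes>\<^sub>M unif)" for t
    by (rule prob_space_pair[OF prob_space_cluster_law[OF tilt(4) a'(1)] prob_unif])
  have "emeasure longer_measure UNIV \<le> (\<integral>\<^sup>+t. 1 \<partial>\<mu>1)"
    unfolding longer_measure_proposal[OF U]
    by (intro nn_integral_mono prob_space.measure_le_1 prob_space.emeasure_le_1[OF pr])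
  also have "\<dots> = ennreal (lam0 * exp \<psi> / \<eta>)"
    using emeasure_exponential_intensity[of lam0 \<eta> \<psi>] lam0 \<eta>(1) by simp
  finally show "emeasure longer_measure (space longer_measure) \<noteq> \<infinity>"
    by (auto simp: space_longer_measure top_unique)
qed

lemma kernel_on: "sets \<mu> = sets borel \<Longrightarrow> \<kappa> \<in> measurable \<mu> (prob_algebra cluster_space)"
    "sets \<mu> = sets borel \<Longrightarrow> (\<lambda>t. \<kappa>' t \<Otimes>\<^sub>M unif) \<in> measurable \<mu> (prob_algebra (cluster_space \<Otimes>\<^sub>M borel))"
  using cluster_kernel[OF f h1_nonneg] tilted_kernel measurable_cong_sets[of \<mu> borel] by blast+

lemma algorithm_marked:
  assumes "algorithm_run lam0 h1 f \<eta> M K \<tau> C X"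
  shows "marked_poisson_process M \<mu>1 (cluster_space \<Otimes>\<^sub>M borel) (\<lambda>t. \<kappa>' t \<Otimes>\<^sub>M unif) (\<lambda>\<omega>. {1..K \<omega>}) \<tau>
    (\<lambda>m \<omega>. (C m \<omega>, X m \<omega>))"
  using assms by (simp add: algorithm_run_def)

lemma N0_process:
  assumes H: "stationary_hawkes lam0 h1 f M \<tau> C"
  shows "N0 \<tau> C \<in> measurable M (config_space cluster_space)" and "poisson_process M longer_measure (N0 \<tau> C) (\<lambda>c \<omega>. c)"
proof -
  let ?\<mu> = "density lborel (\<lambda>t :: real. ennreal lam0)"
  define S where "S = {p :: real \<times> cluster. fst p \<le> 0 \<and> cluster_length (snd p) > - fst p}"
  have P: "marked_poisson_process M ?\<mu> cluster_space \<kappa> (\<lambda>\<omega>. - {0}) \<tau> C"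
    using H by (simp add: stationary_hawkes_def)
  have sp: "sets (?\<mu> \<Otimes>\<^sub>M cluster_space) = sets (borel \<Otimes>\<^sub>M cluster_space)" by (rule sets_pair_measure_cong) simp_all
  have "{p \<in> space (borel \<Otimes>\<^sub>M cluster_space). fst p \<le> 0 \<and> cluster_length (snd p) > - fst p} \<in> sets (borel \<Otimes>\<^sub>M cluster_space)"
    by measurable
  then have S: "S \<in> sets (?\<mu> \<Otimes>\<^sub>M cluster_space)" unfolding sp by (simp add: S_def space_pair_measure)
  have le: "emeasure ?\<mu> A \<le> ennreal lam0 * emeasure lborel A" if "A \<in> sets borel" for A
    using that by (subst emeasure_density) (auto simp: nn_integral_cmult_indicator)
  have arr: "AE c in \<kappa> t. arrival_time (snd (t, c)) = t" for t
    using cluster_props_AE[OF f h1_nonneg h1(2), of t] by eventually_elim simp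
  have \<Lambda>: "emeasure longer_measure D = (\<integral>\<^sup>+t. emeasure (\<kappa> t) {y \<in> space cluster_space. (t, y) \<in> S \<and> snd (t, y) \<in> D} \<partial>?\<mu>)"
    if "D \<in> sets longer_measure" for D
  proof -
    have D: "D \<in> sets cluster_space" using that by (simp add: sets_longer_measure)
    have e: "emeasure (\<kappa> t) {y \<in> space cluster_space. (t, y) \<in> S \<and> snd (t, y) \<in> D} =
      indicator {..0} t * emeasure (\<kappa> t) {C \<in> D. cluster_length C > - t}" for t
      by (cases "t \<le> 0") (auto simp: S_def intro: arg_cong[where f="emeasure (\<kappa> t)"])
    have m: "(\<lambda>t. indicator {..0} t * emeasure (\<kappa> t) {C \<in> D. cluster_length C > - t}) \<in> borel_measurable lborel"
      using longer_measurable[OF D] by measurable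
    show ?thesis unfolding e emeasure_longer_measure[OF D]
      by (subst nn_integral_density[OF _ m]) (auto simp: mult.assoc)
  qed
  define R where "R \<omega> = (\<lambda>m. snd (\<tau> m \<omega>, C m \<omega>)) ` {m \<in> - {0}. (\<tau> m \<omega>, C m \<omega>) \<in> S}" for \<omega>
  have sm: "sets ?\<mu> = sets borel" by simp
  have l0: "0 \<le> lam0" using lam0 by simp
  note th = thinned_cluster_process[OF P kernel_on(1)[OF sm] sm l0 le S measurable_snd arr sets_longer_measure \<Lambda>, folded R_def]
  have eq: "N0 \<tau> C \<omega> = R \<omega>" if "\<omega> \<in> space M" for \<omega>
  proof -
    have mono: "\<And>m n. m \<noteq> 0 \<Longrightarrow> n \<noteq> 0 \<Longrightarrow> m \<le> n \<Longrightarrow> \<tau> m \<omega> \<le> \<tau> n \<omega>" and zero: "\<tau> (-1) \<omega> \<le> 0" "0 < \<tau> 1 \<omega>"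
      using H that by (simp_all add: stationary_hawkes_def)
    \<comment> \<open>\<open>N0\<close> selects by the index, the thinning by the sign of the
      arrival time; the order of the arrival times and the convention around index 0 make the two
      agree.\<close>
    have "m \<le> -1 \<longleftrightarrow> m \<noteq> 0 \<and> \<tau> m \<omega> \<le> 0" for m
    proof (cases "m \<le> -1")
      case True
      then show ?thesis using mono[of m "-1"] zero(1) by simp
    next
      case False
      then show ?thesis using mono[of 1 m] zero(2) by auto
    qed
    then show ?thesis by (auto simp: N0_def R_def S_def)
  qed
  show "N0 \<tau> C \<in> measurable M (config_space cluster_space)"
    using th(1) measurable_cong[of M "N0 \<tau> C" R] eq by blast
  show "poisson_process M longer_measure (N0 \<tau> C) (\<lambda>c \<omega>. c)"
    using th(2) poisson_process_cong[of M "N0 \<tau> C" R] eq by blast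
qed

lemma returned_process:
  assumes A: "algorithm_run lam0 h1 f \<eta> M K \<tau> C X"
  shows "returned \<eta> K \<tau> C X \<in> measurable M (config_space cluster_space)"
    and "poisson_process M longer_measure (returned \<eta> K \<tau> C X) (\<lambda>c \<omega>. c)"
proof -
  note P = algorithm_marked[OF A]
  have S: "proposal_accept \<in> sets (\<mu>1 \<Otimes>\<^sub>M (cluster_space \<Otimes>\<^sub>M borel))"
    unfolding sets_proposal by (rule proposal_accept_sets)
  have Z: "(\<lambda>p. fst (snd p)) \<in> measurable (\<mu>1 \<Otimes>\<^sub>M (cluster_space \<Otimes>\<^sub>M borel)) cluster_space" by measurable
  have arr: "AE y in \<kappa>' t \<Otimes>\<^sub>M unif. arrival_time (fst (snd (t, y))) = t" for t
  proof -
    interpret K: prob_space "\<kappa>' t" by (rule prob_space_cluster_law[OF tilt(4) a'(1)])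
    interpret U: prob_space unif by (rule prob_unif)
    interpret KU: pair_sigma_finite "\<kappa>' t" unif ..
    have "AE y in \<kappa>' t \<Otimes>\<^sub>M unif. arrival_time (fst y) = t"
    proof (rule KU.AE_pair_measure)
      have [measurable]: "arrival_time \<in> borel_measurable (\<kappa>' t)"
        using measurable_arrival_time measurable_cong_sets[OF sets_\<kappa>' refl] by blast
      show "{y \<in> space (\<kappa>' t \<Otimes>\<^sub>M unif). arrival_time (fst y) = t} \<in> sets (\<kappa>' t \<Otimes>\<^sub>M unif)" by measurable
      show "AE C in \<kappa>' t. AE x in unif. arrival_time (fst (C, x)) = t"
        using cluster_props_AE[OF tilt(4) a', of t] by eventually_elim simp
    qed
    then show ?thesis by simp
  qed
  have \<Lambda>: "emeasure longer_measure D = (\<integral>\<^sup>+t. emeasure (\<kappa>' t \<Otimes>\<^sub>M unif)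
      {y \<in> space (cluster_space \<Otimes>\<^sub>M borel). (t, y) \<in> proposal_accept \<and> fst (snd (t, y)) \<in> D} \<partial>\<mu>1)"
    if "D \<in> sets longer_measure" for D
    using longer_measure_proposal[of D] that by (simp add: sets_longer_measure space_pair_measure)
  have sm: "sets \<mu>1 = sets borel" by simp
  have c: "0 \<le> lam0 * exp \<psi>" using lam0 by simp
  define R where "R \<omega> = (\<lambda>m. fst (snd (\<tau> m \<omega>, C m \<omega>, X m \<omega>))) ` {m \<in> {1..K \<omega>}. (\<tau> m \<omega>, C m \<omega>, X m \<omega>) \<in> proposal_accept}" for \<omega>
  note th = thinned_cluster_process[OF P kernel_on(2)[OF sm] sm c proposal_le S Z arr sets_longer_measure \<Lambda>, folded R_def]
  have eq: "returned \<eta> K \<tau> C X = R"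
    by (auto simp: returned_def accepted_def proposal_accept_def R_def fun_eq_iff)
  show "returned \<eta> K \<tau> C X \<in> measurable M (config_space cluster_space)"
    unfolding eq by (rule th(1))
  show "poisson_process M longer_measure (returned \<eta> K \<tau> C X) (\<lambda>c \<omega>. c)"
    unfolding eq by (rule th(2))
qed

lemma longer_tail: "emeasure (\<kappa> t) {C \<in> UNIV. cluster_length C > - t} = ennreal (length_tail h1 f (- t))"
  using cluster_tail_shift[OF f h1_nonneg, of t "- t"] by simp

lemma UNIV_cluster: "UNIV \<in> sets cluster_space"
  using sets.top[of cluster_space] by simp

text \<open>The intensity is pushed forward along \<open>arrival_time\<close>. Under the law of a
  cluster started at t the arrival time is almost surely t, which leaves the probability of a length
  above - t.\<close>

lemma arrival_process:
  assumes P: "poisson_process M longer_measure R (\<lambda>c \<omega>. c)"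
  shows "poisson_process M (density lborel (\<lambda>t. ennreal (lam0 * length_tail h1 f (- t)) * indicator {..0} t)) R (\<lambda>c \<omega>. arrival_time c)"
proof (rule poisson_process_map[OF P space_longer_measure])
  have l0: "ennreal (lam0 * length_tail h1 f (- t)) = ennreal lam0 * emeasure (\<kappa> t) {C \<in> UNIV. cluster_length C > - t}" for t
    unfolding longer_tail using lam0 by (simp add: ennreal_mult length_tail_def)
  have m: "(\<lambda>t. ennreal (lam0 * length_tail h1 f (- t)) * indicator {..0} t) \<in> borel_measurable lborel"
    unfolding l0 using longer_measurable[OF UNIV_cluster] by measurable
  show "arrival_time \<in> measurable longer_measure (density lborel (\<lambda>t. ennreal (lam0 * length_tail h1 f (- t)) * indicator {..0} t))"
    using measurable_arrival_time by (simp add: measurable_cong_sets[OF sets_longer_measure refl])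
  fix A assume "A \<in> sets (density lborel (\<lambda>t. ennreal (lam0 * length_tail h1 f (- t)) * indicator {..0} t))"
  then have A: "A \<in> sets borel" by simp
  have A': "arrival_time -` A \<in> sets cluster_space" using measurable_sets[OF measurable_arrival_time A] by simp
  have e: "emeasure (\<kappa> t) {C \<in> arrival_time -` A. cluster_length C > - t} = indicator A t * emeasure (\<kappa> t) {C \<in> UNIV. cluster_length C > - t}" for t
  proof -
    have "emeasure (\<kappa> t) {C \<in> arrival_time -` A. cluster_length C > - t} = emeasure (\<kappa> t) {C \<in> (if t \<in> A then UNIV else {}). cluster_length C > - t}"
    proof (rule emeasure_eq_AE)
      show "AE C in \<kappa> t. C \<in> {C \<in> arrival_time -` A. cluster_length C > - t} \<longleftrightarrow> C \<in> {C \<in> (if t \<in> A then UNIV else {}). cluster_length C > - t}"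
        using cluster_props_AE[OF f h1_nonneg h1(2), of t] by eventually_elim simp
      show "{C \<in> arrival_time -` A. cluster_length C > - t} \<in> sets (\<kappa> t)"
        and "{C \<in> (if t \<in> A then UNIV else {}). cluster_length C > - t} \<in> sets (\<kappa> t)"
        unfolding sets_\<kappa> using longer_sets[OF A'] longer_sets[OF UNIV_cluster] by auto
    qed
    then show ?thesis by (cases "t \<in> A") simp_all
  qed
  show "emeasure (density lborel (\<lambda>t. ennreal (lam0 * length_tail h1 f (- t)) * indicator {..0} t)) A = emeasure longer_measure (arrival_time -` A)"
    unfolding emeasure_longer_measure[OF A'] e
    by (subst emeasure_density[OF m]) (use A in \<open>simp_all add: l0 mult_ac\<close>)
qed

text \<open>The function g of the arrival time is kept general so that it can later absorb a
  conditional probability.\<close>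

lemma accepted_integral:
  assumes A: "algorithm_run lam0 h1 f \<eta> M K \<tau> C X" and g: "g \<in> borel_measurable borel" and D: "D \<in> sets cluster_space"
  shows "(\<integral>\<^sup>+\<omega>. of_bool (m \<in> accepted \<eta> K \<tau> C X \<omega> \<and> C m \<omega> \<in> D) * g (\<tau> m \<omega>) \<partial>M) =
    (\<integral>\<^sup>+\<omega>. of_bool (m \<in> {1..K \<omega>}) * (g (\<tau> m \<omega>) * (ennreal (exp (- \<psi> - \<eta> * \<tau> m \<omega>)) * emeasure (\<kappa> (\<tau> m \<omega>)) {C \<in> D. cluster_length C > - \<tau> m \<omega>})) \<partial>M)"
proof -
  note P = algorithm_marked[OF A]
  have [measurable]: "Measurable.pred (borel \<Otimes>\<^sub>M (cluster_space \<Otimes>\<^sub>M borel)) (\<lambda>p. p \<in> proposal_accept)"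
    using proposal_accept_sets by measurable
  have [measurable]: "Measurable.pred cluster_space (\<lambda>C. C \<in> D)" using D by measurable
  have h: "(\<lambda>p. of_bool (p \<in> proposal_accept \<and> fst (snd p) \<in> D) * g (fst p)) \<in> borel_measurable (\<mu>1 \<Otimes>\<^sub>M (cluster_space \<Otimes>\<^sub>M borel))"
    unfolding measurable_cong_sets[OF sets_proposal refl] using g by measurable
  have sm: "sets \<mu>1 = sets borel" by simp
  have in_acc: "m \<in> accepted \<eta> K \<tau> C X \<omega> \<longleftrightarrow> m \<in> {1..K \<omega>} \<and> (\<tau> m \<omega>, C m \<omega>, X m \<omega>) \<in> proposal_accept" for \<omega>
    by (simp add: accepted_def proposal_accept_def)
  have "(\<integral>\<^sup>+\<omega>. of_bool (m \<in> accepted \<eta> K \<tau> C X \<omega> \<and> C m \<omega> \<in> D) * g (\<tau> m \<omega>) \<partial>M) =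
    (\<integral>\<^sup>+\<omega>. of_bool (m \<in> {1..K \<omega>}) * (of_bool ((\<tau> m \<omega>, C m \<omega>, X m \<omega>) \<in> proposal_accept \<and> fst (snd (\<tau> m \<omega>, C m \<omega>, X m \<omega>)) \<in> D) * g (fst (\<tau> m \<omega>, C m \<omega>, X m \<omega>))) \<partial>M)"
    unfolding in_acc by (rule nn_integral_cong) (simp add: of_bool_conj mult.assoc del: atLeastAtMost_iff)
  also have "\<dots> = (\<integral>\<^sup>+\<omega>. of_bool (m \<in> {1..K \<omega>}) * (\<integral>\<^sup>+y. of_bool ((\<tau> m \<omega>, y) \<in> proposal_accept \<and> fst (snd (\<tau> m \<omega>, y)) \<in> D) * g (fst (\<tau> m \<omega>, y)) \<partial>(\<kappa>' (\<tau> m \<omega>) \<Otimes>\<^sub>M unif)) \<partial>M)"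
    by (rule marked_poisson_single[OF P kernel_on(2)[OF sm] h])
  also have "\<dots> = (\<integral>\<^sup>+\<omega>. of_bool (m \<in> {1..K \<omega>}) * (g (\<tau> m \<omega>) * (ennreal (exp (- \<psi> - \<eta> * \<tau> m \<omega>)) * emeasure (\<kappa> (\<tau> m \<omega>)) {C \<in> D. cluster_length C > - \<tau> m \<omega>})) \<partial>M)"
  proof -
    have "(\<integral>\<^sup>+y. of_bool ((t, y) \<in> proposal_accept \<and> fst (snd (t, y)) \<in> D) * g (fst (t, y)) \<partial>(\<kappa>' t \<Otimes>\<^sub>M unif)) =
      g t * (ennreal (exp (- \<psi> - \<eta> * t)) * emeasure (\<kappa> t) {C \<in> D. cluster_length C > - t})" for t
    proof -
      have "(\<integral>\<^sup>+y. of_bool ((t, y) \<in> proposal_accept \<and> fst (snd (t, y)) \<in> D) * g (fst (t, y)) \<partial>(\<kappa>' t \<Otimes>\<^sub>M unif)) =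
        (\<integral>\<^sup>+y. g t * indicator {y. (t, y) \<in> proposal_accept \<and> fst y \<in> D} y \<partial>(\<kappa>' t \<Otimes>\<^sub>M unif))"
        by (rule nn_integral_cong) (simp add: indicator_def)
      also have "\<dots> = g t * emeasure (\<kappa>' t \<Otimes>\<^sub>M unif) {y. (t, y) \<in> proposal_accept \<and> fst y \<in> D}"
        by (rule nn_integral_cmult_indicator[OF proposal_accept_section[OF D]])
      finally show ?thesis unfolding acceptance_probability[OF D] .
    qed
    then show ?thesis by simp
  qed
  finally show ?thesis .
qed

text \<open>At arrival time t, acceptance with cluster in D has probability exp (- \<psi> - \<eta>
  t) times the original probability of D together with a length above - t. The first factor does not
  involve D and cancels in the conditional law. Formally \<open>accepted_integral\<close> is applied
  twice: to D, and to \<open>UNIV\<close> with the quotient Q moved into g.\<close>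

lemma accepted_cluster_law:
  assumes Alg: "algorithm_run lam0 h1 f \<eta> M K \<tau> C X" and A: "A \<in> sets borel" and D: "D \<in> sets cluster_space"
  shows "emeasure M {\<omega> \<in> space M. m \<in> accepted \<eta> K \<tau> C X \<omega> \<and> \<tau> m \<omega> \<in> A \<and> C m \<omega> \<in> D} =
    (\<integral>\<^sup>+\<omega>\<in>{\<omega> \<in> space M. m \<in> accepted \<eta> K \<tau> C X \<omega> \<and> \<tau> m \<omega> \<in> A}. emeasure (cluster_law_given_longer h1 f (\<tau> m \<omega>)) D \<partial>M)"
proof -
  note P = algorithm_marked[OF Alg]
  define Q where "Q t = emeasure (\<kappa> t) {C \<in> D. cluster_length C > - t} / emeasure (\<kappa> t) {C \<in> UNIV. cluster_length C > - t}" for t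
  have law: "emeasure (cluster_law_given_longer h1 f t) D = Q t" for t
  proof -
    have "{C \<in> space cluster_space. cluster_length C > - t} \<inter> D = {C \<in> D. cluster_length C > - t}" by auto
    then show ?thesis unfolding cluster_law_given_longer_def Q_def
      using longer_sets[OF UNIV_cluster, of t] D sets_\<kappa> by (subst emeasure_uniform_measure) simp_all
  qed
  \<comment> \<open>If no cluster is long enough, the quotient is 0 / 0 and the product is 0; this
    is still right because the numerator vanishes too.\<close>
  have Q: "Q t * emeasure (\<kappa> t) {C \<in> UNIV. cluster_length C > - t} = emeasure (\<kappa> t) {C \<in> D. cluster_length C > - t}" for t
  proof -
    interpret K: prob_space "\<kappa> t" by (rule prob_space_cluster_law[OF f h1_nonneg])
    have le: "emeasure (\<kappa> t) {C \<in> D. cluster_length C > - t} \<le> emeasure (\<kappa> t) {C \<in> UNIV. cluster_length C > - t}"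
      using longer_sets[OF UNIV_cluster, of t] sets_\<kappa> by (intro emeasure_mono) auto
    show ?thesis
    proof (cases "emeasure (\<kappa> t) {C \<in> UNIV. cluster_length C > - t} = 0")
      case True
      then show ?thesis using le by simp
    next
      case False
      have "emeasure (\<kappa> t) {C \<in> UNIV. cluster_length C > - t} < top"
        by (rule le_less_trans[OF K.emeasure_le_1]) simp
      from ennreal_divide_self[OF False this] show ?thesis unfolding Q_def ennreal_divide_times by simp
    qed
  qed
  have Qm: "Q \<in> borel_measurable borel"
    unfolding Q_def[abs_def] using longer_measurable[OF D] longer_measurable[OF UNIV_cluster] by measurable
  have [measurable]: "Measurable.pred borel (\<lambda>t. t \<in> A)" using A by measurable
  have iA: "(\<lambda>t. of_bool (t \<in> A) :: ennreal) \<in> borel_measurable borel" by measurable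
  have gA: "(\<lambda>t. of_bool (t \<in> A) * Q t) \<in> borel_measurable borel" using Qm by measurable
  have E: "{\<omega> \<in> space M. m \<in> accepted \<eta> K \<tau> C X \<omega> \<and> \<tau> m \<omega> \<in> A \<and> C m \<omega> \<in> D} \<in> sets M"
  proof -
    note I = marked_poissonD(2)[OF P, of m] and T = marked_poissonD(3)[OF P, of m] and Y = marked_poissonD(4)[OF P, of m]
    have T': "\<tau> m \<in> borel_measurable M" using T by simp
    have TY: "(\<lambda>\<omega>. (\<tau> m \<omega>, C m \<omega>, X m \<omega>)) \<in> measurable M (borel \<Otimes>\<^sub>M (cluster_space \<Otimes>\<^sub>M borel))"
      using T' Y by (rule measurable_Pair)
    have Cm: "C m \<in> measurable M cluster_space" using measurable_compose[OF Y measurable_fst] by simp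
    have eq: "{\<omega> \<in> space M. m \<in> accepted \<eta> K \<tau> C X \<omega> \<and> \<tau> m \<omega> \<in> A \<and> C m \<omega> \<in> D} =
      {\<omega> \<in> space M. m \<in> {1..K \<omega>}} \<inter> ((\<lambda>\<omega>. (\<tau> m \<omega>, C m \<omega>, X m \<omega>)) -` proposal_accept \<inter> space M) \<inter> (\<tau> m -` A \<inter> space M) \<inter> (C m -` D \<inter> space M)"
      by (auto simp: accepted_def proposal_accept_def)
    show ?thesis unfolding eq
      by (intro sets.Int I measurable_sets[OF TY proposal_accept_sets] measurable_sets[OF T' A] measurable_sets[OF Cm D])
  qed
  have "emeasure M {\<omega> \<in> space M. m \<in> accepted \<eta> K \<tau> C X \<omega> \<and> \<tau> m \<omega> \<in> A \<and> C m \<omega> \<in> D} =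
    (\<integral>\<^sup>+\<omega>. indicator {\<omega> \<in> space M. m \<in> accepted \<eta> K \<tau> C X \<omega> \<and> \<tau> m \<omega> \<in> A \<and> C m \<omega> \<in> D} \<omega> \<partial>M)"
    by (rule nn_integral_indicator[OF E, symmetric])
  also have "\<dots> = (\<integral>\<^sup>+\<omega>. of_bool (m \<in> accepted \<eta> K \<tau> C X \<omega> \<and> C m \<omega> \<in> D) * of_bool (\<tau> m \<omega> \<in> A) \<partial>M)"
    by (rule nn_integral_cong) (auto simp: indicator_def)
  also have "\<dots> = (\<integral>\<^sup>+\<omega>. of_bool (m \<in> {1..K \<omega>}) * (of_bool (\<tau> m \<omega> \<in> A) * (ennreal (exp (- \<psi> - \<eta> * \<tau> m \<omega>)) * emeasure (\<kappa> (\<tau> m \<omega>)) {C \<in> D. cluster_length C > - \<tau> m \<omega>})) \<partial>M)"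
    by (rule accepted_integral[OF Alg iA D])
  also have "\<dots> = (\<integral>\<^sup>+\<omega>. of_bool (m \<in> {1..K \<omega>}) * ((of_bool (\<tau> m \<omega> \<in> A) * Q (\<tau> m \<omega>)) * (ennreal (exp (- \<psi> - \<eta> * \<tau> m \<omega>)) * emeasure (\<kappa> (\<tau> m \<omega>)) {C \<in> UNIV. cluster_length C > - \<tau> m \<omega>})) \<partial>M)"
    by (rule nn_integral_cong, subst Q[symmetric]) (simp only: mult_ac)
  also have "\<dots> = (\<integral>\<^sup>+\<omega>. of_bool (m \<in> accepted \<eta> K \<tau> C X \<omega> \<and> C m \<omega> \<in> UNIV) * (of_bool (\<tau> m \<omega> \<in> A) * Q (\<tau> m \<omega>)) \<partial>M)"
    by (rule accepted_integral[OF Alg gA UNIV_cluster, symmetric])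
  also have "\<dots> = (\<integral>\<^sup>+\<omega>\<in>{\<omega> \<in> space M. m \<in> accepted \<eta> K \<tau> C X \<omega> \<and> \<tau> m \<omega> \<in> A}. emeasure (cluster_law_given_longer h1 f (\<tau> m \<omega>)) D \<partial>M)"
    unfolding law by (rule nn_integral_cong) (auto simp: indicator_def)
  finally show ?thesis .
qed

text \<open>Given the points, each proposal costs c on average whatever its arrival time: the mean
  cluster size plus 1 for the uniform variable. So the mean cost is c times the mean number of
  proposals, which is the total proposal intensity.\<close>

lemma expected_cost:
  assumes Alg: "algorithm_run lam0 h1 f \<eta> M K \<tau> C X"
  shows "(\<integral>\<^sup>+\<omega>. (\<Sum>m = 1..K \<omega>. (cluster_size (C m \<omega>) + 1)) \<partial>M) =
    ennreal (lam0 * exp \<psi> * (2 - h1 - \<psi>) / (\<eta> * (1 - h1 - \<psi>)))"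
proof -
  note P = algorithm_marked[OF Alg]
  note PP = marked_poissonD(1)[OF P] and I = marked_poissonD(2)[OF P] and Y = marked_poissonD(4)[OF P]
  have [measurable]: "C m \<in> measurable M cluster_space" for m using measurable_compose[OF Y measurable_fst] by simp
  have [measurable]: "Measurable.pred M (\<lambda>\<omega>. m \<in> {1..K \<omega>})" for m unfolding pred_def by (rule I)
  have sm: "sets \<mu>1 = sets borel" by simp
  define c where "c = 1 / (1 - a') + 1"
  have c0: "0 \<le> c" using a' by (simp add: c_def)
  have cost: "(\<integral>\<^sup>+y. cluster_size (fst y) + 1 \<partial>(\<kappa>' t \<Otimes>\<^sub>M unif)) = ennreal c" for t
  proof -
    interpret K: prob_space "\<kappa>' t" by (rule prob_space_cluster_law[OF tilt(4) a'(1)])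
    interpret U: prob_space unif by (rule prob_unif)
    have cs: "cluster_size \<in> borel_measurable (\<kappa>' t)"
      using measurable_cluster_size measurable_cong_sets[OF sets_\<kappa>' refl] by blast
    then have "(\<lambda>y. cluster_size (fst y) + 1) \<in> borel_measurable (\<kappa>' t \<Otimes>\<^sub>M unif)" by measurable
    from U.nn_integral_fst[OF this]
    have "(\<integral>\<^sup>+y. cluster_size (fst y) + 1 \<partial>(\<kappa>' t \<Otimes>\<^sub>M unif)) = (\<integral>\<^sup>+C. cluster_size C + 1 \<partial>\<kappa>' t)"
      by (simp add: U.emeasure_space_1)
    also have "\<dots> = (\<integral>\<^sup>+C. cluster_size C \<partial>\<kappa>' t) + 1"
      using cs by (subst nn_integral_add) (simp_all add: K.emeasure_space_1)
    also have "\<dots> = ennreal (1 / (1 - a')) + 1" by (simp only: expected_cluster_size_law[OF tilt(4) a'])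
    finally show ?thesis unfolding c_def using a' by (simp add: ennreal_plus)
  qed
  have h: "(\<lambda>p. cluster_size (fst (snd p)) + 1) \<in> borel_measurable (\<mu>1 \<Otimes>\<^sub>M (cluster_space \<Otimes>\<^sub>M borel))" by measurable
  \<comment> \<open>A sum with a random number of terms becomes a fixed series with indicators, so
    that sum and integral can be exchanged.\<close>
  have as_series: "(\<Sum>m = 1..K \<omega>. g m) = (\<Sum>m. of_bool (m \<in> {1..K \<omega>}) * g m)" for g :: "nat \<Rightarrow> ennreal" and \<omega>
    by (subst suminf_finite[of "{1..K \<omega>}"]) auto
  have all: "{m \<in> {1..K \<omega>}. \<tau> m \<omega> \<in> UNIV} = {1..K \<omega>}" for \<omega> by auto
  have "(\<integral>\<^sup>+\<omega>. (\<Sum>m = 1..K \<omega>. (cluster_size (C m \<omega>) + 1)) \<partial>M) =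
    (\<Sum>m. \<integral>\<^sup>+\<omega>. of_bool (m \<in> {1..K \<omega>}) * (cluster_size (C m \<omega>) + 1) \<partial>M)"
    unfolding as_series by (rule nn_integral_suminf) measurable
  also have "\<dots> = (\<Sum>m. \<integral>\<^sup>+\<omega>. of_bool (m \<in> {1..K \<omega>}) * ennreal c \<partial>M)"
    using marked_poisson_single[OF P kernel_on(2)[OF sm] h] by (simp add: cost)
  also have "\<dots> = (\<integral>\<^sup>+\<omega>. (\<Sum>m. of_bool (m \<in> {1..K \<omega>}) * ennreal c) \<partial>M)"
    by (rule nn_integral_suminf[symmetric]) measurable
  also have "\<dots> = (\<integral>\<^sup>+\<omega>. ennreal c * of_nat (card {m \<in> {1..K \<omega>}. \<tau> m \<omega> \<in> UNIV}) \<partial>M)"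
    unfolding as_series[symmetric] all by (simp add: mult.commute)
  also have "\<dots> = ennreal c * (\<integral>\<^sup>+\<omega>. of_nat (card {m \<in> {1..K \<omega>}. \<tau> m \<omega> \<in> UNIV}) \<partial>M)"
  proof (rule nn_integral_cmult)
    have "(\<lambda>\<omega>. (\<Sum>m. of_bool (m \<in> {1..K \<omega>}) * 1) :: ennreal) \<in> borel_measurable M" by measurable
    then show "(\<lambda>\<omega>. of_nat (card {m \<in> {1..K \<omega>}. \<tau> m \<omega> \<in> UNIV}) :: ennreal) \<in> borel_measurable M"
      unfolding as_series[symmetric] all by simp
  qed
  also have "\<dots> = ennreal c * emeasure \<mu>1 UNIV"
  proof -
    have "(\<integral>\<^sup>+\<omega>. of_nat (card {m \<in> {1..K \<omega>}. \<tau> m \<omega> \<in> UNIV}) \<partial>M) = emeasure \<mu>1 UNIV"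
      by (rule poisson_process_mean[OF PP]) (use emeasure_exponential_intensity[of lam0 \<eta> \<psi>] lam0 \<eta> in simp_all)
    then show ?thesis by simp
  qed
  also have "\<dots> = ennreal (c * (lam0 * exp \<psi> / \<eta>))"
  proof -
    have "emeasure \<mu>1 UNIV = ennreal (lam0 * exp \<psi> / \<eta>)"
      by (rule emeasure_exponential_intensity) (use lam0 \<eta> in simp_all)
    moreover have "0 \<le> lam0 * exp \<psi> / \<eta>" using lam0 \<eta> by simp
    ultimately show ?thesis by (simp only: ennreal_mult[OF c0])
  qed
  also have "c * (lam0 * exp \<psi> / \<eta>) = lam0 * exp \<psi> * (2 - h1 - \<psi>) / (\<eta> * (1 - h1 - \<psi>))"
  proof -
    \<comment> \<open>In terms of d the cost per proposal is 1 / d + 1 = (1 + d) / d, the quotient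
      (2 - h1 - \<psi>) / (1 - h1 - \<psi>) of the claim.\<close>
    define d where "d = 1 - h1 - \<psi>"
    have d: "0 < d" using tilt(2) by (simp add: d_def)
    have c: "c = 1 / d + 1" unfolding c_def tilt(1) by (simp add: d_def)
    have two: "2 - h1 - \<psi> = 1 + d" by (simp add: d_def)
    show ?thesis unfolding two c d_def[symmetric] using d \<eta>(1) by (simp add: field_simps)
  qed
  finally show ?thesis .
qed

end

theorem theorem1:
  fixes lam0 h1 \<theta>0 \<theta>1 \<eta> :: real
    and f :: "real \<Rightarrow> real"
    and M :: "'w measure"
    and K :: "'w \<Rightarrow> nat"
    and \<tau> :: "nat \<Rightarrow> 'w \<Rightarrow> real"
    and C :: "nat \<Rightarrow> 'w \<Rightarrow> cluster"
    and X :: "nat \<Rightarrow> 'w \<Rightarrow> real"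
  assumes "lam0 > 0" and "0 < h1" and "h1 < 1"
    and "is_density f"
    and "\<theta>0 > 0" and "(\<integral>\<^sup>+t\<in>{0..}. ennreal (exp (\<theta>0 * t) * f t) \<partial>lborel) < \<infinity>"
    and "\<theta>1 > 0"
    and "\<And>\<theta>. 0 < \<theta> \<Longrightarrow> \<theta> < \<theta>1 \<Longrightarrow>
           integrable (cluster_law h1 f 0) (\<lambda>c. exp (\<theta> * total_birth_time c))"
    and "0 < \<eta>" and "\<eta> < \<theta>1"
    and "algorithm_run lam0 h1 f \<eta> M K \<tau> C X"
  shows
    "(\<forall>(M' :: 'v measure) \<tau>' C'. stationary_hawkes lam0 h1 f M' \<tau>' C' \<longrightarrow>
        returned \<eta> K \<tau> C X \<in> measurable M (config_space cluster_space) \<and>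
        N0 \<tau>' C' \<in> measurable M' (config_space cluster_space) \<and>
        distr M (config_space cluster_space) (returned \<eta> K \<tau> C X) =
        distr M' (config_space cluster_space) (N0 \<tau>' C')) \<and>
     poisson_process M
       (density lborel (\<lambda>t. ennreal (lam0 * length_tail h1 f (- t)) * indicator {..0} t))
       (returned \<eta> K \<tau> C X) (\<lambda>c \<omega>. arrival_time c) \<and>
     (\<forall>m. \<forall>A \<in> sets borel. \<forall>D \<in> sets cluster_space.
        emeasure M {\<omega> \<in> space M. m \<in> accepted \<eta> K \<tau> C X \<omega> \<and> \<tau> m \<omega> \<in> A \<and> C m \<omega> \<in> D} =
        (\<integral>\<^sup>+\<omega>\<in>{\<omega> \<in> space M. m \<in> accepted \<eta> K \<tau> C X \<omega> \<and> \<tau> m \<omega> \<in> A}.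
           emeasure (cluster_law_given_longer h1 f (\<tau> m \<omega>)) D \<partial>M)) \<and>
     (\<integral>\<^sup>+\<omega>. (\<Sum>m = 1..K \<omega>. (cluster_size (C m \<omega>) + 1)) \<partial>M) =
       ennreal (lam0 * exp (psi_B h1 f \<eta>) * (2 - h1 - psi_B h1 f \<eta>)
                / (\<eta> * (1 - h1 - psi_B h1 f \<eta>)))"
proof -
  interpret hawkes_tilt lam0 h1 \<eta> \<theta>1 f
    using assms(1-4,8-10) by unfold_locales
  note R = returned_process[OF assms(11)]
  \<comment> \<open>The algorithm and the Hawkes process live on different probability spaces; the
    common intensity \<open>longer_measure\<close> alone links their laws.\<close>
  have "distr M (config_space cluster_space) (returned \<eta> K \<tau> C X) = distr M' (config_space cluster_space) (N0 \<tau>' C')"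
    if "stationary_hawkes lam0 h1 f M' \<tau>' C'" for M' :: "'v measure" and \<tau>' C'
    by (rule poisson_process_law_unique[OF R(2,1) N0_process(2,1)[OF that]
      finite_longer_measure space_longer_measure sets_longer_measure])
  then show ?thesis
    using R(1) N0_process(1) arrival_process[OF R(2)] accepted_cluster_law[OF assms(11)] expected_cost[OF assms(11)]
    by blast
qed

end
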